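(* Suppose that for each $1\le j\le s$ the functions $f_j,g_j$ are holomorphic on $\mathbb{B}_N$ and $f_j\in A^{2N+2}(\mathbb{B}_N)$. If $u=\sum_{j=1}^s f_j\bar g_j$ is an eigenfunction of the invariant Laplacian $\widetilde\Delta$, then $u$ is pluriharmonic.
   Context: $\mathbb{B}_N$ is the unit ball of $\mathbb{C}^N$ with normalized volume measure $dV$; $A^{p}(\mathbb{B}_N)$ is the space of holomorphic functions in $L^p(\mathbb{B}_N,dV)$. The invariant Laplacian is $\widetilde\Delta=(1-|z|^2)\big(\Delta_z-E_z\bar E_z\big)$, where $E_z=\sum_j z_j\partial/\partial z_j$, $\bar E_z=\sum_j\bar z_j\partial/\partial\bar z_j$, $\Delta_z=\sum_j\partial^2/\partial z_j\partial\bar z_j$. *)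

theory Defs
  imports "HOL-Analysis.Analysis"
begin

definition unit_ball :: "(complex ^ 'n) set" where
  "unit_ball = ball 0 1"

definition holo_on :: "(complex ^ 'n \<Rightarrow> complex) \<Rightarrow> (complex ^ 'n) set \<Rightarrow> bool" where
  "holo_on f S \<longleftrightarrow> (\<forall>z\<in>S. \<exists>f'. (f has_derivative f') (at z) \<and>
      (\<forall>c v. f' (c *s v) = c * f' v))"

text \<open>Bergman space A^p of the unit ball (normalization of the volume is irrelevant
  for membership).\<close>
definition bergman :: "nat \<Rightarrow> (complex ^ 'n \<Rightarrow> complex) set" where
  "bergman p = {f. holo_on f unit_ball \<and>
      set_integrable lborel unit_ball (\<lambda>z. norm (f z) ^ p)}"

definition dz :: "'n \<Rightarrow> (complex ^ 'n \<Rightarrow> complex) \<Rightarrow> complex ^ 'n \<Rightarrow> complex" where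
  "dz j u z = (frechet_derivative u (at z) (axis j 1)
              - \<i> * frechet_derivative u (at z) (axis j \<i>)) / 2"

definition dzbar :: "'n \<Rightarrow> (complex ^ 'n \<Rightarrow> complex) \<Rightarrow> complex ^ 'n \<Rightarrow> complex" where
  "dzbar j u z = (frechet_derivative u (at z) (axis j 1)
              + \<i> * frechet_derivative u (at z) (axis j \<i>)) / 2"

definition Eop :: "(complex ^ 'n \<Rightarrow> complex) \<Rightarrow> complex ^ 'n \<Rightarrow> complex" where
  "Eop u z = (\<Sum>j\<in>UNIV. z $ j * dz j u z)"

definition Ebarop :: "(complex ^ 'n \<Rightarrow> complex) \<Rightarrow> complex ^ 'n \<Rightarrow> complex" where
  "Ebarop u z = (\<Sum>j\<in>UNIV. cnj (z $ j) * dzbar j u z)"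

definition inv_laplacian :: "(complex ^ 'n \<Rightarrow> complex) \<Rightarrow> complex ^ 'n \<Rightarrow> complex" where
  "inv_laplacian u z = of_real (1 - (norm z)\<^sup>2) *
     ((\<Sum>j\<in>UNIV. dz j (dzbar j u) z) - Eop (Ebarop u) z)"

definition inv_lap_eigenfunction :: "(complex ^ 'n \<Rightarrow> complex) \<Rightarrow> bool" where
  "inv_lap_eigenfunction u \<longleftrightarrow>
     (\<exists>c::complex. \<forall>z\<in>unit_ball. inv_laplacian u z = c * u z)"

definition C2_on :: "(complex ^ 'n) set \<Rightarrow> (complex ^ 'n \<Rightarrow> complex) \<Rightarrow> bool" where
  "C2_on S u \<longleftrightarrow> u differentiable_on S \<and>
     (\<forall>v. (\<lambda>z. frechet_derivative u (at z) v) differentiable_on S) \<and>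
     (\<forall>v w. continuous_on S
        (\<lambda>z. frechet_derivative (\<lambda>y. frechet_derivative u (at y) v) (at z) w))"

definition pluriharmonic_on :: "(complex ^ 'n) set \<Rightarrow> (complex ^ 'n \<Rightarrow> complex) \<Rightarrow> bool" where
  "pluriharmonic_on S u \<longleftrightarrow> C2_on S u \<and>
     (\<forall>j k. \<forall>z\<in>S. dz j (dzbar k u) z = 0)"

end

(* Put F(z, \<zeta>) = sum_j f_j(z) * cnj (g_j (cnj \<zeta>)), so that u(z) = F(z, cnj z). By polarization the
   eigenvalue equation becomes (1 - x) L_0 F = c F on the product of two balls, where x is the bilinear
   product of z and \<zeta>, L_m = \<Delta> - (m + E)(m + E'), \<Delta> = sum_k d/dz_k d/d\<zeta>_k, and E, E' are the Euler
   operators in z and \<zeta>.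

   If (1 - x) L_m K = \<mu> K with \<mu> nonzero, then K = (1 - x) K' with K' = L_m K / \<mu> again of finite rank, and
   (1 - x) L_{m+1} K' = (\<mu> + N - 2m - 1) K'. Starting from F with c nonzero, either this can be iterated
   forever, so that F divided by any power of 1 - x has finite rank, which forces F = 0 on every complex
   line through the origin; or one reaches a kernel K = F / (1 - x)^m with L_m K = 0 and m \<ge> 1. If c = 0,
   then L_0 F = 0.

   Membership in A^(2N+2) gives f_j(z) = o((1 - |z|)^(-1/2)). If L_m annihilates sum_i a_i(z) b_i(\<zeta>), then
   repeated application of (k + E') to b_i, k = m, m + 1, ..., yields functions c_i for which, with a weighted
   integral I over the ball and holomorphic q,
     sum_i a_i(z) I(q * c_i(cnj w)) = \<theta>^m * sum_i I(q * a_i((1 - \<theta>) w + \<theta> z) * c_i(cnj w))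
   for all 0 < \<theta> \<le> 1. For m \<ge> 1 the growth bound makes the right-hand side small as \<theta> tends to 0, hence c_i = 0 and
   b_i = 0. For m = 0 the same identity is applied with m = 1 to the derivatives of a_i, split into a complex
   tangential part, where a derivative costs only \<theta>^(-1/2), and a radial part that is absorbed because
   (k + E') is bounded below by k in the weighted L^2 norm. *)
theory Submission
  imports Defs "HOL-Complex_Analysis.Complex_Analysis"
begin

section \<open>Holomorphic functions of several variables\<close>

text \<open>The exponent 2N + 2 is critical. Point evaluation on A^p costs (1 - |z|)^(-(N+1)/p),
  here the power -1/2. For m \<ge> 1 the factor \<theta>^m beats \<theta>^(-1/2) with room to spare;
  for m = 0 a tangential derivative costs a further \<theta>^(-1/2), the factor \<theta> is used up,
  and smallness has to come from the little o. Annihilation by L_m is invariant under (z, \<zeta>)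
  -> (R z, \<zeta> / R): with R slightly above 1 the second factors become holomorphic beyond the
  closed ball, while the first are evaluated only at points pulled inwards by \<theta>. Independence
  of R and of the weight is obtained from a reduced representation of the kernel: the first factors
  are finite combinations of its values and possess dual functionals supported on finitely many
  points, so the c_i are recovered from finitely many sums with a constant fixed in advance. The
  weight exponent then stays free, and for m = 0 it is chosen after \<theta>, to beat constants that
  depend on \<theta>.\<close>

definition pd :: "'n \<Rightarrow> (complex ^ 'n \<Rightarrow> complex) \<Rightarrow> complex ^ 'n \<Rightarrow> complex" where
  "pd k f z = frechet_derivative f (at z) (axis k 1)"

definition Eu :: "(complex ^ 'n \<Rightarrow> complex) \<Rightarrow> complex ^ 'n \<Rightarrow> complex" where
  "Eu f z = (\<Sum>k\<in>UNIV. z $ k * pd k f z)"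

lemma bounded_linear_smult_left: "bounded_linear (\<lambda>s::complex. s *s (v::complex^'n))"
proof -
  have "linear (\<lambda>s::complex. s *s (v::complex^'n))"
    by (rule linearI) (auto simp: vec_eq_iff algebra_simps)
  thus ?thesis by (simp add: linear_conv_bounded_linear)
qed

lemma bounded_linear_smult_right: "bounded_linear (\<lambda>v::complex^'n. s *s v)"
proof -
  have "linear (\<lambda>v::complex^'n. s *s v)"
    by (rule linearI) (auto simp: vec_eq_iff algebra_simps)
  thus ?thesis by (simp add: linear_conv_bounded_linear)
qed

lemma norm_smult_vec: "norm (s *s (v::complex^'n)) = norm s * norm v"
  by (simp add: norm_vec_def L2_set_def norm_mult power_mult_distrib sum_distrib_left[symmetric]
      real_sqrt_mult)

lemma continuous_on_smult [continuous_intros]: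
  fixes v :: "'a::topological_space \<Rightarrow> complex^'n"
  assumes "continuous_on S f" "continuous_on S v"
  shows "continuous_on S (\<lambda>x. f x *s v x)"
proof -
  have "continuous_on S (\<lambda>x. \<chi> i. f x * v x $ i)"
    by (intro continuous_intros assms)
  thus ?thesis by (simp add: vector_scalar_mult_def)
qed

lemma sum_axis_mult:
  fixes d :: "'n::finite \<Rightarrow> complex"
  shows "(\<Sum>k\<in>UNIV. axis j 1 $ k * d k) = d j"
proof -
  have "(\<Sum>k\<in>UNIV. axis j 1 $ k * d k) = (\<Sum>k\<in>UNIV. if k = j then d k else 0)"
    by (intro sum.cong) (auto simp: axis_def)
  thus ?thesis by simp
qed

text \<open>Complex linearity determines the derivative from its values on the real directions
  \<open>axis k 1\<close>, which is why \<open>pd\<close> can do without the Wirtinger combination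
  in \<open>dz\<close>.\<close>

lemma has_derivative_pd:
  assumes "(f has_derivative f') (at z)" "\<And>c v. f' (c *s v) = c * f' v"
  shows "(f has_derivative (\<lambda>v. \<Sum>k\<in>UNIV. v $ k * pd k f z)) (at z)"
proof -
  interpret bounded_linear f' using assms(1) by (rule has_derivative_bounded_linear)
  have fd: "frechet_derivative f (at z) = f'"
    by (rule frechet_derivative_at[OF assms(1), symmetric])
  have "f' v = (\<Sum>k\<in>UNIV. v $ k * pd k f z)" for v
  proof -
    have "f' v = f' (\<Sum>k\<in>UNIV. v $ k *s axis k 1)" by (subst basis_expansion) (rule refl)
    also have "\<dots> = (\<Sum>k\<in>UNIV. f' (v $ k *s axis k 1))" by (rule sum)
    also have "\<dots> = (\<Sum>k\<in>UNIV. v $ k * f' (axis k 1))" by (simp only: assms(2))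
    finally show ?thesis by (simp add: pd_def fd)
  qed
  hence "f' = (\<lambda>v. \<Sum>k\<in>UNIV. v $ k * pd k f z)" by blast
  thus ?thesis using assms(1) by simp
qed

lemma holo_on_has_derivative:
  assumes "holo_on f U" "z \<in> U"
  shows "(f has_derivative (\<lambda>v. \<Sum>k\<in>UNIV. v $ k * pd k f z)) (at z)"
proof -
  obtain f' where "(f has_derivative f') (at z)" "\<forall>c v. f' (c *s v) = c * f' v"
    using assms unfolding holo_on_def by blast
  thus ?thesis by (intro has_derivative_pd) auto
qed

lemma pd_eqI:
  assumes "(f has_derivative (\<lambda>v. \<Sum>k\<in>UNIV. v $ k * d k)) (at z)"
  shows "pd j f z = d j"
proof -
  have "frechet_derivative f (at z) = (\<lambda>v. \<Sum>k\<in>UNIV. v $ k * d k)"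
    by (rule frechet_derivative_at[OF assms, symmetric])
  thus ?thesis by (simp add: pd_def sum_axis_mult)
qed

lemma holo_onI:
  assumes "\<And>z. z \<in> U \<Longrightarrow> (f has_derivative (\<lambda>v. \<Sum>k\<in>UNIV. v $ k * d k z)) (at z)"
  shows "holo_on f U"
  unfolding holo_on_def
  by (intro ballI exI conjI, erule assms) (simp add: sum_distrib_left mult.assoc)

lemma holo_on_subset: "holo_on f U \<Longrightarrow> V \<subseteq> U \<Longrightarrow> holo_on f V"
  unfolding holo_on_def by blast

lemma holo_on_continuous: "holo_on f U \<Longrightarrow> continuous_on U f"
  unfolding holo_on_def
  by (metis continuous_at_imp_continuous_on has_derivative_continuous)

lemma has_derivative_cong_open:
  assumes "open U" "z \<in> U" "\<And>w. w \<in> U \<Longrightarrow> f w = g w" "(f has_derivative f') (at z)"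
  shows "(g has_derivative f') (at z)"
  using assms has_derivative_transform_within_open by blast

lemma pd_cong_open:
  assumes "open U" "z \<in> U" "\<And>w. w \<in> U \<Longrightarrow> f w = g w"
  shows "pd k f z = pd k g z"
proof -
  have "(f has_derivative D) (at z) \<longleftrightarrow> (g has_derivative D) (at z)" for D
    using has_derivative_cong_open[OF assms(1,2)] assms(3) by metis
  thus ?thesis unfolding pd_def frechet_derivative_def by simp
qed

lemma holo_on_cong:
  assumes "open U" "\<And>w. w \<in> U \<Longrightarrow> f w = g w" "holo_on f U"
  shows "holo_on g U"
  using assms unfolding holo_on_def by (metis has_derivative_cong_open)

lemma holo_on_line:
  assumes "holo_on f U" "z + s *s v \<in> U"
  shows "((\<lambda>s. f (z + s *s v)) has_field_derivative (\<Sum>k\<in>UNIV. v $ k * pd k f (z + s *s v))) (at s)"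
proof -
  have 1: "((\<lambda>s. z + s *s v) has_derivative (\<lambda>h. h *s v)) (at s)"
    using has_derivative_add[OF has_derivative_const bounded_linear_imp_has_derivative[OF bounded_linear_smult_left]]
    by simp
  have "((\<lambda>s. f (z + s *s v)) has_derivative
     (\<lambda>h. \<Sum>k\<in>UNIV. (h *s v) $ k * pd k f (z + s *s v))) (at s)"
    using has_derivative_compose[OF 1 holo_on_has_derivative[OF assms]] .
  moreover have "(\<lambda>h. \<Sum>k\<in>UNIV. (h *s v) $ k * pd k f (z + s *s v)) = (*) (\<Sum>k\<in>UNIV. v $ k * pd k f (z + s *s v))"
    by (rule ext) (simp add: sum_distrib_left mult_ac)
  ultimately show ?thesis unfolding has_field_derivative_def by simp
qed

section \<open>Cauchy's formula and regularity of partial derivatives\<close>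

lemma pd_line:
  assumes "holo_on f U" "z \<in> U"
  shows "((\<lambda>s. f (z + s *s axis k 1)) has_field_derivative pd k f z) (at 0)"
proof -
  have "(\<Sum>l\<in>UNIV. axis k 1 $ l * pd l f z) = pd k f z"
    by (rule sum_axis_mult)
  thus ?thesis using holo_on_line[OF assms(1), of z 0 "axis k 1"] assms(2) by simp
qed

text \<open>\<open>holo_on\<close> asks for a single derivative and says nothing about its
  continuity. Writing the derivative as a circle integral of \<open>f\<close> itself is what gives
  access to further derivatives. On the parametrized circle du = 2 pi i u dt, so the kernel 1/u^2 of
  Cauchy's formula becomes 1/u.\<close>

lemma cauchy_pd:
  assumes f: "holo_on f U" and U: "open U" and r: "r > 0"
    and sub: "\<And>w. norm w \<le> r \<Longrightarrow> z + w *s axis k 1 \<in> U"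
  shows "pd k f z = integral (cbox 0 1) (\<lambda>t::real. f (z + (of_real r * exp (2 * of_real pi * \<i> * of_real t)) *s axis k 1)
       / (of_real r * exp (2 * of_real pi * \<i> * of_real t)))"
proof -
  define g where "g = (\<lambda>w. f (z + w *s axis k 1))"
  have fd: "g field_differentiable at w" if "norm w \<le> r" for w
    unfolding g_def using holo_on_line[OF f sub[OF that]] field_differentiable_def by blast
  have hol: "g holomorphic_on cball 0 r"
    unfolding holomorphic_on_def
    by (auto intro!: field_differentiable_at_within fd)
  have "((\<lambda>u. g u / (u - 0) ^ Suc 1) has_contour_integral (2 * pi * \<i>) / fact 1 * (deriv ^^ 1) g 0) (circlepath 0 r)"
    by (rule Cauchy_has_contour_integral_higher_derivative_circlepath)
       (use hol r in \<open>auto intro: holomorphic_on_imp_continuous_on holomorphic_on_subset\<close>)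
  hence "((\<lambda>u. g u / u ^ 2) has_contour_integral (2 * pi * \<i>) * deriv g 0) (circlepath 0 r)"
    by (simp add: eval_nat_numeral)
  hence ci: "contour_integral (circlepath 0 r) (\<lambda>u. g u / u ^ 2) = (2 * pi * \<i>) * deriv g 0"
    by (rule contour_integral_unique)
  have dg: "deriv g 0 = pd k f z"
    using pd_line[OF f, of z k] sub[of 0] r unfolding g_def by (intro DERIV_imp_deriv) auto
  have "contour_integral (circlepath 0 r) (\<lambda>u. g u / u ^ 2) =
     integral {0..1} (\<lambda>t. g (circlepath 0 r t) / (circlepath 0 r t)^2 * vector_derivative (circlepath 0 r) (at t))"
    by (rule contour_integral_integral)
  also have "\<dots> = integral {0..1} (\<lambda>t. 2 * pi * \<i> * (g (of_real r * exp (2 * of_real pi * \<i> * of_real t))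
       / (of_real r * exp (2 * of_real pi * \<i> * of_real t))))"
  proof (rule integral_cong)
    fix t :: real assume "t \<in> {0..1}"
    show "g (circlepath 0 r t) / (circlepath 0 r t)\<^sup>2 * vector_derivative (circlepath 0 r) (at t) =
      2 * pi * \<i> * (g (of_real r * exp (2 * of_real pi * \<i> * of_real t))
       / (of_real r * exp (2 * of_real pi * \<i> * of_real t)))"
      unfolding vector_derivative_circlepath using r
      by (simp add: circlepath_def part_circlepath_def linepath_def power2_eq_square mult_ac scaleR_conv_of_real)
  qed
  also have "\<dots> = 2 * pi * \<i> * integral {0..1} (\<lambda>t. (g (of_real r * exp (2 * of_real pi * \<i> * of_real t))
       / (of_real r * exp (2 * of_real pi * \<i> * of_real t))))"
    by (rule integral_mult_right)
  finally show ?thesis using ci dg by (simp add: g_def)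
qed

text \<open>One radius \<open>r\<close> serves every centre \<open>z\<close> near \<open>z0\<close>;
  the margin 2 r keeps all these circles in \<open>U\<close>, so that the formula may be
  differentiated in \<open>z\<close>.\<close>

lemma pd_param:
  assumes f: "holo_on f U" and U: "open U" and r: "r > 0" and sub: "cball z0 (2 * r) \<subseteq> U"
    and z: "z \<in> ball z0 r"
  shows "pd k f z = integral (cbox 0 1) (\<lambda>t::real. f (z + (of_real r * exp (2 * of_real pi * \<i> * of_real t)) *s axis k 1)
       / (of_real r * exp (2 * of_real pi * \<i> * of_real t)))"
proof (rule cauchy_pd[OF f U r])
  fix w :: complex assume w: "norm w \<le> r"
  have "dist z0 (z + w *s axis k 1) \<le> dist z0 z + norm (w *s axis k 1 :: complex^'a)"
    using dist_triangle[of z0 "z + w *s axis k 1" z] by (simp add: dist_norm)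
  also have "norm (w *s axis k 1 :: complex^'a) = norm w" by (simp add: norm_smult_vec)
  finally have "dist z0 (z + w *s axis k 1) \<le> 2 * r" using z w by simp
  thus "z + w *s axis k 1 \<in> U" using sub by auto
qed

lemma circle_shift_mem:
  assumes r: "r > 0" and sub: "cball z0 (2 * r) \<subseteq> U" and z: "z \<in> ball z0 r"
  shows "z + (of_real r * exp (2 * of_real pi * \<i> * of_real t)) *s axis k 1 \<in> U"
proof -
  let ?w = "of_real r * exp (2 * of_real pi * \<i> * of_real t) :: complex"
  have nw: "norm ?w = r" using r by (simp add: norm_mult)
  have "dist z0 (z + ?w *s axis k 1) \<le> dist z0 z + norm (?w *s axis k 1 :: complex^'a)"
    using dist_triangle[of z0 "z + ?w *s axis k 1" z] by (simp add: dist_norm)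
  also have "norm (?w *s axis k 1 :: complex^'a) = r" by (simp only: norm_smult_vec nw) simp
  finally have "dist z0 (z + ?w *s axis k 1) \<le> 2 * r" using z by simp
  thus ?thesis using sub by auto
qed

text \<open>Comes before differentiability because \<open>leibniz_rule\<close> requires the
  z-derivative of the integrand, hence \<open>pd l f\<close>, to be jointly continuous.\<close>

lemma continuous_pd:
  assumes f: "holo_on f U" and U: "open U"
  shows "continuous_on U (pd k f)"
proof (rule continuous_at_imp_continuous_on, rule ballI)
  fix z0 assume "z0 \<in> U"
  then obtain r0 where r0: "r0 > 0" "cball z0 r0 \<subseteq> U" using U open_contains_cball by blast
  define r where "r = r0 / 2"
  have r: "r > 0" and sub: "cball z0 (2 * r) \<subseteq> U" using r0 by (auto simp: r_def)
  let ?F = "\<lambda>z t. f (z + (of_real r * exp (2 * of_real pi * \<i> * of_real t)) *s axis k 1)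
       / (of_real r * exp (2 * of_real pi * \<i> * of_real t))"
  have "continuous_on (ball z0 r) (\<lambda>z. integral (cbox 0 (1::real)) (?F z))"
    using r by (intro integral_continuous_on_param)
      (auto simp: case_prod_unfold intro!: continuous_intros continuous_on_compose2[OF holo_on_continuous[OF f]]
        intro: circle_shift_mem[OF r sub, unfolded mem_ball])
  hence "continuous_on (ball z0 r) (pd k f)"
    by (rule continuous_on_eq) (rule pd_param[OF f U r sub, symmetric])
  thus "isCont (pd k f) z0" using r by (simp add: continuous_on_eq_continuous_at)
qed

lemma pd_has_derivative_param:
  assumes f: "holo_on f U" and U: "open U" and r: "r > 0" and sub: "cball z0 (2 * r) \<subseteq> U"
  shows "((pd k f) has_derivative (\<lambda>v. \<Sum>l\<in>UNIV. v $ l *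
     integral (cbox 0 1) (\<lambda>t::real. pd l f (z0 + (of_real r * exp (2 * of_real pi * \<i> * of_real t)) *s axis k 1)
       / (of_real r * exp (2 * of_real pi * \<i> * of_real t))))) (at z0)"
proof -
  define C where "C = (\<lambda>t::real. of_real r * exp (2 * of_real pi * \<i> * of_real t) :: complex)"
  define W where "W = (\<lambda>z t. z + C t *s (axis k 1 :: complex^'a))"
  \<comment> \<open>The derivative of the integrand in z, packaged as a bounded linear map as
    \<open>leibniz_rule\<close> expects.\<close>
  define fx where "fx = (\<lambda>z t. \<Sum>l\<in>UNIV. blinfun_mult_right (pd l f (W z t) / C t) o\<^sub>L Blinfun (\<lambda>v::complex^'a. v $ l))"
  have fx: "blinfun_apply (fx z t) v = (\<Sum>l\<in>UNIV. v $ l * (pd l f (W z t) / C t))" for z t v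
    by (simp add: fx_def blinfun.sum_left bounded_linear_Blinfun_apply bounded_linear_vec_nth mult_ac)
  have C0: "C t \<noteq> 0" for t using r by (simp add: C_def)
  have contC: "continuous_on S (\<lambda>x. C (g x))" if "continuous_on S g" for S and g :: "'x::topological_space \<Rightarrow> real"
    unfolding C_def by (intro continuous_intros that)
  have mem: "W z t \<in> U" if "z \<in> ball z0 r" for z t
    unfolding W_def C_def by (rule circle_shift_mem[OF r sub that])
  have contW: "continuous_on (ball z0 r \<times> cbox 0 1) (\<lambda>x. h (W (fst x) (snd x)) / C (snd x))"
    if "continuous_on U h" for h :: "complex^'a \<Rightarrow> complex"
    by (intro continuous_intros contC continuous_on_compose2[OF that])
       (auto simp: W_def C0 intro!: continuous_intros contC mem[unfolded W_def mem_ball])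
  have contW1: "continuous_on (cbox 0 1) (\<lambda>t. h (W z t) / C t)"
    if "continuous_on U h" "z \<in> ball z0 r" for h :: "complex^'a \<Rightarrow> complex" and z
    by (intro continuous_intros contC continuous_on_compose2[OF that(1)])
       (auto simp: W_def C0 intro!: continuous_intros contC mem[OF that(2), unfolded W_def])
  have "((\<lambda>z. integral (cbox 0 1) (\<lambda>t. f (W z t) / C t)) has_derivative
          blinfun_apply (integral (cbox 0 1) (fx z0))) (at z0 within ball z0 r)"
  proof (rule leibniz_rule)
    fix z t assume z: "z \<in> ball z0 r" and "t \<in> cbox 0 (1::real)"
    have "((\<lambda>z. W z t) has_derivative (\<lambda>h. h)) (at z)"
      unfolding W_def by (auto intro!: derivative_eq_intros)
    from has_derivative_compose[OF this holo_on_has_derivative[OF f mem[OF z]]]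
    have "((\<lambda>z. f (W z t)) has_derivative (\<lambda>h. \<Sum>l\<in>UNIV. h $ l * pd l f (W z t))) (at z)" .
    hence "((\<lambda>z. inverse (C t) * f (W z t)) has_derivative (\<lambda>h. inverse (C t) * (\<Sum>l\<in>UNIV. h $ l * pd l f (W z t)))) (at z)"
      by (rule has_derivative_mult_right)
    moreover have "(\<lambda>h. inverse (C t) * (\<Sum>l\<in>UNIV. h $ l * pd l f (W z t))) = blinfun_apply (fx z t)"
      by (auto simp: fx sum_distrib_left divide_inverse mult_ac)
    moreover have "(\<lambda>z. inverse (C t) * f (W z t)) = (\<lambda>z. f (W z t) / C t)"
      by (auto simp: divide_inverse mult_ac)
    ultimately show "((\<lambda>z. f (W z t) / C t) has_derivative blinfun_apply (fx z t)) (at z within ball z0 r)"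
      using has_derivative_at_withinI by metis
  next
    fix z assume z: "z \<in> ball z0 r"
    show "(\<lambda>t. f (W z t) / C t) integrable_on cbox 0 1"
      by (rule integrable_continuous[OF contW1[OF holo_on_continuous[OF f] z]])
  next
    show "continuous_on (ball z0 r \<times> cbox 0 1) (\<lambda>(z, t). fx z t)"
      unfolding fx_def case_prod_unfold
      by (intro continuous_intros bounded_linear.continuous_on[OF bounded_linear_blinfun_mult_right]
          contW[OF continuous_pd[OF f U]])
  qed (use r in auto)
  moreover have "blinfun_apply (integral (cbox 0 1) (fx z0)) v =
      (\<Sum>l\<in>UNIV. v $ l * integral (cbox 0 1) (\<lambda>t. pd l f (W z0 t) / C t))" for v
  proof -
    have z0: "z0 \<in> ball z0 r" using r by simp
    have cW: "continuous_on (cbox 0 1) (\<lambda>t. pd l f (W z0 t) / C t)" for l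
      by (rule contW1[OF continuous_pd[OF f U] z0])
    have "continuous_on (cbox 0 1) (fx z0)" unfolding fx_def
      by (intro continuous_intros bounded_linear.continuous_on[OF bounded_linear_blinfun_mult_right] cW)
    hence "blinfun_apply (integral (cbox 0 1) (fx z0)) v = integral (cbox 0 1) (\<lambda>t. blinfun_apply (fx z0 t) v)"
      by (intro blinfun_apply_integral integrable_continuous)
    also have "\<dots> = (\<Sum>l\<in>UNIV. integral (cbox 0 1) (\<lambda>t. v $ l * (pd l f (W z0 t) / C t)))"
      unfolding fx
      by (rule integral_sum) (simp, rule integrable_continuous[OF continuous_on_mult[OF continuous_on_const cW]])
    finally show ?thesis by (simp only: integral_mult_right)
  qed
  hence "blinfun_apply (integral (cbox 0 1) (fx z0)) = (\<lambda>v. \<Sum>l\<in>UNIV. v $ l * integral (cbox 0 1) (\<lambda>t. pd l f (W z0 t) / C t))"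
    by (rule ext)
  ultimately have "((\<lambda>z. integral (cbox 0 1) (\<lambda>t. f (W z t) / C t)) has_derivative
      (\<lambda>v. \<Sum>l\<in>UNIV. v $ l * integral (cbox 0 1) (\<lambda>t. pd l f (W z0 t) / C t))) (at z0 within ball z0 r)"
    by (simp only:)
  hence "((\<lambda>z. integral (cbox 0 1) (\<lambda>t. f (W z t) / C t)) has_derivative
      (\<lambda>v. \<Sum>l\<in>UNIV. v $ l * integral (cbox 0 1) (\<lambda>t. pd l f (W z0 t) / C t))) (at z0)"
    by (simp only: at_within_open[OF centre_in_ball[THEN iffD2, OF r] open_ball])
  hence "(pd k f has_derivative
      (\<lambda>v. \<Sum>l\<in>UNIV. v $ l * integral (cbox 0 1) (\<lambda>t. pd l f (W z0 t) / C t))) (at z0)"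
  proof (rule has_derivative_cong_open[rotated -1])
    fix w assume "w \<in> ball z0 r"
    show "integral (cbox 0 1) (\<lambda>t. f (W w t) / C t) = pd k f w"
      unfolding W_def C_def by (rule pd_param[OF f U r sub, symmetric]) fact
  qed (use r in auto)
  thus ?thesis unfolding W_def C_def .
qed

lemma holo_on_pd:
  assumes f: "holo_on f U" and U: "open U"
  shows "holo_on (pd k f) U"
proof -
  have "\<exists>f'. (pd k f has_derivative f') (at z) \<and> (\<forall>c v. f' (c *s v) = c * f' v)" if "z \<in> U" for z
  proof -
    obtain r0 where r0: "r0 > 0" "cball z r0 \<subseteq> U" using U \<open>z \<in> U\<close> open_contains_cball by blast
    hence "r0/2 > 0" "cball z (2 * (r0/2)) \<subseteq> U" by auto
    show ?thesis
      by (intro exI conjI, rule pd_has_derivative_param[OF f U], fact+)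
         (simp add: sum_distrib_left mult.assoc)
  qed
  thus ?thesis unfolding holo_on_def by blast
qed

text \<open>Differentiating Cauchy's formula for \<open>pd k f\<close> in direction \<open>l\<close>
  gives literally Cauchy's formula for \<open>pd k\<close> of \<open>pd l f\<close>.\<close>

lemma pd_commute:
  assumes f: "holo_on f U" and U: "open U" and z: "z \<in> U"
  shows "pd l (pd k f) z = pd k (pd l f) z"
proof -
  obtain r0 where r0: "r0 > 0" "cball z r0 \<subseteq> U" using U z open_contains_cball by blast
  hence r: "r0/2 > 0" "cball z (2 * (r0/2)) \<subseteq> U" by auto
  show ?thesis
    using pd_eqI[OF pd_has_derivative_param[OF f U r]] pd_param[OF holo_on_pd[OF f U] U r, of z k l] r
    by simp
qed


section \<open>Calculus of partial derivatives\<close>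

lemma holo_on_const [simp]: "holo_on (\<lambda>z. c) U"
  by (rule holo_onI[where d="\<lambda>k z. 0"]) simp

lemma pd_const [simp]: "pd k (\<lambda>z. c) z = 0"
  using pd_eqI[where f="\<lambda>z. c" and d="\<lambda>k. 0" and z=z] by simp

lemma nth_has_derivative: "((\<lambda>z. z $ j) has_derivative (\<lambda>v. \<Sum>k\<in>UNIV. v $ k * (if k = j then 1 else 0))) (at (z::complex^'n))"
proof -
  have "(\<lambda>v. \<Sum>k\<in>UNIV. v $ k * (if k = j then 1 else 0)) = (\<lambda>v::complex^'n. v $ j)"
    by (auto simp: if_distrib cong: if_cong)
  thus ?thesis using bounded_linear_imp_has_derivative[OF bounded_linear_vec_nth] by simp
qed

lemma holo_on_nth [simp]: "holo_on (\<lambda>z. z $ j) U"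
  by (rule holo_onI) (rule nth_has_derivative)

lemma pd_nth [simp]: "pd k (\<lambda>z. z $ j) z = (if k = j then 1 else 0)"
  by (rule pd_eqI) (rule nth_has_derivative)

lemma add_has_derivative_pd:
  assumes "holo_on f U" "holo_on g U" "z \<in> U"
  shows "((\<lambda>z. f z + g z) has_derivative (\<lambda>v. \<Sum>k\<in>UNIV. v $ k * (pd k f z + pd k g z))) (at z)"
  using has_derivative_add[OF holo_on_has_derivative[OF assms(1,3)] holo_on_has_derivative[OF assms(2,3)]]
  by (simp add: sum.distrib ring_distribs)

lemma holo_on_add: "holo_on f U \<Longrightarrow> holo_on g U \<Longrightarrow> holo_on (\<lambda>z. f z + g z) U"
  by (rule holo_onI) (rule add_has_derivative_pd)

lemma pd_add: "holo_on f U \<Longrightarrow> holo_on g U \<Longrightarrow> z \<in> U \<Longrightarrow> pd k (\<lambda>z. f z + g z) z = pd k f z + pd k g z"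
  by (rule pd_eqI) (rule add_has_derivative_pd)

lemma mult_has_derivative_pd:
  assumes "holo_on f U" "holo_on g U" "z \<in> U"
  shows "((\<lambda>z. f z * g z) has_derivative (\<lambda>v. \<Sum>k\<in>UNIV. v $ k * (f z * pd k g z + pd k f z * g z))) (at z)"
  using has_derivative_mult[OF holo_on_has_derivative[OF assms(1,3)] holo_on_has_derivative[OF assms(2,3)]]
  by (simp add: sum.distrib ring_distribs sum_distrib_left sum_distrib_right mult_ac)

lemma holo_on_mult: "holo_on f U \<Longrightarrow> holo_on g U \<Longrightarrow> holo_on (\<lambda>z. f z * g z) U"
  by (rule holo_onI) (rule mult_has_derivative_pd)

lemma pd_mult: "holo_on f U \<Longrightarrow> holo_on g U \<Longrightarrow> z \<in> U \<Longrightarrow> pd k (\<lambda>z. f z * g z) z = f z * pd k g z + pd k f z * g z"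
  by (rule pd_eqI) (rule mult_has_derivative_pd)

lemma holo_on_cmult: "holo_on f U \<Longrightarrow> holo_on (\<lambda>z. c * f z) U"
  by (intro holo_on_mult holo_on_const)

lemma pd_cmult: "holo_on f U \<Longrightarrow> z \<in> U \<Longrightarrow> pd k (\<lambda>z. c * f z) z = c * pd k f z"
  using pd_mult[of "\<lambda>z. c" U f z k] by simp

lemma holo_on_sum: "(\<And>i. i \<in> I \<Longrightarrow> holo_on (f i) U) \<Longrightarrow> holo_on (\<lambda>z. \<Sum>i\<in>I. f i z) U"
  by (induction I rule: infinite_finite_induct) (auto intro: holo_on_add)

lemma pd_sum: "(\<And>i. i \<in> I \<Longrightarrow> holo_on (f i) U) \<Longrightarrow> z \<in> U \<Longrightarrow> pd k (\<lambda>z. \<Sum>i\<in>I. f i z) z = (\<Sum>i\<in>I. pd k (f i) z)"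
proof (induction I rule: infinite_finite_induct)
  case (insert i I)
  thus ?case using pd_add[of "f i" U "\<lambda>z. \<Sum>i\<in>I. f i z" z k] by (simp add: holo_on_sum)
qed auto

lemma holo_on_diff: "holo_on f U \<Longrightarrow> holo_on g U \<Longrightarrow> holo_on (\<lambda>z. f z - g z) U"
  using holo_on_add[OF _ holo_on_cmult[of g U "-1"], of f] by simp

lemma pd_diff: "holo_on f U \<Longrightarrow> holo_on g U \<Longrightarrow> z \<in> U \<Longrightarrow> pd k (\<lambda>z. f z - g z) z = pd k f z - pd k g z"
  using pd_add[OF _ holo_on_cmult[of g U "-1"], of f] pd_cmult[of g U z k "-1"] by simp

lemma holo_on_power: "holo_on f U \<Longrightarrow> holo_on (\<lambda>z. f z ^ n) U"
  by (induction n) (auto intro: holo_on_mult)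

lemma compose_has_derivative_pd:
  assumes f: "holo_on f U" and z: "z \<in> U" and h: "(h has_field_derivative h') (at (f z))"
  shows "((\<lambda>z. h (f z)) has_derivative (\<lambda>v. \<Sum>k\<in>UNIV. v $ k * (h' * pd k f z))) (at z)"
  using has_derivative_compose[OF holo_on_has_derivative[OF f z] h[unfolded has_field_derivative_def]]
  by (simp add: sum_distrib_left mult_ac)

lemma affine_has_derivative_pd:
  assumes f: "holo_on f U" and z: "c + s *s z \<in> U"
  shows "((\<lambda>z. f (c + s *s z)) has_derivative (\<lambda>v. \<Sum>k\<in>UNIV. v $ k * (s * pd k f (c + s *s z)))) (at z)"
proof -
  have "((\<lambda>z. c + s *s z) has_derivative (\<lambda>h. s *s h)) (at z)"
    using has_derivative_add[OF has_derivative_const bounded_linear_imp_has_derivative[OF bounded_linear_smult_right]]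
    by simp
  from has_derivative_compose[OF this holo_on_has_derivative[OF f z]] show ?thesis
    by (simp add: mult_ac)
qed

lemma holo_on_affine:
  assumes "holo_on f U" "\<And>z. z \<in> V \<Longrightarrow> c + s *s z \<in> U"
  shows "holo_on (\<lambda>z. f (c + s *s z)) V"
  by (rule holo_onI) (rule affine_has_derivative_pd[OF assms(1) assms(2)])

lemma pd_affine:
  assumes "holo_on f U" "c + s *s z \<in> U"
  shows "pd k (\<lambda>z. f (c + s *s z)) z = s * pd k f (c + s *s z)"
  by (rule pd_eqI) (rule affine_has_derivative_pd[OF assms])

section \<open>Conjugation, the bilinear pairing and the Euler operator\<close>

definition cv :: "complex ^ 'n \<Rightarrow> complex ^ 'n" where
  "cv z = (\<chi> k. cnj (z $ k))"

lemma cv_nth [simp]: "cv z $ k = cnj (z $ k)" by (simp add: cv_def)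
lemma cv_cv [simp]: "cv (cv z) = z" by (simp add: vec_eq_iff)
lemma cv_add: "cv (z + w) = cv z + cv w" by (simp add: vec_eq_iff)
lemma cv_smult: "cv (c *s z) = cnj c *s cv z" by (simp add: vec_eq_iff)
lemma norm_cv [simp]: "norm (cv z) = norm z" by (simp add: norm_vec_def L2_set_def)

lemma bounded_linear_cv: "bounded_linear (cv :: complex^'n \<Rightarrow> _)"
proof -
  have "linear (cv :: complex^'n \<Rightarrow> _)" by (rule linearI) (auto simp: vec_eq_iff)
  thus ?thesis by (simp add: linear_conv_bounded_linear)
qed

lemmas continuous_on_cv [continuous_intros] = bounded_linear.continuous_on[OF bounded_linear_cv]

lemma cv_has_derivative:
  assumes f: "holo_on f U" and z: "cv z \<in> U"
  shows "((\<lambda>z. f (cv z)) has_derivative (\<lambda>v. \<Sum>k\<in>UNIV. cnj (v $ k) * pd k f (cv z))) (at z)"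
  using has_derivative_compose[OF bounded_linear_imp_has_derivative[OF bounded_linear_cv] holo_on_has_derivative[OF f z]]
  by simp

lemma conj_has_derivative_pd:
  assumes f: "holo_on f U" and z: "cv z \<in> U"
  shows "((\<lambda>z. cnj (f (cv z))) has_derivative (\<lambda>v. \<Sum>k\<in>UNIV. v $ k * cnj (pd k f (cv z)))) (at z)"
  using has_derivative_compose[OF cv_has_derivative[OF f z] bounded_linear_imp_has_derivative[OF bounded_linear_cnj]]
  by simp

lemma holo_on_conj:
  assumes "holo_on f U" "\<And>z. z \<in> V \<Longrightarrow> cv z \<in> U"
  shows "holo_on (\<lambda>z. cnj (f (cv z))) V"
  by (rule holo_onI) (rule conj_has_derivative_pd[OF assms(1) assms(2)])

text \<open>Bilinear, not Hermitian: it is holomorphic in both arguments and is the polarization of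
  the squared norm, with \<open>bil z (cv z)\<close> as its diagonal values.\<close>

definition bil :: "complex ^ 'n \<Rightarrow> complex ^ 'n \<Rightarrow> complex" where
  "bil z w = (\<Sum>k\<in>UNIV. z $ k * w $ k)"

lemma bil_commute: "bil z w = bil w z" by (simp add: bil_def mult.commute)
lemma bil_add_left: "bil (z + z') w = bil z w + bil z' w" by (simp add: bil_def sum.distrib ring_distribs)
lemma bil_add_right: "bil w (z + z') = bil w z + bil w z'" by (simp add: bil_def sum.distrib ring_distribs)
lemma bil_smult_left: "bil (c *s z) w = c * bil z w" by (simp add: bil_def sum_distrib_left mult.assoc)
lemma bil_smult_right: "bil w (c *s z) = c * bil w z" by (simp add: bil_def sum_distrib_left mult_ac)

lemma holo_on_bil: "holo_on (\<lambda>z. bil w z) U"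
  unfolding bil_def by (intro holo_on_sum holo_on_cmult holo_on_nth)

lemma pd_bil [simp]: "pd k (\<lambda>z. bil w z) z = w $ k"
proof -
  have "pd k (\<lambda>z. bil w z) z = (\<Sum>j\<in>UNIV. pd k (\<lambda>z. w $ j * z $ j) z)"
    unfolding bil_def by (rule pd_sum[where U=UNIV]) (auto intro: holo_on_cmult)
  also have "\<dots> = (\<Sum>j\<in>UNIV. if k = j then w $ j else 0)"
    by (intro sum.cong refl) (simp add: pd_cmult[where U=UNIV])
  finally show ?thesis by simp
qed

lemma bil_cv: "bil z (cv z) = of_real ((norm z)\<^sup>2)"
  by (simp add: bil_def norm_vec_def L2_set_def complex_mult_cnj cmod_power2 sum_nonneg)

lemma norm_bil_le: "norm (bil z w) \<le> norm z * norm w"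
proof -
  have "norm (bil z w) \<le> (\<Sum>k\<in>UNIV. \<bar>norm (z $ k)\<bar> * \<bar>norm (w $ k)\<bar>)"
    unfolding bil_def by (rule order_trans[OF norm_sum]) (simp add: norm_mult)
  also have "\<dots> \<le> L2_set (\<lambda>k. norm (z $ k)) UNIV * L2_set (\<lambda>k. norm (w $ k)) UNIV"
    by (rule L2_set_mult_ineq)
  finally show ?thesis by (simp add: norm_vec_def)
qed

lemma continuous_on_bil [continuous_intros]:
  "continuous_on S f \<Longrightarrow> continuous_on S g \<Longrightarrow> continuous_on S (\<lambda>x. bil (f x) (g x))"
  unfolding bil_def by (intro continuous_intros)

lemma holo_on_Eu:
  assumes "holo_on f U" "open U" shows "holo_on (Eu f) U"
proof -
  have "holo_on (\<lambda>z. \<Sum>k\<in>UNIV. z $ k * pd k f z) U"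
    by (intro holo_on_sum holo_on_mult holo_on_nth holo_on_pd assms)
  thus ?thesis by (simp add: Eu_def[abs_def])
qed

text \<open>E counts the degree and a partial derivative lowers it by one. This commutator is the
  origin of the index shifts in \<open>pd_raise\<close>, \<open>rel_raise\<close> and
  \<open>rel_pd\<close>.\<close>

lemma pd_Eu:
  assumes f: "holo_on f U" and U: "open U" and z: "z \<in> U"
  shows "pd k (Eu f) z = pd k f z + Eu (pd k f) z"
proof -
  have "pd k (Eu f) z = pd k (\<lambda>z. \<Sum>l\<in>UNIV. z $ l * pd l f z) z" by (simp add: Eu_def[abs_def])
  also have "\<dots> = (\<Sum>l\<in>UNIV. pd k (\<lambda>z. z $ l * pd l f z) z)"
    by (rule pd_sum[where U=U]) (auto intro!: holo_on_mult holo_on_pd f U z)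
  also have "\<dots> = (\<Sum>l\<in>UNIV. z $ l * pd l (pd k f) z + (if k = l then pd l f z else 0))"
    by (intro sum.cong refl)
       (simp add: pd_mult[OF holo_on_nth holo_on_pd[OF f U] z] pd_commute[OF f U z, of k])
  also have "\<dots> = Eu (pd k f) z + pd k f z" by (simp add: sum.distrib Eu_def)
  finally show ?thesis by simp
qed

lemma Eu_cmult: "holo_on f U \<Longrightarrow> z \<in> U \<Longrightarrow> Eu (\<lambda>z. c * f z) z = c * Eu f z"
  by (simp add: Eu_def pd_cmult sum_distrib_left mult_ac)

lemma Eu_add: "holo_on f U \<Longrightarrow> holo_on g U \<Longrightarrow> z \<in> U \<Longrightarrow> Eu (\<lambda>z. f z + g z) z = Eu f z + Eu g z"
  by (simp add: Eu_def pd_add sum.distrib ring_distribs)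

lemma Eu_sum: "(\<And>i. i \<in> I \<Longrightarrow> holo_on (f i) U) \<Longrightarrow> z \<in> U \<Longrightarrow> Eu (\<lambda>z. \<Sum>i\<in>I. f i z) z = (\<Sum>i\<in>I. Eu (f i) z)"
  unfolding Eu_def by (subst sum.swap) (simp add: pd_sum[where U=U and I=I and f=f] sum_distrib_left)

lemma Eu_mult: "holo_on f U \<Longrightarrow> holo_on g U \<Longrightarrow> z \<in> U \<Longrightarrow> Eu (\<lambda>z. f z * g z) z = f z * Eu g z + Eu f z * g z"
  by (simp add: Eu_def pd_mult sum.distrib ring_distribs sum_distrib_left sum_distrib_right mult_ac)

section \<open>Weighted integrals over the ball\<close>

definition bmeas :: "'a::euclidean_space measure" where
  "bmeas = restrict_space lborel (ball 0 1)"

text \<open>The weight is a power of 1 - |x|^2: each integration by parts lowers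
  \<open>\<kappa>\<close> by one and, for \<open>\<kappa>\<close> at least 2, leaves no boundary
  term.\<close>

definition wI :: "nat \<Rightarrow> ('a::euclidean_space \<Rightarrow> 'b::{banach,second_countable_topology}) \<Rightarrow> 'b" where
  "wI \<kappa> \<phi> = (\<integral>x. (1 - (norm x)\<^sup>2) ^ \<kappa> *\<^sub>R \<phi> x \<partial>bmeas)"

lemma space_bmeas [simp]: "space bmeas = ball 0 1"
  by (simp add: bmeas_def space_restrict_space)

lemma finite_measure_bmeas: "finite_measure (bmeas :: 'a::euclidean_space measure)"
proof
  have "emeasure (bmeas :: 'a measure) (ball 0 1) = emeasure lborel (ball 0 1 :: 'a set)"
    unfolding bmeas_def by (rule emeasure_restrict_space) auto
  thus "emeasure (bmeas :: 'a measure) (space bmeas) \<noteq> \<infinity>"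
    using emeasure_bounded_finite[of "ball 0 1 :: 'a set"] by (simp add: less_top)
qed

lemma measurable_bmeas:
  fixes f :: "'a::euclidean_space \<Rightarrow> 'b::{banach,second_countable_topology}"
  assumes "continuous_on (ball 0 1) f"
  shows "f \<in> borel_measurable bmeas"
proof -
  have "f \<in> borel_measurable (restrict_space borel (ball 0 1))"
    by (rule borel_measurable_continuous_on_restrict[OF assms])
  moreover have "sets (restrict_space lborel (ball 0 1 :: 'a set)) = sets (restrict_space borel (ball 0 1))"
    by (simp add: sets_restrict_space)
  ultimately show ?thesis unfolding bmeas_def using measurable_cong_sets by blast
qed

lemma weight_bounds:
  assumes "norm (x::'a::real_normed_vector) < 1"
  shows "0 < 1 - (norm x)\<^sup>2" "1 - (norm x)\<^sup>2 \<le> 1"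
  using assms by (auto simp: abs_square_less_1)

lemma integrable_bdd:
  fixes f :: "'a::euclidean_space \<Rightarrow> 'b::{banach,second_countable_topology}"
  assumes "continuous_on (ball 0 1) f" "\<And>x. norm x < 1 \<Longrightarrow> norm (f x) \<le> C"
  shows "integrable bmeas (\<lambda>x. (1 - (norm x)\<^sup>2) ^ \<kappa> *\<^sub>R f x)"
proof (rule finite_measure.integrable_const_bound[OF finite_measure_bmeas])
  show "(\<lambda>x. (1 - (norm x)\<^sup>2) ^ \<kappa> *\<^sub>R f x) \<in> borel_measurable bmeas"
    by (intro measurable_bmeas continuous_intros assms)
  show "AE x in bmeas. norm ((1 - (norm x)\<^sup>2) ^ \<kappa> *\<^sub>R f x) \<le> C"
  proof (rule AE_I2)
    fix x :: 'a assume "x \<in> space bmeas"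
    hence x: "norm x < 1" by simp
    have "(1 - (norm x)\<^sup>2) ^ \<kappa> \<le> 1" "0 \<le> (1 - (norm x)\<^sup>2) ^ \<kappa>"
      using weight_bounds[OF x] by (auto intro: power_le_one)
    hence "(1 - (norm x)\<^sup>2) ^ \<kappa> * norm (f x) \<le> 1 * norm (f x)"
      by (intro mult_right_mono) auto
    thus "norm ((1 - (norm x)\<^sup>2) ^ \<kappa> *\<^sub>R f x) \<le> C" using assms(2)[OF x] \<open>0 \<le> _\<close> by simp
  qed
qed

lemma cont_bdd:
  fixes f :: "'a::euclidean_space \<Rightarrow> 'b::real_normed_vector"
  assumes "continuous_on (cball 0 1) f"
  obtains C where "C \<ge> 0" "\<And>x. norm x \<le> 1 \<Longrightarrow> norm (f x) \<le> C"
proof -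
  have "bounded (f ` cball 0 1)"
    by (rule compact_imp_bounded[OF compact_continuous_image[OF assms compact_cball]])
  then obtain C where C: "\<forall>y\<in>f ` cball 0 1. norm y \<le> C"
    unfolding bounded_iff by blast
  hence C: "\<And>x. x \<in> cball 0 1 \<Longrightarrow> norm (f x) \<le> C" by blast
  have "C \<ge> 0" using C[of 0] norm_ge_zero[of "f 0"] by (simp del: norm_ge_zero)
  thus ?thesis using C that by auto
qed

lemma integrable_cont:
  fixes f :: "'a::euclidean_space \<Rightarrow> 'b::{banach,second_countable_topology}"
  assumes "continuous_on (cball 0 1) f"
  shows "integrable bmeas (\<lambda>x. (1 - (norm x)\<^sup>2) ^ \<kappa> *\<^sub>R f x)"
proof -
  obtain C where "\<And>x. norm x \<le> 1 \<Longrightarrow> norm (f x) \<le> C" using cont_bdd[OF assms] by blast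
  thus ?thesis by (intro integrable_bdd[where C=C] continuous_on_subset[OF assms]) auto
qed

lemma wI_cong:
  assumes "\<And>x. norm x < 1 \<Longrightarrow> f x = g x"
  shows "wI \<kappa> f = wI \<kappa> g"
  unfolding wI_def by (rule Bochner_Integration.integral_cong) (auto simp: assms)

lemma wI_add:
  assumes "continuous_on (cball 0 1) f" "continuous_on (cball 0 1) g"
  shows "wI \<kappa> (\<lambda>x. f x + g x) = wI \<kappa> f + wI \<kappa> g"
  unfolding wI_def using Bochner_Integration.integral_add[OF integrable_cont[OF assms(1)] integrable_cont[OF assms(2)]]
  by (simp add: scaleR_add_right)

lemma wI_diff:
  assumes "continuous_on (cball 0 1) f" "continuous_on (cball 0 1) g"
  shows "wI \<kappa> (\<lambda>x. f x - g x) = wI \<kappa> f - wI \<kappa> g"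
  unfolding wI_def using Bochner_Integration.integral_diff[OF integrable_cont[OF assms(1)] integrable_cont[OF assms(2)]]
  by (simp add: scaleR_diff_right)

lemma wI_cmult:
  fixes c :: "'b::{real_normed_field,banach,second_countable_topology}"
  shows "wI \<kappa> (\<lambda>x. c * f x) = c * wI \<kappa> f"
proof -
  have "wI \<kappa> (\<lambda>x. c * f x) = (\<integral>x. c * ((1 - (norm x)\<^sup>2) ^ \<kappa> *\<^sub>R f x) \<partial>bmeas)"
    unfolding wI_def by (rule Bochner_Integration.integral_cong) auto
  also have "\<dots> = c * wI \<kappa> f" unfolding wI_def by (rule integral_mult_right_zero)
  finally show ?thesis .
qed

lemma wI_zero [simp]: "wI \<kappa> (\<lambda>x. 0) = 0" by (simp add: wI_def)

lemma wI_sum: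
  assumes "\<And>i. i \<in> I \<Longrightarrow> continuous_on (cball 0 1) (f i)"
  shows "wI \<kappa> (\<lambda>x. \<Sum>i\<in>I. f i x) = (\<Sum>i\<in>I. wI \<kappa> (f i))"
  using assms
proof (induction I rule: infinite_finite_induct)
  case (insert i I)
  thus ?case by (simp add: wI_add continuous_on_sum)
qed auto

lemma wI_mono:
  fixes f g :: "'a::euclidean_space \<Rightarrow> real"
  assumes "continuous_on (cball 0 1) f" "continuous_on (cball 0 1) g" "\<And>x. norm x < 1 \<Longrightarrow> f x \<le> g x"
  shows "wI \<kappa> f \<le> wI \<kappa> g"
  unfolding wI_def
proof (rule integral_mono[OF integrable_cont[OF assms(1)] integrable_cont[OF assms(2)]])
  fix x :: 'a assume "x \<in> space bmeas"
  hence x: "norm x < 1" by simp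
  show "(1 - (norm x)\<^sup>2) ^ \<kappa> *\<^sub>R f x \<le> (1 - (norm x)\<^sup>2) ^ \<kappa> *\<^sub>R g x"
    using weight_bounds[OF x] assms(3)[OF x] by (intro scaleR_left_mono) auto
qed

lemma norm_wI_le:
  assumes "continuous_on (cball 0 1) f"
  shows "norm (wI \<kappa> f) \<le> wI \<kappa> (\<lambda>x. norm (f x))"
proof -
  have "norm (wI \<kappa> f) \<le> (\<integral>x. norm ((1 - (norm x)\<^sup>2) ^ \<kappa> *\<^sub>R f x) \<partial>bmeas)"
    unfolding wI_def by (rule integral_norm_bound)
  also have "\<dots> = wI \<kappa> (\<lambda>x. norm (f x))" unfolding wI_def
  proof (rule Bochner_Integration.integral_cong[OF refl])
    fix x :: 'a assume "x \<in> space bmeas"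
    hence "norm x < 1" by simp
    from weight_bounds[OF this] show "norm ((1 - (norm x)\<^sup>2) ^ \<kappa> *\<^sub>R f x) = (1 - (norm x)\<^sup>2) ^ \<kappa> *\<^sub>R norm (f x)"
      by simp
  qed
  finally show ?thesis .
qed

lemma wI_nonneg:
  fixes f :: "'a::euclidean_space \<Rightarrow> real"
  assumes "\<And>x. norm x < 1 \<Longrightarrow> 0 \<le> f x"
  shows "0 \<le> wI \<kappa> f"
  unfolding wI_def
proof (rule integral_nonneg_AE, rule AE_I2)
  fix x :: 'a assume "x \<in> space bmeas"
  hence x: "norm x < 1" by simp
  thus "0 \<le> (1 - (norm x)\<^sup>2) ^ \<kappa> *\<^sub>R f x" using weight_bounds[OF x] assms[OF x] by simp
qed

text \<open>Turns a vanishing weighted norm into pointwise vanishing: near a point where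
  \<open>f\<close> were positive, the weighted function would stay above half its value on a small
  ball.\<close>

lemma wI_eq_0_imp:
  fixes f :: "'a::euclidean_space \<Rightarrow> real"
  assumes f: "continuous_on (cball 0 1) f" and nn: "\<And>x. norm x < 1 \<Longrightarrow> 0 \<le> f x"
    and le: "wI \<kappa> f \<le> 0" and x: "norm x < 1"
  shows "f x = 0"
proof (rule ccontr)
  assume "f x \<noteq> 0"
  define g where "g = (\<lambda>y. (1 - (norm y)\<^sup>2) ^ \<kappa> *\<^sub>R f y)"
  have gx: "g x > 0" using \<open>f x \<noteq> 0\<close> nn[OF x] weight_bounds[OF x] by (simp add: g_def)
  have cg: "continuous_on (ball 0 1) g" unfolding g_def
    by (intro continuous_intros continuous_on_subset[OF f]) auto
  have g0: "g y \<ge> 0" if "norm y < 1" for y using nn[OF that] weight_bounds[OF that] by (simp add: g_def)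
  have "isCont g x" using cg x by (simp add: continuous_on_eq_continuous_at)
  then obtain d where d: "d > 0" "\<And>y. dist y x < d \<Longrightarrow> dist (g y) (g x) < g x / 2"
    using gx unfolding continuous_at_eps_delta by (metis half_gt_zero)
  define e where "e = min d (1 - norm x)"
  have e: "e > 0" "e \<le> d" using d x by (auto simp: e_def)
  have sub: "ball x e \<subseteq> ball 0 1"
  proof
    fix y assume "y \<in> ball x e"
    hence "norm (y - x) < 1 - norm x" by (simp add: e_def dist_norm norm_minus_commute)
    thus "y \<in> ball 0 1" using norm_triangle_ineq[of "y - x" x] by simp
  qed
  have lb: "g x / 2 * indicator (ball x e) y \<le> g y" if "norm y < 1" for y
  proof (cases "y \<in> ball x e")
    case True
    hence "dist (g y) (g x) < g x / 2" using d(2)[of y] e by (simp add: dist_commute)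
    thus ?thesis using True by (simp add: dist_real_def abs_if split: if_splits)
  qed (use g0[OF that] in auto)
  have ms: "ball x e \<in> sets bmeas"
    unfolding bmeas_def sets_restrict_space using sub by (auto simp: image_iff intro!: bexI[of _ "ball x e"])
  have m: "measure bmeas (ball x e) = measure lborel (ball x e)"
    unfolding bmeas_def by (rule measure_restrict_space) (use sub in auto)
  have "(\<integral>y. g x / 2 * indicator (ball x e) y \<partial>bmeas) \<le> (\<integral>y. g y \<partial>bmeas)"
  proof (rule integral_mono)
    show "integrable bmeas (\<lambda>y. g x / 2 * indicator (ball x e) y)"
      using ms finite_measure.emeasure_finite[OF finite_measure_bmeas, of "ball x e"]
      by (auto simp: top.not_eq_extremum)
    show "integrable bmeas g" unfolding g_def by (rule integrable_cont[OF f])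
  qed (use lb in auto)
  also have "(\<integral>y. g y \<partial>bmeas) = wI \<kappa> f" by (simp add: wI_def g_def)
  also have "(\<integral>y. g x / 2 * indicator (ball x e) y \<partial>bmeas) = g x / 2 * measure bmeas (ball x e)"
    using ms sub by (simp add: Int_absorb2)
  finally have "g x / 2 * measure lborel (ball x e) \<le> 0" using le unfolding m by linarith
  moreover have "measure lborel (ball x e) > 0"
    using content_ball_pos[OF e(1), of x] by simp
  ultimately show False using gx by (simp add: mult_le_0_iff)
qed

section \<open>Integration by parts\<close>

lemma lborel_integral_shift:
  fixes f :: "'a::euclidean_space \<Rightarrow> 'b::{banach,second_countable_topology}"
  assumes "f \<in> borel_measurable borel"
  shows "(\<integral>x. f (c + x) \<partial>lborel) = (\<integral>x. f x \<partial>lborel)"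
proof -
  have "(\<integral>x. f x \<partial>lborel) = (\<integral>x. f x \<partial>distr lborel borel ((+) c))" by (simp add: lborel_distr_plus)
  also have "\<dots> = (\<integral>x. f (c + x) \<partial>lborel)" by (rule integral_distr) (use assms in auto)
  finally show ?thesis by simp
qed

text \<open>Translation invariance makes every difference quotient of \<open>Y\<close> integrate to
  zero. The quotients converge to the derivative and are dominated, since \<open>Y\<close> is
  Lipschitz with constant \<open>B\<close> and supported in the unit ball.\<close>

lemma integral_directional_derivative_0:
  fixes Y :: "'a::euclidean_space \<Rightarrow> 'b::euclidean_space"
  assumes der: "\<And>x. (Y has_derivative Y' x) (at x)" and B: "\<And>x v. norm (Y' x v) \<le> B * norm v" "B \<ge> 0"
    and supp: "\<And>x. norm x \<ge> 1 \<Longrightarrow> Y x = 0"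
  shows "(\<integral>x. Y' x b \<partial>lborel) = 0"
proof -
  have cont: "continuous_on UNIV Y"
    using der by (meson continuous_at_imp_continuous_on has_derivative_continuous)
  hence meas: "Y \<in> borel_measurable borel" by (rule borel_measurable_continuous_onI)
  have lip: "norm (Y x - Y y) \<le> B * norm (x - y)" for x y
    by (rule differentiable_bound[of UNIV Y Y'])
       (auto intro: has_derivative_at_withinI[OF der] onorm_bound B)
  define h where "h = (\<lambda>n. 1 / real (Suc n))"
  have hpos: "h n > 0" for n by (simp add: h_def)
  have h0: "h \<longlonglongrightarrow> 0" unfolding h_def using LIMSEQ_inverse_real_of_nat by (simp add: inverse_eq_divide)
  define s where "s = (\<lambda>n x. (1 / h n) *\<^sub>R (Y (h n *\<^sub>R b + x) - Y x))"
  have intY: "integrable lborel Y"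
  proof (rule integrableI_bounded_set_indicator[where A="cball 0 1" and B="B", THEN Bochner_Integration.integrable_cong[THEN iffD1, rotated -1]])
    show "AE x in lborel. x \<in> cball 0 1 \<longrightarrow> norm (Y x) \<le> B"
    proof (rule AE_I2, rule impI)
      fix x :: 'a assume "x \<in> cball 0 1"
      show "norm (Y x) \<le> B"
      \<comment> \<open>A bound for \<open>Y\<close> from its zeros on the sphere: compare
        \<open>x\<close> with its radial projection, or the origin with a basis vector.\<close>
      proof (cases "x = 0")
        case True
        obtain e :: 'a where "e \<in> Basis" using nonempty_Basis by blast
        thus ?thesis using lip[of 0 e] supp[of e] True by simp
      next
        case False
        have "norm (Y x - Y (x /\<^sub>R norm x)) \<le> B * norm (x - x /\<^sub>R norm x)" by (rule lip)
        also have "norm (x - x /\<^sub>R norm x) = norm ((1 - 1 / norm x) *\<^sub>R x)" by (simp add: algebra_simps inverse_eq_divide)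
        also have "\<dots> \<le> 1" using \<open>x \<in> cball 0 1\<close> False by (simp add: abs_if field_simps)
        finally show ?thesis using supp[of "x /\<^sub>R norm x"] False B(2) by (simp add: mult_left_mono)
      qed
    qed
    show "indicator (cball 0 1) x *\<^sub>R Y x = Y x" for x using supp[of x] by (auto simp: indicator_def)
  qed (use meas emeasure_bounded_finite[of "cball 0 1 :: 'a set"] in \<open>auto simp: less_top\<close>)
  have ints: "(\<integral>x. s n x \<partial>lborel) = 0" for n
  proof -
    have i2: "integrable lborel (\<lambda>x. Y (h n *\<^sub>R b + x))"
    proof -
      have "integrable (distr lborel borel ((+) (h n *\<^sub>R b))) Y" using intY by (simp add: lborel_distr_plus)
      thus ?thesis by (rule integrable_distr[rotated]) auto
    qed
    show ?thesis unfolding s_def using lborel_integral_shift[OF meas, of "h n *\<^sub>R b"]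
      by (simp add: Bochner_Integration.integral_diff[OF i2 intY])
  qed
  have conv: "(\<lambda>n. s n x) \<longlonglongrightarrow> Y' x b" for x
  proof -
    interpret bounded_linear "Y' x" by (rule has_derivative_bounded_linear[OF der])
    have "((\<lambda>t. x + t *\<^sub>R b) has_derivative (\<lambda>t. t *\<^sub>R b)) (at (0::real))" by (auto intro!: derivative_eq_intros)
    from has_derivative_compose[OF this, of Y "Y' x"] der[of x]
    have "((\<lambda>t. Y (x + t *\<^sub>R b)) has_derivative (\<lambda>t. t *\<^sub>R Y' x b)) (at (0::real))" by (simp add: scaleR)
    hence "((\<lambda>t. Y (x + t *\<^sub>R b)) has_vector_derivative Y' x b) (at 0)" by (simp add: has_vector_derivative_def)
    hence "((\<lambda>t. (1 / t) *\<^sub>R (Y (x + t *\<^sub>R b) - Y x)) \<longlongrightarrow> Y' x b) (at 0)"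
    proof (intro LIM_I)
      fix r :: real assume "r > 0"
      moreover assume "((\<lambda>t. Y (x + t *\<^sub>R b)) has_vector_derivative Y' x b) (at 0)"
      ultimately obtain d where d: "d > 0"
        "\<And>t. t \<noteq> 0 \<Longrightarrow> \<bar>t\<bar> < d \<Longrightarrow> norm (Y (x + t *\<^sub>R b) - Y x - t *\<^sub>R Y' x b) / \<bar>t\<bar> < r"
        unfolding has_vector_derivative_def has_derivative_at' by auto
      have "norm ((1 / t) *\<^sub>R (Y (x + t *\<^sub>R b) - Y x) - Y' x b) < r" if "t \<noteq> 0" "\<bar>t\<bar> < d" for t
      proof -
        have "(1 / t) *\<^sub>R (Y (x + t *\<^sub>R b) - Y x) - Y' x b = (1 / t) *\<^sub>R (Y (x + t *\<^sub>R b) - Y x - t *\<^sub>R Y' x b)"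
          using that by (simp add: scaleR_diff_right)
        thus ?thesis using d(2)[OF that] by simp
      qed
      thus "\<exists>s>0. \<forall>t. t \<noteq> 0 \<and> norm (t - 0) < s \<longrightarrow> norm ((1 / t) *\<^sub>R (Y (x + t *\<^sub>R b) - Y x) - Y' x b) < r"
        using d(1) by auto
    qed
    from filterlim_compose[OF this, of h sequentially] h0 hpos show ?thesis
      by (simp add: s_def filterlim_at add.commute less_imp_neq[symmetric])
  qed
  have dom: "AE x in lborel. norm (s n x) \<le> indicator (cball 0 (1 + norm b)) x *\<^sub>R (B * norm b)" for n
  proof (rule AE_I2)
    fix x :: 'a
    have hn1: "h n \<le> 1" by (simp add: h_def)
    show "norm (s n x) \<le> indicator (cball 0 (1 + norm b)) x *\<^sub>R (B * norm b)"
    proof (cases "x \<in> cball 0 (1 + norm b)")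
      case True
      have "norm (Y (h n *\<^sub>R b + x) - Y x) \<le> B * (h n * norm b)"
        using lip[of "h n *\<^sub>R b + x" x] hpos[of n] by simp
      moreover have "norm (s n x) = norm (Y (h n *\<^sub>R b + x) - Y x) / h n"
        using hpos[of n] by (simp add: s_def)
      ultimately have "norm (s n x) \<le> B * norm b"
        using hpos[of n] by (simp add: pos_divide_le_eq mult_ac)
      thus ?thesis using True by simp
    next
      case False
      have "norm x \<le> norm (h n *\<^sub>R b + x) + norm (h n *\<^sub>R b)"
        by (metis add.commute add_diff_cancel_left' norm_triangle_ineq4)
      moreover have "norm (h n *\<^sub>R b) \<le> norm b" using hn1 hpos[of n] by (simp add: mult_left_le_one_le)
      ultimately have "norm (h n *\<^sub>R b + x) \<ge> 1" using False by simp
      thus ?thesis using False supp[of x] supp[of "h n *\<^sub>R b + x"] norm_ge_zero[of b]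
        by (simp add: s_def del: norm_ge_zero)
    qed
  qed
  have "(\<lambda>n. \<integral>x. s n x \<partial>lborel) \<longlonglongrightarrow> (\<integral>x. Y' x b \<partial>lborel)"
  proof (rule integral_dominated_convergence[where w="\<lambda>x. indicator (cball 0 (1 + norm b)) x *\<^sub>R (B * norm b)"])
    show "s n \<in> borel_measurable lborel" for n unfolding s_def using meas by measurable
    show "(\<lambda>x. Y' x b) \<in> borel_measurable lborel"
      by (rule borel_measurable_LIMSEQ_metric[of s]) (use conv meas in \<open>auto simp: s_def\<close>)
    show "integrable lborel (\<lambda>x. indicator (cball 0 (1 + norm b)) x *\<^sub>R (B * norm b))"
    proof (intro integrable_scaleR_left integrable_real_indicator)
      show "emeasure lborel (cball 0 (1 + norm b)) < \<infinity>" by (rule emeasure_lborel_cball_finite)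
    qed auto
  qed (use conv dom in auto)
  thus ?thesis by (simp add: ints LIMSEQ_const_iff)
qed


lemma wI_lborel:
  fixes f :: "'a::euclidean_space \<Rightarrow> 'b::{banach,second_countable_topology}"
  shows "wI \<kappa> f = (\<integral>x. (if norm x < 1 then (1 - (norm x)\<^sup>2) ^ \<kappa> *\<^sub>R f x else 0) \<partial>lborel)"
proof -
  have "wI \<kappa> f = (\<integral>x. indicator (ball 0 1) x *\<^sub>R ((1 - (norm x)\<^sup>2) ^ \<kappa> *\<^sub>R f x) \<partial>lborel)"
    unfolding wI_def bmeas_def by (subst integral_restrict_space) auto
  also have "\<dots> = (\<integral>x. (if norm x < 1 then (1 - (norm x)\<^sup>2) ^ \<kappa> *\<^sub>R f x else 0) \<partial>lborel)"
    by (rule Bochner_Integration.integral_cong) (auto simp: indicator_def)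
  finally show ?thesis .
qed

lemma weight_has_derivative:
  "((\<lambda>x::'a::real_inner. (1 - (norm x)\<^sup>2) ^ \<kappa>) has_derivative
     (\<lambda>v. - (2 * real \<kappa> * (1 - (norm x)\<^sup>2) ^ (\<kappa> - 1) * (x \<bullet> v)))) (at x)"
proof -
  have "((\<lambda>x. (1 - x \<bullet> x) ^ \<kappa>) has_derivative
     (\<lambda>v. - (2 * real \<kappa> * (1 - x \<bullet> x) ^ (\<kappa> - 1) * (x \<bullet> v)))) (at x)"
    by (auto intro!: derivative_eq_intros simp: inner_commute algebra_simps)
  thus ?thesis by (simp add: power2_norm_eq_inner)
qed

text \<open>The weight vanishes to second order on the sphere, so the weighted function extends by zero
  to a Lipschitz \<open>C\<^sup>1\<close> function and the boundary term disappears by translation invariance.\<close>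
lemma stokes_dir:
  fixes \<phi> :: "'a::euclidean_space \<Rightarrow> 'b::euclidean_space"
  assumes der: "\<And>x. norm x < 1 \<Longrightarrow> (\<phi> has_derivative \<phi>' x) (at x)"
    and c: "continuous_on (cball 0 1) \<phi>" and c': "continuous_on (cball 0 1) (\<lambda>x. \<phi>' x b)"
    and B: "\<And>x v. norm x < 1 \<Longrightarrow> norm (\<phi>' x v) \<le> B * norm v" and \<kappa>: "\<kappa> \<ge> 2"
  shows "wI \<kappa> (\<lambda>x. \<phi>' x b) = wI (\<kappa> - 1) (\<lambda>x. (2 * real \<kappa> * (x \<bullet> b)) *\<^sub>R \<phi> x)"
proof -
  obtain C where C: "C \<ge> 0" "\<And>x. norm x \<le> 1 \<Longrightarrow> norm (\<phi> x) \<le> C" using cont_bdd[OF c] by blast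
  define Y where "Y = (\<lambda>x. if norm x < 1 then (1 - (norm x)\<^sup>2) ^ \<kappa> *\<^sub>R \<phi> x else 0)"
  define Y' where "Y' = (\<lambda>x v. if norm x < 1 then (1 - (norm x)\<^sup>2) ^ \<kappa> *\<^sub>R \<phi>' x v
      - (2 * real \<kappa> * (1 - (norm x)\<^sup>2) ^ (\<kappa> - 1) * (x \<bullet> v)) *\<^sub>R \<phi> x else 0)"
  have derY: "(Y has_derivative Y' x) (at x)" for x
  proof -
    consider "norm x < 1" | "norm x > 1" | "norm x = 1" by linarith
    thus ?thesis
    proof cases
      case 1
      have "((\<lambda>x. (1 - (norm x)\<^sup>2) ^ \<kappa> *\<^sub>R \<phi> x) has_derivative Y' x) (at x)"
        using has_derivative_scaleR[OF weight_has_derivative der[OF 1]] 1 by (simp add: Y'_def)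
      thus ?thesis
        by (rule has_derivative_transform_within_open[where s="ball 0 1"]) (use 1 in \<open>auto simp: Y_def\<close>)
    next
      case 2
      have "((\<lambda>x. 0) has_derivative Y' x) (at x)" using 2 by (simp add: Y'_def)
      thus ?thesis
        by (rule has_derivative_transform_within_open[where s="- cball 0 1"]) (use 2 in \<open>auto simp: Y_def\<close>)
    next
      case 3
      have Yx: "Y x = 0" using 3 by (simp add: Y_def)
      \<comment> \<open>This uses \<open>\<kappa> \<ge> 2\<close>: for |x| = 1 the base 1 - |y|^2 of
        the weight is at most 2 |y - x|, and its square makes the derivative at \<open>x\<close>
        vanish.\<close>
      have bd: "norm (Y y) \<le> 4 * C * (norm (y - x))\<^sup>2" for y
      proof (cases "norm y < 1")
        case True
        have w: "0 < 1 - (norm y)\<^sup>2" "1 - (norm y)\<^sup>2 \<le> 1" using weight_bounds[OF True] .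
        have "1 - norm y \<le> norm (y - x)" using norm_triangle_ineq2[of x y] 3 by (simp add: norm_minus_commute)
        hence "(1 - norm y) * (1 + norm y) \<le> norm (y - x) * 2" using True by (intro mult_mono) auto
        hence "1 - (norm y)\<^sup>2 \<le> 2 * norm (y - x)" by (simp add: power2_eq_square algebra_simps)
        hence "(1 - (norm y)\<^sup>2)\<^sup>2 \<le> (2 * norm (y - x))\<^sup>2" using w by (intro power_mono) auto
        moreover have "(1 - (norm y)\<^sup>2) ^ \<kappa> \<le> (1 - (norm y)\<^sup>2)\<^sup>2" using w \<kappa> by (intro power_decreasing) auto
        ultimately have "(1 - (norm y)\<^sup>2) ^ \<kappa> \<le> 4 * (norm (y - x))\<^sup>2" by (simp add: power_mult_distrib)
        hence "(1 - (norm y)\<^sup>2) ^ \<kappa> * norm (\<phi> y) \<le> (4 * (norm (y - x))\<^sup>2) * C"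
          using True C by (intro mult_mono) auto
        thus ?thesis using True w by (simp add: Y_def mult_ac)
      qed (use C in \<open>simp add: Y_def\<close>)
      have "(Y has_derivative (\<lambda>v. 0)) (at x)"
        unfolding has_derivative_at'
      proof (intro conjI allI impI)
        fix e :: real assume e: "e > 0"
        define d where "d = e / (4 * C + 1)"
        have d: "d > 0" using e C by (simp add: d_def)
        have "norm (Y y - Y x - 0) / norm (y - x) < e" if "0 < norm (y - x)" "norm (y - x) < d" for y
        proof -
          have "norm (Y y - Y x - 0) / norm (y - x) \<le> 4 * C * (norm (y - x))\<^sup>2 / norm (y - x)"
            using bd[of y] Yx that by (simp add: divide_right_mono)
          also have "\<dots> = 4 * C * norm (y - x)" using that by (simp add: power2_eq_square)
          also have "\<dots> \<le> 4 * C * d" using that C by (intro mult_left_mono) auto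
          also have "\<dots> < (4 * C + 1) * d" using d by simp
          also have "\<dots> = e" using C by (simp add: d_def)
          finally show ?thesis .
        qed
        thus "\<exists>d>0. \<forall>y. 0 < norm (y - x) \<and> norm (y - x) < d \<longrightarrow> norm (Y y - Y x - 0) / norm (y - x) < e"
          using d by blast
      qed simp
      thus ?thesis using 3 by (simp add: Y'_def)
    qed
  qed
  have B0: "B \<ge> 0"
  proof -
    obtain e :: 'a where "e \<in> Basis" using nonempty_Basis by blast
    thus ?thesis using order_trans[OF norm_ge_zero B[of 0 e]] by simp
  qed
  have bound: "norm (Y' x v) \<le> (B + 2 * real \<kappa> * C) * norm v" for x v
  proof (cases "norm x < 1")
    case True
    have w: "0 < 1 - (norm x)\<^sup>2" "1 - (norm x)\<^sup>2 \<le> 1" using weight_bounds[OF True] .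
    hence p: "(1 - (norm x)\<^sup>2) ^ n \<le> 1" "0 \<le> (1 - (norm x)\<^sup>2) ^ n" for n by (auto intro: power_le_one)
    have "norm ((1 - (norm x)\<^sup>2) ^ \<kappa> *\<^sub>R \<phi>' x v) \<le> 1 * (B * norm v)"
      unfolding norm_scaleR using p[of \<kappa>] B[OF True, of v] by (intro mult_mono) auto
    moreover have "norm ((2 * real \<kappa> * (1 - (norm x)\<^sup>2) ^ (\<kappa> - 1) * (x \<bullet> v)) *\<^sub>R \<phi> x) \<le> (2 * real \<kappa> * norm v) * C"
    proof -
      have "\<bar>x \<bullet> v\<bar> \<le> 1 * norm v"
        using Cauchy_Schwarz_ineq2[of x v] True by (meson less_imp_le mult_right_mono norm_ge_zero order_trans)
      hence "(1 - (norm x)\<^sup>2) ^ (\<kappa> - 1) * \<bar>x \<bullet> v\<bar> \<le> 1 * norm v"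
        using p[of "\<kappa> - 1"] by (intro mult_mono) auto
      hence "2 * real \<kappa> * ((1 - (norm x)\<^sup>2) ^ (\<kappa> - 1) * \<bar>x \<bullet> v\<bar>) \<le> 2 * real \<kappa> * norm v"
        by (intro mult_left_mono) auto
      hence "\<bar>2 * real \<kappa> * (1 - (norm x)\<^sup>2) ^ (\<kappa> - 1) * (x \<bullet> v)\<bar> \<le> 2 * real \<kappa> * norm v"
        using p[of "\<kappa> - 1"] by (simp add: abs_mult mult.assoc)
      thus ?thesis unfolding norm_scaleR using C(2)[of x] True by (intro mult_mono) auto
    qed
    ultimately have "norm (Y' x v) \<le> 1 * (B * norm v) + (2 * real \<kappa> * norm v) * C"
      unfolding Y'_def using True norm_triangle_ineq4 order_trans add_mono by (smt (verit))
    thus ?thesis by (simp add: algebra_simps)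
  qed (use B0 C in \<open>simp add: Y'_def\<close>)
  have "(\<integral>x. Y' x b \<partial>lborel) = 0"
    by (rule integral_directional_derivative_0[OF derY bound]) (use B0 C in \<open>auto simp: Y_def\<close>)
  moreover have "(\<integral>x. Y' x b \<partial>lborel) = wI 0 (\<lambda>x. Y' x b)"
    unfolding wI_lborel by (rule Bochner_Integration.integral_cong) (auto simp: Y'_def)
  moreover have "wI 0 (\<lambda>x. Y' x b) = wI 0 (\<lambda>x. (1 - (norm x)\<^sup>2) ^ \<kappa> *\<^sub>R \<phi>' x b
       - (1 - (norm x)\<^sup>2) ^ (\<kappa> - 1) *\<^sub>R ((2 * real \<kappa> * (x \<bullet> b)) *\<^sub>R \<phi> x))"
    by (rule wI_cong) (simp add: Y'_def mult_ac)
  moreover have "\<dots> = wI 0 (\<lambda>x. (1 - (norm x)\<^sup>2) ^ \<kappa> *\<^sub>R \<phi>' x b)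
       - wI 0 (\<lambda>x. (1 - (norm x)\<^sup>2) ^ (\<kappa> - 1) *\<^sub>R ((2 * real \<kappa> * (x \<bullet> b)) *\<^sub>R \<phi> x))"
    by (rule wI_diff) (intro continuous_intros c c')+
  ultimately show ?thesis by (simp add: wI_def)
qed


section \<open>Adjoint identities for holomorphic and antiholomorphic factors\<close>

lemma holo_cont_cball:
  assumes "holo_on P (ball 0 R)" "R > 1"
  shows "continuous_on (cball 0 1) P"
  by (rule continuous_on_subset[OF holo_on_continuous[OF assms(1)]]) (use assms in auto)

lemma holo_cont_cball_cv:
  assumes "holo_on H (ball 0 R)" "R > 1"
  shows "continuous_on (cball 0 1) (\<lambda>x. H (cv x))"
  by (rule continuous_on_compose2[OF holo_cont_cball[OF assms]]) (auto intro!: continuous_intros)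

lemma sum_axis_fun:
  fixes d :: "'n::finite \<Rightarrow> complex"
  assumes "h 0 = 0"
  shows "(\<Sum>k\<in>UNIV. h (axis j c $ k) * d k) = h c * d j"
proof -
  have "(\<Sum>k\<in>UNIV. h (axis j c $ k) * d k) = (\<Sum>k\<in>UNIV. if k = j then h c * d k else 0)"
    by (intro sum.cong) (auto simp: axis_def assms)
  thus ?thesis by simp
qed

text \<open>\<open>stokes_dir\<close> speaks of real directions. Along \<open>axis j c\<close> the
  derivative of P(x) H(cv x) is the combination of its two Wirtinger derivatives with coefficients
  \<open>cnj c\<close> and \<open>c\<close>; the choices c = 1 and c = \<i> give two linear
  equations, which are solved for each of them.\<close>

lemma stokes_holo:
  fixes P H :: "complex^'n \<Rightarrow> complex"
  assumes P: "holo_on P (ball 0 R)" and H: "holo_on H (ball 0 R)" and R: "R > 1" and \<kappa>: "\<kappa> \<ge> 2"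
  shows stokes_dbar: "wI \<kappa> (\<lambda>x. P x * pd j H (cv x)) = of_nat \<kappa> * wI (\<kappa> - 1) (\<lambda>x. x $ j * P x * H (cv x))"
    and stokes_d: "wI \<kappa> (\<lambda>x. pd j P x * H (cv x)) = of_nat \<kappa> * wI (\<kappa> - 1) (\<lambda>x. cnj (x $ j) * P x * H (cv x))"
proof -
  define \<phi> where "\<phi> = (\<lambda>x. P x * H (cv x))"
  define \<phi>' where "\<phi>' = (\<lambda>x v. P x * (\<Sum>k\<in>UNIV. cnj (v $ k) * pd k H (cv x)) + (\<Sum>k\<in>UNIV. v $ k * pd k P x) * H (cv x))"
  have op: "open (ball 0 R :: (complex^'n) set)" by simp
  note cP = holo_cont_cball[OF P R] and cH = holo_cont_cball_cv[OF H R]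
  note cP' = holo_cont_cball[OF holo_on_pd[OF P op] R] and cH' = holo_cont_cball_cv[OF holo_on_pd[OF H op] R]
  have der: "(\<phi> has_derivative \<phi>' x) (at x)" if "norm x < 1" for x
    unfolding \<phi>_def \<phi>'_def using that R
    by (intro has_derivative_mult holo_on_has_derivative[OF P] cv_has_derivative[OF H]) auto
  define K where "K = (\<lambda>x. \<Sum>k\<in>UNIV. norm (P x) * norm (pd k H (cv x)) + norm (pd k P x) * norm (H (cv x)))"
  have "continuous_on (cball 0 1) K" unfolding K_def by (intro continuous_intros cP cH cP' cH')
  then obtain B where B: "\<And>x. norm x \<le> 1 \<Longrightarrow> norm (K x) \<le> B" using cont_bdd by blast
  have bd: "norm (\<phi>' x v) \<le> B * norm v" if "norm x < 1" for x v
  proof -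
    have "\<phi>' x v = (\<Sum>k\<in>UNIV. P x * (cnj (v $ k) * pd k H (cv x)) + v $ k * pd k P x * H (cv x))"
      by (simp add: \<phi>'_def sum.distrib sum_distrib_left sum_distrib_right)
    also have "norm \<dots> \<le> (\<Sum>k\<in>UNIV. (norm (P x) * norm (pd k H (cv x)) + norm (pd k P x) * norm (H (cv x))) * norm v)"
    proof (rule sum_norm_le)
      fix k :: 'n
      have vk: "norm (v $ k) \<le> norm v" by (rule Finite_Cartesian_Product.norm_nth_le)
      have "norm (P x * (cnj (v $ k) * pd k H (cv x)) + v $ k * pd k P x * H (cv x))
         \<le> (norm (P x) * norm (pd k H (cv x)) + norm (pd k P x) * norm (H (cv x))) * norm (v $ k)"
        by (rule order_trans[OF norm_triangle_ineq]) (simp add: norm_mult algebra_simps)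
      also have "\<dots> \<le> (norm (P x) * norm (pd k H (cv x)) + norm (pd k P x) * norm (H (cv x))) * norm v"
        using vk by (intro mult_left_mono) auto
      finally show "norm (P x * (cnj (v $ k) * pd k H (cv x)) + v $ k * pd k P x * H (cv x))
         \<le> (norm (P x) * norm (pd k H (cv x)) + norm (pd k P x) * norm (H (cv x))) * norm v" .
    qed
    also have "\<dots> = K x * norm v" by (simp add: K_def sum_distrib_right)
    also have "\<dots> \<le> B * norm v" using B[of x] that by (intro mult_right_mono) auto
    finally show ?thesis .
  qed
  have ev: "\<phi>' x (axis j c) = P x * (cnj c * pd j H (cv x)) + (c * pd j P x) * H (cv x)" for x c
    unfolding \<phi>'_def using sum_axis_fun[of cnj j c] sum_axis_fun[of "\<lambda>x. x" j c] by simp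
  have st: "wI \<kappa> (\<lambda>x. P x * (cnj c * pd j H (cv x)) + (c * pd j P x) * H (cv x)) =
      wI (\<kappa> - 1) (\<lambda>x. (2 * real \<kappa> * (x $ j \<bullet> c)) *\<^sub>R (P x * H (cv x)))" for c
    using stokes_dir[OF der, of "axis j c" B \<kappa>] bd \<kappa>
    by (simp add: ev \<phi>_def inner_axis continuous_intros cP cH cP' cH')
  define A1 where "A1 = wI \<kappa> (\<lambda>x. P x * pd j H (cv x))"
  define A2 where "A2 = wI \<kappa> (\<lambda>x. pd j P x * H (cv x))"
  define X where "X = wI (\<kappa> - 1) (\<lambda>x. of_real (Re (x $ j)) * (P x * H (cv x)))"
  define Y where "Y = wI (\<kappa> - 1) (\<lambda>x. of_real (Im (x $ j)) * (P x * H (cv x)))"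
  have split: "wI \<kappa> (\<lambda>x. P x * (cnj c * pd j H (cv x)) + (c * pd j P x) * H (cv x)) = cnj c * A1 + c * A2" for c
  proof -
    have "wI \<kappa> (\<lambda>x. P x * (cnj c * pd j H (cv x)) + (c * pd j P x) * H (cv x)) =
       wI \<kappa> (\<lambda>x. cnj c * (P x * pd j H (cv x)) + c * (pd j P x * H (cv x)))"
      by (rule wI_cong) (simp add: algebra_simps)
    also have "\<dots> = cnj c * A1 + c * A2"
      unfolding A1_def A2_def
      by (subst wI_add) (intro continuous_intros cP cH cP' cH' | simp add: wI_cmult)+
    finally show ?thesis .
  qed
  have e1: "A1 + A2 = 2 * of_nat \<kappa> * X"
  proof -
    have "A1 + A2 = wI (\<kappa> - 1) (\<lambda>x. (2 * real \<kappa> * (x $ j \<bullet> 1)) *\<^sub>R (P x * H (cv x)))"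
      using st[of 1] split[of 1] by simp
    also have "\<dots> = wI (\<kappa> - 1) (\<lambda>x. (2 * of_nat \<kappa>) * (of_real (Re (x $ j)) * (P x * H (cv x))))"
      by (rule wI_cong) (simp add: inner_complex_def scaleR_conv_of_real)
    finally show ?thesis by (simp only: wI_cmult X_def)
  qed
  have e2: "- \<i> * A1 + \<i> * A2 = 2 * of_nat \<kappa> * Y"
  proof -
    have "- \<i> * A1 + \<i> * A2 = wI (\<kappa> - 1) (\<lambda>x. (2 * real \<kappa> * (x $ j \<bullet> \<i>)) *\<^sub>R (P x * H (cv x)))"
      using st[of \<i>] split[of \<i>] by simp
    also have "\<dots> = wI (\<kappa> - 1) (\<lambda>x. (2 * of_nat \<kappa>) * (of_real (Im (x $ j)) * (P x * H (cv x))))"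
      by (rule wI_cong) (simp add: inner_complex_def scaleR_conv_of_real)
    finally show ?thesis by (simp only: wI_cmult Y_def)
  qed
  have xy: "wI (\<kappa> - 1) (\<lambda>x. x $ j * P x * H (cv x)) = X + \<i> * Y"
  proof -
    have "wI (\<kappa> - 1) (\<lambda>x. x $ j * P x * H (cv x)) =
       wI (\<kappa> - 1) (\<lambda>x. of_real (Re (x $ j)) * (P x * H (cv x)) + \<i> * (of_real (Im (x $ j)) * (P x * H (cv x))))"
      by (rule wI_cong) (subst complex_eq[of "x $ j" for x], simp add: algebra_simps)
    thus ?thesis unfolding X_def Y_def
      by (subst (asm) wI_add) (intro continuous_intros cP cH | simp add: wI_cmult)+
  qed
  have xy': "wI (\<kappa> - 1) (\<lambda>x. cnj (x $ j) * P x * H (cv x)) = X - \<i> * Y"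
  proof -
    have "wI (\<kappa> - 1) (\<lambda>x. cnj (x $ j) * P x * H (cv x)) =
       wI (\<kappa> - 1) (\<lambda>x. of_real (Re (x $ j)) * (P x * H (cv x)) - \<i> * (of_real (Im (x $ j)) * (P x * H (cv x))))"
    proof (rule wI_cong)
      fix x :: "complex^'n"
      have c: "cnj (x $ j) = of_real (Re (x $ j)) - \<i> * of_real (Im (x $ j))" by (simp add: complex_eq_iff)
      show "cnj (x $ j) * P x * H (cv x) =
         of_real (Re (x $ j)) * (P x * H (cv x)) - \<i> * (of_real (Im (x $ j)) * (P x * H (cv x)))"
        unfolding c by (simp add: algebra_simps)
    qed
    thus ?thesis unfolding X_def Y_def
      by (subst (asm) wI_diff) (intro continuous_intros cP cH | simp add: wI_cmult)+
  qed
  have "2 * A1 = (A1 + A2) + \<i> * (- \<i> * A1 + \<i> * A2)" by (simp add: algebra_simps)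
  also have "\<dots> = 2 * (of_nat \<kappa> * (X + \<i> * Y))" unfolding e1 e2 by (simp add: algebra_simps)
  finally have "A1 = of_nat \<kappa> * (X + \<i> * Y)" by (metis mult_left_cancel zero_neq_numeral)
  thus "wI \<kappa> (\<lambda>x. P x * pd j H (cv x)) = of_nat \<kappa> * wI (\<kappa> - 1) (\<lambda>x. x $ j * P x * H (cv x))"
    by (simp only: A1_def xy)
  have "2 * A2 = (A1 + A2) - \<i> * (- \<i> * A1 + \<i> * A2)" by (simp add: algebra_simps)
  also have "\<dots> = 2 * (of_nat \<kappa> * (X - \<i> * Y))" unfolding e1 e2 by (simp add: algebra_simps)
  finally have "A2 = of_nat \<kappa> * (X - \<i> * Y)" by (metis mult_left_cancel zero_neq_numeral)
  thus "wI \<kappa> (\<lambda>x. pd j P x * H (cv x)) = of_nat \<kappa> * wI (\<kappa> - 1) (\<lambda>x. cnj (x $ j) * P x * H (cv x))"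
    by (simp only: A2_def xy')
qed

lemma sum_mult_cnj: "(\<Sum>j\<in>UNIV. x $ j * cnj (x $ j)) = of_real ((norm (x::complex^'n))\<^sup>2)"
  using bil_cv[of x] by (simp add: bil_def)

lemma wI_drop:
  assumes "\<kappa> \<ge> 1"
  shows "wI \<kappa> f = wI (\<kappa> - 1) (\<lambda>x. (1 - (norm x)\<^sup>2) *\<^sub>R f x)"
  using assms by (cases \<kappa>) (simp_all add: wI_def mult.commute)

text \<open>Apply \<open>stokes_dbar\<close> to \<zeta>_j H(\<zeta>) and sum over j: the derivatives
  add up to N H + E H, and the products of x_j with its conjugate to |x|^2.\<close>

lemma wI_shift_dbar:
  fixes P H :: "complex^'n \<Rightarrow> complex"
  assumes P: "holo_on P (ball 0 R)" and H: "holo_on H (ball 0 R)" and R: "R > 1" and \<kappa>: "\<kappa> \<ge> 2"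
  shows "wI \<kappa> (\<lambda>x. P x * (of_nat CARD('n) * H (cv x) + Eu H (cv x))) =
     of_nat \<kappa> * wI (\<kappa> - 1) (\<lambda>x. of_real ((norm x)\<^sup>2) * (P x * H (cv x)))"
proof -
  have op: "open (ball 0 R :: (complex^'n) set)" by simp
  note cP = holo_cont_cball[OF P R] and cH = holo_cont_cball_cv[OF H R]
  note cH' = holo_cont_cball_cv[OF holo_on_pd[OF H op] R]
  have "wI \<kappa> (\<lambda>x. P x * (of_nat CARD('n) * H (cv x) + Eu H (cv x))) =
      wI \<kappa> (\<lambda>x. \<Sum>j\<in>UNIV. P x * (cnj (x $ j) * pd j H (cv x) + H (cv x)))"
    by (rule wI_cong) (simp add: Eu_def sum_distrib_left[symmetric] sum.distrib)
  also have "\<dots> = (\<Sum>j\<in>UNIV. wI \<kappa> (\<lambda>x. P x * (cnj (x $ j) * pd j H (cv x) + H (cv x))))"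
    by (rule wI_sum) (intro continuous_intros cP cH cH')
  also have "\<dots> = (\<Sum>j\<in>UNIV. wI \<kappa> (\<lambda>x. P x * pd j (\<lambda>\<zeta>. \<zeta> $ j * H \<zeta>) (cv x)))"
    using R by (intro sum.cong refl wI_cong) (simp add: pd_mult[OF holo_on_nth H])
  also have "\<dots> = (\<Sum>j\<in>UNIV. of_nat \<kappa> * wI (\<kappa> - 1) (\<lambda>x. x $ j * P x * (cv x $ j * H (cv x))))"
    by (intro sum.cong refl stokes_dbar[OF P holo_on_mult[OF holo_on_nth H] R \<kappa>])
  also have "\<dots> = of_nat \<kappa> * wI (\<kappa> - 1) (\<lambda>x. \<Sum>j\<in>UNIV. x $ j * P x * (cv x $ j * H (cv x)))"
    by (subst wI_sum) (intro continuous_intros cP cH | simp add: sum_distrib_left)+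
  also have "wI (\<kappa> - 1) (\<lambda>x. \<Sum>j\<in>UNIV. x $ j * P x * (cv x $ j * H (cv x))) =
      wI (\<kappa> - 1) (\<lambda>x. of_real ((norm x)\<^sup>2) * (P x * H (cv x)))"
    by (rule wI_cong) (simp only: sum_mult_cnj[symmetric], simp add: sum_distrib_left sum_distrib_right mult_ac)
  finally show ?thesis .
qed

text \<open>Multiplication by a coordinate function is adjoint to \<open>\<partial>\<^sub>k (N + \<kappa> + E)\<^sup>-\<^sup>1\<close>.\<close>
lemma wI_mult_coord:
  fixes P H :: "complex^'n \<Rightarrow> complex"
  assumes P: "holo_on P (ball 0 R)" and H: "holo_on H (ball 0 R)" and R: "R > 1" and \<kappa>: "\<kappa> \<ge> 2"
  shows "wI \<kappa> (\<lambda>x. P x * x $ k * (of_nat (CARD('n) + \<kappa>) * H (cv x) + Eu H (cv x))) =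
     wI \<kappa> (\<lambda>x. P x * pd k H (cv x))"
proof -
  have op: "open (ball 0 R :: (complex^'n) set)" by simp
  note cP = holo_cont_cball[OF P R] and cH = holo_cont_cball_cv[OF H R]
  note cH' = holo_cont_cball_cv[OF holo_on_Eu[OF H op] R]
  have Pk: "holo_on (\<lambda>x. P x * x $ k) (ball 0 R)" by (intro holo_on_mult P holo_on_nth)
  have "wI \<kappa> (\<lambda>x. P x * x $ k * (of_nat (CARD('n) + \<kappa>) * H (cv x) + Eu H (cv x))) =
     wI \<kappa> (\<lambda>x. P x * x $ k * (of_nat CARD('n) * H (cv x) + Eu H (cv x)) + of_nat \<kappa> * (P x * x $ k * H (cv x)))"
    by (rule wI_cong) (simp add: algebra_simps)
  also have "\<dots> = wI \<kappa> (\<lambda>x. P x * x $ k * (of_nat CARD('n) * H (cv x) + Eu H (cv x)))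
       + of_nat \<kappa> * wI \<kappa> (\<lambda>x. P x * x $ k * H (cv x))"
    by (subst wI_add) (intro continuous_intros cP cH cH' | simp add: wI_cmult)+
  also have "\<dots> = of_nat \<kappa> * (wI (\<kappa> - 1) (\<lambda>x. of_real ((norm x)\<^sup>2) * (P x * x $ k * H (cv x))) +
      wI \<kappa> (\<lambda>x. P x * x $ k * H (cv x)))"
    by (subst wI_shift_dbar[OF Pk H R \<kappa>]) (rule distrib_left[symmetric])
  \<comment> \<open>The extra summand \<open>\<kappa>\<close> H, written with one power of the
    weight less, supplies 1 - |x|^2 and completes |x|^2 to 1. This forces the index N +
    \<open>\<kappa>\<close>.\<close>
  also have "wI \<kappa> (\<lambda>x. P x * x $ k * H (cv x)) = wI (\<kappa> - 1) (\<lambda>x. of_real (1 - (norm x)\<^sup>2) * (P x * x $ k * H (cv x)))"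
    using \<kappa> by (subst wI_drop) (auto simp: scaleR_conv_of_real)
  also have "wI (\<kappa> - 1) (\<lambda>x. of_real ((norm x)\<^sup>2) * (P x * x $ k * H (cv x))) + \<dots> =
      wI (\<kappa> - 1) (\<lambda>x. x $ k * P x * H (cv x))"
    by (subst wI_add[symmetric]) (intro continuous_intros cP cH | simp add: algebra_simps)+
  finally show ?thesis by (simp add: stokes_dbar[OF P H R \<kappa>])
qed

section \<open>Bilinear differential relations\<close>

lemma sum_norm_mult_le:
  fixes x y :: "'n::finite \<Rightarrow> complex"
  shows "(norm (\<Sum>k\<in>UNIV. x k * y k))\<^sup>2 \<le> (\<Sum>k\<in>UNIV. (norm (x k))\<^sup>2) * (\<Sum>k\<in>UNIV. (norm (y k))\<^sup>2)"
proof -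
  have "norm (\<Sum>k\<in>UNIV. x k * y k) \<le> L2_set (\<lambda>k. norm (x k)) UNIV * L2_set (\<lambda>k. norm (y k)) UNIV"
    using norm_bil_le[of "\<chi> k. x k" "\<chi> k. y k"] by (simp add: bil_def norm_vec_def)
  hence "(norm (\<Sum>k\<in>UNIV. x k * y k))\<^sup>2 \<le> (L2_set (\<lambda>k. norm (x k)) UNIV * L2_set (\<lambda>k. norm (y k)) UNIV)\<^sup>2"
    by (rule power_mono) simp
  thus ?thesis by (simp add: power_mult_distrib L2_set_def sum_nonneg)
qed

lemma wI_of_real: "wI \<kappa> (\<lambda>x. complex_of_real (f x)) = complex_of_real (wI \<kappa> f)"
proof -
  have "wI \<kappa> (\<lambda>x. complex_of_real (f x)) = (\<integral>x. complex_of_real ((1 - (norm x)\<^sup>2) ^ \<kappa> *\<^sub>R f x) \<partial>bmeas)"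
    unfolding wI_def by (rule Bochner_Integration.integral_cong) (auto simp: scaleR_conv_of_real)
  also have "\<dots> = complex_of_real (wI \<kappa> f)" unfolding wI_def by (rule integral_complex_of_real)
  finally show ?thesis .
qed

lemma norm_Eu_le:
  assumes "norm z \<le> 1"
  shows "(norm (Eu f z))\<^sup>2 \<le> (\<Sum>k\<in>UNIV. (norm (pd k f z))\<^sup>2)"
proof -
  have "(norm (Eu f z))\<^sup>2 \<le> (\<Sum>k\<in>UNIV. (norm (z $ k))\<^sup>2) * (\<Sum>k\<in>UNIV. (norm (pd k f z))\<^sup>2)"
    unfolding Eu_def by (rule sum_norm_mult_le)
  also have "(\<Sum>k\<in>UNIV. (norm (z $ k))\<^sup>2) = (norm z)\<^sup>2"
    by (simp add: norm_vec_def L2_set_def sum_nonneg)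
  also have "(norm z)\<^sup>2 * (\<Sum>k\<in>UNIV. (norm (pd k f z))\<^sup>2) \<le> 1 * (\<Sum>k\<in>UNIV. (norm (pd k f z))\<^sup>2)"
    using assms by (intro mult_right_mono) (auto intro: sum_nonneg power_le_one)
  finally show ?thesis by simp
qed

text \<open>Pairing (M + E) h with E h and applying \<open>wI_mult_coord\<close> to each conjugated
  partial derivative gives the integral of the sum of all |pd k h|^2, which dominates |E h|^2 on the
  ball. Hence the cross term in |M h + E h|^2 has nonnegative integral. The constant M grows with
  \<open>\<kappa>\<close>, and that is what the case of order zero exploits.\<close>

lemma wI_norm_raise_ge:
  fixes h :: "complex^'n \<Rightarrow> complex"
  assumes h: "holo_on h (ball 0 R)" and R: "R > 1" and \<kappa>: "\<kappa> \<ge> 2"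
  defines "M \<equiv> CARD('n) + \<kappa>"
  shows "(real M)\<^sup>2 * wI \<kappa> (\<lambda>x. (norm (h (cv x)))\<^sup>2) \<le> wI \<kappa> (\<lambda>x. (norm (of_nat M * h (cv x) + Eu h (cv x)))\<^sup>2)"
proof -
  have op: "open (ball 0 R :: (complex^'n) set)" by simp
  define c where "c = (\<lambda>\<zeta>. of_nat M * h \<zeta> + Eu h \<zeta>)"
  note ch = holo_cont_cball_cv[OF h R] and ce = holo_cont_cball_cv[OF holo_on_Eu[OF h op] R]
    and cp = holo_cont_cball_cv[OF holo_on_pd[OF h op] R]
  have Pk: "holo_on (\<lambda>x. cnj (pd k h (cv x))) (ball 0 R)" for k
    by (rule holo_on_conj[OF holo_on_pd[OF h op]]) simp
  have "(\<Sum>k\<in>UNIV. wI \<kappa> (\<lambda>x. cnj (pd k h (cv x)) * x $ k * c (cv x))) =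
        (\<Sum>k\<in>UNIV. wI \<kappa> (\<lambda>x. cnj (pd k h (cv x)) * pd k h (cv x)))"
    unfolding c_def M_def by (intro sum.cong refl wI_mult_coord[OF Pk h R \<kappa>])
  moreover have "(\<Sum>k\<in>UNIV. wI \<kappa> (\<lambda>x. cnj (pd k h (cv x)) * x $ k * c (cv x))) =
      wI \<kappa> (\<lambda>x. \<Sum>k\<in>UNIV. cnj (pd k h (cv x)) * x $ k * c (cv x))"
    unfolding c_def by (rule wI_sum[symmetric]) (intro continuous_intros ch ce cp)
  \<comment> \<open>Summed over k, the conjugated partial derivatives times x_k form the conjugate
    of E h.\<close>
  moreover have "\<dots> = wI \<kappa> (\<lambda>x. cnj (Eu h (cv x)) * c (cv x))"
    by (rule wI_cong) (simp add: Eu_def sum_distrib_left sum_distrib_right mult_ac)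
  moreover have "(\<Sum>k\<in>UNIV. wI \<kappa> (\<lambda>x. cnj (pd k h (cv x)) * pd k h (cv x))) =
      wI \<kappa> (\<lambda>x. \<Sum>k\<in>UNIV. cnj (pd k h (cv x)) * pd k h (cv x))"
    by (rule wI_sum[symmetric]) (intro continuous_intros cp)
  moreover have "\<dots> = wI \<kappa> (\<lambda>x. complex_of_real (\<Sum>k\<in>UNIV. (norm (pd k h (cv x)))\<^sup>2))"
    by (rule wI_cong) (simp add: complex_norm_square mult.commute del: of_real_power)
  ultimately have 1: "wI \<kappa> (\<lambda>x. cnj (Eu h (cv x)) * c (cv x)) = complex_of_real (wI \<kappa> (\<lambda>x. \<Sum>k\<in>UNIV. (norm (pd k h (cv x)))\<^sup>2))"
    by (simp only: wI_of_real)
  have "wI \<kappa> (\<lambda>x. cnj (Eu h (cv x)) * c (cv x)) =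
     wI \<kappa> (\<lambda>x. of_nat M * (cnj (Eu h (cv x)) * h (cv x)) + complex_of_real ((norm (Eu h (cv x)))\<^sup>2))"
    by (rule wI_cong) (simp add: c_def complex_norm_square algebra_simps del: of_real_power)
  also have "\<dots> = of_nat M * wI \<kappa> (\<lambda>x. cnj (Eu h (cv x)) * h (cv x)) + complex_of_real (wI \<kappa> (\<lambda>x. (norm (Eu h (cv x)))\<^sup>2))"
    by (subst wI_add) (intro continuous_intros ch ce | simp only: wI_cmult wI_of_real)+
  finally have 2: "of_nat M * wI \<kappa> (\<lambda>x. cnj (Eu h (cv x)) * h (cv x)) =
     complex_of_real (wI \<kappa> (\<lambda>x. \<Sum>k\<in>UNIV. (norm (pd k h (cv x)))\<^sup>2) - wI \<kappa> (\<lambda>x. (norm (Eu h (cv x)))\<^sup>2))"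
    using 1 by simp
  have "wI \<kappa> (\<lambda>x. (norm (Eu h (cv x)))\<^sup>2) \<le> wI \<kappa> (\<lambda>x. \<Sum>k\<in>UNIV. (norm (pd k h (cv x)))\<^sup>2)"
    by (rule wI_mono) (intro continuous_intros ce cp | simp add: norm_Eu_le)+
  hence 3: "0 \<le> Re (of_nat M * wI \<kappa> (\<lambda>x. cnj (Eu h (cv x)) * h (cv x)))" unfolding 2 by simp
  have "complex_of_real (wI \<kappa> (\<lambda>x. (norm (c (cv x)))\<^sup>2)) = wI \<kappa> (\<lambda>x. cnj (c (cv x)) * c (cv x))"
    unfolding wI_of_real[symmetric] by (rule wI_cong) (simp add: complex_norm_square mult.commute del: of_real_power)
  also have "\<dots> = wI \<kappa> (\<lambda>x. complex_of_real ((real M)\<^sup>2 * (norm (h (cv x)))\<^sup>2 + (norm (Eu h (cv x)))\<^sup>2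
       + 2 * Re (of_nat M * (cnj (Eu h (cv x)) * h (cv x)))))"
  proof (rule wI_cong)
    fix x :: "complex^'n"
    let ?a = "h (cv x)" and ?b = "Eu h (cv x)"
    have "cnj (c (cv x)) * c (cv x) = complex_of_real ((norm (of_nat M * ?a + ?b))\<^sup>2)"
      by (simp add: c_def complex_norm_square mult.commute del: of_real_power)
    also have "(norm (of_nat M * ?a + ?b))\<^sup>2 = (real M)\<^sup>2 * (norm ?a)\<^sup>2 + (norm ?b)\<^sup>2 + 2 * Re (of_nat M * (cnj ?b * ?a))"
      by (simp only: cmod_power2) (simp add: power2_eq_square algebra_simps)
    finally show "cnj (c (cv x)) * c (cv x) = complex_of_real ((real M)\<^sup>2 * (norm ?a)\<^sup>2 + (norm ?b)\<^sup>2 + 2 * Re (of_nat M * (cnj ?b * ?a)))" .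
  qed
  finally have "wI \<kappa> (\<lambda>x. (norm (c (cv x)))\<^sup>2) = wI \<kappa> (\<lambda>x. (real M)\<^sup>2 * (norm (h (cv x)))\<^sup>2 + (norm (Eu h (cv x)))\<^sup>2
       + 2 * Re (of_nat M * (cnj (Eu h (cv x)) * h (cv x))))"
    unfolding wI_of_real by (simp only: of_real_eq_iff)
  also have "\<dots> = (real M)\<^sup>2 * wI \<kappa> (\<lambda>x. (norm (h (cv x)))\<^sup>2) + wI \<kappa> (\<lambda>x. (norm (Eu h (cv x)))\<^sup>2)
       + 2 * wI \<kappa> (\<lambda>x. Re (of_nat M * (cnj (Eu h (cv x)) * h (cv x))))"
    by (simp only: wI_cmult[symmetric]) (subst wI_add[symmetric], (intro continuous_intros ch ce | simp)+)+
  also have "wI \<kappa> (\<lambda>x. Re (of_nat M * (cnj (Eu h (cv x)) * h (cv x)))) = Re (wI \<kappa> (\<lambda>x. of_nat M * (cnj (Eu h (cv x)) * h (cv x))))"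
  proof -
    have "integrable bmeas (\<lambda>x. (1 - (norm x)\<^sup>2) ^ \<kappa> *\<^sub>R (of_nat M * (cnj (Eu h (cv x)) * h (cv x))))"
      by (rule integrable_cont) (intro continuous_intros ch ce)
    from integral_Re[OF this] show ?thesis unfolding wI_def by simp
  qed
  finally show ?thesis
    using 3 wI_nonneg[of "\<lambda>x. (norm (Eu h (cv x)))\<^sup>2" \<kappa>] unfolding wI_cmult c_def by simp
qed

section \<open>Differentiation under the weighted integral\<close>

lemma has_vector_derivative_within_tendsto:
  "(f has_vector_derivative D) (at t within S) \<longleftrightarrow> ((\<lambda>s. (1 / (s - t)) *\<^sub>R (f s - f t)) \<longlongrightarrow> D) (at t within S)"
proof -
  have "((\<lambda>y. (1 / norm (y - t)) *\<^sub>R (f y - (f t + (y - t) *\<^sub>R D))) \<longlongrightarrow> 0) (at t within S) \<longleftrightarrow>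
    ((\<lambda>y. norm ((1 / norm (y - t)) *\<^sub>R (f y - (f t + (y - t) *\<^sub>R D)))) \<longlongrightarrow> 0) (at t within S)"
    by (rule tendsto_norm_zero_iff[symmetric])
  also have "\<dots> \<longleftrightarrow> ((\<lambda>s. norm ((1 / (s - t)) *\<^sub>R (f s - f t) - D)) \<longlongrightarrow> 0) (at t within S)"
  proof (rule filterlim_cong[OF refl refl])
    have "norm ((1 / norm (y - t)) *\<^sub>R (f y - (f t + (y - t) *\<^sub>R D))) = norm ((1 / (y - t)) *\<^sub>R (f y - f t) - D)" if "y \<noteq> t" for y
    proof -
      have "(1 / (y - t)) *\<^sub>R (f y - f t) - D = (1 / (y - t)) *\<^sub>R (f y - (f t + (y - t) *\<^sub>R D))"
        using that by (simp add: diff_diff_eq[symmetric] scaleR_diff_right[of _ "f y - f t"])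
      thus ?thesis by simp
    qed
    thus "\<forall>\<^sub>F y in at t within S. norm ((1 / norm (y - t)) *\<^sub>R (f y - (f t + (y - t) *\<^sub>R D))) = norm ((1 / (y - t)) *\<^sub>R (f y - f t) - D)"
      by (auto simp: eventually_at_filter)
  qed
  also have "\<dots> \<longleftrightarrow> ((\<lambda>s. (1 / (s - t)) *\<^sub>R (f s - f t)) \<longlongrightarrow> D) (at t within S)"
    unfolding tendsto_norm_zero_iff by (rule LIM_zero_iff)
  finally show ?thesis
    unfolding has_vector_derivative_def has_derivative_within by (simp add: bounded_linear_scaleR_left)
qed

text \<open>The ball has finite measure, so the constant \<open>C\<close>, which bounds the
  difference quotients by the mean value inequality on the convex set \<open>S\<close>, is a
  dominating function.\<close>

lemma wI_has_vector_derivative: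
  fixes \<phi> :: "real \<Rightarrow> 'a::euclidean_space \<Rightarrow> 'b::euclidean_space"
  assumes S: "convex S" and t: "t \<in> S"
    and der: "\<And>s x. s \<in> S \<Longrightarrow> norm x < 1 \<Longrightarrow> ((\<lambda>s. \<phi> s x) has_vector_derivative \<phi>' s x) (at s within S)"
    and bd: "\<And>s x. s \<in> S \<Longrightarrow> norm x < 1 \<Longrightarrow> norm (\<phi>' s x) \<le> C"
    and c: "\<And>s. s \<in> S \<Longrightarrow> continuous_on (cball 0 1) (\<phi> s)"
    and c': "continuous_on (cball 0 1) (\<phi>' t)"
  shows "((\<lambda>s. wI \<kappa> (\<phi> s)) has_vector_derivative wI \<kappa> (\<phi>' t)) (at t within S)"
  unfolding has_vector_derivative_within_tendsto tendsto_at_iff_sequentially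
proof (intro allI impI)
  fix X :: "nat \<Rightarrow> real" assume X: "\<forall>i. X i \<in> S - {t}" "X \<longlonglongrightarrow> t"
  let ?w = "\<lambda>x::'a. (1 - (norm x)\<^sup>2) ^ \<kappa>"
  define s where "s = (\<lambda>n x. ?w x *\<^sub>R ((1 / (X n - t)) *\<^sub>R (\<phi> (X n) x - \<phi> t x)))"
  have eq: "(1 / (X n - t)) *\<^sub>R (wI \<kappa> (\<phi> (X n)) - wI \<kappa> (\<phi> t)) = (\<integral>x. s n x \<partial>bmeas)" for n
  proof -
    have "wI \<kappa> (\<phi> (X n)) - wI \<kappa> (\<phi> t) = wI \<kappa> (\<lambda>x. \<phi> (X n) x - \<phi> t x)"
      by (rule wI_diff[symmetric]) (use X t c in auto)
    also have "(1 / (X n - t)) *\<^sub>R \<dots> = (\<integral>x. (1 / (X n - t)) *\<^sub>R (?w x *\<^sub>R (\<phi> (X n) x - \<phi> t x)) \<partial>bmeas)"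
      unfolding wI_def by (rule integral_scaleR_right[symmetric])
    also have "\<dots> = (\<integral>x. s n x \<partial>bmeas)" unfolding s_def by (simp add: mult.commute)
    finally show ?thesis .
  qed
  have "(\<lambda>n. \<integral>x. s n x \<partial>bmeas) \<longlonglongrightarrow> (\<integral>x. ?w x *\<^sub>R \<phi>' t x \<partial>bmeas)"
  proof (rule integral_dominated_convergence[where w="\<lambda>x. C"])
    show "(\<lambda>x. ?w x *\<^sub>R \<phi>' t x) \<in> borel_measurable bmeas"
      by (intro measurable_bmeas continuous_intros continuous_on_subset[OF c']) auto
    show "s n \<in> borel_measurable bmeas" for n unfolding s_def
      by (intro measurable_bmeas continuous_intros continuous_on_subset[OF c]) (use X t in auto)
    show "integrable bmeas (\<lambda>x. C)"
      by (rule finite_measure.integrable_const[OF finite_measure_bmeas])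
    show "AE x in bmeas. (\<lambda>n. s n x) \<longlonglongrightarrow> ?w x *\<^sub>R \<phi>' t x"
    proof (rule AE_I2)
      fix x :: 'a assume "x \<in> space bmeas"
      hence x: "norm x < 1" by simp
      have "((\<lambda>s. (1 / (s - t)) *\<^sub>R (\<phi> s x - \<phi> t x)) \<longlongrightarrow> \<phi>' t x) (at t within S)"
        using der[OF t x] unfolding has_vector_derivative_within_tendsto .
      hence "((\<lambda>s. (1 / (s - t)) *\<^sub>R (\<phi> s x - \<phi> t x)) \<circ> X) \<longlonglongrightarrow> \<phi>' t x"
        using X unfolding tendsto_at_iff_sequentially by blast
      thus "(\<lambda>n. s n x) \<longlonglongrightarrow> ?w x *\<^sub>R \<phi>' t x" unfolding s_def o_def by (intro tendsto_intros)
    qed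
    show "AE x in bmeas. norm (s n x) \<le> C" for n
    proof (rule AE_I2)
      fix x :: 'a assume "x \<in> space bmeas"
      hence x: "norm x < 1" by simp
      have Xn: "X n \<in> S" "X n \<noteq> t" using X by auto
      have "norm (\<phi> (X n) x - \<phi> t x) \<le> C * norm (X n - t)"
      proof (rule differentiable_bound[OF S, where f'="\<lambda>s h. h *\<^sub>R \<phi>' s x"])
        show "((\<lambda>s. \<phi> s x) has_derivative (\<lambda>h. h *\<^sub>R \<phi>' s x)) (at s within S)" if "s \<in> S" for s
          using der[OF that x] by (simp add: has_vector_derivative_def)
        show "onorm (\<lambda>h. h *\<^sub>R \<phi>' s x) \<le> C" if "s \<in> S" for s
          by (rule onorm_bound) (use bd[OF that x] order_trans[OF norm_ge_zero bd[OF that x]] in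
              \<open>auto simp: mult.commute[of C] intro: mult_left_mono\<close>)
      qed (use Xn t in auto)
      hence "norm ((1 / (X n - t)) *\<^sub>R (\<phi> (X n) x - \<phi> t x)) \<le> C"
        unfolding norm_scaleR using Xn by (simp add: field_simps abs_if split: if_splits)
      moreover have "?w x \<le> 1" "0 \<le> ?w x" using weight_bounds[OF x] by (auto intro: power_le_one)
      ultimately have "?w x * norm ((1 / (X n - t)) *\<^sub>R (\<phi> (X n) x - \<phi> t x)) \<le> 1 * C"
        by (intro mult_mono) auto
      thus "norm (s n x) \<le> C" using \<open>0 \<le> ?w x\<close> by (simp add: s_def)
    qed
  qed
  thus "((\<lambda>s. (1 / (s - t)) *\<^sub>R (wI \<kappa> (\<phi> s) - wI \<kappa> (\<phi> t))) \<circ> X) \<longlonglongrightarrow> wI \<kappa> (\<phi>' t)"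
    unfolding o_def eq by (simp add: wI_def)
qed

text \<open>The kernel \<open>\<Sum>i. a\<^sub>i(z) h\<^sub>i(\<zeta>)\<close> is annihilated by \<open>\<Delta> - (m + E\<^sub>z)(j + E\<^sub>\<zeta>)\<close>.\<close>
definition rel :: "nat \<Rightarrow> nat \<Rightarrow> 'i set \<Rightarrow> ('i \<Rightarrow> complex^'n \<Rightarrow> complex) \<Rightarrow> ('i \<Rightarrow> complex^'n \<Rightarrow> complex) \<Rightarrow> real \<Rightarrow> real \<Rightarrow> bool" where
  "rel m j I a h r s \<longleftrightarrow> (\<forall>z\<in>ball 0 r. \<forall>\<zeta>\<in>ball 0 s.
     (\<Sum>i\<in>I. \<Sum>k\<in>UNIV. pd k (a i) z * pd k (h i) \<zeta>) =
     (\<Sum>i\<in>I. (of_nat m * a i z + Eu (a i) z) * (of_nat j * h i \<zeta> + Eu (h i) \<zeta>)))"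

text \<open>The operator j + E. It multiplies homogeneous polynomials of degree d by j + d, so for j
  \<ge> 1 it loses no information.\<close>

definition raise :: "nat \<Rightarrow> (complex^'n \<Rightarrow> complex) \<Rightarrow> complex^'n \<Rightarrow> complex" where
  "raise j h = (\<lambda>\<zeta>. of_nat j * h \<zeta> + Eu h \<zeta>)"

lemma holo_on_raise: "holo_on h U \<Longrightarrow> open U \<Longrightarrow> holo_on (raise j h) U"
  unfolding raise_def by (intro holo_on_add holo_on_cmult holo_on_Eu)

lemma pd_raise:
  assumes "holo_on h U" "open U" "z \<in> U"
  shows "pd k (raise j h) z = raise (Suc j) (pd k h) z"
proof -
  have "pd k (raise j h) z = pd k (\<lambda>z. of_nat j * h z) z + pd k (Eu h) z"
    unfolding raise_def by (rule pd_add[OF holo_on_cmult[OF assms(1)] holo_on_Eu[OF assms(1,2)] assms(3)])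
  thus ?thesis by (simp add: pd_cmult[OF assms(1,3)] pd_Eu[OF assms] raise_def algebra_simps)
qed

lemma raise_cong_open:
  assumes "open U" "z \<in> U" "\<And>w. w \<in> U \<Longrightarrow> f w = g w"
  shows "raise j f z = raise j g z"
  using assms pd_cong_open[OF assms] by (simp add: raise_def Eu_def)

lemma raise_sum:
  assumes "\<And>i. i \<in> I \<Longrightarrow> holo_on (f i) U" "z \<in> U"
  shows "raise j (\<lambda>z. \<Sum>i\<in>I. c i * f i z) z = (\<Sum>i\<in>I. c i * raise j (f i) z)"
proof -
  have "Eu (\<lambda>z. \<Sum>i\<in>I. c i * f i z) z = (\<Sum>i\<in>I. Eu (\<lambda>z. c i * f i z) z)"
    by (rule Eu_sum[where U=U]) (use assms in \<open>auto intro: holo_on_cmult\<close>)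
  also have "\<dots> = (\<Sum>i\<in>I. c i * Eu (f i) z)"
    by (intro sum.cong refl Eu_cmult[where U=U]) (use assms in auto)
  finally show ?thesis by (simp add: raise_def sum.distrib sum_distrib_left ring_distribs mult_ac)
qed

text \<open>By \<open>pd_raise\<close>, j + 1 + E in \<zeta> passes through the partial derivatives
  as j + E, so the relation survives with both the functions and the index raised. Iteration brings
  the index to N + \<open>\<kappa>\<close>, the value at which \<open>wI_mult_coord\<close>
  applies.\<close>

lemma rel_raise:
  assumes r: "rel m j I a h r s" and h: "\<And>i. i \<in> I \<Longrightarrow> holo_on (h i) (ball 0 s)"
  shows "rel m (Suc j) I a (\<lambda>i. raise j (h i)) r s"
  unfolding rel_def
proof (intro ballI)
  fix z \<zeta> :: "complex^'b" assume z: "z \<in> ball 0 r" and \<zeta>: "\<zeta> \<in> ball 0 s"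
  have op: "open (ball 0 s :: (complex^'b) set)" by simp
  have "raise (Suc j) (\<lambda>\<zeta>. \<Sum>i\<in>I. \<Sum>k\<in>UNIV. pd k (a i) z * pd k (h i) \<zeta>) \<zeta> =
        raise (Suc j) (\<lambda>\<zeta>. \<Sum>i\<in>I. (of_nat m * a i z + Eu (a i) z) * raise j (h i) \<zeta>) \<zeta>"
    by (rule raise_cong_open[OF op \<zeta>]) (use r z in \<open>simp add: rel_def raise_def\<close>)
  also have "raise (Suc j) (\<lambda>\<zeta>. \<Sum>i\<in>I. \<Sum>k\<in>UNIV. pd k (a i) z * pd k (h i) \<zeta>) \<zeta> =
      raise (Suc j) (\<lambda>\<zeta>. \<Sum>i\<in>I. 1 * (\<Sum>k\<in>UNIV. pd k (a i) z * pd k (h i) \<zeta>)) \<zeta>" by simp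
  also have "\<dots> = (\<Sum>i\<in>I. 1 * raise (Suc j) (\<lambda>\<zeta>. \<Sum>k\<in>UNIV. pd k (a i) z * pd k (h i) \<zeta>) \<zeta>)"
    by (rule raise_sum[OF _ \<zeta>]) (intro holo_on_sum holo_on_cmult holo_on_pd h op)
  also have "\<dots> = (\<Sum>i\<in>I. \<Sum>k\<in>UNIV. pd k (a i) z * raise (Suc j) (pd k (h i)) \<zeta>)"
    unfolding mult_1 by (intro sum.cong refl raise_sum[OF _ \<zeta>] holo_on_pd h op)
  also have "\<dots> = (\<Sum>i\<in>I. \<Sum>k\<in>UNIV. pd k (a i) z * pd k (raise j (h i)) \<zeta>)"
    by (intro sum.cong refl) (simp add: pd_raise[OF h op \<zeta>])
  also have "raise (Suc j) (\<lambda>\<zeta>. \<Sum>i\<in>I. (of_nat m * a i z + Eu (a i) z) * raise j (h i) \<zeta>) \<zeta> =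
      (\<Sum>i\<in>I. (of_nat m * a i z + Eu (a i) z) * raise (Suc j) (raise j (h i)) \<zeta>)"
    by (rule raise_sum[OF _ \<zeta>]) (intro holo_on_raise h op)
  finally show "(\<Sum>i\<in>I. \<Sum>k\<in>UNIV. pd k (a i) z * pd k (raise j (h i)) \<zeta>) =
     (\<Sum>i\<in>I. (of_nat m * a i z + Eu (a i) z) * (of_nat (Suc j) * raise j (h i) \<zeta> + Eu (raise j (h i)) \<zeta>))"
    by (simp add: raise_def)
qed

text \<open>Since pd l (E f) = (1 + E) (pd l f), differentiation in z trades order 0 for order 1,
  and \<open>radial_identity\<close> asks for order at least 1.\<close>

lemma rel_pd:
  assumes r: "rel 0 j I f h r s" and f: "\<And>i. i \<in> I \<Longrightarrow> holo_on (f i) (ball 0 r)"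
  shows "rel 1 j I (\<lambda>i. pd l (f i)) h r s"
  unfolding rel_def
proof (intro ballI)
  fix z \<zeta> :: "complex^'b" assume z: "z \<in> ball 0 r" and \<zeta>: "\<zeta> \<in> ball 0 s"
  have op: "open (ball 0 r :: (complex^'b) set)" by simp
  have "pd l (\<lambda>z. \<Sum>i\<in>I. \<Sum>k\<in>UNIV. pd k (h i) \<zeta> * pd k (f i) z) z =
        pd l (\<lambda>z. \<Sum>i\<in>I. raise j (h i) \<zeta> * Eu (f i) z) z"
    by (rule pd_cong_open[OF op z]) (use r \<zeta> in \<open>simp add: rel_def raise_def mult.commute\<close>)
  also have "pd l (\<lambda>z. \<Sum>i\<in>I. \<Sum>k\<in>UNIV. pd k (h i) \<zeta> * pd k (f i) z) z =
      (\<Sum>i\<in>I. pd l (\<lambda>z. \<Sum>k\<in>UNIV. pd k (h i) \<zeta> * pd k (f i) z) z)"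
    by (rule pd_sum[OF _ z]) (intro holo_on_sum holo_on_cmult holo_on_pd f op)
  also have "\<dots> = (\<Sum>i\<in>I. \<Sum>k\<in>UNIV. pd l (\<lambda>z. pd k (h i) \<zeta> * pd k (f i) z) z)"
    by (intro sum.cong refl pd_sum[OF _ z] holo_on_cmult holo_on_pd f op)
  also have "\<dots> = (\<Sum>i\<in>I. \<Sum>k\<in>UNIV. pd k (pd l (f i)) z * pd k (h i) \<zeta>)"
    by (intro sum.cong refl)
       (simp only: pd_cmult[OF holo_on_pd[OF f op] z] pd_commute[OF f op z, of _ l], rule mult.commute)
  also have "pd l (\<lambda>z. \<Sum>i\<in>I. raise j (h i) \<zeta> * Eu (f i) z) z = (\<Sum>i\<in>I. pd l (\<lambda>z. raise j (h i) \<zeta> * Eu (f i) z) z)"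
    by (rule pd_sum[OF _ z]) (intro holo_on_cmult holo_on_Eu f op)
  also have "\<dots> = (\<Sum>i\<in>I. (of_nat 1 * pd l (f i) z + Eu (pd l (f i)) z) * (of_nat j * h i \<zeta> + Eu (h i) \<zeta>))"
    by (intro sum.cong refl)
       (simp only: pd_cmult[OF holo_on_Eu[OF f op] z] pd_Eu[OF f op z] raise_def of_nat_1 mult_1, rule mult.commute)
  finally show "(\<Sum>i\<in>I. \<Sum>k\<in>UNIV. pd k (pd l (f i)) z * pd k (h i) \<zeta>) =
     (\<Sum>i\<in>I. (of_nat 1 * pd l (f i) z + Eu (pd l (f i)) z) * (of_nat j * h i \<zeta> + Eu (h i) \<zeta>))" .
qed

lemma smult_mem_ball:
  fixes z :: "complex^'n"
  assumes "z \<in> ball 0 r" "norm c * r \<le> s" "c \<noteq> 0"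
  shows "c *s z \<in> ball 0 s"
proof -
  have "norm c * norm z < norm c * r" using assms by (intro mult_strict_left_mono) auto
  also have "\<dots> \<le> s" by fact
  finally show ?thesis by (simp add: norm_smult_vec)
qed

lemma scale_facts:
  fixes f :: "complex^'n \<Rightarrow> complex"
  assumes f: "holo_on f (ball 0 r)" and c: "c \<noteq> 0" and s: "norm c * s \<le> r"
  shows scale_holo: "holo_on (\<lambda>z. f (c *s z)) (ball 0 s)"
    and scale_pd: "z \<in> ball 0 s \<Longrightarrow> pd k (\<lambda>z. f (c *s z)) z = c * pd k f (c *s z)"
    and scale_Eu: "(z :: complex^'n) \<in> ball 0 s \<Longrightarrow> Eu (\<lambda>z. f (c *s z)) z = Eu f (c *s z)"
proof -
  show "holo_on (\<lambda>z. f (c *s z)) (ball 0 s)"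
  proof -
    have "holo_on (\<lambda>z. f (0 + c *s z)) (ball 0 s)"
      by (rule holo_on_affine[OF f]) (use smult_mem_ball[OF _ s c] in auto)
    thus ?thesis by simp
  qed
  show p: "pd k (\<lambda>z. f (c *s z)) z = c * pd k f (c *s z)" if "z \<in> ball 0 s" for k z
    using pd_affine[OF f, of 0 c z k] smult_mem_ball[OF that s c] by simp
  show "Eu (\<lambda>z. f (c *s z)) z = Eu f (c *s z)" if "z \<in> ball 0 s" for z
    by (simp add: Eu_def p[OF that] mult_ac)
qed

text \<open>The factors R and 1 / R cancel in each product of partial derivatives, and E commutes
  with dilations. For R > 1 the second factors thereby become holomorphic on a ball larger than the
  unit ball.\<close>

lemma rel_scale:
  assumes r: "rel m j I a h 1 1" and a: "\<And>i. i \<in> I \<Longrightarrow> holo_on (a i) (ball 0 1)"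
    and h: "\<And>i. i \<in> I \<Longrightarrow> holo_on (h i) (ball 0 1)" and R: "R > 0"
  shows "rel m j I (\<lambda>i z. a i (of_real R *s z)) (\<lambda>i \<zeta>. h i (of_real (1 / R) *s \<zeta>)) (1 / R) R"
  unfolding rel_def
proof (intro ballI)
  fix z \<zeta> :: "complex^'b" assume z: "z \<in> ball 0 (1 / R)" and \<zeta>: "\<zeta> \<in> ball 0 R"
  have c: "of_real R \<noteq> (0::complex)" "norm (of_real R :: complex) * (1 / R) \<le> 1"
    "of_real (1 / R) \<noteq> (0::complex)" "norm (of_real (1 / R) :: complex) * R \<le> 1" using R by (auto simp del: of_real_divide)
  have m: "of_real R *s z \<in> ball 0 1" "of_real (1 / R) *s \<zeta> \<in> ball 0 1"
    using smult_mem_ball[OF z c(2,1)] smult_mem_ball[OF \<zeta> c(4,3)] .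
  have "pd k (\<lambda>z. a i (of_real R *s z)) z * pd k (\<lambda>\<zeta>. h i (of_real (1 / R) *s \<zeta>)) \<zeta> =
      pd k (a i) (of_real R *s z) * pd k (h i) (of_real (1 / R) *s \<zeta>)" if "i \<in> I" for i k
    unfolding scale_pd[OF a[OF that] c(1,2) z] scale_pd[OF h[OF that] c(3,4) \<zeta>] using R by simp
  moreover have "Eu (\<lambda>z. a i (of_real R *s z)) z = Eu (a i) (of_real R *s z)"
    "Eu (\<lambda>\<zeta>. h i (of_real (1 / R) *s \<zeta>)) \<zeta> = Eu (h i) (of_real (1 / R) *s \<zeta>)" if "i \<in> I" for i
    using scale_Eu[OF a[OF that] c(1,2) z] scale_Eu[OF h[OF that] c(3,4) \<zeta>] by auto
  ultimately show "(\<Sum>i\<in>I. \<Sum>k\<in>UNIV. pd k (\<lambda>z. a i (of_real R *s z)) z * pd k (\<lambda>\<zeta>. h i (of_real (1 / R) *s \<zeta>)) \<zeta>) =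
     (\<Sum>i\<in>I. (of_nat m * a i (of_real R *s z) + Eu (\<lambda>z. a i (of_real R *s z)) z) *
       (of_nat j * h i (of_real (1 / R) *s \<zeta>) + Eu (\<lambda>\<zeta>. h i (of_real (1 / R) *s \<zeta>)) \<zeta>))"
    using r m unfolding rel_def by (simp cong: sum.cong)
qed

section \<open>The radial identity and rank reduction\<close>

lemma line_point_alt: "x + of_real t *s (z0 - x) = of_real t *s z0 + of_real (1 - t) *s (x::complex^'n)"
  by (simp add: vec_eq_iff algebra_simps)

text \<open>The start \<open>x\<close> of the segment to \<open>z0\<close> may lie outside the ball
  of radius \<open>r\<close>; after the fraction \<open>\<theta>\<close> of the way all points are
  inside, because the norm is convex.\<close>

lemma line_point_mem:
  fixes x z0 :: "complex^'n"
  assumes "0 < \<theta>" "\<theta> \<le> t" "t \<le> 1" "norm z0 < r" "norm z0 \<le> R" "(1 - \<theta>) * R + \<theta> * norm z0 \<le> r" "norm x < R"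
  shows "norm (x + of_real t *s (z0 - x)) < r"
proof (cases "t = 1")
  case True
  thus ?thesis using assms(4) by simp
next
  case False
  have "norm (x + of_real t *s (z0 - x)) \<le> norm (of_real t *s z0) + norm (of_real (1 - t) *s x)"
    unfolding line_point_alt by (rule norm_triangle_ineq)
  also have "\<dots> = t * norm z0 + (1 - t) * norm x"
    unfolding norm_smult_vec norm_of_real using assms by simp
  also have "\<dots> < t * norm z0 + (1 - t) * R" using False assms by (intro add_strict_left_mono mult_strict_left_mono) auto
  also have "\<dots> = R - t * (R - norm z0)" by (simp add: algebra_simps)
  also have "\<dots> \<le> R - \<theta> * (R - norm z0)" using assms by (intro diff_left_mono mult_right_mono) auto
  also have "\<dots> \<le> r" using assms(6) by (simp add: algebra_simps)
  finally show ?thesis .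
qed

text \<open>The relation is evaluated at (u + s x, cv x) and integrated. On its left side
  \<open>wI_mult_coord\<close> replaces \<open>pd k (h i)\<close> by x_k (M + E) h_i, with M = N +
  \<open>\<kappa>\<close>, because the remaining factors are holomorphic in x. Both sides then carry
  (M + E) h_i, and their difference is the claim.\<close>

lemma rel_wI:
  fixes a h :: "'i \<Rightarrow> complex^'n \<Rightarrow> complex"
  assumes a: "\<And>i. i \<in> I \<Longrightarrow> holo_on (a i) (ball 0 r)"
    and h: "\<And>i. i \<in> I \<Longrightarrow> holo_on (h i) (ball 0 R)" and R: "R > 1" and \<kappa>: "\<kappa> \<ge> 2"
    and rel: "rel m (CARD('n) + \<kappa>) I a h r R" and q: "holo_on q (ball 0 R)"
    and y: "\<And>x. norm x < R \<Longrightarrow> norm (u + s *s x) < r"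
  shows "wI \<kappa> (\<lambda>x. q x * (\<Sum>i\<in>I. ((of_nat m * a i (u + s *s x) + Eu (a i) (u + s *s x))
      - (\<Sum>k\<in>UNIV. x $ k * pd k (a i) (u + s *s x))) * raise (CARD('n) + \<kappa>) (h i) (cv x))) = 0"
proof -
  let ?M = "CARD('n) + \<kappa>" and ?y = "\<lambda>x. u + s *s x"
  have op: "open (ball 0 r :: (complex^'n) set)" "open (ball 0 R :: (complex^'n) set)" by simp_all
  have hy: "holo_on (\<lambda>x. f (?y x)) (ball 0 R)" if "holo_on f (ball 0 r)" for f
    by (rule holo_on_affine[OF that]) (use y in auto)
  have cy: "continuous_on (cball 0 1) (\<lambda>x. f (?y x))" if "holo_on f (ball 0 r)" for f
    by (rule holo_cont_cball[OF hy[OF that] R])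
  note cq = holo_cont_cball[OF q R]
  have cc: "continuous_on (cball 0 1) (\<lambda>x. raise j (h i) (cv x))" "continuous_on (cball 0 1) (\<lambda>x. pd k (h i) (cv x))"
    "continuous_on (cball 0 1) (\<lambda>x. pd k (a i) (?y x))" "continuous_on (cball 0 1) (\<lambda>x. a i (?y x))"
    "continuous_on (cball 0 1) (\<lambda>x. Eu (a i) (?y x))" if "i \<in> I" for i j k
    by (intro holo_cont_cball_cv[OF holo_on_raise[OF h[OF that] op(2)] R] holo_cont_cball_cv[OF holo_on_pd[OF h[OF that] op(2)] R]
        cy holo_on_pd[OF a[OF that] op(1)] holo_on_Eu[OF a[OF that] op(1)] a that)+
  have P: "holo_on (\<lambda>x. q x * pd k (a i) (?y x)) (ball 0 R)" if "i \<in> I" for i k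
    by (intro holo_on_mult q hy holo_on_pd a op that)
  have st: "wI \<kappa> (\<lambda>x. q x * pd k (a i) (?y x) * x $ k * raise ?M (h i) (cv x)) =
        wI \<kappa> (\<lambda>x. q x * pd k (a i) (?y x) * pd k (h i) (cv x))" if "i \<in> I" for i k
    using wI_mult_coord[OF P[OF that] h[OF that] R \<kappa>, of k k] unfolding raise_def .
  have "wI \<kappa> (\<lambda>x. q x * (\<Sum>i\<in>I. (\<Sum>k\<in>UNIV. x $ k * pd k (a i) (?y x)) * raise ?M (h i) (cv x))) =
     wI \<kappa> (\<lambda>x. \<Sum>i\<in>I. \<Sum>k\<in>UNIV. q x * pd k (a i) (?y x) * x $ k * raise ?M (h i) (cv x))"
    by (rule wI_cong) (simp add: sum_distrib_left sum_distrib_right mult_ac)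
  also have "\<dots> = (\<Sum>i\<in>I. wI \<kappa> (\<lambda>x. \<Sum>k\<in>UNIV. q x * pd k (a i) (?y x) * x $ k * raise ?M (h i) (cv x)))"
    by (rule wI_sum) (intro continuous_intros cq cc)
  also have "\<dots> = (\<Sum>i\<in>I. \<Sum>k\<in>UNIV. wI \<kappa> (\<lambda>x. q x * pd k (a i) (?y x) * x $ k * raise ?M (h i) (cv x)))"
    by (intro sum.cong refl wI_sum) (intro continuous_intros cq cc)
  also have "\<dots> = (\<Sum>i\<in>I. \<Sum>k\<in>UNIV. wI \<kappa> (\<lambda>x. q x * pd k (a i) (?y x) * pd k (h i) (cv x)))"
    by (intro sum.cong refl st)
  also have "\<dots> = (\<Sum>i\<in>I. wI \<kappa> (\<lambda>x. \<Sum>k\<in>UNIV. q x * pd k (a i) (?y x) * pd k (h i) (cv x)))"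
    by (intro sum.cong refl wI_sum[symmetric]) (intro continuous_intros cq cc)
  also have "\<dots> = wI \<kappa> (\<lambda>x. \<Sum>i\<in>I. \<Sum>k\<in>UNIV. q x * pd k (a i) (?y x) * pd k (h i) (cv x))"
    by (rule wI_sum[symmetric]) (intro continuous_intros cq cc)
  also have "\<dots> = wI \<kappa> (\<lambda>x. q x * (\<Sum>i\<in>I. (of_nat m * a i (?y x) + Eu (a i) (?y x)) * raise ?M (h i) (cv x)))"
  proof (rule wI_cong)
    fix x :: "complex^'n" assume "norm x < 1"
    hence x: "?y x \<in> ball 0 r" "cv x \<in> ball 0 R" using y[of x] R by auto
    have e: "(\<Sum>i\<in>I. \<Sum>k\<in>UNIV. pd k (a i) (?y x) * pd k (h i) (cv x)) =
        (\<Sum>i\<in>I. (of_nat m * a i (?y x) + Eu (a i) (?y x)) * raise ?M (h i) (cv x))"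
      using rel x unfolding rel_def raise_def by blast
    show "(\<Sum>i\<in>I. \<Sum>k\<in>UNIV. q x * pd k (a i) (?y x) * pd k (h i) (cv x)) =
      q x * (\<Sum>i\<in>I. (of_nat m * a i (?y x) + Eu (a i) (?y x)) * raise ?M (h i) (cv x))"
      unfolding e[symmetric] by (simp add: sum_distrib_left mult.assoc)
  qed
  finally have e: "wI \<kappa> (\<lambda>x. q x * (\<Sum>i\<in>I. (of_nat m * a i (?y x) + Eu (a i) (?y x)) * raise ?M (h i) (cv x))) -
     wI \<kappa> (\<lambda>x. q x * (\<Sum>i\<in>I. (\<Sum>k\<in>UNIV. x $ k * pd k (a i) (?y x)) * raise ?M (h i) (cv x))) = 0" by simp
  have "wI \<kappa> (\<lambda>x. q x * (\<Sum>i\<in>I. (of_nat m * a i (?y x) + Eu (a i) (?y x)) * raise ?M (h i) (cv x))) -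
     wI \<kappa> (\<lambda>x. q x * (\<Sum>i\<in>I. (\<Sum>k\<in>UNIV. x $ k * pd k (a i) (?y x)) * raise ?M (h i) (cv x))) =
    wI \<kappa> (\<lambda>x. q x * (\<Sum>i\<in>I. (of_nat m * a i (?y x) + Eu (a i) (?y x)) * raise ?M (h i) (cv x)) -
      q x * (\<Sum>i\<in>I. (\<Sum>k\<in>UNIV. x $ k * pd k (a i) (?y x)) * raise ?M (h i) (cv x)))"
    by (rule wI_diff[symmetric]; (intro continuous_intros cq cc; assumption))
  also have "\<dots> = wI \<kappa> (\<lambda>x. q x * (\<Sum>i\<in>I. ((of_nat m * a i (?y x) + Eu (a i) (?y x))
      - (\<Sum>k\<in>UNIV. x $ k * pd k (a i) (?y x))) * raise ?M (h i) (cv x)))"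
    by (rule wI_cong) (simp add: sum_subtractf left_diff_distrib right_diff_distrib)
  finally show ?thesis using e by simp
qed

text \<open>The right-hand side does not depend on \<open>\<theta>\<close>: its derivative is killed by \<open>rel_wI\<close>.\<close>
lemma radial_identity:
  fixes a h :: "'i \<Rightarrow> complex^'n \<Rightarrow> complex"
  assumes a: "\<And>i. i \<in> I \<Longrightarrow> holo_on (a i) (ball 0 r)"
    and h: "\<And>i. i \<in> I \<Longrightarrow> holo_on (h i) (ball 0 R)" and R: "R > 1" and \<kappa>: "\<kappa> \<ge> 2"
    and rel: "rel m (CARD('n) + \<kappa>) I a h r R" and q: "holo_on q (ball 0 R)"
    and \<theta>: "0 < \<theta>" "\<theta> \<le> 1" and z0: "norm z0 < r" "norm z0 \<le> 1" and r: "(1 - \<theta>) * R + \<theta> * norm z0 \<le> r"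
    and m: "m \<ge> 1"
  shows "wI \<kappa> (\<lambda>x. q x * (\<Sum>i\<in>I. a i z0 * raise (CARD('n) + \<kappa>) (h i) (cv x))) =
     of_real \<theta> ^ m * wI \<kappa> (\<lambda>x. q x * (\<Sum>i\<in>I. a i (x + of_real \<theta> *s (z0 - x)) * raise (CARD('n) + \<kappa>) (h i) (cv x)))"
proof -
  let ?M = "CARD('n) + \<kappa>" and ?y = "\<lambda>t::real. \<lambda>x. x + of_real t *s (z0 - x)"
  define c where "c = (\<lambda>i. raise ?M (h i))"
  have op: "open (ball 0 r :: (complex^'n) set)" "open (ball 0 R :: (complex^'n) set)" by simp_all
  have mem: "?y t x \<in> ball 0 r" if "t \<in> {\<theta>..1}" "norm x < R" for t x
    using line_point_mem[of \<theta> t z0 r R x] that \<theta> z0 R r by auto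
  define \<phi> where "\<phi> = (\<lambda>t::real. \<lambda>x. of_real t ^ m * (q x * (\<Sum>i\<in>I. a i (?y t x) * c i (cv x))))"
  \<comment> \<open>The t-derivative of \<open>\<phi>\<close>, already written as t^(m-1) times the
    integrand of \<open>rel_wI\<close>.\<close>
  define \<phi>' where "\<phi>' = (\<lambda>t::real. \<lambda>x. of_real t ^ (m - 1) * (q x * (\<Sum>i\<in>I.
     ((of_nat m * a i (?y t x) + Eu (a i) (?y t x)) - (\<Sum>k\<in>UNIV. x $ k * pd k (a i) (?y t x))) * c i (cv x))))"
  have cq: "continuous_on (cball 0 1) q" by (rule holo_cont_cball[OF q R])
  have cc: "continuous_on (cball 0 1) (\<lambda>x. c i (cv x))" if "i \<in> I" for i
    unfolding c_def by (rule holo_cont_cball_cv[OF holo_on_raise[OF h[OF that] op(2)] R])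
  have cy2: "continuous_on ({\<theta>..1} \<times> cball 0 1) (\<lambda>p. f (?y (fst p) (snd p)))" if "holo_on f (ball 0 r)" for f
    by (rule continuous_on_compose2[OF holo_on_continuous[OF that]])
       (use mem R in \<open>auto intro!: continuous_intros\<close>)
  have cy: "continuous_on (cball 0 1) (\<lambda>x. f (?y t x))" if "holo_on f (ball 0 r)" "t \<in> {\<theta>..1}" for f t
    by (rule continuous_on_compose2[OF holo_on_continuous[OF that(1)]])
       (use mem[OF that(2)] R in \<open>auto intro!: continuous_intros\<close>)
  have c\<phi>: "continuous_on (cball 0 1) (\<phi> t)" if "t \<in> {\<theta>..1}" for t
    unfolding \<phi>_def by (intro continuous_intros cq cc cy a that)
  have c\<phi>': "continuous_on (cball 0 1) (\<phi>' t)" if "t \<in> {\<theta>..1}" for t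
    unfolding \<phi>'_def by (intro continuous_intros cq cc cy a holo_on_pd holo_on_Eu op that)
  have snd2: "continuous_on ({\<theta>..1} \<times> cball 0 1) (\<lambda>p. f (snd p))" if "continuous_on (cball 0 1) f" for f :: "complex^'n \<Rightarrow> complex"
    by (rule continuous_on_compose2[OF that]) (auto intro!: continuous_intros)
  have "continuous_on ({\<theta>..1} \<times> cball 0 1) (\<lambda>p. \<phi>' (fst p) (snd p))"
    unfolding \<phi>'_def
    by (intro continuous_intros snd2[OF cq] snd2[OF cc] cy2 a holo_on_pd holo_on_Eu op)
  hence "bounded ((\<lambda>p. \<phi>' (fst p) (snd p)) ` ({\<theta>..1} \<times> cball 0 1))"
    by (intro compact_imp_bounded compact_continuous_image compact_Times) auto
  then obtain C where C: "\<And>t x. t \<in> {\<theta>..1} \<Longrightarrow> norm x \<le> 1 \<Longrightarrow> norm (\<phi>' t x) \<le> C"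
    unfolding bounded_iff by fastforce
  have der: "((\<lambda>t. \<phi> t x) has_vector_derivative \<phi>' t x) (at t within {\<theta>..1})" if t: "t \<in> {\<theta>..1}" and x: "norm x < 1" for t x
  proof -
    have yt: "x + of_real t *s (z0 - x) \<in> ball 0 r" using mem[OF t, of x] x R by simp
    let ?D = "\<lambda>i. \<Sum>k\<in>UNIV. (z0 - x) $ k * pd k (a i) (?y t x)"
    have dz: "((\<lambda>\<tau>. \<tau> ^ m * (q x * (\<Sum>i\<in>I. a i (x + \<tau> *s (z0 - x)) * c i (cv x)))) has_field_derivative
       of_nat m * of_real t ^ (m - 1) * (q x * (\<Sum>i\<in>I. a i (?y t x) * c i (cv x))) +
       of_real t ^ m * (q x * (\<Sum>i\<in>I. ?D i * c i (cv x)))) (at (of_real t))"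
      by (rule derivative_eq_intros refl holo_on_line[OF a yt] | assumption | simp)+
    \<comment> \<open>As t (z0 - x) = y - x for the point y on the segment, a factor t turns the
      directional derivative into E minus the derivative along x. Taking this factor from t^m needs
      m \<ge> 1.\<close>
    have e: "of_real t * ?D i = Eu (a i) (?y t x) - (\<Sum>k\<in>UNIV. x $ k * pd k (a i) (?y t x))" for i
      by (simp add: Eu_def sum_distrib_left sum_subtractf[symmetric] algebra_simps)
    have tm: "of_real t ^ m = of_real t ^ (m - 1) * complex_of_real t"
      using m by (metis Suc_diff_1 less_le_trans mult.commute power_Suc zero_less_one)
    have "of_nat m * of_real t ^ (m - 1) * (q x * (\<Sum>i\<in>I. a i (?y t x) * c i (cv x))) +
       of_real t ^ m * (q x * (\<Sum>i\<in>I. ?D i * c i (cv x))) =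
       of_real t ^ (m - 1) * (q x * (\<Sum>i\<in>I. (of_nat m * a i (?y t x) + of_real t * ?D i) * c i (cv x)))"
      unfolding tm by (simp add: sum_distrib_left sum.distrib ring_distribs mult_ac)
    also have "\<dots> = \<phi>' t x" unfolding e \<phi>'_def by (simp add: algebra_simps)
    finally show ?thesis using has_vector_derivative_real_field[OF dz] unfolding \<phi>_def by simp
  qed
  have zero: "wI \<kappa> (\<phi>' t) = 0" if t: "t \<in> {\<theta>..1}" for t
  proof -
    have "wI \<kappa> (\<lambda>x. q x * (\<Sum>i\<in>I. ((of_nat m * a i (of_real t *s z0 + of_real (1 - t) *s x) + Eu (a i) (of_real t *s z0 + of_real (1 - t) *s x))
      - (\<Sum>k\<in>UNIV. x $ k * pd k (a i) (of_real t *s z0 + of_real (1 - t) *s x))) * raise (CARD('n) + \<kappa>) (h i) (cv x))) = 0"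
    proof (rule rel_wI[OF a h R \<kappa> rel q])
      fix x :: "complex^'n" assume "norm x < R"
      from mem[OF t this] show "norm (of_real t *s z0 + of_real (1 - t) *s x) < r"
        unfolding line_point_alt by (simp only: mem_ball dist_0_norm)
    qed
    thus ?thesis unfolding \<phi>'_def c_def line_point_alt wI_cmult by simp
  qed
  have "((\<lambda>t. wI \<kappa> (\<phi> t)) has_vector_derivative 0) (at t within {\<theta>..1})" if t: "t \<in> {\<theta>..1}" for t
    using wI_has_vector_derivative[of "{\<theta>..1}" t \<phi> \<phi>' C \<kappa>] der C c\<phi> c\<phi>'[OF t] t zero[OF t] by auto
  then obtain k where "\<And>t. t \<in> {\<theta>..1} \<Longrightarrow> wI \<kappa> (\<phi> t) = k"
    using has_vector_derivative_zero_constant[of "{\<theta>..1}" "\<lambda>t. wI \<kappa> (\<phi> t)"] by (metis convex_real_interval(5))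
  hence "wI \<kappa> (\<phi> 1) = wI \<kappa> (\<phi> \<theta>)" using \<theta> by simp
  thus ?thesis by (simp add: \<phi>_def c_def wI_cmult)
qed

text \<open>The left side contains (M + E) h_i, the right side h_i undifferentiated. Both come from
  \<open>wI_mult_coord\<close> for the products \<alpha> h_i: the terms where \<alpha> is not
  differentiated combine, through the relation of order zero, to the derivative of f_i along x - (u
  + s x); those where it is differentiated carry h_i alone. In \<open>tame_rel_const\<close> this
  turns the radial part of a derivative into a term that \<open>wI_norm_raise_ge\<close>
  controls.\<close>

lemma alpha_identity:
  fixes f h :: "'i \<Rightarrow> complex^'n \<Rightarrow> complex"
  assumes f: "\<And>i. i \<in> I \<Longrightarrow> holo_on (f i) (ball 0 r)"
    and h: "\<And>i. i \<in> I \<Longrightarrow> holo_on (h i) (ball 0 R)" and R: "R > 1" and \<kappa>: "\<kappa> \<ge> 2"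
    and rel: "rel 0 (CARD('n) + \<kappa>) I f h r R" and q: "holo_on q (ball 0 R)" and \<alpha>: "holo_on \<alpha> (ball 0 R)"
    and y: "\<And>x. norm x < R \<Longrightarrow> norm (u + s *s x) < r"
  shows "wI \<kappa> (\<lambda>x. q x * \<alpha> (cv x) * (\<Sum>i\<in>I. (\<Sum>k\<in>UNIV. (x - (u + s *s x)) $ k * pd k (f i) (u + s *s x)) * raise (CARD('n) + \<kappa>) (h i) (cv x))) =
     - wI \<kappa> (\<lambda>x. q x * (\<Sum>i\<in>I. h i (cv x) * (\<Sum>k\<in>UNIV. (Eu \<alpha> (cv x) * x $ k - pd k \<alpha> (cv x)) * pd k (f i) (u + s *s x))))"
proof -
  let ?M = "CARD('n) + \<kappa>" and ?y = "\<lambda>x. u + s *s x"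
  have op: "open (ball 0 r :: (complex^'n) set)" "open (ball 0 R :: (complex^'n) set)" by simp_all
  have hy: "holo_on (\<lambda>x. f (?y x)) (ball 0 R)" if "holo_on f (ball 0 r)" for f
    by (rule holo_on_affine[OF that]) (use y in auto)
  have cy: "continuous_on (cball 0 1) (\<lambda>x. f (?y x))" if "holo_on f (ball 0 r)" for f
    by (rule holo_cont_cball[OF hy[OF that] R])
  have H: "holo_on (\<lambda>\<zeta>. \<alpha> \<zeta> * h i \<zeta>) (ball 0 R)" if "i \<in> I" for i by (intro holo_on_mult \<alpha> h that)
  note cq = holo_cont_cball[OF q R]
  note c\<alpha> = holo_cont_cball_cv[OF \<alpha> R] holo_cont_cball_cv[OF holo_on_pd[OF \<alpha> op(2)] R] holo_cont_cball_cv[OF holo_on_Eu[OF \<alpha> op(2)] R]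
  have cc: "continuous_on (cball 0 1) (\<lambda>x. raise j (h i) (cv x))" "continuous_on (cball 0 1) (\<lambda>x. pd k (h i) (cv x))"
    "continuous_on (cball 0 1) (\<lambda>x. h i (cv x))" "continuous_on (cball 0 1) (\<lambda>x. pd k (f i) (?y x))"
    "continuous_on (cball 0 1) (\<lambda>x. raise j (\<lambda>\<zeta>. \<alpha> \<zeta> * h i \<zeta>) (cv x))"
    "continuous_on (cball 0 1) (\<lambda>x. pd k (\<lambda>\<zeta>. \<alpha> \<zeta> * h i \<zeta>) (cv x))" if "i \<in> I" for i j k
    by (intro holo_cont_cball_cv[OF holo_on_raise[OF h[OF that] op(2)] R] holo_cont_cball_cv[OF holo_on_pd[OF h[OF that] op(2)] R]
        holo_cont_cball_cv[OF h[OF that] R] holo_cont_cball_cv[OF holo_on_raise[OF H[OF that] op(2)] R]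
        holo_cont_cball_cv[OF holo_on_pd[OF H[OF that] op(2)] R]
        cy holo_on_pd[OF f[OF that] op(1)] that)+
  have P: "holo_on (\<lambda>x. q x * pd k (f i) (?y x)) (ball 0 R)" if "i \<in> I" for i k
    by (intro holo_on_mult q hy holo_on_pd f op that)
  have st: "wI \<kappa> (\<lambda>x. q x * pd k (f i) (?y x) * x $ k * raise ?M (\<lambda>\<zeta>. \<alpha> \<zeta> * h i \<zeta>) (cv x)
        - q x * pd k (f i) (?y x) * pd k (\<lambda>\<zeta>. \<alpha> \<zeta> * h i \<zeta>) (cv x)) = 0" if "i \<in> I" for i k
    using wI_mult_coord[OF P[OF that] H[OF that] R \<kappa>, of k k]
    by (subst wI_diff) (intro continuous_intros cq cc that | simp add: raise_def)+
  have "0 = (\<Sum>i\<in>I. \<Sum>k\<in>UNIV. wI \<kappa> (\<lambda>x. q x * pd k (f i) (?y x) * x $ k * raise ?M (\<lambda>\<zeta>. \<alpha> \<zeta> * h i \<zeta>) (cv x)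
        - q x * pd k (f i) (?y x) * pd k (\<lambda>\<zeta>. \<alpha> \<zeta> * h i \<zeta>) (cv x)))"
    by (rule sym, intro sum.neutral ballI st)
  also have "\<dots> = (\<Sum>i\<in>I. wI \<kappa> (\<lambda>x. \<Sum>k\<in>UNIV. q x * pd k (f i) (?y x) * x $ k * raise ?M (\<lambda>\<zeta>. \<alpha> \<zeta> * h i \<zeta>) (cv x)
        - q x * pd k (f i) (?y x) * pd k (\<lambda>\<zeta>. \<alpha> \<zeta> * h i \<zeta>) (cv x)))"
    by (intro sum.cong refl wI_sum[symmetric]) (intro continuous_intros cq cc)
  also have "\<dots> = wI \<kappa> (\<lambda>x. \<Sum>i\<in>I. \<Sum>k\<in>UNIV. q x * pd k (f i) (?y x) * x $ k * raise ?M (\<lambda>\<zeta>. \<alpha> \<zeta> * h i \<zeta>) (cv x)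
        - q x * pd k (f i) (?y x) * pd k (\<lambda>\<zeta>. \<alpha> \<zeta> * h i \<zeta>) (cv x))"
    by (rule wI_sum[symmetric]) (intro continuous_intros cq cc)
  also have "\<dots> = wI \<kappa> (\<lambda>x. q x * \<alpha> (cv x) * (\<Sum>i\<in>I. (\<Sum>k\<in>UNIV. (x - ?y x) $ k * pd k (f i) (?y x)) * raise ?M (h i) (cv x)) +
      q x * (\<Sum>i\<in>I. h i (cv x) * (\<Sum>k\<in>UNIV. (Eu \<alpha> (cv x) * x $ k - pd k \<alpha> (cv x)) * pd k (f i) (?y x))))"
  proof (rule wI_cong)
    fix x :: "complex^'n" assume "norm x < 1"
    hence x: "?y x \<in> ball 0 r" "cv x \<in> ball 0 R" using y[of x] R by auto
    define d where "d = (\<lambda>i k. pd k (f i) (?y x))"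
    have rel': "(\<Sum>i\<in>I. \<Sum>k\<in>UNIV. d i k * pd k (h i) (cv x)) = (\<Sum>i\<in>I. \<Sum>k\<in>UNIV. ?y x $ k * d i k * raise ?M (h i) (cv x))"
    proof -
      have "(\<Sum>i\<in>I. \<Sum>k\<in>UNIV. pd k (f i) (?y x) * pd k (h i) (cv x)) = (\<Sum>i\<in>I. (of_nat 0 * f i (?y x) + Eu (f i) (?y x)) * raise ?M (h i) (cv x))"
        using rel x unfolding rel_def raise_def by blast
      thus ?thesis by (simp add: d_def Eu_def sum_distrib_right)
    qed
    have t: "q x * d i k * x $ k * raise ?M (\<lambda>\<zeta>. \<alpha> \<zeta> * h i \<zeta>) (cv x) - q x * d i k * pd k (\<lambda>\<zeta>. \<alpha> \<zeta> * h i \<zeta>) (cv x) =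
       q x * \<alpha> (cv x) * (x $ k * d i k * raise ?M (h i) (cv x)) - q x * \<alpha> (cv x) * (d i k * pd k (h i) (cv x))
        + q x * (h i (cv x) * ((Eu \<alpha> (cv x) * x $ k - pd k \<alpha> (cv x)) * d i k))" if "i \<in> I" for i k
      unfolding raise_def Eu_mult[OF \<alpha> h[OF that] x(2)] pd_mult[OF \<alpha> h[OF that] x(2)] by (simp add: algebra_simps)
    have "(\<Sum>i\<in>I. \<Sum>k\<in>UNIV. q x * d i k * x $ k * raise ?M (\<lambda>\<zeta>. \<alpha> \<zeta> * h i \<zeta>) (cv x) - q x * d i k * pd k (\<lambda>\<zeta>. \<alpha> \<zeta> * h i \<zeta>) (cv x)) =
      q x * \<alpha> (cv x) * (\<Sum>i\<in>I. \<Sum>k\<in>UNIV. x $ k * d i k * raise ?M (h i) (cv x)) - q x * \<alpha> (cv x) * (\<Sum>i\<in>I. \<Sum>k\<in>UNIV. d i k * pd k (h i) (cv x))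
        + q x * (\<Sum>i\<in>I. \<Sum>k\<in>UNIV. h i (cv x) * ((Eu \<alpha> (cv x) * x $ k - pd k \<alpha> (cv x)) * d i k))"
      by (simp add: t sum.distrib sum_subtractf sum_distrib_left)
    also have "\<dots> = q x * \<alpha> (cv x) * ((\<Sum>i\<in>I. \<Sum>k\<in>UNIV. x $ k * d i k * raise ?M (h i) (cv x)) - (\<Sum>i\<in>I. \<Sum>k\<in>UNIV. ?y x $ k * d i k * raise ?M (h i) (cv x)))
        + q x * (\<Sum>i\<in>I. \<Sum>k\<in>UNIV. h i (cv x) * ((Eu \<alpha> (cv x) * x $ k - pd k \<alpha> (cv x)) * d i k))"
      unfolding rel' right_diff_distrib ..
    also have "(\<Sum>i\<in>I. \<Sum>k\<in>UNIV. x $ k * d i k * raise ?M (h i) (cv x)) - (\<Sum>i\<in>I. \<Sum>k\<in>UNIV. ?y x $ k * d i k * raise ?M (h i) (cv x)) =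
       (\<Sum>i\<in>I. (\<Sum>k\<in>UNIV. (x - ?y x) $ k * d i k) * raise ?M (h i) (cv x))"
      unfolding sum_subtractf[symmetric] sum_distrib_right
      by (intro sum.cong refl) (simp add: algebra_simps)
    finally show "(\<Sum>i\<in>I. \<Sum>k\<in>UNIV. q x * pd k (f i) (?y x) * x $ k * raise ?M (\<lambda>\<zeta>. \<alpha> \<zeta> * h i \<zeta>) (cv x)
        - q x * pd k (f i) (?y x) * pd k (\<lambda>\<zeta>. \<alpha> \<zeta> * h i \<zeta>) (cv x)) = q x * \<alpha> (cv x) * (\<Sum>i\<in>I. (\<Sum>k\<in>UNIV. (x - ?y x) $ k * pd k (f i) (?y x)) * raise ?M (h i) (cv x)) +
      q x * (\<Sum>i\<in>I. h i (cv x) * (\<Sum>k\<in>UNIV. (Eu \<alpha> (cv x) * x $ k - pd k \<alpha> (cv x)) * pd k (f i) (?y x)))"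
      unfolding d_def by (simp only: sum_distrib_left)
  qed
  also have "\<dots> = wI \<kappa> (\<lambda>x. q x * \<alpha> (cv x) * (\<Sum>i\<in>I. (\<Sum>k\<in>UNIV. (x - ?y x) $ k * pd k (f i) (?y x)) * raise ?M (h i) (cv x))) +
      wI \<kappa> (\<lambda>x. q x * (\<Sum>i\<in>I. h i (cv x) * (\<Sum>k\<in>UNIV. (Eu \<alpha> (cv x) * x $ k - pd k \<alpha> (cv x)) * pd k (f i) (?y x))))"
    unfolding vector_minus_component vector_add_component vector_smult_component
    by (rule wI_add; (intro continuous_intros cq cc c\<alpha>; assumption))
  finally show ?thesis by (subst eq_neg_iff_add_eq_0) (rule sym)
qed

text \<open>Coefficients of reduced kernels are represented this way because holomorphy, growth and
  derivatives in the other variable pass through a finite combination of point evaluations.\<close>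

definition evcomb :: "'x set \<Rightarrow> (('x \<Rightarrow> complex) \<Rightarrow> complex) \<Rightarrow> bool" where
  "evcomb S L \<longleftrightarrow> (\<exists>T \<gamma>. finite T \<and> T \<subseteq> S \<and> (\<forall>f. L f = (\<Sum>x\<in>T. \<gamma> x * f x)))"

lemma evcomb_add:
  assumes "evcomb S L" "x0 \<in> S"
  shows "evcomb S (\<lambda>f. L f + c * f x0)"
proof -
  obtain T \<gamma> where T: "finite T" "T \<subseteq> S" "\<And>f. L f = (\<Sum>x\<in>T. \<gamma> x * f x)"
    using assms(1) unfolding evcomb_def by blast
  define \<gamma>' where "\<gamma>' = (\<lambda>x. (if x \<in> T then \<gamma> x else 0) + (if x = x0 then c else 0))"
  have "L f + c * f x0 = (\<Sum>x\<in>insert x0 T. \<gamma>' x * f x)" for f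
  proof -
    have "(\<Sum>x\<in>insert x0 T. \<gamma>' x * f x) = (\<Sum>x\<in>insert x0 T. (if x \<in> T then \<gamma> x * f x else 0) + (if x = x0 then c * f x0 else 0))"
      by (intro sum.cong) (auto simp: \<gamma>'_def ring_distribs)
    also have "\<dots> = (\<Sum>x\<in>insert x0 T. if x \<in> T then \<gamma> x * f x else 0) + c * f x0"
      using T(1) by (simp add: sum.distrib)
    also have "(\<Sum>x\<in>insert x0 T. if x \<in> T then \<gamma> x * f x else 0) = (\<Sum>x\<in>T. \<gamma> x * f x)"
      using T(1) by (intro sum.mono_neutral_cong_right) auto
    finally show ?thesis by (simp add: T(3))
  qed
  thus ?thesis using T assms(2) unfolding evcomb_def by (intro exI[of _ "insert x0 T"] exI[of _ \<gamma>']) auto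
qed

lemma evcomb_eval: "x0 \<in> S \<Longrightarrow> evcomb S (\<lambda>f. c * f x0)"
  unfolding evcomb_def by (intro exI[of _ "{x0}"] exI[of _ "\<lambda>_. c"]) auto

lemma evcomb_linear:
  assumes "evcomb S L"
  shows "L (\<lambda>x. f x - c * g x) = L f - c * L g"
proof -
  obtain T \<gamma> where "\<And>f. L f = (\<Sum>x\<in>T. \<gamma> x * f x)" using assms unfolding evcomb_def by blast
  thus ?thesis by (simp add: sum_subtractf sum_distrib_left algebra_simps)
qed

lemma evcomb_cong:
  assumes "evcomb S L" "\<And>x. x \<in> S \<Longrightarrow> f x = g x"
  shows "L f = L g"
proof -
  obtain T \<gamma> where "T \<subseteq> S" "\<And>f. L f = (\<Sum>x\<in>T. \<gamma> x * f x)" using assms(1) unfolding evcomb_def by blast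
  thus ?thesis using assms(2) by (auto intro!: sum.cong)
qed

lemma evcomb_sum:
  assumes "evcomb S L"
  shows "L (\<lambda>x. \<Sum>i\<in>I. f i x * c i) = (\<Sum>i\<in>I. L (f i) * c i)"
proof -
  obtain T \<gamma> where "\<And>f. L f = (\<Sum>x\<in>T. \<gamma> x * f x)" using assms unfolding evcomb_def by blast
  thus ?thesis by (simp add: sum_distrib_left sum_distrib_right mult.assoc) (rule sum.swap)
qed

text \<open>Gaussian elimination on the kernel \<open>K\<close>: each step subtracts the rank one kernel through a
  point where \<open>K\<close> does not vanish.\<close>
lemma rank_reduce:
  fixes K :: "'x \<Rightarrow> 'y \<Rightarrow> complex"
  assumes "finite J" "\<And>x y. x \<in> S \<Longrightarrow> y \<in> T \<Longrightarrow> K x y = (\<Sum>j\<in>J. a j x * b j y)"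
  shows "\<exists>(n::nat) A B La Ld. (\<forall>x\<in>S. \<forall>y\<in>T. K x y = (\<Sum>i<n. A i x * B i y)) \<and>
     (\<forall>i<n. evcomb T (La i) \<and> A i = (\<lambda>x. La i (K x))) \<and>
     (\<forall>i<n. evcomb S (Ld i) \<and> (\<forall>i'<n. Ld i (A i') = (if i' = i then 1 else 0)))"
  using assms
proof (induction "card J" arbitrary: J K a b)
  case 0
  hence "J = {}" by simp
  thus ?case using 0 by (intro exI[of _ "0::nat"]) auto
next
  case (Suc c)
  show ?case
  proof (cases "\<forall>x\<in>S. \<forall>y\<in>T. K x y = 0")
    case True
    thus ?thesis by (intro exI[of _ "0::nat"]) auto
  next
    case False
    then obtain x0 y0 where xy: "x0 \<in> S" "y0 \<in> T" "K x0 y0 \<noteq> 0" by blast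
    define k0 where "k0 = K x0 y0"
    \<comment> \<open>Vanishes at \<open>x0\<close> for all y, and at \<open>y0\<close> for all x.
      The former makes one of the functions \<open>b1\<close> dependent on the others, so an index
      drops.\<close>
    define K1 where "K1 = (\<lambda>x y. K x y - K x y0 / k0 * K x0 y)"
    define b1 where "b1 = (\<lambda>j y. b j y - b j y0 / k0 * K x0 y)"
    obtain j0 where j0: "j0 \<in> J" "a j0 x0 \<noteq> 0"
      using xy Suc.prems(2)[OF xy(1,2)] by (metis (no_types, lifting) mult_zero_left sum.neutral)
    have k0: "k0 \<noteq> 0" using xy by (simp add: k0_def)
    have K1: "K1 x y = (\<Sum>j\<in>J. a j x * b1 j y)" if "x \<in> S" "y \<in> T" for x y
      unfolding K1_def b1_def using Suc.prems(2)[OF that] Suc.prems(2)[OF that(1) xy(2)]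
      by (simp add: sum_subtractf right_diff_distrib sum_distrib_left sum_distrib_right sum_divide_distrib mult_ac)
    have K10: "K1 x0 y = 0" for y using k0 by (simp add: K1_def k0_def)
    define a1 where "a1 = (\<lambda>j x. a j x - a j x0 / a j0 x0 * a j0 x)"
    have K1': "K1 x y = (\<Sum>j\<in>J - {j0}. a1 j x * b1 j y)" if "x \<in> S" "y \<in> T" for x y
    proof -
      have "0 = (\<Sum>j\<in>J. a j x0 * b1 j y)" using K1[OF xy(1) that(2)] K10 by simp
      hence "a j0 x0 * b1 j0 y = - (\<Sum>j\<in>J - {j0}. a j x0 * b1 j y)"
        using j0 Suc.prems(1) by (simp add: sum.remove[of J j0] eq_neg_iff_add_eq_0)
      hence "b1 j0 y = - (\<Sum>j\<in>J - {j0}. a j x0 * b1 j y) / a j0 x0" using j0 by (simp add: field_simps)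
      hence "K1 x y = a j0 x * (- (\<Sum>j\<in>J - {j0}. a j x0 * b1 j y) / a j0 x0) + (\<Sum>j\<in>J - {j0}. a j x * b1 j y)"
        using K1[OF that] j0 Suc.prems(1) by (simp add: sum.remove[of J j0])
      also have "\<dots> = (\<Sum>j\<in>J - {j0}. a1 j x * b1 j y)"
        by (simp add: a1_def left_diff_distrib right_diff_distrib sum_subtractf sum_distrib_left sum_divide_distrib mult_ac)
      finally show ?thesis .
    qed
    have "c = card (J - {j0})" using Suc j0 by simp
    have "finite (J - {j0})" using Suc.prems(1) by simp
    have "\<exists>(n::nat) A B La Ld. (\<forall>x\<in>S. \<forall>y\<in>T. K1 x y = (\<Sum>i<n. A i x * B i y)) \<and>
      (\<forall>i<n. evcomb T (La i) \<and> A i = (\<lambda>x. La i (K1 x))) \<and>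
      (\<forall>i<n. evcomb S (Ld i) \<and> (\<forall>i'<n. Ld i (A i') = (if i' = i then 1 else 0)))"
    proof (rule Suc.hyps(1)[of "J - {j0}" K1 a1 b1])
      show "c = card (J - {j0})" by fact
      show "finite (J - {j0})" by fact
      show "\<And>x y. x \<in> S \<Longrightarrow> y \<in> T \<Longrightarrow> K1 x y = (\<Sum>j\<in>J - {j0}. a1 j x * b1 j y)" by (rule K1')
    qed
    then obtain n A B La Ld where ih: "\<forall>x\<in>S. \<forall>y\<in>T. K1 x y = (\<Sum>i<(n::nat). A i x * B i y)"
      "\<forall>i<n. evcomb T (La i) \<and> A i = (\<lambda>x. La i (K1 x))"
      "\<forall>i<n. evcomb S (Ld i) \<and> (\<forall>i'<n. Ld i (A i') = (if i' = i then 1 else 0))"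
      by (elim exE conjE) (rule that)
    have IH: "\<And>x y. x \<in> S \<Longrightarrow> y \<in> T \<Longrightarrow> K1 x y = (\<Sum>i<n. A i x * B i y)"
      "\<And>i. i < n \<Longrightarrow> evcomb T (La i)" "\<And>i. i < n \<Longrightarrow> A i = (\<lambda>x. La i (K1 x))"
      "\<And>i. i < n \<Longrightarrow> evcomb S (Ld i)" "\<And>i i'. i < n \<Longrightarrow> i' < n \<Longrightarrow> Ld i (A i') = (if i' = i then 1 else 0)"
      using ih(1) apply blast
      using ih(2) apply blast
      using ih(2) apply blast
      using ih(3) apply blast
      using ih(3) apply blast
      done
    define An where "An = (\<lambda>x. 1 / k0 * K x y0)"
    define A' where "A' = A(n := An)"
    define B' where "B' = B(n := K x0)"
    \<comment> \<open>\<open>La i\<close> applied to \<open>K1 x\<close>, expressed through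
      \<open>K x\<close>, acquires an extra evaluation at \<open>y0\<close>.\<close>
    define La' where "La' = (\<lambda>i. if i = n then (\<lambda>f. 1 / k0 * f y0) else (\<lambda>f. La i f + (- (La i (K x0) / k0)) * f y0))"
    \<comment> \<open>All older \<open>A i\<close> vanish at \<open>x0\<close>, while
      \<open>An\<close> equals 1 there. Evaluation at \<open>x0\<close> is therefore dual to
      \<open>An\<close>, and subtracting \<open>Ld i An\<close> times it makes \<open>Ld i\<close>
      annihilate \<open>An\<close> without changing it on the older functions.\<close>
    define Ld' where "Ld' = (\<lambda>i. if i = n then (\<lambda>f. 1 * f x0) else (\<lambda>f. Ld i f + (- Ld i An) * f x0))"
    have An1: "An x0 = 1" using k0 by (simp add: An_def k0_def)
    have Ai0: "A i x0 = 0" if "i < n" for i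
    proof -
      have "A i x0 = La i (K1 x0)" using IH(3)[OF that] by metis
      also have "K1 x0 = (\<lambda>y. 0 - 0 * (0::complex))" using K10 by auto
      also have "La i \<dots> = La i (\<lambda>y. 0) - 0 * La i (\<lambda>y. 0)" by (rule evcomb_linear[OF IH(2)[OF that], of "\<lambda>y. 0" 0 "\<lambda>y. 0"])
      also have "\<dots> = 0"
        using IH(2)[OF that] unfolding evcomb_def by auto
      finally show ?thesis .
    qed
    have "K x y = (\<Sum>i<Suc n. A' i x * B' i y)" if "x \<in> S" "y \<in> T" for x y
    proof -
      have "(\<Sum>i<Suc n. A' i x * B' i y) = (\<Sum>i<n. A i x * B i y) + An x * K x0 y"
        by (simp add: A'_def B'_def)
      also have "\<dots> = K x y" using IH(1)[OF that, symmetric] by (simp add: K1_def An_def)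
      finally show ?thesis by simp
    qed
    moreover have "evcomb T (La' i) \<and> A' i = (\<lambda>x. La' i (K x))" if "i < Suc n" for i
    proof (cases "i = n")
      case True
      thus ?thesis using evcomb_eval[OF xy(2), of "1 / k0"] by (simp add: La'_def A'_def An_def)
    next
      case False
      hence i: "i < n" using that by simp
      have "A i x = La i (K x) + (- (La i (K x0) / k0)) * K x y0" for x
      proof -
        have "A i x = La i (\<lambda>y. K x y - K x y0 / k0 * K x0 y)" using IH(3)[OF i] unfolding K1_def by metis
        also have "\<dots> = La i (K x) - K x y0 / k0 * La i (K x0)" by (rule evcomb_linear[OF IH(2)[OF i]])
        finally show ?thesis by simp
      qed
      thus ?thesis using evcomb_add[OF IH(2)[OF i] xy(2), of "- (La i (K x0) / k0)"] False by (auto simp: La'_def A'_def)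
    qed
    moreover have "evcomb S (Ld' i) \<and> (\<forall>i'<Suc n. Ld' i (A' i') = (if i' = i then 1 else 0))" if "i < Suc n" for i
    proof (cases "i = n")
      case True
      thus ?thesis using evcomb_eval[OF xy(1), of 1] Ai0 An1 by (auto simp: Ld'_def A'_def less_Suc_eq)
    next
      case False
      hence i: "i < n" using that by simp
      have "Ld' i (A' i') = (if i' = i then 1 else 0)" if "i' < Suc n" for i'
      proof (cases "i' = n")
        case True
        thus ?thesis using False An1 by (simp add: Ld'_def A'_def)
      next
        case F: False
        hence "i' < n" using that by simp
        thus ?thesis using F False IH(5)[OF i \<open>i' < n\<close>] Ai0[OF \<open>i' < n\<close>] by (simp add: Ld'_def A'_def)
      qed
      thus ?thesis using evcomb_add[OF IH(4)[OF i] xy(1), of "- Ld i An"] False by (simp add: Ld'_def)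
    qed
    ultimately show ?thesis by blast
  qed
qed

section \<open>Relations of positive order\<close>

text \<open>The product (m + d - 1 + E) ... (m + 1 + E) (m + E): \<open>m\<close> is the first index
  and \<open>d\<close> the number of factors.\<close>

fun rit :: "nat \<Rightarrow> nat \<Rightarrow> (complex^'n \<Rightarrow> complex) \<Rightarrow> complex^'n \<Rightarrow> complex" where
  "rit m 0 h = h"
| "rit m (Suc d) h = raise (m + d) (rit m d h)"

lemma holo_on_rit: "holo_on h U \<Longrightarrow> open U \<Longrightarrow> holo_on (rit m d h) U"
  by (induction d) (auto intro: holo_on_raise)

lemma rel_rit:
  assumes "rel m j I a h r s" "\<And>i. i \<in> I \<Longrightarrow> holo_on (h i) (ball 0 s)"
  shows "rel m (j + d) I a (\<lambda>i. rit j d (h i)) r s"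
proof (induction d)
  case (Suc d)
  show ?case using rel_raise[OF Suc.IH] holo_on_rit[OF assms(2)] by simp
qed (use assms in auto)

text \<open>t^j h(t z) has derivative t^(j-1) times (j + E) h at t z, which is 0, so its values at t
  = 1 and t = 0 agree. The convention 0^0 = 1 covers both outcomes: h is constant for j = 0 and zero
  for j \<ge> 1.\<close>

lemma raise_ray:
  fixes h :: "complex^'n \<Rightarrow> complex"
  assumes h: "holo_on h (ball 0 r)" and z: "z \<in> ball 0 r" and 0: "\<And>w. w \<in> ball 0 r \<Longrightarrow> raise j h w = 0"
  shows "h z = 0 ^ j * h 0"
proof -
  have mem: "of_real t *s z \<in> ball 0 r" if "t \<in> {0..1}" for t
  proof -
    have "t * norm z \<le> 1 * norm z" using that by (intro mult_right_mono) auto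
    thus ?thesis using z that by (simp add: norm_smult_vec)
  qed
  define F where "F = (\<lambda>t::real. of_real t ^ j * h (of_real t *s z))"
  have der: "(F has_vector_derivative 0) (at t within {0..1})" if t: "t \<in> {0..1}" for t
  \<comment> \<open>At t = 0 the hypothesis yields the derivative directly only for j = 1. For j = 0
    a factor s has to be cancelled at nonzero s before a limit is taken; for j \<ge> 2 the powers of
    t vanish.\<close>
  proof (cases "t = 0 \<and> j \<noteq> 1")
    case False
    let ?D = "\<Sum>k\<in>UNIV. z $ k * pd k h (of_real t *s z)"
    have e: "of_real t * ?D = Eu h (of_real t *s z)" by (simp add: Eu_def sum_distrib_left mult_ac)
    have dz: "((\<lambda>\<tau>. \<tau> ^ j * h (\<tau> *s z)) has_field_derivative
       of_nat j * of_real t ^ (j - 1) * h (of_real t *s z) + of_real t ^ j * ?D) (at (of_real t))"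
      using holo_on_line[OF h, of 0 "of_real t" z] mem[OF t] by (auto intro!: derivative_eq_intros)
    have "of_nat j * of_real t ^ (j - 1) * h (of_real t *s z) + of_real t ^ j * ?D = 0"
    proof (cases j)
      case 0
      hence "t \<noteq> 0" using False by auto
      thus ?thesis using assms(3)[OF mem[OF t]] e 0 by (simp add: raise_def)
    next
      case (Suc j')
      have "of_nat j * of_real t ^ (j - 1) * h (of_real t *s z) + of_real t ^ j * ?D = of_real t ^ j' * raise j h (of_real t *s z)"
        using e Suc by (simp add: raise_def algebra_simps)
      thus ?thesis using assms(3)[OF mem[OF t]] by simp
    qed
    thus ?thesis using has_vector_derivative_real_field[OF dz] unfolding F_def by simp
  next
    case True
    let ?D = "\<Sum>k\<in>UNIV. z $ k * pd k h (of_real t *s z)"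
    show ?thesis
    proof (cases "j = 0")
      case j: True
      have "((\<lambda>\<tau>. h (\<tau> *s z)) has_field_derivative ?D) (at (of_real t))"
        using holo_on_line[OF h, of 0 "of_real t" z] mem[OF t] by simp
      hence F': "(F has_vector_derivative ?D) (at t within {0..1})"
        using has_vector_derivative_real_field j unfolding F_def by fastforce
      have "continuous_on {0..1} (\<lambda>t::real. \<Sum>k\<in>UNIV. z $ k * pd k h (of_real t *s z))"
        by (intro continuous_intros continuous_on_compose2[OF continuous_pd[OF h]]) (use mem in auto)
      hence "((\<lambda>t::real. \<Sum>k\<in>UNIV. z $ k * pd k h (of_real t *s z)) \<longlongrightarrow> ?D) (at t within {0..1})"
        using t by (simp add: continuous_on_def)
      moreover have "\<forall>\<^sub>F s in at t within {0..1}. (\<Sum>k\<in>UNIV. z $ k * pd k h (of_real s *s z)) = 0"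
      proof -
        have "(\<Sum>k\<in>UNIV. z $ k * pd k h (of_real s *s z)) = 0" if "s \<noteq> t" "s \<in> {0..1}" for s
        proof -
          have "of_real s * (\<Sum>k\<in>UNIV. z $ k * pd k h (of_real s *s z)) = raise 0 h (of_real s *s z)"
            by (simp add: raise_def Eu_def sum_distrib_left mult_ac)
          thus ?thesis using 0[OF mem[OF that(2)]] that True j by simp
        qed
        thus ?thesis by (auto simp: eventually_at_filter)
      qed
      hence "((\<lambda>t::real. \<Sum>k\<in>UNIV. z $ k * pd k h (of_real t *s z)) \<longlongrightarrow> 0) (at t within {0..1})"
        by (simp add: tendsto_eventually)
      moreover have "at t within {0..1} \<noteq> bot" using True by (simp add: at_within_Icc_at_right)
      ultimately have "?D = 0" using tendsto_unique by blast
      thus ?thesis using F' by simp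
    next
      case j: False
      hence "j > 1" using True by simp
      have dz: "((\<lambda>\<tau>. \<tau> ^ j * h (\<tau> *s z)) has_field_derivative
         of_nat j * of_real t ^ (j - 1) * h (of_real t *s z) + of_real t ^ j * ?D) (at (of_real t))"
        using holo_on_line[OF h, of 0 "of_real t" z] mem[OF t] by (auto intro!: derivative_eq_intros)
      have "of_nat j * of_real t ^ (j - 1) * h (of_real t *s z) + of_real t ^ j * ?D = 0"
        using True \<open>j > 1\<close> by (simp add: power_0_left)
      thus ?thesis using has_vector_derivative_real_field[OF dz] unfolding F_def by simp
    qed
  qed
  then obtain k where "\<And>t. t \<in> {0..1} \<Longrightarrow> F t = k"
    using has_vector_derivative_zero_constant[of "{0..1}" F] by (metis convex_real_interval(5))
  hence "F 1 = F 0" by simp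
  thus ?thesis by (simp add: F_def)
qed

lemma rit_zero_imp:
  assumes h: "holo_on h (ball 0 r)" and m: "m \<ge> 1" and z: "\<And>z. z \<in> ball 0 r \<Longrightarrow> rit m d h z = 0"
  shows "\<forall>z\<in>ball 0 r. h z = 0"
  using z
proof (induction d)
  case (Suc d)
  have "rit m d h z = 0" if "z \<in> ball 0 r" for z
    using raise_ray[OF holo_on_rit[OF h] that, where j="m + d"] Suc.prems m by simp
  thus ?case by (rule Suc.IH)
qed auto

text \<open>Separates the innermost factor. For m = 0 that factor is E, which kills constants,
  whereas the outer ones start at index 1 and are injective.\<close>

lemma rit_Suc_shift: "rit m (Suc d) h = rit (Suc m) d (raise m h)"
  by (induction d) auto

text \<open>That is, \<open>f z = o((1 - \<bar>z\<bar>)\<^sup>-\<^sup>1\<^sup>/\<^sup>2)\<close> at the sphere.\<close>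
definition tame :: "(complex^'n \<Rightarrow> complex) \<Rightarrow> bool" where
  "tame f \<longleftrightarrow> (\<forall>\<epsilon>>0. \<exists>s0>0. \<forall>s z. 0 < s \<and> s < s0 \<and> norm z \<le> 1 - s \<longrightarrow> norm (f z) * sqrt s \<le> \<epsilon>)"

section \<open>Stability of the growth condition\<close>

lemma tame_add:
  fixes f g :: "complex^'n \<Rightarrow> complex"
  assumes "tame f" "tame g" shows "tame (\<lambda>z. f z + g z)"
  unfolding tame_def
proof (intro allI impI)
  fix e :: real assume "e > 0"
  hence e: "e / 2 > 0" by simp
  obtain s1 where s1: "s1 > 0" "\<forall>s z. 0 < s \<and> s < s1 \<and> norm z \<le> 1 - s \<longrightarrow> norm (f z) * sqrt s \<le> e / 2"
    using assms(1) e unfolding tame_def by blast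
  obtain s2 where s2: "s2 > 0" "\<forall>s z. 0 < s \<and> s < s2 \<and> norm z \<le> 1 - s \<longrightarrow> norm (g z) * sqrt s \<le> e / 2"
    using assms(2) e unfolding tame_def by blast
  show "\<exists>s0>0. \<forall>s z. 0 < s \<and> s < s0 \<and> norm z \<le> 1 - s \<longrightarrow> norm (f z + g z) * sqrt s \<le> e"
  proof (intro exI[of _ "min s1 s2"] conjI allI impI)
    fix s and z :: "complex^'n" assume a: "0 < s \<and> s < min s1 s2 \<and> norm z \<le> 1 - s"
    have "norm (f z + g z) * sqrt s \<le> (norm (f z) + norm (g z)) * sqrt s"
      using a by (intro mult_right_mono norm_triangle_ineq) auto
    thus "norm (f z + g z) * sqrt s \<le> e" using s1(2)[rule_format, of s z] s2(2)[rule_format, of s z] a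
      by (simp add: ring_distribs)
  qed (use s1 s2 in auto)
qed

lemma tame_mult_bdd:
  fixes f g :: "complex^'n \<Rightarrow> complex"
  assumes "tame f" "\<And>z. norm z < 1 \<Longrightarrow> norm (g z) \<le> C" shows "tame (\<lambda>z. g z * f z)"
  unfolding tame_def
proof (intro allI impI)
  fix e :: real assume "e > 0"
  have C: "C \<ge> 0" using assms(2)[of 0] norm_ge_zero[of "g 0"] by (simp del: norm_ge_zero)
  hence e: "e / (C + 1) > 0" using \<open>e > 0\<close> by simp
  obtain s1 where s1: "s1 > 0" "\<forall>s z. 0 < s \<and> s < s1 \<and> norm z \<le> 1 - s \<longrightarrow> norm (f z) * sqrt s \<le> e / (C + 1)"
    using assms(1) e unfolding tame_def by blast
  show "\<exists>s0>0. \<forall>s z. 0 < s \<and> s < s0 \<and> norm z \<le> 1 - s \<longrightarrow> norm (g z * f z) * sqrt s \<le> e"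
  proof (intro exI[of _ s1] conjI allI impI)
    fix s and z :: "complex^'n" assume a: "0 < s \<and> s < s1 \<and> norm z \<le> 1 - s"
    have "norm (g z * f z) * sqrt s = norm (g z) * (norm (f z) * sqrt s)" by (simp add: norm_mult)
    also have "\<dots> \<le> (C + 1) * (e / (C + 1))"
      using a s1(2)[rule_format, of s z] assms(2)[of z] C by (intro mult_mono) auto
    also have "\<dots> = e" using C by simp
    finally show "norm (g z * f z) * sqrt s \<le> e" .
  qed (use s1 in auto)
qed

lemma tame_0: "tame (\<lambda>z. 0)"
  unfolding tame_def by (auto intro!: exI[of _ 1])

lemma tame_sum: "(\<And>i. i \<in> I \<Longrightarrow> tame (f i)) \<Longrightarrow> tame (\<lambda>z. \<Sum>i\<in>I. f i z)"
  by (induction I rule: infinite_finite_induct) (auto intro: tame_add tame_0)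

lemma tame_family:
  fixes n :: nat
  assumes "\<And>i. i < n \<Longrightarrow> tame (f i)" "\<epsilon> > 0"
  shows "\<exists>s0>0. \<forall>s z. \<forall>i<n. 0 < s \<and> s < s0 \<and> norm z \<le> 1 - s \<longrightarrow> norm (f i z) * sqrt s \<le> \<epsilon>"
  using assms(1)
proof (induction n)
  case (Suc n)
  then obtain s1 where s1: "s1 > 0" "\<forall>s z. \<forall>i<n. 0 < s \<and> s < s1 \<and> norm z \<le> 1 - s \<longrightarrow> norm (f i z) * sqrt s \<le> \<epsilon>"
    by auto
  have "tame (f n)" using Suc.prems by simp
  then obtain s2 where s2: "s2 > 0" "\<forall>s z. 0 < s \<and> s < s2 \<and> norm z \<le> 1 - s \<longrightarrow> norm (f n z) * sqrt s \<le> \<epsilon>"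
    using \<open>\<epsilon> > 0\<close> unfolding tame_def by blast
  show ?case using s1 s2 by (intro exI[of _ "min s1 s2"]) (auto simp: less_Suc_eq)
qed (auto intro!: exI[of _ 1])

text \<open>Applying the functional \<open>Ld i\<close> to the sums recovers \<open>c i\<close> from
  their values at finitely many points, and Cauchy-Schwarz passes to the norms.
  \<open>\<Gamma>\<close> and \<open>T\<close> precede the quantifiers over the weight, the
  functions and the bound, so all parameters chosen later may depend on them.\<close>

lemma dual_bound:
  fixes A :: "nat \<Rightarrow> 'x \<Rightarrow> complex"
  assumes dual: "\<And>i. i < n \<Longrightarrow> evcomb S (Ld i)" "\<And>i i'. i < n \<Longrightarrow> i' < n \<Longrightarrow> Ld i (A i') = (if i' = i then 1 else 0)"
  shows "\<exists>\<Gamma> T. \<Gamma> \<ge> 0 \<and> finite T \<and> T \<subseteq> S \<and>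
     (\<forall>\<kappa> (c :: nat \<Rightarrow> complex^'n \<Rightarrow> complex) B. (\<forall>i<n. continuous_on (cball 0 1) (c i)) \<longrightarrow> B \<ge> 0 \<longrightarrow>
       (\<forall>x\<in>T. wI \<kappa> (\<lambda>\<eta>. (norm (\<Sum>i<n. A i x * c i \<eta>))\<^sup>2) \<le> B) \<longrightarrow>
       (\<Sum>i<n. wI \<kappa> (\<lambda>\<eta>. (norm (c i \<eta>))\<^sup>2)) \<le> \<Gamma> * B)"
proof -
  have "\<forall>i\<in>{..<n}. \<exists>Tg. finite (fst Tg) \<and> fst Tg \<subseteq> S \<and> (\<forall>f. Ld i f = (\<Sum>x\<in>fst Tg. snd Tg x * f x))"
    using dual(1) unfolding evcomb_def by fastforce
  from bchoice[OF this] obtain Tg where "\<forall>i\<in>{..<n}. finite (fst (Tg i)) \<and> fst (Tg i) \<subseteq> S \<and>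
    (\<forall>f. Ld i f = (\<Sum>x\<in>fst (Tg i). snd (Tg i) x * f x))" by blast
  hence Tg: "\<And>i. i < n \<Longrightarrow> finite (fst (Tg i))" "\<And>i. i < n \<Longrightarrow> fst (Tg i) \<subseteq> S"
    "\<And>i f. i < n \<Longrightarrow> Ld i f = (\<Sum>x\<in>fst (Tg i). snd (Tg i) x * f x)" by blast+
  define T where "T = (\<Union>i<n. fst (Tg i))"
  define \<Gamma> where "\<Gamma> = (\<Sum>i<n. (\<Sum>x\<in>fst (Tg i). (norm (snd (Tg i) x))\<^sup>2) * real (card (fst (Tg i))))"
  have main: "(\<Sum>i<n. wI \<kappa> (\<lambda>\<eta>. (norm (c i \<eta>))\<^sup>2)) \<le> \<Gamma> * B"
    if c: "\<forall>i<n. continuous_on (cball 0 1) (c i)" and B: "B \<ge> 0"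
      and le: "\<forall>x\<in>T. wI \<kappa> (\<lambda>\<eta>. (norm (\<Sum>i<n. A i x * c i \<eta>))\<^sup>2) \<le> B" for \<kappa> B and c :: "nat \<Rightarrow> complex^'n \<Rightarrow> complex"
  proof -
    have "wI \<kappa> (\<lambda>\<eta>. (norm (c i \<eta>))\<^sup>2) \<le> (\<Sum>x\<in>fst (Tg i). (norm (snd (Tg i) x))\<^sup>2) * real (card (fst (Tg i))) * B" if i: "i < n" for i
    proof -
      let ?K = "\<lambda>x \<eta>. \<Sum>i<n. A i x * c i \<eta>"
      let ?G = "\<Sum>x\<in>fst (Tg i). (norm (snd (Tg i) x))\<^sup>2"
      have cc: "continuous_on (cball 0 1) (?K x)" for x using c by (intro continuous_intros) auto
      have ci: "c i \<eta> = (\<Sum>x\<in>fst (Tg i). snd (Tg i) x * ?K x \<eta>)" for \<eta>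
      proof -
        have "(\<Sum>x\<in>fst (Tg i). snd (Tg i) x * ?K x \<eta>) = Ld i (\<lambda>x. \<Sum>i<n. A i x * c i \<eta>)" using Tg(3)[OF i] by simp
        also have "\<dots> = (\<Sum>i'<n. Ld i (A i') * c i' \<eta>)" by (rule evcomb_sum[OF dual(1)[OF i]])
        also have "\<dots> = (\<Sum>i'<n. if i' = i then c i' \<eta> else 0)" using dual(2)[OF i] by (intro sum.cong) auto
        also have "\<dots> = c i \<eta>" using i by simp
        finally show ?thesis by simp
      qed
      have pt: "(norm (c i \<eta>))\<^sup>2 \<le> ?G * (\<Sum>x\<in>fst (Tg i). (norm (?K x \<eta>))\<^sup>2)" for \<eta>
      proof -
        have "norm (c i \<eta>) \<le> (\<Sum>x\<in>fst (Tg i). norm (snd (Tg i) x) * norm (?K x \<eta>))"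
          unfolding ci by (rule order_trans[OF norm_sum]) (simp add: norm_mult)
        hence "(norm (c i \<eta>))\<^sup>2 \<le> (\<Sum>x\<in>fst (Tg i). norm (snd (Tg i) x) * norm (?K x \<eta>))\<^sup>2"
          by (rule power_mono) simp
        also have "\<dots> \<le> ?G * (\<Sum>x\<in>fst (Tg i). (norm (?K x \<eta>))\<^sup>2)" by (rule Cauchy_Schwarz_ineq_sum)
        finally show ?thesis .
      qed
      have "wI \<kappa> (\<lambda>\<eta>. (norm (c i \<eta>))\<^sup>2) \<le> wI \<kappa> (\<lambda>\<eta>. ?G * (\<Sum>x\<in>fst (Tg i). (norm (?K x \<eta>))\<^sup>2))"
        by (rule wI_mono[OF _ _ pt]) (use c i in \<open>auto intro!: continuous_intros cc\<close>)
      also have "\<dots> = ?G * (\<Sum>x\<in>fst (Tg i). wI \<kappa> (\<lambda>\<eta>. (norm (?K x \<eta>))\<^sup>2))"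
        unfolding wI_cmult by (subst wI_sum) (intro continuous_intros cc, rule refl)
      also have "\<dots> \<le> ?G * (real (card (fst (Tg i))) * B)"
      proof (rule mult_left_mono)
        show "(\<Sum>x\<in>fst (Tg i). wI \<kappa> (\<lambda>\<eta>. (norm (?K x \<eta>))\<^sup>2)) \<le> real (card (fst (Tg i))) * B"
          by (rule sum_bounded_above) (use le i in \<open>auto simp: T_def\<close>)
      qed (auto intro: sum_nonneg)
      finally show ?thesis by (simp add: mult.assoc)
    qed
    hence "(\<Sum>i<n. wI \<kappa> (\<lambda>\<eta>. (norm (c i \<eta>))\<^sup>2)) \<le> (\<Sum>i<n. (\<Sum>x\<in>fst (Tg i). (norm (snd (Tg i) x))\<^sup>2) * real (card (fst (Tg i))) * B)"
      by (intro sum_mono) auto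
    thus ?thesis by (simp add: \<Gamma>_def sum_distrib_right)
  qed
  have G: "\<Gamma> \<ge> 0" unfolding \<Gamma>_def by (intro sum_nonneg mult_nonneg_nonneg) auto
  have T: "finite T" "T \<subseteq> S" using Tg by (auto simp: T_def)
  show ?thesis
  proof (rule exI[of _ \<Gamma>], rule exI[of _ T], intro conjI allI impI)
    fix \<kappa> B and c :: "nat \<Rightarrow> complex^'n \<Rightarrow> complex"
    assume "\<forall>i<n. continuous_on (cball 0 1) (c i)" "B \<ge> 0"
      "\<forall>x\<in>T. wI \<kappa> (\<lambda>\<eta>. (norm (\<Sum>i<n. A i x * c i \<eta>))\<^sup>2) \<le> B"
    thus "(\<Sum>i<n. wI \<kappa> (\<lambda>\<eta>. (norm (c i \<eta>))\<^sup>2)) \<le> \<Gamma> * B" by (rule main)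
  qed (fact G T)+
qed

text \<open>The error bound of the main estimate, with the mixed products split by the
  arithmetic-geometric mean inequality.\<close>
lemma wI_amgm:
  fixes q :: "complex^'n \<Rightarrow> complex"
  assumes q: "continuous_on (cball 0 1) q" and c: "\<And>i. i < n \<Longrightarrow> continuous_on (cball 0 1) (c i)"
    and a: "\<And>i. i < n \<Longrightarrow> continuous_on (cball 0 1) (a i)"
    and E: "\<And>i x. i < n \<Longrightarrow> norm x < 1 \<Longrightarrow> norm (a i x) \<le> E" and p: "p > 0"
  shows "norm (wI \<kappa> (\<lambda>x. q x * (\<Sum>i<n. a i x * c i x))) \<le>
     (p * real n * wI \<kappa> (\<lambda>x. (norm (q x))\<^sup>2) + E\<^sup>2 / p * (\<Sum>i<n. wI \<kappa> (\<lambda>x. (norm (c i x))\<^sup>2))) / 2"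
proof -
  have "norm (wI \<kappa> (\<lambda>x. q x * (\<Sum>i<n. a i x * c i x))) \<le> wI \<kappa> (\<lambda>x. norm (q x * (\<Sum>i<n. a i x * c i x)))"
    by (rule norm_wI_le) (use q c a in \<open>auto intro!: continuous_intros\<close>)
  also have "\<dots> \<le> wI \<kappa> (\<lambda>x. 1 / 2 * (\<Sum>i<n. p * (norm (q x))\<^sup>2 + E\<^sup>2 / p * (norm (c i x))\<^sup>2))"
  proof (rule wI_mono)
    fix x :: "complex^'n" assume x: "norm x < 1"
    have "norm (q x * (\<Sum>i<n. a i x * c i x)) = norm (\<Sum>i<n. q x * (a i x * c i x))" by (simp add: sum_distrib_left)
    also have "\<dots> \<le> (\<Sum>i<n. (p * (norm (q x))\<^sup>2 + E\<^sup>2 / p * (norm (c i x))\<^sup>2) / 2)"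
    proof (rule sum_norm_le)
      fix i assume "i \<in> {..<n}"
      hence i: "i < n" by simp
      have "norm (q x * (a i x * c i x)) = norm (a i x) * (norm (q x) * norm (c i x))" by (simp add: norm_mult mult_ac)
      also have "\<dots> \<le> E * (norm (q x) * norm (c i x))" using E[OF i x] by (intro mult_right_mono) auto
      also have "\<dots> \<le> (p * (norm (q x))\<^sup>2 + E\<^sup>2 / p * (norm (c i x))\<^sup>2) / 2"
      proof -
        have "0 \<le> (p * norm (q x) - E * norm (c i x))\<^sup>2" by simp
        hence "2 * p * (E * (norm (q x) * norm (c i x))) \<le> p * (p * (norm (q x))\<^sup>2) + E\<^sup>2 * (norm (c i x))\<^sup>2"
          by (simp add: power2_eq_square algebra_simps)
        thus ?thesis using p by (simp add: field_simps power2_eq_square)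
      qed
      finally show "norm (q x * (a i x * c i x)) \<le> (p * (norm (q x))\<^sup>2 + E\<^sup>2 / p * (norm (c i x))\<^sup>2) / 2" .
    qed
    finally show "norm (q x * (\<Sum>i<n. a i x * c i x)) \<le> 1 / 2 * (\<Sum>i<n. p * (norm (q x))\<^sup>2 + E\<^sup>2 / p * (norm (c i x))\<^sup>2)"
      by (simp add: sum_divide_distrib)
  qed (use q c a p in \<open>auto intro!: continuous_intros\<close>)
  also have "\<dots> = 1 / 2 * (\<Sum>i<n. wI \<kappa> (\<lambda>x. p * (norm (q x))\<^sup>2 + E\<^sup>2 / p * (norm (c i x))\<^sup>2))"
    unfolding wI_cmult by (subst wI_sum) (use q c p in \<open>auto intro!: continuous_intros\<close>)
  also have "(\<Sum>i<n. wI \<kappa> (\<lambda>x. p * (norm (q x))\<^sup>2 + E\<^sup>2 / p * (norm (c i x))\<^sup>2)) =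
     (\<Sum>i<n. p * wI \<kappa> (\<lambda>x. (norm (q x))\<^sup>2) + E\<^sup>2 / p * wI \<kappa> (\<lambda>x. (norm (c i x))\<^sup>2))"
    unfolding wI_cmult[symmetric] by (intro sum.cong refl wI_add) (use q c p in \<open>auto intro!: continuous_intros\<close>)
  also have "\<dots> = p * real n * wI \<kappa> (\<lambda>x. (norm (q x))\<^sup>2) + E\<^sup>2 / p * (\<Sum>i<n. wI \<kappa> (\<lambda>x. (norm (c i x))\<^sup>2))"
    by (simp add: sum.distrib sum_distrib_left)
  finally show ?thesis by simp
qed

lemma finite_subset_ball:
  fixes T :: "'a::real_normed_vector set"
  assumes "finite T" "T \<subseteq> ball 0 1"
  shows "\<exists>\<delta>>0. \<delta> < 1 \<and> (\<forall>z\<in>T. norm z \<le> 1 - \<delta>)"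
  using assms
proof (induction T)
  case empty
  show ?case by (rule exI[of _ "1/2"]) auto
next
  case (insert x T)
  then obtain \<delta> where \<delta>: "\<delta> > 0" "\<delta> < 1" "\<forall>z\<in>T. norm z \<le> 1 - \<delta>" by auto
  show ?case using \<delta> insert.prems by (intro exI[of _ "min \<delta> (1 - norm x)"]) auto
qed

lemma scaled_rel:
  fixes a h :: "'i \<Rightarrow> complex^'n \<Rightarrow> complex"
  assumes rel: "rel m j I a h 1 1" and a: "\<And>i. i \<in> I \<Longrightarrow> holo_on (a i) (ball 0 1)"
    and h: "\<And>i. i \<in> I \<Longrightarrow> holo_on (h i) (ball 0 1)" and R: "R > 1"
  defines "a' \<equiv> \<lambda>i z. a i (of_real R *s z)" and "h' \<equiv> \<lambda>i \<zeta>. h i (of_real (1 / R) *s \<zeta>)"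
  shows "rel m j I a' h' (1 / R) R" "\<And>i. i \<in> I \<Longrightarrow> holo_on (a' i) (ball 0 (1 / R))"
    "\<And>i. i \<in> I \<Longrightarrow> holo_on (h' i) (ball 0 R)"
    "\<And>i z k. i \<in> I \<Longrightarrow> norm z < 1 / R \<Longrightarrow> pd k (a' i) z = of_real R * pd k (a i) (of_real R *s z)"
proof -
  show "rel m j I a' h' (1 / R) R" unfolding a'_def h'_def by (rule rel_scale[OF rel a h]) (use R in auto)
  have c: "of_real R \<noteq> (0::complex)" "norm (of_real R :: complex) * (1 / R) \<le> 1"
    "of_real (1 / R) \<noteq> (0::complex)" "norm (of_real (1 / R) :: complex) * R \<le> 1" using R by (auto simp del: of_real_divide)
  show "holo_on (a' i) (ball 0 (1 / R))" if "i \<in> I" for i unfolding a'_def by (rule scale_holo[OF a[OF that] c(1,2)])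
  show "holo_on (h' i) (ball 0 R)" if "i \<in> I" for i unfolding h'_def by (rule scale_holo[OF h[OF that] c(3,4)])
  show "pd k (a' i) z = of_real R * pd k (a i) (of_real R *s z)" if "i \<in> I" "norm z < 1 / R" for i z k
    unfolding a'_def by (rule scale_pd[OF a[OF that(1)] c(1,2)]) (use that in simp)
qed

lemma wI_norm2:
  "wI \<kappa> (\<lambda>x. cnj (c x) * c x) = complex_of_real (wI \<kappa> (\<lambda>x. (norm (c x))\<^sup>2))"
  unfolding wI_of_real[symmetric] by (rule wI_cong) (simp add: complex_norm_square mult.commute del: of_real_power)

text \<open>After the dilation a first factor is evaluated at R times a point of the segment. The
  bound keeps this argument at distance at least \<theta> \<delta> / 2 from the sphere; \<rho> is
  the norm of the target point before dilation.\<close>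

lemma scale_bound:
  fixes \<delta> \<theta> R :: real
  assumes "0 < \<theta>" "\<theta> \<le> 1" "0 < \<delta>" "\<delta> < 1" "1 < R" "R\<^sup>2 \<le> 1 + \<theta> * \<delta> / 2" "0 \<le> \<rho>" "\<rho> \<le> 1 - \<delta>"
  shows "(1 - \<theta>) * R + \<theta> * (\<rho> / R) \<le> 1 / R * (1 - \<theta> * \<delta> / 2)"
proof -
  have "(1 - \<theta>) * R\<^sup>2 + \<theta> * \<rho> \<le> (1 - \<theta>) * (1 + \<theta> * \<delta> / 2) + \<theta> * (1 - \<delta>)"
    using assms by (intro add_mono mult_left_mono) auto
  also have "\<dots> \<le> 1 - \<theta> * \<delta> / 2" using assms by (simp add: algebra_simps)
  finally have "((1 - \<theta>) * R\<^sup>2 + \<theta> * \<rho>) / R \<le> (1 - \<theta> * \<delta> / 2) / R" using assms by (intro divide_right_mono) auto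
  thus ?thesis using assms by (simp add: power2_eq_square add_divide_distrib)
qed

lemma near_one_root:
  fixes e :: real
  assumes "e > 0" "r < 1"
  shows "\<exists>R>1. R\<^sup>2 \<le> 1 + e \<and> r * R < 1"
proof -
  have "((\<lambda>R. R\<^sup>2) \<longlongrightarrow> (1::real)\<^sup>2) (at_right 1)" "((\<lambda>R. r * R) \<longlongrightarrow> r * 1) (at_right 1)" by (intro tendsto_intros)+
  from order_tendstoD(2)[OF this(1), of "1 + e"] order_tendstoD(2)[OF this(2), of 1]
  have "\<forall>\<^sub>F R in at_right (1::real). R\<^sup>2 < 1 + e" "\<forall>\<^sub>F R in at_right 1. r * R < 1"
    using assms by simp_all
  moreover have "\<forall>\<^sub>F R in at_right (1::real). 1 < R" by (auto simp: eventually_at_right_less)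
  ultimately have "\<forall>\<^sub>F R in at_right (1::real). 1 < R \<and> R\<^sup>2 < 1 + e \<and> r * R < 1" by eventually_elim auto
  from eventually_happens'[OF trivial_limit_at_right_real this] show ?thesis by (metis less_imp_le)
qed

text \<open>In \<open>radial_identity\<close> the test function q is the conjugate of the kernel sum
  at z, so the left side is a squared norm. The growth bound makes the right side a small multiple
  of the norms involved; \<open>dual_bound\<close> converts this into S2 \<le> S2 / 4, hence all c_i
  vanish. Dilation and raising are then undone.\<close>

lemma tame_rel_vanish:
  fixes a b :: "nat \<Rightarrow> complex^'n \<Rightarrow> complex"
  assumes a: "\<And>i. i < n \<Longrightarrow> holo_on (a i) (ball 0 1)" and b: "\<And>i. i < n \<Longrightarrow> holo_on (b i) (ball 0 1)"
    and rel: "rel m m {..<n} a b 1 1" and m: "m \<ge> 1" and tame: "\<And>i. i < n \<Longrightarrow> tame (a i)"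
    and dual: "\<And>i. i < n \<Longrightarrow> evcomb (ball 0 1) (Ld i)" "\<And>i i'. i < n \<Longrightarrow> i' < n \<Longrightarrow> Ld i (a i') = (if i' = i then 1 else 0)"
    and i: "i < n" and \<zeta>: "norm \<zeta> < 1"
  shows "b i \<zeta> = 0"
proof -
  \<comment> \<open>At least 2 for the integration by parts, and large enough that M = N +
    \<open>\<kappa>\<close> can be reached from m by raising.\<close>
  define \<kappa> where "\<kappa> = m + 2"
  define M where "M = CARD('n) + \<kappa>"
  define d where "d = M - m"
  have M: "M = m + d" by (simp add: d_def M_def \<kappa>_def)
  have \<kappa>: "\<kappa> \<ge> 2" by (simp add: \<kappa>_def)
  define h where "h = (\<lambda>i. rit m d (b i))"
  have h: "holo_on (h i) (ball 0 1)" if "i < n" for i unfolding h_def by (intro holo_on_rit b that) simp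
  have relM: "rel m M {..<n} a h 1 1" unfolding h_def M by (rule rel_rit[OF rel]) (use b in auto)
  have "\<exists>\<Gamma> T. \<Gamma> \<ge> 0 \<and> finite T \<and> T \<subseteq> ball 0 1 \<and>
     (\<forall>\<kappa> (c :: nat \<Rightarrow> complex^'n \<Rightarrow> complex) B. (\<forall>i<n. continuous_on (cball 0 1) (c i)) \<longrightarrow> B \<ge> 0 \<longrightarrow>
       (\<forall>x\<in>T. wI \<kappa> (\<lambda>\<eta>. (norm (\<Sum>i<n. a i x * c i \<eta>))\<^sup>2) \<le> B) \<longrightarrow>
       (\<Sum>i<n. wI \<kappa> (\<lambda>\<eta>. (norm (c i \<eta>))\<^sup>2)) \<le> \<Gamma> * B)"
    by (rule dual_bound[OF dual])
  then obtain \<Gamma> T where G: "\<Gamma> \<ge> 0 \<and> finite T \<and> T \<subseteq> ball 0 1 \<and>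
     (\<forall>\<kappa> (c :: nat \<Rightarrow> complex^'n \<Rightarrow> complex) B. (\<forall>i<n. continuous_on (cball 0 1) (c i)) \<longrightarrow> B \<ge> 0 \<longrightarrow>
       (\<forall>x\<in>T. wI \<kappa> (\<lambda>\<eta>. (norm (\<Sum>i<n. a i x * c i \<eta>))\<^sup>2) \<le> B) \<longrightarrow>
       (\<Sum>i<n. wI \<kappa> (\<lambda>\<eta>. (norm (c i \<eta>))\<^sup>2)) \<le> \<Gamma> * B)"
    by (elim exE) (rule that)
  note \<Gamma> = G[THEN conjunct1] G[THEN conjunct2, THEN conjunct1] G[THEN conjunct2, THEN conjunct2, THEN conjunct1]
  note db = G[THEN conjunct2, THEN conjunct2, THEN conjunct2, THEN spec, THEN spec, THEN spec, THEN mp, THEN mp, THEN mp]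
  obtain \<delta> where \<delta>: "\<delta> > 0" "\<delta> < 1" "\<And>z. z \<in> T \<Longrightarrow> norm z \<le> 1 - \<delta>"
    using finite_subset_ball[OF \<Gamma>(2,3)] by blast
  \<comment> \<open>Small enough for two absorptions: p n \<le> 1 for the norm of q, and 4 p
    \<Gamma> \<le> 1 for the final sum.\<close>
  define p where "p = 1 / (real n + 4 * \<Gamma> + 1)"
  have p: "p > 0" "p * real n \<le> 1" "4 * (p * \<Gamma>) \<le> 1" using \<Gamma>(1) by (auto simp: p_def field_simps)
  define E where "E = p"
  obtain s0 where s0: "s0 > 0" "\<And>s z i. i < n \<Longrightarrow> 0 < s \<Longrightarrow> s < s0 \<Longrightarrow> norm z \<le> 1 - s \<Longrightarrow> norm (a i z) * sqrt s \<le> 1"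
    using tame_family[of n a 1] tame by auto
  \<comment> \<open>With s = \<theta> \<delta> / 2, the second bound brings s into the range of the
    growth estimate, and the third means \<theta> \<le> E sqrt s, which gives \<theta>^m |a_i| \<le>
    E at distance s from the sphere.\<close>
  define \<theta> where "\<theta> = min (min 1 (s0 / \<delta>)) (E\<^sup>2 * \<delta> / 2)"
  have "E > 0" using p by (simp add: E_def)
  hence \<theta>: "0 < \<theta>" "\<theta> \<le> 1" "\<theta> \<le> s0 / \<delta>" "\<theta> \<le> E\<^sup>2 * \<delta> / 2"
    unfolding \<theta>_def using s0(1) \<delta>(1) by (simp_all del: times_divide_eq_right divide_le_eq_numeral1 le_divide_eq_numeral1)
  define s where "s = \<theta> * \<delta> / 2"
  have s: "0 < s" "s < s0"
  proof -
    show "0 < s" using \<theta> \<delta> by (simp add: s_def)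
    have "\<theta> * \<delta> \<le> s0" using \<theta>(3) \<delta>(1) by (simp add: field_simps)
    thus "s < s0" using \<theta> \<delta> s0 unfolding s_def by linarith
  qed
  have small: "\<theta> ^ m * norm (a i z) \<le> E" if "i < n" "norm z \<le> 1 - s" for i z
  proof -
    have "\<theta> ^ m \<le> \<theta> ^ 1" using \<theta> m by (intro power_decreasing) auto
    hence "\<theta> ^ m * norm (a i z) \<le> \<theta> * norm (a i z)" by (intro mult_right_mono) auto
    also have "norm (a i z) \<le> 1 / sqrt s" using s0(2)[OF that(1) s that(2)] s by (simp add: field_simps)
    hence "\<theta> * norm (a i z) \<le> \<theta> * (1 / sqrt s)" using \<theta> by (intro mult_left_mono) auto
    also have "\<dots> \<le> E"
    proof -
      have "\<theta>\<^sup>2 \<le> E\<^sup>2 * s" using \<theta> \<delta> by (simp add: s_def power2_eq_square mult_mono)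
      hence "sqrt (\<theta>\<^sup>2) \<le> sqrt (E\<^sup>2 * s)" by (rule real_sqrt_le_mono)
      hence "\<theta> \<le> E * sqrt s" using \<theta> p by (simp add: real_sqrt_mult E_def)
      thus ?thesis using s by (simp add: field_simps)
    qed
    finally show ?thesis .
  qed
  \<comment> \<open>R depends on \<theta> and on the given point: the last condition puts \<zeta>
    into the ball of radius 1 / R, where vanishing will be obtained.\<close>
  obtain R where R: "R > 1" "R\<^sup>2 \<le> 1 + \<theta> * \<delta> / 2" "norm \<zeta> * R < 1"
    using near_one_root[of "\<theta> * \<delta> / 2" "norm \<zeta>"] \<theta> \<delta> \<zeta> by auto
  define a' where "a' = (\<lambda>i z. a i (of_real R *s z))"
  define h' where "h' = (\<lambda>i \<zeta>. h i (of_real (1 / R) *s \<zeta>))"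
  define c where "c = (\<lambda>i. raise M (h' i))"
  have sc: "rel m M {..<n} a' h' (1 / R) R" "\<And>i. i < n \<Longrightarrow> holo_on (a' i) (ball 0 (1 / R))"
    "\<And>i. i < n \<Longrightarrow> holo_on (h' i) (ball 0 R)"
    using scaled_rel[OF relM _ _ R(1)] a h unfolding a'_def h'_def by auto
  have ch: "holo_on (c i) (ball 0 R)" if "i < n" for i unfolding c_def by (intro holo_on_raise sc that) simp
  note cc = holo_cont_cball_cv[OF ch R(1)]
  define S2 where "S2 = (\<Sum>i<n. wI \<kappa> (\<lambda>x. (norm (c i (cv x)))\<^sup>2))"
  have S2: "S2 \<ge> 0" unfolding S2_def by (intro sum_nonneg wI_nonneg) auto
  have key: "wI \<kappa> (\<lambda>x. (norm (\<Sum>i<n. a i z * c i (cv x)))\<^sup>2) \<le> p * S2" if z: "z \<in> T" for z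
  proof -
    \<comment> \<open>The sum is antiholomorphic in x, so its conjugate is an admissible holomorphic
      test function.\<close>
    define q where "q = (\<lambda>x. cnj (\<Sum>i<n. a i z * c i (cv x)))"
    define z' where "z' = of_real (1 / R) *s z"
    have nz: "norm z' = norm z / R" using R by (simp add: z'_def norm_smult_vec norm_divide)
    have q: "holo_on q (ball 0 R)" unfolding q_def
      by (rule holo_on_conj[where U="ball 0 R"]) (auto intro!: holo_on_sum holo_on_cmult ch)
    have az: "a' i z' = a i z" for i using R by (simp add: a'_def z'_def vector_smult_assoc)
    have bnd: "(1 - \<theta>) * R + \<theta> * norm z' \<le> 1 / R * (1 - \<theta> * \<delta> / 2)"
      unfolding nz by (rule scale_bound) (use \<theta> \<delta> R z in auto)
    also have "\<dots> \<le> 1 / R * 1" using \<theta> \<delta> R by (intro mult_left_mono) auto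
    finally have bnd': "(1 - \<theta>) * R + \<theta> * norm z' \<le> 1 / R" by simp
    have z1: "norm z < 1" using \<delta>(1) \<delta>(3)[OF z] by simp
    have nz1: "norm z' < 1 / R" "norm z' \<le> 1" using z1 R unfolding nz by (auto simp: field_simps)
    have mem: "norm (x + of_real \<theta> *s (z' - x)) < 1 / R" if "norm x < R" for x
      by (rule line_point_mem[of \<theta>]) (use \<theta> nz1 R bnd' that in auto)
    have "complex_of_real (wI \<kappa> (\<lambda>x. (norm (\<Sum>i<n. a i z * c i (cv x)))\<^sup>2)) = wI \<kappa> (\<lambda>x. q x * (\<Sum>i<n. a' i z' * c i (cv x)))"
      unfolding q_def az by (rule wI_norm2[symmetric])
    also have "\<dots> = of_real \<theta> ^ m * wI \<kappa> (\<lambda>x. q x * (\<Sum>i<n. a' i (x + of_real \<theta> *s (z' - x)) * c i (cv x)))"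
      unfolding c_def M_def
      by (rule radial_identity) (use sc R \<kappa> q \<theta> nz1 bnd' m in \<open>auto simp: M_def\<close>)
    also have "\<dots> = wI \<kappa> (\<lambda>x. of_real \<theta> ^ m * (q x * (\<Sum>i<n. a' i (x + of_real \<theta> *s (z' - x)) * c i (cv x))))"
      by (rule wI_cmult[symmetric])
    also have "\<dots> = wI \<kappa> (\<lambda>x. q x * (\<Sum>i<n. (of_real \<theta> ^ m * a' i (x + of_real \<theta> *s (z' - x))) * c i (cv x)))"
      by (rule wI_cong) (simp add: sum_distrib_left mult_ac)
    finally have "norm (complex_of_real (wI \<kappa> (\<lambda>x. (norm (\<Sum>i<n. a i z * c i (cv x)))\<^sup>2))) =
       norm (wI \<kappa> (\<lambda>x. q x * (\<Sum>i<n. (of_real \<theta> ^ m * a' i (x + of_real \<theta> *s (z' - x))) * c i (cv x))))" by simp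
    also have "\<dots> \<le> (p * real n * wI \<kappa> (\<lambda>x. (norm (q x))\<^sup>2) + E\<^sup>2 / p * (\<Sum>i<n. wI \<kappa> (\<lambda>x. (norm (c i (cv x)))\<^sup>2))) / 2"
    proof (rule wI_amgm)
      show "continuous_on (cball 0 1) q" by (rule holo_cont_cball[OF q R(1)])
      show "continuous_on (cball 0 1) (\<lambda>x. c i (cv x))" if "i < n" for i by (rule cc[OF that])
      show "continuous_on (cball 0 1) (\<lambda>x. of_real \<theta> ^ m * a' i (x + of_real \<theta> *s (z' - x)))" if "i < n" for i
        by (intro continuous_intros continuous_on_compose2[OF holo_on_continuous[OF sc(2)[OF that]]])
           (use mem R in auto)
      show "norm (of_real \<theta> ^ m * a' i (x + of_real \<theta> *s (z' - x))) \<le> E" if "i < n" "norm x < 1" for i x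
      proof -
        let ?y = "x + of_real \<theta> *s (z' - x)"
        have "norm ?y \<le> norm (of_real \<theta> *s z') + norm (of_real (1 - \<theta>) *s x)"
          unfolding line_point_alt by (rule norm_triangle_ineq)
        also have "\<dots> = \<theta> * norm z' + (1 - \<theta>) * norm x" unfolding norm_smult_vec norm_of_real using \<theta> by simp
        also have "\<dots> \<le> \<theta> * norm z' + (1 - \<theta>) * R" using \<theta> R that by (intro add_left_mono mult_left_mono) auto
        also have "\<dots> \<le> 1 / R * (1 - s)" using bnd by (simp add: s_def)
        finally have "R * norm ?y \<le> 1 - s" using R by (simp add: field_simps)
        hence "norm (of_real R *s ?y) \<le> 1 - s" unfolding norm_smult_vec norm_of_real using R by simp
        from small[OF that(1) this] show ?thesis using \<theta> by (simp add: a'_def norm_mult norm_power)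
      qed
    qed (rule p)
    also have "E\<^sup>2 / p = p" using p by (simp add: E_def power2_eq_square)
    also have "wI \<kappa> (\<lambda>x. (norm (q x))\<^sup>2) = wI \<kappa> (\<lambda>x. (norm (\<Sum>i<n. a i z * c i (cv x)))\<^sup>2)"
      by (simp only: q_def complex_mod_cnj)
    finally have e: "wI \<kappa> (\<lambda>x. (norm (\<Sum>i<n. a i z * c i (cv x)))\<^sup>2) \<le>
       (p * real n * wI \<kappa> (\<lambda>x. (norm (\<Sum>i<n. a i z * c i (cv x)))\<^sup>2) + p * S2) / 2" (is "?N \<le> _")
      unfolding S2_def using wI_nonneg[of "\<lambda>x. (norm (\<Sum>i<n. a i z * c i (cv x)))\<^sup>2" \<kappa>] by simp
    \<comment> \<open>Half of \<open>?N\<close> on the right is absorbed by the left.\<close>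
    have "p * real n * ?N \<le> 1 * ?N" using p by (intro mult_right_mono wI_nonneg) auto
    thus ?thesis using e by simp
  qed
  have "S2 \<le> \<Gamma> * (p * S2)" unfolding S2_def
  proof (rule db)
    show "\<forall>i<n. continuous_on (cball 0 1) (\<lambda>x. c i (cv x))" using cc by blast
  qed (use key S2 p in \<open>auto simp: S2_def\<close>)
  also have "\<dots> = (p * \<Gamma>) * S2" by simp
  also have "\<dots> \<le> 1 / 4 * S2" using p S2 by (intro mult_right_mono) auto
  finally have S20: "S2 = 0" using S2 by simp
  have c0: "c i x = 0" if "i < n" "norm x < 1" for i x
  proof -
    have "wI \<kappa> (\<lambda>x. (norm (c i (cv x)))\<^sup>2) \<le> S2" unfolding S2_def
      by (rule member_le_sum) (use that in \<open>auto intro: wI_nonneg\<close>)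
    hence "(norm (c i (cv (cv x))))\<^sup>2 = 0" using S20 that
      by (intro wI_eq_0_imp[of "\<lambda>x. (norm (c i (cv x)))\<^sup>2" \<kappa>]) (auto intro!: continuous_intros cc)
    thus ?thesis by simp
  qed
  have hb: "holo_on (h' i) (ball 0 1)"
    by (rule holo_on_subset[OF sc(3)[OF i]]) (use R in auto)
  have h0: "\<forall>z\<in>ball 0 1. h' i z = 0"
  proof
    fix z :: "complex^'n" assume z: "z \<in> ball 0 1"
    have "h' i z = 0 ^ M * h' i 0"
      by (rule raise_ray[of _ 1]) (use z i c0 hb in \<open>auto simp: c_def\<close>)
    thus "h' i z = 0" by (simp add: M_def \<kappa>_def)
  qed
  have "h i z = 0" if "z \<in> ball 0 (1 / R)" for z
  proof -
    have "of_real R *s z \<in> ball 0 1" using that R by (simp add: norm_smult_vec field_simps)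
    hence "h' i (of_real R *s z) = 0" using h0 by blast
    thus ?thesis using R by (simp add: h'_def vector_smult_assoc)
  qed
  moreover have "holo_on (b i) (ball 0 (1 / R))"
    by (rule holo_on_subset[OF b[OF i] subset_ball]) (use R in simp)
  ultimately have "\<forall>z\<in>ball 0 (1 / R). b i z = 0"
    unfolding h_def by (intro rit_zero_imp[where d=d and m=m] m) auto
  moreover have "\<zeta> \<in> ball 0 (1 / R)" using R by (simp add: field_simps)
  ultimately show ?thesis by blast
qed

section \<open>Relations of order zero\<close>

lemma directional_cauchy:
  fixes f :: "complex^'n \<Rightarrow> complex"
  assumes f: "holo_on f (ball 0 \<rho>)" and r: "r > 0"
    and B: "\<And>\<tau>. norm \<tau> \<le> r \<Longrightarrow> norm (y + \<tau> *s v) < \<rho> \<and> norm (f (y + \<tau> *s v)) \<le> B"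
  shows "norm (\<Sum>k\<in>UNIV. v $ k * pd k f y) \<le> B / r"
proof -
  define g where "g = (\<lambda>\<tau>. f (y + \<tau> *s v))"
  have der: "(g has_field_derivative (\<Sum>k\<in>UNIV. v $ k * pd k f (y + \<tau> *s v))) (at \<tau>)" if "norm \<tau> \<le> r" for \<tau>
    unfolding g_def by (rule holo_on_line[OF f]) (use B[OF that] in auto)
  have hol: "g holomorphic_on cball 0 r"
    unfolding holomorphic_on_def field_differentiable_def
    by (auto intro!: exI has_field_derivative_at_within[OF der])
  have "norm ((deriv ^^ 1) g 0) \<le> fact 1 * B / r ^ 1"
    by (rule Cauchy_inequality)
       (use hol r B in \<open>auto simp: g_def intro: holomorphic_on_subset holomorphic_on_imp_continuous_on\<close>)
  moreover have "deriv g 0 = (\<Sum>k\<in>UNIV. v $ k * pd k f y)" using der[of 0] r by (auto intro!: DERIV_imp_deriv)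
  ultimately show ?thesis by simp
qed

lemma norm_add_sq: "(norm (y + w))\<^sup>2 = (norm y)\<^sup>2 + 2 * Re (bil w (cv y)) + (norm (w :: complex^'n))\<^sup>2"
proof -
  have c: "bil y (cv w) = cnj (bil w (cv y))" by (simp add: bil_def mult.commute)
  have "complex_of_real ((norm (y + w))\<^sup>2) = bil (y + w) (cv (y + w))" by (rule bil_cv[symmetric])
  also have "\<dots> = bil y (cv y) + (bil w (cv y) + cnj (bil w (cv y))) + bil w (cv w)"
    by (simp add: cv_add bil_add_left bil_add_right c)
  also have "\<dots> = complex_of_real ((norm y)\<^sup>2 + 2 * Re (bil w (cv y)) + (norm w)\<^sup>2)"
    unfolding bil_cv complex_add_cnj by simp
  finally show ?thesis by (simp only: of_real_eq_iff)
qed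

lemma bil_axis: "bil (axis l 1) \<zeta> = \<zeta> $ l"
  unfolding bil_def by (rule sum_axis_mult)

lemma bil_diff_left: "bil (z - z') w = bil z w - bil z' w" by (simp add: bil_def sum_subtractf ring_distribs)

lemma one_minus_bil_ge:
  assumes "norm z \<le> 1 - \<delta>" "norm \<zeta> \<le> 1" "\<delta> \<le> 1"
  shows "\<delta> \<le> norm (1 - bil z \<zeta>)"
proof -
  have "norm (bil z \<zeta>) \<le> (1 - \<delta>) * 1"
    by (rule order_trans[OF norm_bil_le mult_mono]) (use assms in auto)
  thus ?thesis using norm_triangle_ineq2[of 1 "bil z \<zeta>"] by simp
qed

text \<open>The vector \<open>v\<close> is complex tangential at \<open>x\<close> up to \<open>1 - \<bar>x\<bar>\<^sup>2\<close>, so a complex disc of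
  radius of order \<open>sqrt \<theta>\<close> in its direction stays at distance of order \<open>\<theta>\<close> from the sphere.\<close>
lemma tangential_disc:
  fixes x z' :: "complex^'n"
  assumes x: "norm x \<le> 1" and z': "norm z' \<le> 1 - \<delta>" and \<delta>: "0 < \<delta>" "\<delta> < 1" and \<theta>: "0 < \<theta>" "\<theta> \<le> 1 / 2"
    and v: "v = axis l 1 - (cv x $ l / (1 - bil z' (cv x))) *s (x - z')"
    and y: "y = x + of_real \<theta> *s (z' - x)"
    and V: "V = 1 + 2 / \<delta>" and \<tau>: "norm \<tau> \<le> \<delta> / (8 * V) * sqrt \<theta>"
  shows "(norm (y + \<tau> *s v))\<^sup>2 \<le> 1 - \<theta> * \<delta> / 2"
proof -
  define u where "u = 1 - (norm x)\<^sup>2"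
  define \<zeta> where "\<zeta> = cv x"
  define \<beta> where "\<beta> = \<zeta> $ l / (1 - bil z' \<zeta>)"
  define r where "r = \<delta> / (8 * V) * sqrt \<theta>"
  have u: "0 \<le> u" "u \<le> 1" using x by (auto simp: u_def power_le_one)
  have n\<zeta>: "norm \<zeta> \<le> 1" using x by (simp add: \<zeta>_def)
  have lb: "\<delta> \<le> norm (1 - bil z' \<zeta>)" using one_minus_bil_ge[OF z' n\<zeta>] \<delta> by simp
  have "norm (\<zeta> $ l) \<le> 1" using Finite_Cartesian_Product.norm_nth_le[of \<zeta> l] n\<zeta> by simp
  hence \<beta>: "norm \<beta> \<le> 1 / \<delta>" unfolding \<beta>_def norm_divide using lb \<delta> by (intro frac_le) auto
  have V1: "V \<ge> 1" using V \<delta> by simp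
  have nx: "norm (x - z') \<le> 2" using norm_triangle_ineq4[of x z'] x z' \<delta> by simp
  have nv: "norm v \<le> V"
  proof -
    have "norm v \<le> norm (axis l 1 :: complex^'n) + norm (\<beta> *s (x - z'))"
      unfolding v \<beta>_def \<zeta>_def by (rule norm_triangle_ineq4)
    also have "\<dots> \<le> 1 + 1 / \<delta> * 2" unfolding norm_smult_vec using \<beta> nx \<delta> by (intro add_mono mult_mono) auto
    finally show ?thesis by (simp add: V)
  qed
  \<comment> \<open>Pairing x - z' with \<open>\<zeta>\<close> = \<open>cv x\<close> gives |x|^2 -
    \<open>bil z' \<zeta>\<close>. With 1 in place of |x|^2 the coefficient \<beta> would cancel
    \<zeta>_l exactly; the defect is \<beta> u.\<close>
  have "bil v \<zeta> = \<zeta> $ l - \<beta> * (of_real ((norm x)\<^sup>2) - bil z' \<zeta>)"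
    unfolding v \<beta>_def \<zeta>_def by (simp only: bil_diff_left bil_smult_left bil_axis bil_cv)
  also have "\<zeta> $ l = \<beta> * (1 - bil z' \<zeta>)"
  proof -
    have "1 - bil z' \<zeta> \<noteq> 0" using lb \<delta> by auto
    thus ?thesis by (simp add: \<beta>_def)
  qed
  also have "\<beta> * (1 - bil z' \<zeta>) - \<beta> * (of_real ((norm x)\<^sup>2) - bil z' \<zeta>) = \<beta> * of_real u"
    by (simp add: u_def algebra_simps)
  finally have bv: "norm (bil v \<zeta>) \<le> u / \<delta>" using mult_right_mono[OF \<beta> u(1)] u by (simp add: norm_mult)
  have cvy: "cv y = of_real \<theta> *s cv z' + of_real (1 - \<theta>) *s \<zeta>"
    unfolding y line_point_alt by (simp only: cv_add cv_smult \<zeta>_def complex_cnj_complex_of_real)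
  have bvy: "norm (bil v (cv y)) \<le> \<theta> * V + u / \<delta>"
  proof -
    have "norm (bil v (cv y)) \<le> norm (of_real \<theta> * bil v (cv z')) + norm (of_real (1 - \<theta>) * bil v \<zeta>)"
      unfolding cvy bil_add_right bil_smult_right by (rule norm_triangle_ineq)
    also have "\<dots> = \<theta> * norm (bil v (cv z')) + (1 - \<theta>) * norm (bil v \<zeta>)" unfolding norm_mult norm_of_real using \<theta> by simp
    also have "\<dots> \<le> \<theta> * (V * 1) + 1 * (u / \<delta>)"
    proof (intro add_mono mult_mono)
      show "norm (bil v (cv z')) \<le> V * 1"
        by (rule order_trans[OF norm_bil_le mult_mono]) (use nv z' \<delta> V1 in auto)
    qed (use \<theta> bv u \<delta> V1 in auto)
    finally show ?thesis by simp
  qed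
  have ny: "(norm y)\<^sup>2 \<le> 1 - u / 2 - \<theta> * \<delta>"
  proof -
    have "norm y \<le> norm (of_real \<theta> *s z') + norm (of_real (1 - \<theta>) *s x)"
      unfolding y line_point_alt by (rule norm_triangle_ineq)
    also have "\<dots> = \<theta> * norm z' + (1 - \<theta>) * norm x" unfolding norm_smult_vec norm_of_real using \<theta> by simp
    finally have "(norm y)\<^sup>2 \<le> (\<theta> * norm z' + (1 - \<theta>) * norm x)\<^sup>2" by (rule power_mono) simp
    also have "\<dots> \<le> \<theta> * (norm z')\<^sup>2 + (1 - \<theta>) * (norm x)\<^sup>2"
    proof -
      have "0 \<le> \<theta> * (1 - \<theta>) * (norm z' - norm x)\<^sup>2" using \<theta> by simp
      thus ?thesis by (simp add: power2_eq_square algebra_simps)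
    qed
    also have "\<dots> \<le> \<theta> * (1 - \<delta>) + (1 - \<theta>) * (1 - u)"
    proof (intro add_mono mult_left_mono)
      have "(norm z')\<^sup>2 \<le> (1 - \<delta>)\<^sup>2" using z' by (intro power_mono) auto
      also have "\<dots> \<le> 1 - \<delta>" using \<delta> by (simp add: power2_eq_square mult_left_le)
      finally show "(norm z')\<^sup>2 \<le> 1 - \<delta>" .
    qed (use \<theta> in \<open>auto simp: u_def\<close>)
    also have "\<dots> \<le> 1 - u / 2 - \<theta> * \<delta>"
      using mult_right_mono[OF \<theta>(2) u(1)] by (simp add: algebra_simps)
    finally show ?thesis .
  qed
  have r0: "0 \<le> r" using \<delta> V1 \<theta> by (simp add: r_def)
  have rV: "r * V = \<delta> / 8 * sqrt \<theta>" using V1 by (simp add: r_def)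
  have sq1: "sqrt \<theta> \<le> 1" using \<theta> by simp
  have rV1: "r * V \<le> \<delta> / 8" unfolding rV using \<delta> sq1 by (simp add: mult_left_le)
  have r1: "r \<le> \<delta> / 8"
    using rV1 V1 r0 by (smt (verit, best) mult_left_mono mult_cancel_left2)
  have "norm (bil (\<tau> *s v) (cv y)) \<le> r * (\<theta> * V + u / \<delta>)"
    unfolding bil_smult_left norm_mult using \<tau> bvy r0 by (intro mult_mono) (auto simp: r_def)
  also have "\<dots> = (r * V) * \<theta> + r * (u / \<delta>)" by (simp add: algebra_simps)
  also have "\<dots> \<le> \<delta> / 8 * \<theta> + \<delta> / 8 * (u / \<delta>)" using rV1 r1 \<theta> u \<delta> by (intro add_mono mult_right_mono) auto
  also have "\<dots> = \<theta> * \<delta> / 8 + u / 8" using \<delta> by simp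
  finally have t1: "Re (bil (\<tau> *s v) (cv y)) \<le> \<theta> * \<delta> / 8 + u / 8" using complex_Re_le_cmod order_trans by blast
  have "norm (\<tau> *s v) \<le> r * V" unfolding norm_smult_vec using \<tau> nv r0 by (intro mult_mono) (auto simp: r_def)
  hence "(norm (\<tau> *s v))\<^sup>2 \<le> (r * V)\<^sup>2" by (rule power_mono) simp
  also have "\<dots> = \<delta> * \<delta> * \<theta> / 64" unfolding rV using \<theta> by (simp add: power_mult_distrib power2_eq_square)
  also have "\<dots> \<le> 1 * \<delta> * \<theta> / 64" using \<delta> \<theta> by (intro divide_right_mono mult_right_mono) auto
  finally have t2: "(norm (\<tau> *s v))\<^sup>2 \<le> \<theta> * \<delta> / 64" by (simp add: mult.commute)
  have "(norm (y + \<tau> *s v))\<^sup>2 = (norm y)\<^sup>2 + 2 * Re (bil (\<tau> *s v) (cv y)) + (norm (\<tau> *s v))\<^sup>2" by (rule norm_add_sq)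
  moreover have "0 \<le> \<theta> * \<delta>" using \<theta> \<delta> by simp
  ultimately show ?thesis using ny t1 t2 u by linarith
qed

text \<open>On the sphere the vector x - z' pairs with \<open>cv x\<close> to 1 -
  \<open>bil z' (cv x)\<close>. Hence \<alpha>(cv x) is the multiple of x - z' to be subtracted from
  the l-th unit vector in order to reach the complex tangent space. It depends on x only through
  \<open>cv x\<close>, and holomorphically, as \<open>alpha_identity\<close> demands.\<close>

lemma alpha_facts:
  fixes z' :: "complex^'n" and l :: 'n
  assumes nz: "\<And>\<zeta>. \<zeta> \<in> U \<Longrightarrow> 1 - bil z' \<zeta> \<noteq> 0"
  defines "\<alpha> \<equiv> \<lambda>\<zeta>. \<zeta> $ l * inverse (1 - bil z' \<zeta>)"
  shows "holo_on \<alpha> U"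
    and "\<zeta> \<in> U \<Longrightarrow> pd k \<alpha> \<zeta> = \<zeta> $ l * (z' $ k * inverse ((1 - bil z' \<zeta>)\<^sup>2)) + (if k = l then 1 else 0) * inverse (1 - bil z' \<zeta>)"
proof -
  have b: "holo_on (\<lambda>\<zeta>. 1 - bil z' \<zeta>) U" by (intro holo_on_diff holo_on_const holo_on_bil)
  have pb: "pd k (\<lambda>\<zeta>. 1 - bil z' \<zeta>) \<zeta> = - (z' $ k)" for k \<zeta>
    using pd_diff[OF holo_on_const holo_on_bil, of \<zeta> UNIV] by simp
  have d: "((\<lambda>\<zeta>. inverse (1 - bil z' \<zeta>)) has_derivative (\<lambda>v. \<Sum>k\<in>UNIV. v $ k * (- inverse ((1 - bil z' \<zeta>)\<^sup>2) * - (z' $ k)))) (at \<zeta>)"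
    if "\<zeta> \<in> U" for \<zeta>
    using compose_has_derivative_pd[OF b that, of inverse "- inverse ((1 - bil z' \<zeta>)\<^sup>2)"] DERIV_inverse[OF nz[OF that]]
    by (simp add: pb power2_eq_square)
  have hi: "holo_on (\<lambda>\<zeta>. inverse (1 - bil z' \<zeta>)) U" by (rule holo_onI[OF d])
  have pi: "pd k (\<lambda>\<zeta>. inverse (1 - bil z' \<zeta>)) \<zeta> = z' $ k * inverse ((1 - bil z' \<zeta>)\<^sup>2)" if "\<zeta> \<in> U" for k \<zeta>
    using pd_eqI[OF d[OF that], of k] by simp
  show "holo_on \<alpha> U" unfolding \<alpha>_def by (intro holo_on_mult holo_on_nth hi)
  show "pd k \<alpha> \<zeta> = \<zeta> $ l * (z' $ k * inverse ((1 - bil z' \<zeta>)\<^sup>2)) + (if k = l then 1 else 0) * inverse (1 - bil z' \<zeta>)" if "\<zeta> \<in> U"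
    unfolding \<alpha>_def by (simp only: pd_mult[OF holo_on_nth hi that] pi[OF that] pd_nth)
qed

lemma bounded_pd_family:
  fixes f :: "nat \<Rightarrow> complex^'n \<Rightarrow> complex"
  assumes f: "\<And>i. i < n \<Longrightarrow> holo_on (f i) (ball 0 1)" and r: "r < 1"
  shows "\<exists>D. D \<ge> 0 \<and> (\<forall>i<n. \<forall>k z. norm z \<le> r \<longrightarrow> norm (pd k (f i) z) \<le> D)"
proof -
  define K where "K = (\<lambda>z. \<Sum>i<n. \<Sum>k\<in>UNIV. norm (pd k (f i) z))"
  have "continuous_on (cball 0 r) K" unfolding K_def
    by (intro continuous_intros continuous_on_subset[OF continuous_pd[OF f]]) (use r in auto)
  hence "bounded (K ` cball 0 r)" by (intro compact_imp_bounded compact_continuous_image) auto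
  then obtain D where D: "\<forall>y\<in>K ` cball 0 r. norm y \<le> D" unfolding bounded_iff by blast
  have "norm (pd k (f i) z) \<le> max D 0" if "i < n" "norm z \<le> r" for i k z
  proof -
    have "norm (pd k (f i) z) \<le> (\<Sum>k\<in>UNIV. norm (pd k (f i) z))" by (rule member_le_sum) auto
    also have "\<dots> \<le> K z" unfolding K_def by (rule member_le_sum) (use that in \<open>auto intro: sum_nonneg\<close>)
    also have "\<dots> \<le> D" using D that by force
    finally show ?thesis by simp
  qed
  thus ?thesis by (intro exI[of _ "max D 0"]) auto
qed


lemma half_absorb: "W \<le> (X + a) / 2 + (X + b) / 2 \<Longrightarrow> X \<le> 1 / 2 * W \<Longrightarrow> W \<le> a + b" for W X a b :: real
  by argo

text \<open>The l-th unit vector is split as v + \<alpha> (x - z'). The tangential part costs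
  \<theta>^(-1/2) twice, once for the growth and once for the radius of the disc; the factor
  \<theta> of \<open>radial_identity\<close> just compensates this, and smallness comes from
  \<epsilon>. The radial part has a bound C that depends on \<theta>, but it multiplies h_i and not
  c_i = (M + E) h_i, and M is chosen after C. The conclusion concerns E g_i since raising starts
  from index 0.\<close>

lemma tame_rel_const:
  fixes f g :: "nat \<Rightarrow> complex^'n \<Rightarrow> complex"
  assumes f: "\<And>i. i < n \<Longrightarrow> holo_on (f i) (ball 0 1)" and g: "\<And>i. i < n \<Longrightarrow> holo_on (g i) (ball 0 1)"
    and rel: "rel 0 0 {..<n} f g 1 1" and tame: "\<And>i. i < n \<Longrightarrow> tame (f i)"
    and dual: "\<And>i. i < n \<Longrightarrow> evcomb (UNIV \<times> ball 0 1) (Ld i)"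
      "\<And>i i'. i < n \<Longrightarrow> i' < n \<Longrightarrow> Ld i (\<lambda>x. pd (fst x) (f i') (snd x)) = (if i' = i then 1 else 0)"
    and i: "i < n" and \<zeta>: "norm \<zeta> < 1"
  shows "Eu (g i) \<zeta> = 0"
proof -
  let ?N = "CARD('n)"
  define A where "A = (\<lambda>i x. pd (fst x) (f i) (snd x))"
  have dual': "\<And>i i'. i < n \<Longrightarrow> i' < n \<Longrightarrow> Ld i (A i') = (if i' = i then 1 else 0)"
    using dual(2) by (simp add: A_def)
  have "\<exists>\<Gamma> T. \<Gamma> \<ge> 0 \<and> finite T \<and> T \<subseteq> UNIV \<times> ball 0 1 \<and>
     (\<forall>\<kappa> (c :: nat \<Rightarrow> complex^'n \<Rightarrow> complex) B. (\<forall>i<n. continuous_on (cball 0 1) (c i)) \<longrightarrow> B \<ge> 0 \<longrightarrow>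
       (\<forall>x\<in>T. wI \<kappa> (\<lambda>\<eta>. (norm (\<Sum>i<n. A i x * c i \<eta>))\<^sup>2) \<le> B) \<longrightarrow>
       (\<Sum>i<n. wI \<kappa> (\<lambda>\<eta>. (norm (c i \<eta>))\<^sup>2)) \<le> \<Gamma> * B)"
    by (rule dual_bound[OF dual(1) dual'])
  then obtain \<Gamma> T where G: "\<Gamma> \<ge> 0 \<and> finite T \<and> T \<subseteq> UNIV \<times> ball 0 1 \<and>
     (\<forall>\<kappa> (c :: nat \<Rightarrow> complex^'n \<Rightarrow> complex) B. (\<forall>i<n. continuous_on (cball 0 1) (c i)) \<longrightarrow> B \<ge> 0 \<longrightarrow>
       (\<forall>x\<in>T. wI \<kappa> (\<lambda>\<eta>. (norm (\<Sum>i<n. A i x * c i \<eta>))\<^sup>2) \<le> B) \<longrightarrow>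
       (\<Sum>i<n. wI \<kappa> (\<lambda>\<eta>. (norm (c i \<eta>))\<^sup>2)) \<le> \<Gamma> * B)"
    by (elim exE) (rule that)
  note \<Gamma> = G[THEN conjunct1] G[THEN conjunct2, THEN conjunct1] G[THEN conjunct2, THEN conjunct2, THEN conjunct1]
  note db = G[THEN conjunct2, THEN conjunct2, THEN conjunct2, THEN spec, THEN spec, THEN spec, THEN mp, THEN mp, THEN mp]
  have "finite (snd ` T)" "snd ` T \<subseteq> ball 0 1" using \<Gamma> by auto
  then obtain \<delta> where \<delta>: "\<delta> > 0" "\<delta> < 1" and \<delta>T: "\<And>x. x \<in> T \<Longrightarrow> norm (snd x) \<le> 1 - \<delta>"
    using finite_subset_ball[of "snd ` T"] by blast
  define V where "V = 1 + 2 / \<delta>"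
  define \<sigma> where "\<sigma> = \<delta> / (8 * V)"
  have V: "V \<ge> 1" using \<delta> by (simp add: V_def)
  hence \<sigma>: "\<sigma> > 0" using \<delta> by (simp add: \<sigma>_def)
  \<comment> \<open>Two error terms now contribute p n each, hence the factor 2 before n.\<close>
  define p where "p = 1 / (2 * real n + 2 * \<Gamma> + 2)"
  have p: "p > 0" "2 * (p * real n) \<le> 1" "2 * (p * \<Gamma>) \<le> 1" using \<Gamma>(1) by (auto simp: p_def field_simps)
  \<comment> \<open>Chosen so that \<theta> times the Cauchy estimate (\<epsilon> / sqrt s) /
    (\<sigma> sqrt \<theta>) equals p, with s = \<theta> \<delta> / 8.\<close>
  define \<epsilon> where "\<epsilon> = p * \<sigma> * sqrt (\<delta> / 8)"
  have \<epsilon>: "\<epsilon> > 0" using p \<sigma> \<delta> by (simp add: \<epsilon>_def)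
  obtain s0 where s0: "s0 > 0" "\<And>s z i. i < n \<Longrightarrow> 0 < s \<Longrightarrow> s < s0 \<Longrightarrow> norm z \<le> 1 - s \<Longrightarrow> norm (f i z) * sqrt s \<le> \<epsilon>"
    using tame_family[of n f \<epsilon>] tame \<epsilon> by auto
  define \<theta> where "\<theta> = min (1 / 2) s0"
  have \<theta>: "0 < \<theta>" "\<theta> \<le> 1 / 2" "\<theta> \<le> s0" using s0 by (auto simp: \<theta>_def)
  \<comment> \<open>The discs of \<open>tangential_disc\<close> keep the squared norm below 1 -
    \<theta> \<delta> / 2; after a dilation with R^2 \<le> 1 + \<theta> \<delta> / 4 there remains
    the distance s from the sphere.\<close>
  define s where "s = \<theta> * \<delta> / 8"
  have \<theta>\<delta>: "0 < \<theta> * \<delta>" "\<theta> * \<delta> \<le> \<theta>" using \<theta> \<delta> by (auto simp: mult_left_le)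
  have s: "0 < s" "s < s0" "s < 1" using \<theta>\<delta> \<theta> unfolding s_def by linarith+
  have r1: "1 - \<theta> * \<delta> / 2 < 1" using \<theta>\<delta> by simp
  \<comment> \<open>\<theta> is fixed by now, so a compactness bound for the derivatives is enough,
    however it depends on \<theta>.\<close>
  have "\<exists>D. D \<ge> 0 \<and> (\<forall>i<n. \<forall>k z. norm z \<le> 1 - \<theta> * \<delta> / 2 \<longrightarrow> norm (pd k (f i) z) \<le> D)"
    by (rule bounded_pd_family[OF f r1])
  then obtain D where "D \<ge> 0 \<and> (\<forall>i<n. \<forall>k z. norm z \<le> 1 - \<theta> * \<delta> / 2 \<longrightarrow> norm (pd k (f i) z) \<le> D)" by (elim exE) (rule that)
  hence D: "D \<ge> 0" "\<And>i k z. i < n \<Longrightarrow> norm z \<le> 1 - \<theta> * \<delta> / 2 \<Longrightarrow> norm (pd k (f i) z) \<le> D" by auto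
  define P where "P = 1 / \<delta>\<^sup>2 + 1 / \<delta>"
  have P: "P \<ge> 0" using \<delta> by (simp add: P_def)
  define C where "C = real ?N * ((real ?N * P + P) * (2 * D))"
  have C: "C \<ge> 0" using P D by (simp add: C_def)
  \<comment> \<open>C is fixed at this point, and \<open>\<Gamma>\<close> and \<open>T\<close> do
    not depend on the weight, so the exponent may be taken large enough for M^2 to exceed the
    constant in the final comparison.\<close>
  obtain \<kappa>0 :: nat where \<kappa>0: "real \<kappa>0 > 2 * \<Gamma> * (C\<^sup>2 / p)" using reals_Archimedean2 by blast
  define \<kappa> where "\<kappa> = \<kappa>0 + 2"
  define M where "M = ?N + \<kappa>"
  have \<kappa>: "\<kappa> \<ge> 2" by (simp add: \<kappa>_def)
  have "real \<kappa>0 \<le> real M * 1" by (simp add: M_def \<kappa>_def)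
  also have "\<dots> \<le> real M * real M" by (intro mult_left_mono) (auto simp: M_def \<kappa>_def)
  finally have MM: "(real M)\<^sup>2 > 2 * \<Gamma> * (C\<^sup>2 / p)" using \<kappa>0 by (simp add: power2_eq_square)
  define h where "h = (\<lambda>i. rit 0 M (g i))"
  have h: "holo_on (h i) (ball 0 1)" if "i < n" for i unfolding h_def by (intro holo_on_rit g that) simp
  have relM: "rel 0 M {..<n} f h 1 1" using rel_rit[OF rel, of M] g unfolding h_def by simp
  obtain R where R: "R > 1" "R\<^sup>2 \<le> 1 + \<theta> * \<delta> / 4" "norm \<zeta> * R < 1"
    using near_one_root[of "\<theta> * \<delta> / 4" "norm \<zeta>"] \<theta>\<delta> \<zeta> by auto
  have R2: "R \<le> 2"
  proof -
    have "R * 1 \<le> R * R" using R by (intro mult_left_mono) auto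
    thus ?thesis using R(2) \<theta>\<delta> \<theta> unfolding power2_eq_square by linarith
  qed
  define f' where "f' = (\<lambda>i z. f i (of_real R *s z))"
  define h' where "h' = (\<lambda>i \<zeta>. h i (of_real (1 / R) *s \<zeta>))"
  define c where "c = (\<lambda>i. raise M (h' i))"
  have sc: "rel 0 M {..<n} f' h' (1 / R) R" "\<And>i. i < n \<Longrightarrow> holo_on (f' i) (ball 0 (1 / R))"
    "\<And>i. i < n \<Longrightarrow> holo_on (h' i) (ball 0 R)"
    "\<And>i z k. i < n \<Longrightarrow> norm z < 1 / R \<Longrightarrow> pd k (f' i) z = of_real R * pd k (f i) (of_real R *s z)"
    using scaled_rel[OF relM _ _ R(1)] f h unfolding f'_def h'_def by auto
  have ch: "holo_on (c i) (ball 0 R)" if "i < n" for i unfolding c_def by (intro holo_on_raise sc that) simp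
  note cc = holo_cont_cball_cv[OF ch R(1)] and chh = holo_cont_cball_cv[OF sc(3) R(1)]
  define S2 where "S2 = (\<Sum>i<n. wI \<kappa> (\<lambda>x. (norm (c i (cv x)))\<^sup>2))"
  define T2 where "T2 = (\<Sum>i<n. wI \<kappa> (\<lambda>x. (norm (h' i (cv x)))\<^sup>2))"
  have S2: "S2 \<ge> 0" unfolding S2_def by (intro sum_nonneg wI_nonneg) auto
  have T2: "T2 \<ge> 0" unfolding T2_def by (intro sum_nonneg wI_nonneg) auto
  have key: "wI \<kappa> (\<lambda>x. (norm (\<Sum>i<n. A i w * c i (cv x)))\<^sup>2) \<le> p * S2 + C\<^sup>2 / p * T2" if w: "w \<in> T" for w
  proof -
    obtain l z where wl: "w = (l, z)" by (cases w)
    have nzz: "norm z \<le> 1 - \<delta>" using \<delta>T[OF w] wl by simp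
    have Aw: "A i w = pd l (f i) z" for i by (simp add: A_def wl)
    define q where "q = (\<lambda>x. cnj (\<Sum>i<n. A i w * c i (cv x)))"
    define z' where "z' = of_real (1 / R) *s z"
    have nz: "norm z' = norm z / R" using R by (simp add: z'_def norm_smult_vec norm_divide)
    have q: "holo_on q (ball 0 R)" unfolding q_def
      by (rule holo_on_conj[where U="ball 0 R"]) (auto intro!: holo_on_sum holo_on_cmult ch)
    have R2': "R\<^sup>2 \<le> 1 + \<theta> * \<delta> / 2" using R(2) \<theta>\<delta> by simp
    have bnd: "(1 - \<theta>) * R + \<theta> * norm z' \<le> 1 / R * (1 - \<theta> * \<delta> / 2)"
      unfolding nz by (rule scale_bound) (use \<theta> \<delta> R R2' nzz in auto)
    also have "\<dots> \<le> 1 / R * 1" using \<theta>\<delta> R by (intro mult_left_mono) auto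
    finally have bnd': "(1 - \<theta>) * R + \<theta> * norm z' \<le> 1 / R" by simp
    have z1: "norm z < 1" using nzz \<delta> by simp
    have "norm z / R \<le> norm z" using R mult_right_mono[of 1 R "norm z"] by (simp add: field_simps)
    hence nz1: "norm z' < 1 / R" "norm z' \<le> 1 - \<delta>" "norm z' \<le> 1" using z1 R nzz \<delta> unfolding nz by (auto simp: divide_strict_right_mono)
    let ?y = "\<lambda>x. x + of_real \<theta> *s (z' - x)"
    have mem: "norm (?y x) < 1 / R" if "norm x < R" for x
      by (rule line_point_mem[of \<theta>]) (use \<theta> nz1 R bnd' that in auto)
    have ynorm: "R * norm (?y x) \<le> 1 - \<theta> * \<delta> / 2" if "norm x < 1" for x
    proof -
      have "norm (?y x) \<le> norm (of_real \<theta> *s z') + norm (of_real (1 - \<theta>) *s x)"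
        unfolding line_point_alt by (rule norm_triangle_ineq)
      also have "\<dots> = \<theta> * norm z' + (1 - \<theta>) * norm x" unfolding norm_smult_vec norm_of_real using \<theta> by simp
      also have "\<dots> \<le> \<theta> * norm z' + (1 - \<theta>) * R" using \<theta> R that by (intro add_left_mono mult_left_mono) auto
      also have "\<dots> \<le> 1 / R * (1 - \<theta> * \<delta> / 2)" using bnd by simp
      finally show ?thesis using R by (simp add: field_simps)
    qed
    have nzb: "1 - bil z' \<xi> \<noteq> 0" if "\<xi> \<in> ball 0 R" for \<xi>
    proof -
      have "norm (bil z' \<xi>) \<le> norm z' * norm \<xi>" by (rule norm_bil_le)
      also have "\<dots> \<le> norm z' * R" using that by (intro mult_left_mono) auto
      also have "\<dots> < 1" using z1 R unfolding nz by simp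
      finally show ?thesis by (metis eq_iff_diff_eq_0 less_irrefl norm_one)
    qed
    define \<alpha> where "\<alpha> = (\<lambda>\<xi>. \<xi> $ l * inverse (1 - bil z' \<xi>))"
    have \<alpha>: "holo_on \<alpha> (ball 0 R)" unfolding \<alpha>_def by (rule alpha_facts(1)) (rule nzb)
    have p\<alpha>: "norm (pd k \<alpha> \<xi>) \<le> P" if "norm \<xi> \<le> 1" for k \<xi>
    proof -
      have lb: "\<delta> \<le> norm (1 - bil z' \<xi>)" using one_minus_bil_ge[OF nz1(2) that] \<delta> by simp
      have nk: "norm (\<xi> $ l) \<le> 1" "norm (z' $ k) \<le> 1"
        using Finite_Cartesian_Product.norm_nth_le[of \<xi> l] Finite_Cartesian_Product.norm_nth_le[of z' k] that nz1 by linarith+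
      have i1: "inverse (norm (1 - bil z' \<xi>)) \<le> 1 / \<delta>" using lb \<delta> by (simp add: inverse_eq_divide frac_le)
      have i2: "inverse ((norm (1 - bil z' \<xi>))\<^sup>2) \<le> 1 / \<delta>\<^sup>2"
        using lb \<delta> by (simp add: inverse_eq_divide frac_le power_mono)
      have "\<xi> \<in> ball 0 R" using that R by simp
      hence "norm (pd k \<alpha> \<xi>) \<le> norm (\<xi> $ l * (z' $ k * inverse ((1 - bil z' \<xi>)\<^sup>2))) + norm ((if k = l then 1 else 0) * inverse (1 - bil z' \<xi>))"
        unfolding \<alpha>_def by (subst alpha_facts(2)[where U="ball 0 R", OF nzb]) (auto intro: norm_triangle_ineq)
      also have "\<dots> = norm (\<xi> $ l) * (norm (z' $ k) * inverse ((norm (1 - bil z' \<xi>))\<^sup>2)) + (if k = l then 1 else 0) * inverse (norm (1 - bil z' \<xi>))"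
        by (simp add: norm_mult norm_inverse norm_power)
      also have "\<dots> \<le> 1 * (1 * (1 / \<delta>\<^sup>2)) + 1 * (1 / \<delta>)"
        using nk i1 i2 \<delta> by (intro add_mono mult_mono) auto
      finally show ?thesis by (simp add: P_def)
    qed
    have E\<alpha>: "norm (Eu \<alpha> \<xi>) \<le> real ?N * P" if "norm \<xi> \<le> 1" for \<xi>
    proof -
      have "norm (Eu \<alpha> \<xi>) \<le> (\<Sum>k\<in>(UNIV :: 'n set). P)" unfolding Eu_def
      proof (rule sum_norm_le)
        fix k
        have "norm (\<xi> $ k) \<le> 1" using Finite_Cartesian_Product.norm_nth_le[of \<xi> k] that by simp
        thus "norm (\<xi> $ k * pd k \<alpha> \<xi>) \<le> P" unfolding norm_mult using p\<alpha>[OF that, of k] P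
          by (metis mult_le_one mult_left_le_one_le norm_ge_zero order_trans)
      qed
      thus ?thesis by simp
    qed
    have pdf: "norm (pd k (f' i) (?y x)) \<le> 2 * D" if "i < n" "norm x < 1" for i k x
    proof -
      have m: "norm (?y x) < 1 / R" using mem[of x] that R by simp
      have "norm (of_real R *s ?y x) \<le> 1 - \<theta> * \<delta> / 2"
        unfolding norm_smult_vec norm_of_real using ynorm[OF that(2)] R by simp
      hence "norm (pd k (f i) (of_real R *s ?y x)) \<le> D" by (rule D(2)[OF that(1)])
      hence "R * norm (pd k (f i) (of_real R *s ?y x)) \<le> 2 * D" using R2 D R by (intro mult_mono) auto
      thus ?thesis unfolding sc(4)[OF that(1) m] norm_mult norm_of_real using R by simp
    qed
    \<comment> \<open>The l-th unit vector is v x + \<alpha>(cv x) (x - z'), and \<theta> (x - z')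
      is x minus the point y on the segment. So \<theta> times \<open>pd l (f' i)\<close> splits
      into \<open>a1\<close> and \<alpha> times the derivative along x - y, which has the form
      treated by \<open>alpha_identity\<close>.\<close>
    define v where "v = (\<lambda>x. axis l 1 - \<alpha> (cv x) *s (x - z'))"
    define a1 where "a1 = (\<lambda>i x. of_real \<theta> * (\<Sum>k\<in>UNIV. v x $ k * pd k (f' i) (?y x)))"
    define a2 where "a2 = (\<lambda>i x. \<Sum>k\<in>UNIV. (Eu \<alpha> (cv x) * x $ k - pd k \<alpha> (cv x)) * pd k (f' i) (?y x))"
    have op: "open (ball 0 R :: (complex^'n) set)" "open (ball 0 (1 / R) :: (complex^'n) set)" by simp_all
    have cq: "continuous_on (cball 0 1) q" by (rule holo_cont_cball[OF q R(1)])
    have c\<alpha>: "continuous_on (cball 0 1) (\<lambda>x. \<alpha> (cv x))" "continuous_on (cball 0 1) (\<lambda>x. Eu \<alpha> (cv x))"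
      "\<And>k. continuous_on (cball 0 1) (\<lambda>x. pd k \<alpha> (cv x))"
      using holo_cont_cball_cv[OF \<alpha> R(1)] holo_cont_cball_cv[OF holo_on_Eu[OF \<alpha> op(1)] R(1)]
        holo_cont_cball_cv[OF holo_on_pd[OF \<alpha> op(1)] R(1)] by auto
    have cpf: "continuous_on (cball 0 1) (\<lambda>x. pd k (f' i) (?y x))" if "i < n" for i k
      by (rule continuous_on_compose2[OF holo_on_continuous[OF holo_on_pd[OF sc(2)[OF that] op(2)]]])
         (use mem R in \<open>auto intro!: continuous_intros\<close>)
    have cv': "continuous_on (cball 0 1) (\<lambda>x. v x $ k)" for k
    proof -
      have "continuous_on (cball 0 1) (\<lambda>x. axis l 1 $ k - \<alpha> (cv x) * (x $ k - z' $ k))" by (intro continuous_intros c\<alpha>)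
      thus ?thesis unfolding v_def vector_minus_component vector_smult_component .
    qed
    have ca1: "continuous_on (cball 0 1) (a1 i)" if "i < n" for i
      unfolding a1_def by (intro continuous_intros cv' cpf that)
    have ca2: "continuous_on (cball 0 1) (a2 i)" if "i < n" for i
      unfolding a2_def by (intro continuous_intros c\<alpha> cpf that)
    have ba2: "norm (a2 i x) \<le> C" if "i < n" "norm x < 1" for i x
    proof -
      have "norm (a2 i x) \<le> (\<Sum>k\<in>(UNIV :: 'n set). (real ?N * P + P) * (2 * D))" unfolding a2_def
      proof (rule sum_norm_le)
        fix k :: 'n
        have n1: "norm (cv x) \<le> 1" using that by simp
        have xk: "norm (x $ k) \<le> 1" using Finite_Cartesian_Product.norm_nth_le[of x k] that by simp
        have "norm (Eu \<alpha> (cv x) * x $ k - pd k \<alpha> (cv x)) \<le> norm (Eu \<alpha> (cv x)) * norm (x $ k) + norm (pd k \<alpha> (cv x))"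
          by (rule order_trans[OF norm_triangle_ineq4]) (simp add: norm_mult)
        also have "\<dots> \<le> (real ?N * P) * 1 + P"
          using E\<alpha>[OF n1] p\<alpha>[OF n1, of k] xk P by (intro add_mono mult_mono) auto
        finally show "norm ((Eu \<alpha> (cv x) * x $ k - pd k \<alpha> (cv x)) * pd k (f' i) (?y x)) \<le> (real ?N * P + P) * (2 * D)"
          unfolding norm_mult using pdf[OF that, of k] P by (intro mult_mono) auto
      qed
      thus ?thesis by (simp add: C_def)
    qed
    have ba1: "norm (a1 i x) \<le> p" if "i < n" "norm x < 1" for i x
    proof -
      have disc: "norm (?y x + \<tau> *s v x) < 1 / R \<and> norm (f' i (?y x + \<tau> *s v x)) \<le> \<epsilon> / sqrt s" if \<tau>: "norm \<tau> \<le> \<sigma> * sqrt \<theta>" for \<tau>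
      proof -
        let ?w = "?y x + \<tau> *s v x"
        have "(norm ?w)\<^sup>2 \<le> 1 - \<theta> * \<delta> / 2"
        proof (rule tangential_disc[where l=l, OF _ nz1(2) \<delta> \<theta>(1,2) _ refl V_def])
          show "norm x \<le> 1" using \<open>norm x < 1\<close> by simp
          show "v x = axis l 1 - (cv x $ l / (1 - bil z' (cv x))) *s (x - z')"
            by (simp only: v_def \<alpha>_def divide_inverse)
          show "norm \<tau> \<le> \<delta> / (8 * V) * sqrt \<theta>" using \<tau> unfolding \<sigma>_def .
        qed
        hence "R\<^sup>2 * (norm ?w)\<^sup>2 \<le> (1 + \<theta> * \<delta> / 4) * (1 - \<theta> * \<delta> / 2)"
          using R(2) \<theta>\<delta> \<theta> \<delta> by (intro mult_mono) auto
        also have "\<dots> \<le> (1 - s)\<^sup>2"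
          using zero_le_square[of "\<theta> * \<delta>"] by (simp add: s_def power2_eq_square algebra_simps)
        finally have "(R * norm ?w)\<^sup>2 \<le> (1 - s)\<^sup>2" by (simp only: power_mult_distrib)
        hence Rw: "R * norm ?w \<le> 1 - s" by (rule power2_le_imp_le) (use s in linarith)
        hence "norm (of_real R *s ?w) \<le> 1 - s" unfolding norm_smult_vec norm_of_real using R by simp
        from s0(2)[OF \<open>i < n\<close> s(1,2) this] have "norm (f' i ?w) * sqrt s \<le> \<epsilon>" by (simp add: f'_def)
        hence "norm (f' i ?w) \<le> \<epsilon> / sqrt s" using s by (simp add: field_simps)
        moreover have "norm ?w < 1 / R" using Rw s R by (simp add: field_simps)
        ultimately show ?thesis by blast
      qed
      have "norm (\<Sum>k\<in>UNIV. v x $ k * pd k (f' i) (?y x)) \<le> \<epsilon> / sqrt s / (\<sigma> * sqrt \<theta>)"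
        by (rule directional_cauchy[OF sc(2)[OF that(1)]]) (use disc \<sigma> \<theta> in auto)
      hence "\<theta> * norm (\<Sum>k\<in>UNIV. v x $ k * pd k (f' i) (?y x)) \<le> \<theta> * (\<epsilon> / sqrt s / (\<sigma> * sqrt \<theta>))"
        using \<theta> by (intro mult_left_mono) auto
      also have "\<dots> = p"
      proof -
        have "sqrt s = sqrt \<theta> * sqrt (\<delta> / 8)" by (simp add: s_def real_sqrt_mult[symmetric])
        moreover have "sqrt \<theta> * sqrt \<theta> = \<theta>" using \<theta> by simp
        ultimately show ?thesis using \<theta> \<sigma> \<delta> by (simp add: \<epsilon>_def field_simps)
      qed
      finally show ?thesis unfolding a1_def norm_mult norm_of_real using \<theta> by simp
    qed
    \<comment> \<open>The factor R comes from differentiating the dilated functions; being above 1,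
      it is discarded in the estimate.\<close>
    have "of_real R * complex_of_real (wI \<kappa> (\<lambda>x. (norm (\<Sum>i<n. A i w * c i (cv x)))\<^sup>2)) =
        of_real R * wI \<kappa> (\<lambda>x. q x * (\<Sum>i<n. A i w * c i (cv x)))"
      unfolding q_def by (simp only: wI_norm2)
    also have "\<dots> = wI \<kappa> (\<lambda>x. of_real R * (q x * (\<Sum>i<n. A i w * c i (cv x))))" by (rule wI_cmult[symmetric])
    also have "\<dots> = wI \<kappa> (\<lambda>x. q x * (\<Sum>i<n. pd l (f' i) z' * c i (cv x)))"
    proof (rule wI_cong)
      fix x :: "complex^'n"
      have Rz: "of_real R *s z' = z" using R by (simp add: z'_def vector_smult_assoc)
      have "(\<Sum>i<n. pd l (f' i) z' * c i (cv x)) = (\<Sum>i<n. of_real R * (A i w * c i (cv x)))"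
        by (intro sum.cong refl) (simp add: sc(4)[OF _ nz1(1)] Rz Aw)
      thus "of_real R * (q x * (\<Sum>i<n. A i w * c i (cv x))) = q x * (\<Sum>i<n. pd l (f' i) z' * c i (cv x))"
        by (simp add: sum_distrib_left[symmetric])
    qed
    also have "\<dots> = of_real \<theta> ^ 1 * wI \<kappa> (\<lambda>x. q x * (\<Sum>i<n. pd l (f' i) (?y x) * c i (cv x)))"
      unfolding c_def M_def
    proof (rule radial_identity)
      show "rel 1 (CARD('n) + \<kappa>) {..<n} (\<lambda>i. pd l (f' i)) h' (1 / R) R"
        by (rule rel_pd) (use sc in \<open>auto simp: M_def\<close>)
      show "holo_on (pd l (f' i)) (ball 0 (1 / R))" if "i \<in> {..<n}" for i
        by (rule holo_on_pd[OF sc(2) op(2)]) (use that in simp)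
    qed (use sc R \<kappa> q \<theta> nz1 bnd' in auto)
    also have "\<dots> = wI \<kappa> (\<lambda>x. of_real \<theta> ^ 1 * (q x * (\<Sum>i<n. pd l (f' i) (?y x) * c i (cv x))))" by (rule wI_cmult[symmetric])
    also have "\<dots> = wI \<kappa> (\<lambda>x. q x * (\<Sum>i<n. a1 i x * c i (cv x)) +
        q x * \<alpha> (cv x) * (\<Sum>i<n. (\<Sum>k\<in>UNIV. (x - ?y x) $ k * pd k (f' i) (?y x)) * c i (cv x)))"
    proof (rule wI_cong)
      fix x :: "complex^'n"
      have e: "of_real \<theta> * pd l (f' i) (?y x) = a1 i x + \<alpha> (cv x) * (\<Sum>k\<in>UNIV. (x - ?y x) $ k * pd k (f' i) (?y x))" for i
      proof -
        have "a1 i x + \<alpha> (cv x) * (\<Sum>k\<in>UNIV. (x - ?y x) $ k * pd k (f' i) (?y x)) =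
          (\<Sum>k\<in>UNIV. of_real \<theta> * (axis l 1 $ k * pd k (f' i) (?y x)))"
          unfolding a1_def v_def sum_distrib_left sum.distrib[symmetric]
          by (intro sum.cong refl) (simp add: algebra_simps)
        thus ?thesis by (simp only: sum_distrib_left[symmetric] sum_axis_mult)
      qed
      have "of_real \<theta> ^ 1 * (q x * (\<Sum>i<n. pd l (f' i) (?y x) * c i (cv x))) =
         q x * (\<Sum>i<n. (of_real \<theta> * pd l (f' i) (?y x)) * c i (cv x))"
        by (simp add: sum_distrib_left mult_ac)
      also have "\<dots> = q x * (\<Sum>i<n. a1 i x * c i (cv x)) +
        q x * \<alpha> (cv x) * (\<Sum>i<n. (\<Sum>k\<in>UNIV. (x - ?y x) $ k * pd k (f' i) (?y x)) * c i (cv x))"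
      proof -
        define Q where "Q = (\<lambda>i. \<Sum>k\<in>UNIV. (x - ?y x) $ k * pd k (f' i) (?y x))"
        have Q: "(\<Sum>k\<in>UNIV. (x - ?y x) $ k * pd k (f' i) (?y x)) = Q i" for i by (simp only: Q_def)
        show ?thesis unfolding e Q
          by (simp add: distrib_right distrib_left sum.distrib sum_distrib_left mult.assoc)
      qed
      finally show "of_real \<theta> ^ 1 * (q x * (\<Sum>i<n. pd l (f' i) (?y x) * c i (cv x))) =
        q x * (\<Sum>i<n. a1 i x * c i (cv x)) +
        q x * \<alpha> (cv x) * (\<Sum>i<n. (\<Sum>k\<in>UNIV. (x - ?y x) $ k * pd k (f' i) (?y x)) * c i (cv x))" .
    qed
    also have "\<dots> = wI \<kappa> (\<lambda>x. q x * (\<Sum>i<n. a1 i x * c i (cv x))) +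
        wI \<kappa> (\<lambda>x. q x * \<alpha> (cv x) * (\<Sum>i<n. (\<Sum>k\<in>UNIV. (x - ?y x) $ k * pd k (f' i) (?y x)) * c i (cv x)))"
      by (rule wI_add; (intro continuous_intros cq ca1 cc c\<alpha> cpf; simp))
    \<comment> \<open>The radial part: (M + E) h_i is exchanged for h_i itself.\<close>
    also have "wI \<kappa> (\<lambda>x. q x * \<alpha> (cv x) * (\<Sum>i<n. (\<Sum>k\<in>UNIV. (x - ?y x) $ k * pd k (f' i) (?y x)) * c i (cv x))) =
        - wI \<kappa> (\<lambda>x. q x * (\<Sum>i<n. a2 i x * h' i (cv x)))"
    proof -
      have "wI \<kappa> (\<lambda>x. q x * \<alpha> (cv x) * (\<Sum>i<n. (\<Sum>k\<in>UNIV. (x - (of_real \<theta> *s z' + of_real (1 - \<theta>) *s x)) $ k * pd k (f' i) (of_real \<theta> *s z' + of_real (1 - \<theta>) *s x)) * raise (CARD('n) + \<kappa>) (h' i) (cv x))) =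
         - wI \<kappa> (\<lambda>x. q x * (\<Sum>i<n. h' i (cv x) * (\<Sum>k\<in>UNIV. (Eu \<alpha> (cv x) * x $ k - pd k \<alpha> (cv x)) * pd k (f' i) (of_real \<theta> *s z' + of_real (1 - \<theta>) *s x))))"
        by (rule alpha_identity[where r="1 / R" and R=R])
           (use sc R \<kappa> q \<alpha> mem[unfolded line_point_alt] in \<open>auto simp: M_def\<close>)
      thus ?thesis unfolding c_def a2_def M_def line_point_alt by (simp only: mult.commute[of "h' _ _"])
    qed
    finally have eq: "of_real R * complex_of_real (wI \<kappa> (\<lambda>x. (norm (\<Sum>i<n. A i w * c i (cv x)))\<^sup>2)) =
      wI \<kappa> (\<lambda>x. q x * (\<Sum>i<n. a1 i x * c i (cv x))) - wI \<kappa> (\<lambda>x. q x * (\<Sum>i<n. a2 i x * h' i (cv x)))" (is "_ * complex_of_real ?W = ?I1 - ?I2")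
      by simp
    have W0: "?W \<ge> 0" by (rule wI_nonneg) simp
    have Wq: "wI \<kappa> (\<lambda>x. (norm (q x))\<^sup>2) = ?W" by (simp only: q_def complex_mod_cnj)
    have "?W \<le> R * ?W" using W0 R by (simp add: mult_right_mono[of 1 R ?W, simplified])
    also have "\<dots> = norm (of_real R * complex_of_real ?W)" using W0 R by (simp add: norm_mult)
    also have "\<dots> \<le> norm ?I1 + norm ?I2" unfolding eq by (rule norm_triangle_ineq4)
    also have "norm ?I1 \<le> (p * real n * wI \<kappa> (\<lambda>x. (norm (q x))\<^sup>2) + p\<^sup>2 / p * (\<Sum>i<n. wI \<kappa> (\<lambda>x. (norm (c i (cv x)))\<^sup>2))) / 2"
      by (rule wI_amgm[OF cq cc ca1 ba1 p(1)])
    also have "norm ?I2 \<le> (p * real n * wI \<kappa> (\<lambda>x. (norm (q x))\<^sup>2) + C\<^sup>2 / p * (\<Sum>i<n. wI \<kappa> (\<lambda>x. (norm (h' i (cv x)))\<^sup>2))) / 2"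
      by (rule wI_amgm[OF cq chh ca2 ba2 p(1)])
    finally have e2: "?W \<le> (p * real n * ?W + p\<^sup>2 / p * S2) / 2 + (p * real n * ?W + C\<^sup>2 / p * T2) / 2"
      unfolding Wq S2_def[symmetric] T2_def[symmetric] by linarith
    have "p\<^sup>2 / p = p" using p by (simp add: power2_eq_square)
    note e3 = e2[unfolded this]
    have "p * real n * ?W \<le> 1 / 2 * ?W" using p W0 by (intro mult_right_mono) auto
    thus ?thesis by (rule half_absorb[OF e3])
  qed
  have nn: "0 \<le> p * S2 + C\<^sup>2 / p * T2" using p S2 T2 by simp
  have "S2 \<le> \<Gamma> * (p * S2 + C\<^sup>2 / p * T2)" unfolding S2_def
  proof (rule db)
    show "\<forall>i<n. continuous_on (cball 0 1) (\<lambda>x. c i (cv x))" using cc by blast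
    show "0 \<le> p * (\<Sum>i<n. wI \<kappa> (\<lambda>x. (norm (c i (cv x)))\<^sup>2)) + C\<^sup>2 / p * T2" using nn unfolding S2_def .
    show "\<forall>x\<in>T. wI \<kappa> (\<lambda>\<eta>. (norm (\<Sum>i<n. A i x * c i (cv \<eta>)))\<^sup>2) \<le> p * (\<Sum>i<n. wI \<kappa> (\<lambda>x. (norm (c i (cv x)))\<^sup>2)) + C\<^sup>2 / p * T2"
      using key unfolding S2_def by blast
  qed
  also have "\<dots> = (p * \<Gamma>) * S2 + \<Gamma> * (C\<^sup>2 / p) * T2" by (simp add: algebra_simps)
  also have "(p * \<Gamma>) * S2 \<le> 1 / 2 * S2" using p S2 by (intro mult_right_mono) auto
  finally have ST: "S2 \<le> 2 * \<Gamma> * (C\<^sup>2 / p) * T2" by simp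
  \<comment> \<open>Against S2 \<le> 2 \<Gamma> (C^2 / p) T2 this leaves only T2 = 0, by the choice
    of M.\<close>
  have "(real M)\<^sup>2 * T2 \<le> S2" unfolding S2_def T2_def sum_distrib_left
  proof (rule sum_mono)
    fix i assume "i \<in> {..<n}"
    hence "i < n" by simp
    show "(real M)\<^sup>2 * wI \<kappa> (\<lambda>x. (norm (h' i (cv x)))\<^sup>2) \<le> wI \<kappa> (\<lambda>x. (norm (c i (cv x)))\<^sup>2)"
      using wI_norm_raise_ge[OF sc(3)[OF \<open>i < n\<close>] R(1) \<kappa>] unfolding c_def raise_def M_def .
  qed
  hence "((real M)\<^sup>2 - 2 * \<Gamma> * (C\<^sup>2 / p)) * T2 \<le> 0" using ST by (simp add: algebra_simps)
  hence "T2 \<le> 0" using MM by (simp add: mult_le_0_iff)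
  hence T20: "T2 = 0" using T2 by simp
  have h0: "h' i x = 0" if "norm x < 1" for x
  proof -
    have "wI \<kappa> (\<lambda>x. (norm (h' i (cv x)))\<^sup>2) \<le> T2" unfolding T2_def
      by (rule member_le_sum) (use i in \<open>auto intro: wI_nonneg\<close>)
    hence "(norm (h' i (cv (cv x))))\<^sup>2 = 0" using T20 that i
      by (intro wI_eq_0_imp[of "\<lambda>x. (norm (h' i (cv x)))\<^sup>2" \<kappa>]) (auto intro!: continuous_intros chh)
    thus ?thesis by simp
  qed
  have "h i z = 0" if "z \<in> ball 0 (1 / R)" for z
  proof -
    have "norm (of_real R *s z) < 1" using that R by (simp add: norm_smult_vec field_simps)
    hence "h' i (of_real R *s z) = 0" by (rule h0)
    thus ?thesis using R by (simp add: h'_def vector_smult_assoc)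
  qed
  moreover have "holo_on (Eu (g i)) (ball 0 (1 / R))"
    by (rule holo_on_subset[OF holo_on_Eu[OF g[OF i]] subset_ball]) (use R in auto)
  moreover have "h i = rit 1 (M - 1) (Eu (g i))"
  proof -
    have "M = Suc (M - 1)" by (simp add: M_def \<kappa>_def)
    hence "h i = rit 0 (Suc (M - 1)) (g i)" by (simp add: h_def)
    also have "\<dots> = rit (Suc 0) (M - 1) (raise 0 (g i))" by (rule rit_Suc_shift)
    also have "raise 0 (g i) = Eu (g i)" by (simp add: raise_def)
    finally show ?thesis by simp
  qed
  ultimately have "\<forall>z\<in>ball 0 (1 / R). Eu (g i) z = 0"
    by (intro rit_zero_imp[where d="M - 1" and m=1]) auto
  moreover have "\<zeta> \<in> ball 0 (1 / R)" using R by (simp add: field_simps)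
  ultimately show ?thesis by blast
qed

section \<open>Growth of Bergman functions\<close>

lemma inverse_power_kernel:
  fixes z :: "complex^'n"
  assumes nz: "\<And>\<zeta>. \<zeta> \<in> U \<Longrightarrow> 1 - bil z \<zeta> \<noteq> 0"
  defines "K \<equiv> \<lambda>n \<zeta>. inverse (1 - bil z \<zeta>) ^ n"
  shows "holo_on (K n) U" and "\<zeta> \<in> U \<Longrightarrow> pd k (K n) \<zeta> = of_nat n * z $ k * K (Suc n) \<zeta>"
proof -
  have b: "holo_on (\<lambda>\<zeta>. 1 - bil z \<zeta>) U" by (intro holo_on_diff holo_on_const holo_on_bil)
  have pb: "pd k (\<lambda>\<zeta>. 1 - bil z \<zeta>) \<zeta> = - (z $ k)" for k \<zeta>
    using pd_diff[OF holo_on_const holo_on_bil, of \<zeta> UNIV] by simp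
  have d: "(K n has_derivative (\<lambda>v. \<Sum>k\<in>UNIV. v $ k * (of_nat n * z $ k * K (Suc n) \<zeta>))) (at \<zeta>)" if "\<zeta> \<in> U" for \<zeta>
  proof -
    let ?w = "1 - bil z \<zeta>"
    have "((\<lambda>w. inverse w ^ n) has_field_derivative of_nat n * (- (inverse ?w * 1 * inverse ?w) * inverse ?w ^ (n - 1))) (at ?w)"
      by (rule DERIV_power[THEN DERIV_cong]) (rule DERIV_inverse'[OF DERIV_ident nz[OF that]], simp)
    from compose_has_derivative_pd[OF b that this]
    have "(K n has_derivative (\<lambda>v. \<Sum>k\<in>UNIV. v $ k * (of_nat n * (- (inverse ?w * 1 * inverse ?w) * inverse ?w ^ (n - 1)) * - (z $ k)))) (at \<zeta>)"
      unfolding pb K_def .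
    moreover have "(\<lambda>k. of_nat n * (- (inverse ?w * 1 * inverse ?w) * inverse ?w ^ (n - 1)) * - (z $ k)) = (\<lambda>k. of_nat n * z $ k * K (Suc n) \<zeta>)"
      by (cases n) (simp_all add: K_def fun_eq_iff)
    ultimately show ?thesis by (simp only: fun_eq_iff)
  qed
  show "holo_on (K n) U" by (rule holo_onI[OF d])
  show "pd k (K n) \<zeta> = of_nat n * z $ k * K (Suc n) \<zeta>" if "\<zeta> \<in> U" using pd_eqI[OF d[OF that], of k] .
qed

lemma one_minus_bil_nz:
  assumes "norm z * R < 1" "norm \<zeta> < R"
  shows "1 - bil z \<zeta> \<noteq> 0"
proof -
  have "norm (bil z \<zeta>) \<le> norm z * norm \<zeta>" by (rule norm_bil_le)
  also have "\<dots> \<le> norm z * R" using assms by (intro mult_left_mono) auto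
  finally have "norm (bil z \<zeta>) < 1" using assms by simp
  thus ?thesis by (metis eq_iff_diff_eq_0 less_irrefl norm_one)
qed

text \<open>For K = 1 / (1 - \<open>bil z \<zeta>\<close>) and M = N + \<open>\<kappa>\<close> one
  has (M + E) K^M = M K^(M+1), while the k-th partial derivative of K^M is M z_k K^(M+1). So
  \<open>wI_mult_coord\<close> says that under the integral against K^(M+1) multiplication by x_k
  acts as multiplication by z_k.\<close>

lemma wI_kernel_coord:
  fixes P :: "complex^'n \<Rightarrow> complex"
  assumes P: "holo_on P (ball 0 R)" and R: "R > 1" and z: "norm z * R < 1" and \<kappa>: "\<kappa> \<ge> 2"
  shows "wI \<kappa> (\<lambda>x. P x * (x $ k - z $ k) * inverse (1 - bil z (cv x)) ^ Suc (CARD('n) + \<kappa>)) = 0"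
proof -
  let ?M = "CARD('n) + \<kappa>"
  define K where "K = (\<lambda>n \<zeta>. inverse (1 - bil z \<zeta>) ^ n)"
  have nz: "1 - bil z \<zeta> \<noteq> 0" if "\<zeta> \<in> ball 0 R" for \<zeta> by (rule one_minus_bil_nz[OF z]) (use that in simp)
  have hK: "holo_on (K n) (ball 0 R)" for n unfolding K_def by (rule inverse_power_kernel(1)[OF nz])
  have pK: "pd k (K n) \<zeta> = of_nat n * z $ k * K (Suc n) \<zeta>" if "norm \<zeta> < R" for k n \<zeta>
    unfolding K_def by (rule inverse_power_kernel(2)[where U = "ball 0 R"]) (use that nz in auto)
  note cK = holo_cont_cball_cv[OF hK R] and cP = holo_cont_cball[OF P R]
  have r: "of_nat ?M * K ?M \<zeta> + Eu (K ?M) \<zeta> = of_nat ?M * K (Suc ?M) \<zeta>" if "norm \<zeta> < R" for \<zeta>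
  proof -
    have "Eu (K ?M) \<zeta> = of_nat ?M * (bil z \<zeta> * K (Suc ?M) \<zeta>)"
      unfolding Eu_def pK[OF that] bil_def by (simp add: sum_distrib_left sum_distrib_right mult_ac)
    moreover have "K ?M \<zeta> = (1 - bil z \<zeta>) * K (Suc ?M) \<zeta>" using nz[of \<zeta>] that by (simp add: K_def)
    ultimately show ?thesis by algebra
  qed
  have "wI \<kappa> (\<lambda>x. of_nat ?M * (P x * x $ k * K (Suc ?M) (cv x))) = wI \<kappa> (\<lambda>x. P x * x $ k * (of_nat ?M * K ?M (cv x) + Eu (K ?M) (cv x)))"
    using R by (intro wI_cong, subst r) simp_all
  also have "\<dots> = wI \<kappa> (\<lambda>x. P x * pd k (K ?M) (cv x))" by (rule wI_mult_coord[OF P hK R \<kappa>])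
  also have "\<dots> = wI \<kappa> (\<lambda>x. of_nat ?M * (P x * z $ k * K (Suc ?M) (cv x)))"
    using R by (intro wI_cong) (simp add: pK)
  finally have "wI \<kappa> (\<lambda>x. P x * x $ k * K (Suc ?M) (cv x)) = wI \<kappa> (\<lambda>x. P x * z $ k * K (Suc ?M) (cv x))"
    unfolding wI_cmult mult_cancel_left of_nat_eq_0_iff using \<kappa> by simp
  moreover have "wI \<kappa> (\<lambda>x. P x * (x $ k - z $ k) * K (Suc ?M) (cv x)) =
     wI \<kappa> (\<lambda>x. P x * x $ k * K (Suc ?M) (cv x)) - wI \<kappa> (\<lambda>x. P x * z $ k * K (Suc ?M) (cv x))"
    by (subst wI_diff[symmetric]) (intro continuous_intros cP cK | simp add: algebra_simps)+
  ultimately show ?thesis by (simp add: K_def)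
qed

text \<open>The t-derivative of the integral of H(t cv x) consists of integrals of the conjugate of
  x_k times an antiholomorphic function. These vanish by \<open>stokes_d\<close> with weight
  exponent \<open>Suc \<kappa>\<close> and the constant P = 1, whose derivative is 0.\<close>

lemma wI_mean_value:
  fixes H :: "complex^'n \<Rightarrow> complex"
  assumes H: "holo_on H (ball 0 R)" and R: "R > 1" and \<kappa>: "\<kappa> \<ge> 1"
  shows "wI \<kappa> (\<lambda>x. H (cv x)) = H 0 * wI \<kappa> (\<lambda>x::complex^'n. 1)"
proof -
  have op: "open (ball 0 R :: (complex^'n) set)" by simp
  have mem: "norm (of_real t *s x) < R" if "t \<in> {0..1}" "norm x < R" for t and x :: "complex^'n"
  proof -
    have "t * norm x \<le> 1 * norm x" using that by (intro mult_right_mono) auto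
    thus ?thesis unfolding norm_smult_vec norm_of_real using that by simp
  qed
  define \<phi> where "\<phi> = (\<lambda>t::real. \<lambda>x. H (of_real t *s cv x))"
  define \<phi>' where "\<phi>' = (\<lambda>t::real. \<lambda>x. \<Sum>k\<in>UNIV. cnj (x $ k) * pd k H (of_real t *s cv x))"
  have ht: "holo_on (\<lambda>\<zeta>. G (of_real t *s \<zeta>)) (ball 0 R)" if "holo_on G (ball 0 R)" "t \<in> {0..1}" for G :: "complex^'n \<Rightarrow> complex" and t
    using holo_on_affine[OF that(1), of "ball 0 R" 0 "of_real t"] mem[OF that(2)] by simp
  have c\<phi>: "continuous_on (cball 0 1) (\<phi> t)" if "t \<in> {0..1}" for t
    unfolding \<phi>_def by (rule holo_cont_cball_cv[OF ht[OF H that] R])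
  have cpd: "continuous_on (cball 0 1) (\<lambda>x. pd k H (of_real t *s cv x))" if "t \<in> {0..1}" for t k
    by (rule holo_cont_cball_cv[OF ht[OF holo_on_pd[OF H op] that] R])
  have c\<phi>': "continuous_on (cball 0 1) (\<phi>' t)" if "t \<in> {0..1}" for t
    unfolding \<phi>'_def by (intro continuous_intros cpd that)
  have "continuous_on ({0..1} \<times> cball 0 1) (\<lambda>p. \<phi>' (fst p) (snd p))" unfolding \<phi>'_def
    by (intro continuous_intros continuous_on_compose2[OF continuous_pd[OF H op]])
       (use mem R in \<open>auto intro!: continuous_intros\<close>)
  hence "bounded ((\<lambda>p. \<phi>' (fst p) (snd p)) ` ({0..1} \<times> cball 0 1))"
    by (intro compact_imp_bounded compact_continuous_image compact_Times) auto
  then obtain C where C: "\<And>t x. t \<in> {0..1} \<Longrightarrow> norm x \<le> 1 \<Longrightarrow> norm (\<phi>' t x) \<le> C"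
    unfolding bounded_iff by fastforce
  have der: "((\<lambda>t. \<phi> t x) has_vector_derivative \<phi>' t x) (at t within {0..1})" if t: "t \<in> {0..1}" and x: "norm x < 1" for t x
  proof -
    have "of_real t *s cv x \<in> ball 0 R" using mem[OF t, of "cv x"] x R by simp
    hence "((\<lambda>s. H (0 + s *s cv x)) has_field_derivative (\<Sum>k\<in>UNIV. cv x $ k * pd k H (0 + of_real t *s cv x))) (at (of_real t))"
      by (intro holo_on_line[OF H]) simp
    from has_vector_derivative_real_field[OF this] show ?thesis unfolding \<phi>_def \<phi>'_def by simp
  qed
  have zero: "wI \<kappa> (\<phi>' t) = 0" if t: "t \<in> {0..1}" for t
  proof -
    have "wI \<kappa> (\<lambda>x. cnj (x $ k) * pd k H (of_real t *s cv x)) = 0" for k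
    proof -
      have "wI (Suc \<kappa>) (\<lambda>x. pd k (\<lambda>x. 1) x * pd k H (of_real t *s cv x)) =
        of_nat (Suc \<kappa>) * wI (Suc \<kappa> - 1) (\<lambda>x. cnj (x $ k) * 1 * pd k H (of_real t *s cv x))"
        by (rule stokes_d[OF holo_on_const ht[OF holo_on_pd[OF H op] t] R]) (use \<kappa> in simp)
      thus ?thesis by (simp del: of_nat_Suc)
    qed
    thus ?thesis unfolding \<phi>'_def by (subst wI_sum) (intro continuous_intros cpd t | simp)+
  qed
  have "((\<lambda>t. wI \<kappa> (\<phi> t)) has_vector_derivative 0) (at t within {0..1})" if t: "t \<in> {0..1}" for t
    using wI_has_vector_derivative[of "{0..1}" t \<phi> \<phi>' C \<kappa>] der C c\<phi> c\<phi>'[OF t] t zero[OF t] by auto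
  then obtain k where "\<And>t. t \<in> {0..1} \<Longrightarrow> wI \<kappa> (\<phi> t) = k"
    using has_vector_derivative_zero_constant[of "{0..1}" "\<lambda>t. wI \<kappa> (\<phi> t)"] by (metis convex_real_interval(5))
  hence "wI \<kappa> (\<phi> 1) = wI \<kappa> (\<phi> 0)" by simp
  also have "\<phi> 0 = (\<lambda>x. H 0 * 1)" by (simp add: \<phi>_def)
  also have "wI \<kappa> \<dots> = H 0 * wI \<kappa> (\<lambda>x::complex^'n. 1)" by (rule wI_cmult)
  finally show ?thesis by (simp add: \<phi>_def)
qed

text \<open>The argument of Q is moved from x to z along the segment. The derivative contains z_k -
  x_k and integrates to 0 by \<open>wI_kernel_coord\<close>; at the end Q(z) factors out and
  \<open>wI_mean_value\<close> evaluates the kernel at 0.\<close>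

lemma wI_reproducing:
  fixes Q :: "complex^'n \<Rightarrow> complex"
  assumes Q: "holo_on Q (ball 0 R)" and R: "R > 1" and z: "norm z < 1" "norm z * R < 1" and \<kappa>: "\<kappa> \<ge> 2"
  shows "wI \<kappa> (\<lambda>x. Q x * inverse (1 - bil z (cv x)) ^ Suc (CARD('n) + \<kappa>)) = Q z * wI \<kappa> (\<lambda>x::complex^'n. 1)"
proof -
  define K where "K = (\<lambda>\<zeta>. inverse (1 - bil z \<zeta>) ^ Suc (CARD('n) + \<kappa>))"
  have nz: "1 - bil z \<zeta> \<noteq> 0" if "\<zeta> \<in> ball 0 R" for \<zeta> by (rule one_minus_bil_nz[OF z(2)]) (use that in simp)
  have hK: "holo_on K (ball 0 R)" unfolding K_def by (rule inverse_power_kernel(1)[OF nz])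
  have op: "open (ball 0 R :: (complex^'n) set)" by simp
  let ?y = "\<lambda>t::real. \<lambda>x. x + of_real t *s (z - x)"
  have mem: "norm (?y t x) < R" if t: "t \<in> {0..1}" and x: "norm x < R" for t x
  proof -
    have "norm (?y t x) \<le> norm (of_real t *s z) + norm (of_real (1 - t) *s x)"
      unfolding line_point_alt by (rule norm_triangle_ineq)
    also have "\<dots> = t * norm z + (1 - t) * norm x" unfolding norm_smult_vec norm_of_real using t by simp
    also have "\<dots> \<le> t * max (norm z) (norm x) + (1 - t) * max (norm z) (norm x)"
      using t by (intro add_mono mult_left_mono) auto
    also have "\<dots> = max (norm z) (norm x)" by (simp add: algebra_simps)
    also have "\<dots> < R" using x z R by simp
    finally show ?thesis .
  qed
  have hy: "holo_on (\<lambda>x. G (?y t x)) (ball 0 R)" if "holo_on G (ball 0 R)" "t \<in> {0..1}" for G t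
  proof -
    have "holo_on (\<lambda>x. G (of_real t *s z + of_real (1 - t) *s x)) (ball 0 R)"
      by (rule holo_on_affine[OF that(1)]) (use mem[OF that(2), unfolded line_point_alt] in auto)
    thus ?thesis unfolding line_point_alt .
  qed
  have cK: "continuous_on (cball 0 1) (\<lambda>x. K (cv x))" by (rule holo_cont_cball_cv[OF hK R])
  have cy: "continuous_on (cball 0 1) (\<lambda>x. G (?y t x))" if "holo_on G (ball 0 R)" "t \<in> {0..1}" for G t
    by (rule holo_cont_cball[OF hy[OF that] R])
  define \<phi> where "\<phi> = (\<lambda>t::real. \<lambda>x. Q (?y t x) * K (cv x))"
  define \<phi>' where "\<phi>' = (\<lambda>t::real. \<lambda>x. (\<Sum>k\<in>UNIV. (z - x) $ k * pd k Q (?y t x)) * K (cv x))"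
  have c\<phi>: "continuous_on (cball 0 1) (\<phi> t)" if "t \<in> {0..1}" for t
    unfolding \<phi>_def by (intro continuous_intros cK cy Q that)
  have c\<phi>': "continuous_on (cball 0 1) (\<phi>' t)" if "t \<in> {0..1}" for t
    unfolding \<phi>'_def vector_minus_component by (intro continuous_intros cK cy holo_on_pd Q op that)
  have "continuous_on ({0..1} \<times> cball 0 1) (\<lambda>p. K (cv (snd p)))"
    by (rule continuous_on_compose2[OF cK]) (auto intro!: continuous_intros)
  hence "continuous_on ({0..1} \<times> cball 0 1) (\<lambda>p. \<phi>' (fst p) (snd p))" unfolding \<phi>'_def vector_minus_component
    by (intro continuous_intros continuous_on_compose2[OF continuous_pd[OF Q op]])
       (use mem R in \<open>auto intro!: continuous_intros\<close>)
  hence "bounded ((\<lambda>p. \<phi>' (fst p) (snd p)) ` ({0..1} \<times> cball 0 1))"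
    by (intro compact_imp_bounded compact_continuous_image compact_Times) auto
  then obtain C where C: "\<And>t x. t \<in> {0..1} \<Longrightarrow> norm x \<le> 1 \<Longrightarrow> norm (\<phi>' t x) \<le> C"
    unfolding bounded_iff by fastforce
  have der: "((\<lambda>t. \<phi> t x) has_vector_derivative \<phi>' t x) (at t within {0..1})" if t: "t \<in> {0..1}" and x: "norm x < 1" for t x
  proof -
    have "?y t x \<in> ball 0 R" using mem[OF t, of x] x R by simp
    hence "((\<lambda>s. Q (x + s *s (z - x))) has_field_derivative (\<Sum>k\<in>UNIV. (z - x) $ k * pd k Q (?y t x))) (at (of_real t))"
      by (rule holo_on_line[OF Q])
    hence "((\<lambda>s. Q (x + s *s (z - x)) * K (cv x)) has_field_derivative (\<Sum>k\<in>UNIV. (z - x) $ k * pd k Q (?y t x)) * K (cv x)) (at (of_real t))"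
      by (rule DERIV_cmult_right)
    from has_vector_derivative_real_field[OF this] show ?thesis unfolding \<phi>_def \<phi>'_def by simp
  qed
  have zero: "wI \<kappa> (\<phi>' t) = 0" if t: "t \<in> {0..1}" for t
  proof -
    have "wI \<kappa> (\<phi>' t) = wI \<kappa> (\<lambda>x. \<Sum>k\<in>UNIV. (-1) * (pd k Q (?y t x) * (x $ k - z $ k) * K (cv x)))"
      unfolding \<phi>'_def sum_distrib_right vector_minus_component by (intro wI_cong sum.cong refl) algebra
    also have "\<dots> = (\<Sum>k\<in>UNIV. wI \<kappa> (\<lambda>x. (-1) * (pd k Q (?y t x) * (x $ k - z $ k) * K (cv x))))"
      by (rule wI_sum) (intro continuous_intros cK cy holo_on_pd Q op t)
    also have "\<dots> = 0" unfolding wI_cmult K_def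
      by (intro sum.neutral ballI) (simp only: wI_kernel_coord[OF hy[OF holo_on_pd[OF Q op] t] R z(2) \<kappa>] mult_zero_right)
    finally show ?thesis .
  qed
  have "((\<lambda>t. wI \<kappa> (\<phi> t)) has_vector_derivative 0) (at t within {0..1})" if t: "t \<in> {0..1}" for t
    using wI_has_vector_derivative[of "{0..1}" t \<phi> \<phi>' C \<kappa>] der C c\<phi> c\<phi>'[OF t] t zero[OF t] by auto
  then obtain k where "\<And>t. t \<in> {0..1} \<Longrightarrow> wI \<kappa> (\<phi> t) = k"
    using has_vector_derivative_zero_constant[of "{0..1}" "\<lambda>t. wI \<kappa> (\<phi> t)"] by (metis convex_real_interval(5))
  hence "wI \<kappa> (\<phi> 0) = wI \<kappa> (\<phi> 1)" by simp
  also have "\<phi> 1 = (\<lambda>x. Q z * K (cv x))" by (simp add: \<phi>_def)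
  also have "wI \<kappa> \<dots> = Q z * wI \<kappa> (\<lambda>x. K (cv x))" by (rule wI_cmult)
  also have "wI \<kappa> (\<lambda>x. K (cv x)) = K 0 * wI \<kappa> (\<lambda>x::complex^'n. 1)" by (rule wI_mean_value[OF hK R]) (use \<kappa> in simp)
  also have "K 0 = 1" by (simp add: K_def bil_def)
  finally show ?thesis by (simp add: \<phi>_def K_def)
qed

section \<open>Pointwise growth from integrals over thin shells\<close>

lemma lborel_integral_scale:
  fixes g :: "'a::euclidean_space \<Rightarrow> real"
  assumes c: "c > 0" and g: "integrable lborel g"
  shows "integrable lborel (\<lambda>x. g (c *\<^sub>R x))"
    and "(\<integral>x. g x \<partial>lborel) = c ^ DIM('a) * (\<integral>x. g (c *\<^sub>R x) \<partial>lborel)"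
proof -
  let ?D = "distr lborel borel (\<lambda>x. 0 + c *\<^sub>R x) :: 'a measure"
  have m: "g \<in> borel_measurable borel" using g by (simp add: borel_measurable_integrable)
  have e: "(lborel :: 'a measure) = density ?D (\<lambda>_. c ^ DIM('a))"
    using lborel_affine[of c "0::'a"] c by simp
  have e': "(lborel :: 'a measure) = density ?D (\<lambda>_. ennreal (c ^ DIM('a)))" using e by simp
  have "integrable (density ?D (\<lambda>_. ennreal (c ^ DIM('a)))) g" using g by (simp only: e'[symmetric])
  hence "integrable ?D (\<lambda>x. c ^ DIM('a) *\<^sub>R g x)"
    by (subst (asm) integrable_density) (use m c in auto)
  hence "integrable ?D g" using c by simp
  thus "integrable lborel (\<lambda>x. g (c *\<^sub>R x))" by (subst (asm) integrable_distr_eq) (use m in auto)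
  have "(\<integral>x. g x \<partial>lborel) = (\<integral>x. g x \<partial>density ?D (\<lambda>_. ennreal (c ^ DIM('a))))" by (simp only: e'[symmetric])
  also have "\<dots> = (\<integral>x. c ^ DIM('a) *\<^sub>R g x \<partial>?D)" by (subst integral_density) (use m c in auto)
  also have "\<dots> = c ^ DIM('a) * (\<integral>x. g x \<partial>?D)" by simp
  also have "(\<integral>x. g x \<partial>?D) = (\<integral>x. g (c *\<^sub>R x) \<partial>lborel)" by (subst integral_distr) (use m in auto)
  finally show "(\<integral>x. g x \<partial>lborel) = c ^ DIM('a) * (\<integral>x. g (c *\<^sub>R x) \<partial>lborel)" .
qed

text \<open>The reproducing formula is applied to H times the conjugate kernel, so that the squared
  modulus of the kernel appears and the value at z is H(z) (1 - |z|^2)^(-N-3). With a = 1 - |z|, on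
  the shell |x| > \<rho> the integrand is at most 4 a^(-2N-4) |H|, which the available powers of a
  exactly cancel; on the remaining part the kernel is bounded and a factor a survives. Thus only the
  shell matters as z approaches the sphere.\<close>

lemma kernel_growth:
  fixes H :: "complex^'n \<Rightarrow> complex"
  assumes H: "holo_on H (ball 0 R)" and R: "R > 1" and z: "norm z < 1" and \<rho>: "0 < \<rho>" "\<rho> < 1"
  defines "N \<equiv> CARD('n)"
  shows "(1 - norm z) ^ (N + 1) * norm (H z) * norm (wI 2 (\<lambda>x::complex^'n. 1::complex)) \<le>
    2 ^ (N + 5) * (\<integral>x. (if \<rho> < norm x \<and> norm x < 1 then norm (H x) else 0) \<partial>lborel) +
    2 ^ (N + 3) * (1 - norm z) * inverse (1 - \<rho>) ^ (2 * N + 6) * (\<integral>x. (if norm x < 1 then norm (H x) else 0) \<partial>lborel)"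
proof -
  define a where "a = 1 - norm z"
  have a: "0 < a" "a \<le> 1" using z by (simp_all add: a_def)
  \<comment> \<open>The second bound gives |z| R' < 1, so that the kernel is holomorphic on the ball
    of radius R'.\<close>
  define R' where "R' = min R (2 / (1 + norm z))"
  have "0 < 1 + norm z" by (simp add: add_pos_nonneg)
  hence R': "R' > 1" using R z by (simp add: R'_def less_divide_eq)
  have "norm z * R' \<le> norm z * (2 / (1 + norm z))" unfolding R'_def by (intro mult_left_mono) auto
  also have "\<dots> = 2 * norm z / (1 + norm z)" by simp
  also have "\<dots> < 1" using z by (subst divide_less_eq_1_pos) (auto intro: add_pos_nonneg)
  finally have zR: "norm z * R' < 1" .
  have H': "holo_on H (ball 0 R')" by (rule holo_on_subset[OF H]) (auto simp: R'_def)
  define K where "K = (\<lambda>(y::complex^'n) \<zeta>. inverse (1 - bil y \<zeta>) ^ (N + 3))"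
  have hK: "holo_on (K y) (ball 0 R')" if "norm y = norm z" for y :: "complex^'n"
    unfolding K_def by (rule inverse_power_kernel(1)) (rule one_minus_bil_nz[of y R'], use that zR in auto)
  define Q where "Q = (\<lambda>x. H x * K (cv z) x)"
  have hQ: "holo_on Q (ball 0 R')" unfolding Q_def by (intro holo_on_mult H' hK) simp
  have e: "Suc (CARD('n) + 2) = N + 3" by (simp add: N_def)
  have rep: "wI 2 (\<lambda>x. Q x * K z (cv x)) = Q z * wI 2 (\<lambda>x::complex^'n. 1)"
    using wI_reproducing[OF hQ R' z zR, of 2] unfolding K_def e by simp
  have cQ: "continuous_on (cball 0 1) (\<lambda>x. Q x * K z (cv x))"
    by (intro continuous_intros holo_cont_cball[OF hQ R'] holo_cont_cball_cv[OF hK[OF refl] R'])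
  define J1 where "J1 = (\<lambda>x. if \<rho> < norm x \<and> norm x < 1 then norm (H x) else 0)"
  define J2 where "J2 = (\<lambda>x. if norm x < 1 then norm (H x) else 0)"
  have cH: "continuous_on (cball 0 1) (\<lambda>x. norm (H x))" by (intro continuous_intros holo_cont_cball[OF H R])
  have si: "set_integrable lborel S (\<lambda>x. norm (H x))" if "S \<subseteq> cball 0 1" "S \<in> sets lborel" for S
    by (rule set_integrable_subset[OF _ that(2,1)]) (use borel_integrable_compact[OF compact_cball cH] in \<open>simp add: set_integrable_def\<close>)
  have "{x::complex^'n. \<rho> < norm x \<and> norm x < 1} = ball 0 1 - cball 0 \<rho>" by auto
  hence S1: "{x::complex^'n. \<rho> < norm x \<and> norm x < 1} \<in> sets lborel" by simp
  have iJ1: "integrable lborel J1"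
    using si[OF _ S1] unfolding set_integrable_def J1_def
    by (rule back_subst[where P = "integrable lborel"]) (auto simp: indicator_def fun_eq_iff)
  have iJ2: "integrable lborel J2"
    using si[of "ball 0 1"] unfolding set_integrable_def J2_def
    by (rule back_subst[where P = "integrable lborel"]) (auto simp: indicator_def fun_eq_iff)
  have le: "(if norm x < 1 then (1 - (norm x)\<^sup>2) ^ 2 *\<^sub>R norm (Q x * K z (cv x)) else 0) \<le>
     4 * inverse a ^ (2 * N + 4) * J1 x + inverse (1 - \<rho>) ^ (2 * N + 6) * J2 x" for x
  proof (cases "norm x < 1")
    case True
    define d where "d = norm (1 - bil z (cv x))"
    have "1 - norm z * norm x \<le> d"
    proof -
      have "norm (1::complex) - norm (bil z (cv x)) \<le> d" unfolding d_def by (rule norm_triangle_ineq2)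
      thus ?thesis using norm_bil_le[of z "cv x"] by (simp add: norm_cv)
    qed
    moreover have "norm z * norm x \<le> norm z" "norm z * norm x \<le> norm x"
      using mult_left_mono[of "norm x" 1 "norm z"] mult_right_mono[of "norm z" 1 "norm x"] True z by auto
    ultimately have d: "a \<le> d" "1 - norm x \<le> d" by (auto simp: a_def)
    have dpos: "d > 0" using d a by simp
    have "1 - bil (cv z) x = cnj (1 - bil z (cv x))" by (simp add: bil_def cv_nth mult.commute)
    hence "norm (1 - bil (cv z) x) = d" unfolding d_def by (simp only: complex_mod_cnj)
    hence nQ: "norm (Q x * K z (cv x)) = norm (H x) * inverse d ^ (2 * N + 6)"
      by (simp add: Q_def K_def norm_mult norm_power norm_inverse d_def[symmetric] power_add[symmetric] mult.assoc)
    have w: "0 \<le> 1 - (norm x)\<^sup>2" "1 - (norm x)\<^sup>2 \<le> 1" using weight_bounds[OF True] by simp_all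
    \<comment> \<open>d dominates both 1 - |x| and a. On the shell the weight (1 - |x|^2)^2 \<le> 4
      d^2 removes two powers of 1 / d; elsewhere d \<ge> 1 - \<rho> suffices.\<close>
    have key: "(1 - (norm x)\<^sup>2) ^ 2 * inverse d ^ (2 * N + 6) \<le>
       (if \<rho> < norm x then 4 * inverse a ^ (2 * N + 4) else inverse (1 - \<rho>) ^ (2 * N + 6))"
    proof (cases "\<rho> < norm x")
      case r: True
      have "1 - (norm x)\<^sup>2 = (1 + norm x) * (1 - norm x)" by (simp add: power2_eq_square algebra_simps)
      also have "\<dots> \<le> 2 * d" using True d dpos by (intro mult_mono) auto
      finally have "(1 - (norm x)\<^sup>2) ^ 2 \<le> (2 * d) ^ 2" using w by (intro power_mono)
      hence "(1 - (norm x)\<^sup>2) ^ 2 * inverse d ^ (2 * N + 6) \<le> (2 * d) ^ 2 * inverse d ^ (2 * N + 6)"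
        using dpos by (intro mult_right_mono) auto
      also have e6: "inverse d ^ (2 * N + 6) = inverse d ^ 2 * inverse d ^ (2 * N + 4)"
        unfolding power_add[symmetric] by (rule arg_cong[where f = "power (inverse d)"]) simp
      also have "(2 * d) ^ 2 * (inverse d ^ 2 * inverse d ^ (2 * N + 4)) = 4 * (d * inverse d) ^ 2 * inverse d ^ (2 * N + 4)"
        by (simp only: power_mult_distrib) simp
      also have "\<dots> = 4 * inverse d ^ (2 * N + 4)" using dpos by simp
      also have "\<dots> \<le> 4 * inverse a ^ (2 * N + 4)"
        using d a by (intro mult_left_mono power_mono le_imp_inverse_le) auto
      finally show ?thesis using r by (simp only: e6 if_True)
    next
      case r: False
      have "(1 - (norm x)\<^sup>2) ^ 2 * inverse d ^ (2 * N + 6) \<le> 1 * inverse (1 - \<rho>) ^ (2 * N + 6)"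
        using r d \<rho> dpos w by (intro mult_mono power_le_one power_mono le_imp_inverse_le) auto
      thus ?thesis using r by simp
    qed
    have "(1 - (norm x)\<^sup>2) ^ 2 * (norm (H x) * inverse d ^ (2 * N + 6)) =
      (1 - (norm x)\<^sup>2) ^ 2 * inverse d ^ (2 * N + 6) * norm (H x)" by (simp only: mult_ac)
    also have "\<dots> \<le> (if \<rho> < norm x then 4 * inverse a ^ (2 * N + 4) else inverse (1 - \<rho>) ^ (2 * N + 6)) * norm (H x)"
      by (rule mult_right_mono[OF key]) simp
    also have "\<dots> \<le> 4 * inverse a ^ (2 * N + 4) * J1 x + inverse (1 - \<rho>) ^ (2 * N + 6) * J2 x"
      using True \<rho> by (simp add: J1_def J2_def)
    finally show ?thesis using True nQ by simp
  next
    case False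
    thus ?thesis by (simp add: J1_def J2_def)
  qed
  have J0: "0 \<le> J1 x" "0 \<le> J2 x" for x by (simp_all add: J1_def J2_def)
  have "norm (Q z) * norm (wI 2 (\<lambda>x::complex^'n. 1::complex)) = norm (wI 2 (\<lambda>x. Q x * K z (cv x)))"
    unfolding rep by (rule norm_mult[symmetric])
  also have "\<dots> \<le> wI 2 (\<lambda>x. norm (Q x * K z (cv x)))" by (rule norm_wI_le[OF cQ])
  also have "\<dots> \<le> (\<integral>x. 4 * inverse a ^ (2 * N + 4) * J1 x + inverse (1 - \<rho>) ^ (2 * N + 6) * J2 x \<partial>lborel)"
    unfolding wI_lborel
    by (rule integral_mono'[OF _ le]) (use iJ1 iJ2 J0 a \<rho> in \<open>auto intro!: add_nonneg_nonneg mult_nonneg_nonneg\<close>)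
  also have "\<dots> = 4 * inverse a ^ (2 * N + 4) * integral\<^sup>L lborel J1 + inverse (1 - \<rho>) ^ (2 * N + 6) * integral\<^sup>L lborel J2"
    using iJ1 iJ2 by simp
  finally have main: "norm (Q z) * norm (wI 2 (\<lambda>x::complex^'n. 1::complex)) \<le> \<dots>" .
  have I0: "0 \<le> integral\<^sup>L lborel J1" "0 \<le> integral\<^sup>L lborel J2" using J0 by simp_all
  have w: "0 < 1 - (norm z)\<^sup>2" using weight_bounds(1)[OF z] .
  have "1 - bil (cv z) z = of_real (1 - (norm z)\<^sup>2)" using bil_cv[of z] by (simp add: bil_commute)
  hence nQ: "norm (H z) = (1 - (norm z)\<^sup>2) ^ (N + 3) * norm (Q z)"

    unfolding Q_def K_def using w by (simp add: norm_mult norm_power norm_inverse power_inverse del: of_real_diff of_real_power)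
  have wa: "(1 - (norm z)\<^sup>2) ^ (N + 3) \<le> (2 * a) ^ (N + 3)"
  proof (rule power_mono)
    have "1 - (norm z)\<^sup>2 = (1 + norm z) * a" by (simp add: a_def power2_eq_square algebra_simps)
    also have "\<dots> \<le> 2 * a" using z a by (intro mult_right_mono) auto
    finally show "1 - (norm z)\<^sup>2 \<le> 2 * a" .
  qed (use w in simp)
  let ?B = "4 * inverse a ^ (2 * N + 4) * integral\<^sup>L lborel J1 + inverse (1 - \<rho>) ^ (2 * N + 6) * integral\<^sup>L lborel J2"
  have B0: "0 \<le> ?B" using I0 a \<rho> by (intro add_nonneg_nonneg mult_nonneg_nonneg) auto
  have "a ^ (N + 1) * norm (H z) * norm (wI 2 (\<lambda>x::complex^'n. 1::complex)) =
     (a ^ (N + 1) * (1 - (norm z)\<^sup>2) ^ (N + 3)) * (norm (Q z) * norm (wI 2 (\<lambda>x::complex^'n. 1::complex)))"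
    unfolding nQ by (simp only: mult_ac)
  also have "\<dots> \<le> (a ^ (N + 1) * (1 - (norm z)\<^sup>2) ^ (N + 3)) * ?B"
    using a w by (intro mult_left_mono[OF main] mult_nonneg_nonneg) auto
  also have "\<dots> \<le> (a ^ (N + 1) * (2 * a) ^ (N + 3)) * ?B"
    using a by (intro mult_right_mono[OF _ B0] mult_left_mono[OF wa]) auto
  also have "a ^ (N + 1) * (2 * a) ^ (N + 3) = 2 ^ (N + 3) * a ^ (2 * N + 4)"
  proof -
    have "a ^ (N + 1) * (2 * a) ^ (N + 3) = 2 ^ (N + 3) * (a ^ (N + 1) * a ^ (N + 3))" by (simp only: power_mult_distrib mult_ac)
    also have "a ^ (N + 1) * a ^ (N + 3) = a ^ (2 * N + 4)" unfolding power_add[symmetric] by (rule arg_cong[where f = "power a"]) simp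
    finally show ?thesis .
  qed
  also have "2 ^ (N + 3) * a ^ (2 * N + 4) * ?B = 2 ^ (N + 3) * 4 * (a * inverse a) ^ (2 * N + 4) * integral\<^sup>L lborel J1 +
     2 ^ (N + 3) * a ^ (2 * N + 4) * inverse (1 - \<rho>) ^ (2 * N + 6) * integral\<^sup>L lborel J2"
    by (simp only: power_mult_distrib distrib_left mult_ac)
  also have "\<dots> \<le> 2 ^ (N + 5) * integral\<^sup>L lborel J1 + 2 ^ (N + 3) * a * inverse (1 - \<rho>) ^ (2 * N + 6) * integral\<^sup>L lborel J2"
  proof (rule add_mono)
    show "2 ^ (N + 3) * 4 * (a * inverse a) ^ (2 * N + 4) * integral\<^sup>L lborel J1 \<le> 2 ^ (N + 5) * integral\<^sup>L lborel J1"
      using a by (simp add: power_add)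
    have "a ^ (2 * N + 4) \<le> a ^ 1" using a by (intro power_decreasing) auto
    thus "2 ^ (N + 3) * a ^ (2 * N + 4) * inverse (1 - \<rho>) ^ (2 * N + 6) * integral\<^sup>L lborel J2 \<le>
      2 ^ (N + 3) * a * inverse (1 - \<rho>) ^ (2 * N + 6) * integral\<^sup>L lborel J2"
      using I0 \<rho> by (intro mult_right_mono mult_left_mono) auto
  qed
  finally show ?thesis unfolding a_def J1_def J2_def .
qed

text \<open>\<open>kernel_growth\<close> is applied to the p-th power of a dilate of f: it is again
  holomorphic, its modulus is |f|^p dilated, and the dilation extends it beyond the closed ball.
  Integrability of |f|^p makes the integral over a thin shell small, which yields the limit 0 and
  not mere boundedness.\<close>

lemma bergman_growth:
  fixes f :: "complex^'n \<Rightarrow> complex"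
  assumes f: "f \<in> bergman p" and \<eta>: "\<eta> > 0"
  shows "\<exists>\<delta>>0. \<forall>\<zeta>. norm \<zeta> < 1 \<and> 1 - norm \<zeta> < \<delta> \<longrightarrow> norm (f \<zeta>) ^ p * (1 - norm \<zeta>) ^ (CARD('n) + 1) \<le> \<eta>"
proof -
  define N where "N = CARD('n)"
  define D where "D = DIM(complex^'n)"
  define c where "c = norm (wI 2 (\<lambda>x::complex^'n. 1::complex))"
  have hf: "holo_on f (ball 0 1)" using f by (simp add: bergman_def unit_ball_def)
  \<comment> \<open>The cut-off \<sigma> = -1 stands for the whole ball, the origin
    included.\<close>
  define \<Phi> where "\<Phi> = (\<lambda>\<sigma> y. if \<sigma> < norm y \<and> norm y < 1 then norm (f y) ^ p else 0)"
  have "set_integrable lborel (ball 0 1) (\<lambda>z. norm (f z) ^ p)" using f by (simp add: bergman_def unit_ball_def)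
  hence i0: "set_integrable lborel S (\<lambda>z. norm (f z) ^ p)" if "S \<subseteq> ball 0 1" "S \<in> sets lborel" for S
    by (rule set_integrable_subset[OF _ that(2,1)])
  have int: "integrable lborel (\<Phi> \<sigma>)" for \<sigma>
  proof -
    have "{x::complex^'n. \<sigma> < norm x \<and> norm x < 1} = ball 0 1 - cball 0 \<sigma>" by auto
    hence "{x::complex^'n. \<sigma> < norm x \<and> norm x < 1} \<in> sets lborel" by simp
    from i0[OF _ this] show ?thesis unfolding set_integrable_def \<Phi>_def
      by (rule back_subst[where P = "integrable lborel"]) (auto simp: indicator_def fun_eq_iff)
  qed
  have \<Phi>0: "0 \<le> \<Phi> \<sigma> y" for \<sigma> y by (simp add: \<Phi>_def)
  define A where "A = integral\<^sup>L lborel (\<Phi> (-1))"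
  have A0: "A \<ge> 0" unfolding A_def using \<Phi>0 by simp
  have cpos: "c > 0"
  proof -
    have "wI 2 (\<lambda>x::complex^'n. 1::real) \<noteq> 0"
    proof
      assume "wI 2 (\<lambda>x::complex^'n. 1::real) = 0"
      hence "(1::real) = 0" by (intro wI_eq_0_imp[of "\<lambda>x::complex^'n. 1" 2 0]) auto
      thus False by simp
    qed
    moreover have "c = \<bar>wI 2 (\<lambda>x::complex^'n. 1::real)\<bar>" unfolding c_def using wI_of_real[of 2 "\<lambda>x::complex^'n. 1"] by simp
    ultimately show ?thesis by simp
  qed
  \<comment> \<open>The squares anticipate the dilation: for |x| > \<rho> and \<tau> \<ge> \<rho>
    the point \<tau> x has norm above \<rho>^2.\<close>
  have lim: "(\<lambda>n. integral\<^sup>L lborel (\<Phi> ((1 - inverse (real (Suc n)))\<^sup>2))) \<longlonglongrightarrow> integral\<^sup>L lborel (\<lambda>y::complex^'n. 0::real)"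
  proof (rule integral_dominated_convergence[where w = "\<Phi> (-1)"])
    show "AE y in lborel. (\<lambda>n. \<Phi> ((1 - inverse (real (Suc n)))\<^sup>2) y) \<longlonglongrightarrow> 0"
    proof (rule AE_I2)
      fix y :: "complex^'n"
      have "(\<lambda>n. (1 - inverse (real (Suc n)))\<^sup>2) \<longlonglongrightarrow> (1 - 0)\<^sup>2"
        by (intro tendsto_intros LIMSEQ_inverse_real_of_nat)
      hence l: "(\<lambda>n. (1 - inverse (real (Suc n)))\<^sup>2) \<longlonglongrightarrow> 1" by simp
      show "(\<lambda>n. \<Phi> ((1 - inverse (real (Suc n)))\<^sup>2) y) \<longlonglongrightarrow> 0"
      proof (cases "norm y < 1")
        case True
        from order_tendstoD(1)[OF l True] show ?thesis
          by (intro tendsto_eventually, elim eventually_mono) (auto simp: \<Phi>_def)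
      qed (simp add: \<Phi>_def)
    qed
    have "\<bar>\<Phi> (t\<^sup>2) y\<bar> \<le> \<Phi> (-1) y" for t y
    proof -
      have "-1 < norm y" by (rule order.strict_trans2[OF _ norm_ge_zero]) simp
      thus ?thesis unfolding \<Phi>_def by simp
    qed
    thus "AE y in lborel. norm (\<Phi> ((1 - inverse (real (Suc n)))\<^sup>2) y) \<le> \<Phi> (-1) y" for n by simp
  qed (use int in \<open>simp_all add: borel_measurable_integrable\<close>)
  \<comment> \<open>The power of 2 collects 2^(N+1) from halving 1 - |\<zeta>|, 2^(N+5) from
    \<open>kernel_growth\<close> and 2^D from the change of variables.\<close>
  define \<eta>' where "\<eta>' = \<eta> * c / 2 / (2 ^ (2 * N + 6 + D))"
  have \<eta>': "\<eta>' > 0" using \<eta> cpos by (simp add: \<eta>'_def)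
  have "eventually (\<lambda>n. integral\<^sup>L lborel (\<Phi> ((1 - inverse (real (Suc n)))\<^sup>2)) < \<eta>') sequentially"
    using order_tendstoD(2)[OF lim, of \<eta>'] \<eta>' by simp
  hence "eventually (\<lambda>n. integral\<^sup>L lborel (\<Phi> ((1 - inverse (real (Suc n)))\<^sup>2)) < \<eta>' \<and> n \<ge> 1) sequentially"
    by (rule eventually_conj) (rule eventually_ge_at_top)
  then obtain n where n: "integral\<^sup>L lborel (\<Phi> ((1 - inverse (real (Suc n)))\<^sup>2)) < \<eta>'" "n \<ge> 1"
    unfolding eventually_sequentially by blast
  define \<rho> where "\<rho> = 1 - inverse (real (Suc n))"
  have \<rho>: "0 < \<rho>" "\<rho> < 1" using n(2) by (auto simp: \<rho>_def inverse_eq_divide field_simps)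
  have A\<rho>: "integral\<^sup>L lborel (\<Phi> (\<rho>\<^sup>2)) \<le> \<eta>'" using n(1) by (simp add: \<rho>_def)
  define B where "B = 2 ^ (2 * N + 4 + D) * inverse (1 - \<rho>) ^ (2 * N + 6) * A"
  have B0: "B \<ge> 0" unfolding B_def using A0 \<rho> by simp
  define \<delta> where "\<delta> = min (1 - \<rho>) (\<eta> * c / 2 / (B + 1))"
  have \<delta>: "\<delta> > 0" using \<rho> \<eta> cpos B0 by (simp add: \<delta>_def)
  have "norm (f \<zeta>) ^ p * (1 - norm \<zeta>) ^ (N + 1) \<le> \<eta>" if \<zeta>: "norm \<zeta> < 1" "1 - norm \<zeta> < \<delta>" for \<zeta>
  proof -
    \<comment> \<open>Halfway between |\<zeta>| and 1, so that 1 - |\<zeta>| / \<tau> is comparable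
      with 1 - |\<zeta>|.\<close>
    define \<tau> where "\<tau> = (1 + norm \<zeta>) / 2"
    have r\<zeta>: "\<rho> < norm \<zeta>" using \<zeta>(2) by (simp add: \<delta>_def)
    have \<tau>: "1/2 \<le> \<tau>" "\<tau> < 1" "\<rho> \<le> \<tau>" "norm \<zeta> < \<tau>" using \<zeta> r\<zeta> \<rho> by (simp_all add: \<tau>_def)
    define H where "H = (\<lambda>x. f (0 + of_real \<tau> *s x) ^ p)"
    have hH: "holo_on H (ball 0 (1 / \<tau>))" unfolding H_def
      by (intro holo_on_power holo_on_affine[OF hf]) (use \<tau> in \<open>simp add: norm_smult_vec field_simps\<close>)
    have nH: "norm (H x) = norm (f (\<tau> *\<^sub>R x)) ^ p" for x
      by (simp add: H_def norm_power scaleR_vec_def vector_scalar_mult_def scaleR_conv_of_real)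
    define z where "z = inverse \<tau> *\<^sub>R \<zeta>"
    have \<tau>0: "\<tau> > 0" using \<tau>(1) by simp
    have tz: "\<tau> *\<^sub>R z = \<zeta>" using \<tau>0 by (simp add: z_def)
    have nz: "norm z = norm \<zeta> / \<tau>"
    proof -
      have "\<bar>inverse \<tau>\<bar> = inverse \<tau>" using \<tau>0 by (intro abs_of_pos) simp
      thus ?thesis unfolding z_def norm_scaleR divide_inverse by (simp only: mult.commute)
    qed
    have z1: "norm z < 1" unfolding nz using \<tau> by simp
    have az: "1 - norm z = (1 - norm \<zeta>) / (2 * \<tau>)"
    proof -
      have e: "norm \<zeta> = 2 * \<tau> - 1" by (simp add: \<tau>_def field_simps)
      show ?thesis unfolding nz unfolding e using \<tau>0 by (simp add: field_simps)
    qed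
    have az1: "(1 - norm \<zeta>) / 2 \<le> 1 - norm z" unfolding az using \<tau> \<zeta> by (intro divide_left_mono) auto
    have az2: "1 - norm z \<le> 1 - norm \<zeta>"
    proof -
      have "(1 - norm \<zeta>) / (2 * \<tau>) \<le> (1 - norm \<zeta>) / 1" using \<tau> \<zeta> by (intro divide_left_mono) auto
      thus ?thesis unfolding az by simp
    qed
    have sc: "(\<integral>x. (if P x \<and> norm x < 1 then norm (H x) else 0) \<partial>lborel) \<le> 2 ^ D * integral\<^sup>L lborel (\<Phi> \<sigma>)"
      if P: "\<And>x. P x \<Longrightarrow> \<sigma> < \<tau> * norm x" for P \<sigma>
    proof -
      have "(\<integral>x. (if P x \<and> norm x < 1 then norm (H x) else 0) \<partial>lborel) \<le> (\<integral>x. \<Phi> \<sigma> (\<tau> *\<^sub>R x) \<partial>lborel)"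
      proof (rule integral_mono')
        show "integrable lborel (\<lambda>x. \<Phi> \<sigma> (\<tau> *\<^sub>R x))" using \<tau> by (intro lborel_integral_scale(1)[OF _ int]) simp
        show "(if P x \<and> norm x < 1 then norm (H x) else 0) \<le> \<Phi> \<sigma> (\<tau> *\<^sub>R x)" for x
        proof (cases "P x \<and> norm x < 1")
          case True
          have "\<tau> * norm x < 1" using True \<tau> mult_strict_mono[of \<tau> 1 "norm x" 1] by auto
          thus ?thesis using True P[of x] \<tau> by (simp add: \<Phi>_def nH)
        next
          case False thus ?thesis using \<Phi>0 by auto
        qed
      qed (rule \<Phi>0)
      also have "\<dots> = inverse \<tau> ^ D * integral\<^sup>L lborel (\<Phi> \<sigma>)"
      proof -
        have "integral\<^sup>L lborel (\<Phi> \<sigma>) = \<tau> ^ D * (\<integral>x. \<Phi> \<sigma> (\<tau> *\<^sub>R x) \<partial>lborel)"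
          unfolding D_def using \<tau> by (intro lborel_integral_scale(2)[OF _ int]) simp
        thus ?thesis using \<tau> by (simp add: power_inverse)
      qed
      also have "\<dots> \<le> 2 ^ D * integral\<^sup>L lborel (\<Phi> \<sigma>)"
        using \<tau> \<Phi>0 by (intro mult_right_mono power_mono) (auto simp: inverse_eq_divide field_simps)
      finally show ?thesis .
    qed
    have 1: "(\<integral>x. (if \<rho> < norm x \<and> norm x < 1 then norm (H x) else 0) \<partial>lborel) \<le> 2 ^ D * \<eta>'"
    proof -
      have "\<rho>\<^sup>2 < \<tau> * norm x" if "\<rho> < norm x" for x :: "complex^'n"
      proof -
        have "\<rho>\<^sup>2 \<le> \<tau> * \<rho>" unfolding power2_eq_square using \<tau> \<rho> by (intro mult_right_mono) auto
        also have "\<dots> < \<tau> * norm x" using that \<tau> by (intro mult_strict_left_mono) auto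
        finally show ?thesis .
      qed
      from sc[of "\<lambda>x. \<rho> < norm x", OF this] have "(\<integral>x. (if \<rho> < norm x \<and> norm x < 1 then norm (H x) else 0) \<partial>lborel) \<le> 2 ^ D * integral\<^sup>L lborel (\<Phi> (\<rho>\<^sup>2))" .
      also have "\<dots> \<le> 2 ^ D * \<eta>'" by (intro mult_left_mono A\<rho>) simp
      finally show ?thesis .
    qed
    have 2: "(\<integral>x. (if norm x < 1 then norm (H x) else 0) \<partial>lborel) \<le> 2 ^ D * A"
    proof -
      have "-1 < \<tau> * norm x" for x :: "complex^'n" by (rule order.strict_trans2[of "-1" 0]) (use \<tau>0 in simp_all)
      from sc[of "\<lambda>x. True", OF this] show ?thesis unfolding A_def by simp
    qed
    have "norm (f \<zeta>) ^ p * ((1 - norm \<zeta>) / 2) ^ (N + 1) * c \<le> (1 - norm z) ^ (N + 1) * norm (H z) * c"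
    proof -
      have "((1 - norm \<zeta>) / 2) ^ (N + 1) \<le> (1 - norm z) ^ (N + 1)" using \<zeta> by (intro power_mono az1) auto
      hence "norm (f \<zeta>) ^ p * ((1 - norm \<zeta>) / 2) ^ (N + 1) \<le> norm (f \<zeta>) ^ p * (1 - norm z) ^ (N + 1)"
        by (intro mult_left_mono) auto
      hence "norm (f \<zeta>) ^ p * ((1 - norm \<zeta>) / 2) ^ (N + 1) * c \<le> norm (f \<zeta>) ^ p * (1 - norm z) ^ (N + 1) * c"
        using cpos by (intro mult_right_mono) auto
      thus ?thesis unfolding nH tz by (simp only: mult.commute[of "(1 - norm z) ^ (N + 1)"])
    qed
    also have "\<dots> \<le> 2 ^ (N + 5) * (\<integral>x. (if \<rho> < norm x \<and> norm x < 1 then norm (H x) else 0) \<partial>lborel) +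
        2 ^ (N + 3) * (1 - norm z) * inverse (1 - \<rho>) ^ (2 * N + 6) * (\<integral>x. (if norm x < 1 then norm (H x) else 0) \<partial>lborel)"
      unfolding c_def N_def by (rule kernel_growth[OF hH _ z1 \<rho>]) (use \<tau> in simp)
    also have "\<dots> \<le> 2 ^ (N + 5) * (2 ^ D * \<eta>') + 2 ^ (N + 3) * (1 - norm \<zeta>) * inverse (1 - \<rho>) ^ (2 * N + 6) * (2 ^ D * A)"
    proof (rule add_mono)
      show "2 ^ (N + 5) * (\<integral>x. (if \<rho> < norm x \<and> norm x < 1 then norm (H x) else 0) \<partial>lborel) \<le> 2 ^ (N + 5) * (2 ^ D * \<eta>')"
        by (intro mult_left_mono 1) simp
      show "2 ^ (N + 3) * (1 - norm z) * inverse (1 - \<rho>) ^ (2 * N + 6) * (\<integral>x. (if norm x < 1 then norm (H x) else 0) \<partial>lborel)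
         \<le> 2 ^ (N + 3) * (1 - norm \<zeta>) * inverse (1 - \<rho>) ^ (2 * N + 6) * (2 ^ D * A)"
        using \<zeta> \<rho> z1 az2 by (intro mult_mono[OF _ 2] mult_right_mono mult_left_mono mult_nonneg_nonneg Bochner_Integration.integral_nonneg) auto
    qed
    finally have m: "norm (f \<zeta>) ^ p * ((1 - norm \<zeta>) / 2) ^ (N + 1) * c \<le> \<dots>" .
    have "norm (f \<zeta>) ^ p * (1 - norm \<zeta>) ^ (N + 1) * c = 2 ^ (N + 1) * (norm (f \<zeta>) ^ p * ((1 - norm \<zeta>) / 2) ^ (N + 1) * c)"
      by (simp add: power_divide)
    also have "\<dots> \<le> 2 ^ (N + 1) * (2 ^ (N + 5) * (2 ^ D * \<eta>') + 2 ^ (N + 3) * (1 - norm \<zeta>) * inverse (1 - \<rho>) ^ (2 * N + 6) * (2 ^ D * A))"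
      by (rule mult_left_mono[OF m]) simp
    also have "\<dots> = 2 ^ (N + 1) * 2 ^ (N + 5) * 2 ^ D * \<eta>' +
        (1 - norm \<zeta>) * (2 ^ (N + 1) * 2 ^ (N + 3) * 2 ^ D * inverse (1 - \<rho>) ^ (2 * N + 6) * A)"
      by (simp only: distrib_left mult_ac)
    also have "(2::real) ^ (N + 1) * 2 ^ (N + 3) * 2 ^ D = 2 ^ (2 * N + 4 + D)"
      unfolding power_add[symmetric] by (rule arg_cong[where f = "power 2"]) simp
    also have "(2::real) ^ (N + 1) * 2 ^ (N + 5) * 2 ^ D = 2 ^ (2 * N + 6 + D)"
      unfolding power_add[symmetric] by (rule arg_cong[where f = "power 2"]) simp
    also have "2 ^ (2 * N + 4 + D) * inverse (1 - \<rho>) ^ (2 * N + 6) * A = B" by (simp add: B_def)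
    also have "2 ^ (2 * N + 6 + D) * \<eta>' = \<eta> * c / 2" by (simp add: \<eta>'_def)
    also have "(1 - norm \<zeta>) * B \<le> \<eta> * c / 2"
    proof -
      have "1 - norm \<zeta> \<le> \<eta> * c / 2 / (B + 1)" using \<zeta>(2) by (simp add: \<delta>_def)
      hence "(1 - norm \<zeta>) * (B + 1) \<le> \<eta> * c / 2" using B0 by (subst (asm) pos_le_divide_eq) auto
      moreover have "(1 - norm \<zeta>) * B \<le> (1 - norm \<zeta>) * (B + 1)" using \<zeta> by (intro mult_left_mono) auto
      ultimately show ?thesis by linarith
    qed
    finally have "norm (f \<zeta>) ^ p * (1 - norm \<zeta>) ^ (N + 1) * c \<le> \<eta> * c" by simp
    thus ?thesis using cpos by simp
  qed
  thus ?thesis using \<delta> unfolding N_def by blast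
qed

text \<open>Taking p-th roots turns the exponent N + 1 into (N + 1) / p = 1 / 2. \<open>tame\<close>
  is uniform over all |z| \<le> 1 - s, so points away from the sphere have to be covered as well, by
  boundedness of f there and smallness of s.\<close>

lemma bergman_tame:
  fixes f :: "complex^'n \<Rightarrow> complex"
  assumes f: "f \<in> bergman (2 * CARD('n) + 2)"
  shows "tame f"
  unfolding tame_def
proof (intro allI impI)
  fix \<epsilon> :: real assume \<epsilon>: "\<epsilon> > 0"
  define p where "p = 2 * CARD('n) + 2"
  have hf: "holo_on f (ball 0 1)" using f by (simp add: bergman_def unit_ball_def)
  obtain \<delta> where \<delta>: "\<delta> > 0" "\<And>\<zeta>. norm \<zeta> < 1 \<Longrightarrow> 1 - norm \<zeta> < \<delta> \<Longrightarrow> norm (f \<zeta>) ^ p * (1 - norm \<zeta>) ^ (CARD('n) + 1) \<le> \<epsilon> ^ p"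
    using bergman_growth[OF f, of "\<epsilon> ^ p"] \<epsilon> unfolding p_def by auto
  have near: "norm (f \<zeta>) * sqrt (1 - norm \<zeta>) \<le> \<epsilon>" if "norm \<zeta> < 1" "1 - norm \<zeta> < \<delta>" for \<zeta>
  proof -
    have "p = 2 * (CARD('n) + 1)" by (simp add: p_def)
    hence "sqrt (1 - norm \<zeta>) ^ p = (sqrt (1 - norm \<zeta>) ^ 2) ^ (CARD('n) + 1)" by (simp only: power_mult)
    also have "\<dots> = (1 - norm \<zeta>) ^ (CARD('n) + 1)" by (subst real_sqrt_pow2) (use that in auto)
    finally have "(norm (f \<zeta>) * sqrt (1 - norm \<zeta>)) ^ p \<le> \<epsilon> ^ p" using \<delta>(2)[OF that] by (simp only: power_mult_distrib)
    moreover have "p = Suc (p - 1)" by (simp add: p_def)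
    ultimately have "(norm (f \<zeta>) * sqrt (1 - norm \<zeta>)) ^ Suc (p - 1) \<le> \<epsilon> ^ Suc (p - 1)" by (simp only:)
    thus ?thesis by (rule power_le_imp_le_base) (use \<epsilon> in simp)
  qed
  have "continuous_on (cball 0 (1 - \<delta>)) f" using holo_on_continuous[OF hf] by (rule continuous_on_subset) (use \<delta> in auto)
  hence "bounded (f ` cball 0 (1 - \<delta>))" by (intro compact_imp_bounded compact_continuous_image) auto
  then obtain C where "C > 0" "\<forall>w\<in>f ` cball 0 (1 - \<delta>). norm w \<le> C" unfolding bounded_pos by blast
  hence C: "\<And>z. norm z \<le> 1 - \<delta> \<Longrightarrow> norm (f z) \<le> C" "C > 0" by auto
  show "\<exists>s0>0. \<forall>s z. 0 < s \<and> s < s0 \<and> norm z \<le> 1 - s \<longrightarrow> norm (f z) * sqrt s \<le> \<epsilon>"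
  proof (intro exI conjI allI impI)
    show "(\<epsilon> / C)\<^sup>2 > 0" using \<epsilon> C by simp
    fix s and z :: "complex^'n" assume sz: "0 < s \<and> s < (\<epsilon> / C)\<^sup>2 \<and> norm z \<le> 1 - s"
    show "norm (f z) * sqrt s \<le> \<epsilon>"
    proof (cases "1 - norm z < \<delta>")
      case True
      have "norm (f z) * sqrt s \<le> norm (f z) * sqrt (1 - norm z)" using sz by (intro mult_left_mono real_sqrt_le_mono) auto
      also have "\<dots> \<le> \<epsilon>" by (rule near) (use True sz in auto)
      finally show ?thesis .
    next
      case False
      have "sqrt s \<le> sqrt ((\<epsilon> / C)\<^sup>2)" using sz by (intro real_sqrt_le_mono) simp
      hence "sqrt s \<le> \<epsilon> / C" using \<epsilon> C by simp
      hence "norm (f z) * sqrt s \<le> C * (\<epsilon> / C)" using False C sz by (intro mult_mono) auto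
      thus ?thesis using C by simp
    qed
  qed
qed

section \<open>Finite rank kernels and polarization\<close>

definition finite_rank :: "(complex^'n \<Rightarrow> complex^'n \<Rightarrow> complex) \<Rightarrow> bool" where
  "finite_rank K \<longleftrightarrow> (\<exists>(n::nat) a b. (\<forall>i<n. holo_on (a i) (ball 0 1) \<and> holo_on (b i) (ball 0 1)) \<and>
     (\<forall>z\<in>ball 0 1. \<forall>\<zeta>\<in>ball 0 1. K z \<zeta> = (\<Sum>i<n. a i z * b i \<zeta>)))"

lemma finite_rankE:
  assumes "finite_rank K"
  obtains n :: nat and a b where "\<And>i. i < n \<Longrightarrow> holo_on (a i) (ball 0 1)" "\<And>i. i < n \<Longrightarrow> holo_on (b i) (ball 0 1)"
    "\<And>z \<zeta>. norm z < 1 \<Longrightarrow> norm \<zeta> < 1 \<Longrightarrow> K z \<zeta> = (\<Sum>i<n. a i z * b i \<zeta>)"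
proof -
  obtain n :: nat and a b where *: "\<forall>i<n. holo_on (a i) (ball 0 1) \<and> holo_on (b i) (ball 0 1)"
    "\<forall>z\<in>ball 0 1. \<forall>\<zeta>\<in>ball 0 1. K z \<zeta> = (\<Sum>i<n. a i z * b i \<zeta>)"
    using assms unfolding finite_rank_def by blast
  show thesis by (rule that[of n a b]) (use * in auto)
qed

lemma finite_rank_sumI:
  assumes "finite I" "\<And>i. i \<in> I \<Longrightarrow> holo_on (a i) (ball 0 1)" "\<And>i. i \<in> I \<Longrightarrow> holo_on (b i) (ball 0 1)"
    "\<And>z \<zeta>. norm z < 1 \<Longrightarrow> norm \<zeta> < 1 \<Longrightarrow> K z \<zeta> = (\<Sum>i\<in>I. a i z * b i \<zeta>)"
  shows "finite_rank K"
proof -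
  obtain h where h: "bij_betw h {..<card I} I" using ex_bij_betw_nat_finite[OF assms(1)] by (auto simp: atLeast0LessThan)
  have m: "h i \<in> I" if "i < card I" for i using h that by (auto simp: bij_betw_def)
  have "K z \<zeta> = (\<Sum>i<card I. a (h i) z * b (h i) \<zeta>)" if "norm z < 1" "norm \<zeta> < 1" for z \<zeta>
    unfolding assms(4)[OF that] using sum.reindex_bij_betw[OF h, of "\<lambda>i. a i z * b i \<zeta>"] by simp
  thus ?thesis unfolding finite_rank_def
    by (intro exI[of _ "card I"] exI[of _ "\<lambda>i. a (h i)"] exI[of _ "\<lambda>i. b (h i)"]) (auto intro: assms m)
qed

lemma finite_rank_mult:
  assumes K: "finite_rank K" and p: "holo_on p (ball 0 1)" and q: "holo_on q (ball 0 1)"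
  shows "finite_rank (\<lambda>z \<zeta>. p z * q \<zeta> * K z \<zeta>)"
proof -
  from K obtain n a b where ab: "\<And>i::nat. i < n \<Longrightarrow> holo_on (a i) (ball 0 1)" "\<And>i. i < n \<Longrightarrow> holo_on (b i) (ball 0 1)"
    "\<And>z \<zeta>. norm z < 1 \<Longrightarrow> norm \<zeta> < 1 \<Longrightarrow> K z \<zeta> = (\<Sum>i<n. a i z * b i \<zeta>)" by (rule finite_rankE) blast
  show ?thesis
    by (rule finite_rank_sumI[of "{..<n}" "\<lambda>i z. p z * a i z" "\<lambda>i \<zeta>. q \<zeta> * b i \<zeta>"])
       (auto intro!: holo_on_mult p q ab simp: ab(3) sum_distrib_left mult_ac)
qed

lemma finite_rank_cmult: "finite_rank K \<Longrightarrow> finite_rank (\<lambda>z \<zeta>. c * K z \<zeta>)"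
  using finite_rank_mult[of K "\<lambda>_. c" "\<lambda>_. 1"] by simp

lemma finite_rank_add:
  assumes K: "finite_rank K" and L: "finite_rank L"
  shows "finite_rank (\<lambda>z \<zeta>. K z \<zeta> + L z \<zeta>)"
proof -
  from K obtain n a b where ab: "\<And>i::nat. i < n \<Longrightarrow> holo_on (a i) (ball 0 1)" "\<And>i. i < n \<Longrightarrow> holo_on (b i) (ball 0 1)"
    "\<And>z \<zeta>. norm z < 1 \<Longrightarrow> norm \<zeta> < 1 \<Longrightarrow> K z \<zeta> = (\<Sum>i<n. a i z * b i \<zeta>)" by (rule finite_rankE) blast
  from L obtain m c d where cd: "\<And>i::nat. i < m \<Longrightarrow> holo_on (c i) (ball 0 1)" "\<And>i. i < m \<Longrightarrow> holo_on (d i) (ball 0 1)"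
    "\<And>z \<zeta>. norm z < 1 \<Longrightarrow> norm \<zeta> < 1 \<Longrightarrow> L z \<zeta> = (\<Sum>i<m. c i z * d i \<zeta>)" by (rule finite_rankE) blast
  show ?thesis
    by (rule finite_rank_sumI[of "{..<n} <+> {..<m}" "case_sum a c" "case_sum b d"])
       (auto simp: ab cd sum.Plus comp_def)
qed

lemma finite_rank_sum:
  "finite I \<Longrightarrow> (\<And>i. i \<in> I \<Longrightarrow> finite_rank (K i)) \<Longrightarrow> finite_rank (\<lambda>z \<zeta>. \<Sum>i\<in>I. K i z \<zeta>)"
proof (induction I rule: finite_induct)
  case empty
  show ?case by (rule finite_rank_sumI[of "{}"]) auto
next
  case (insert i I)
  thus ?case using finite_rank_add[of "K i" "\<lambda>z \<zeta>. \<Sum>i\<in>I. K i z \<zeta>"] by simp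
qed

lemma finite_rank_diff: "finite_rank K \<Longrightarrow> finite_rank L \<Longrightarrow> finite_rank (\<lambda>z \<zeta>. K z \<zeta> - L z \<zeta>)"
  using finite_rank_add[OF _ finite_rank_cmult[of L "-1"], of K] by simp

lemma finite_rank_bil_mult: "finite_rank K \<Longrightarrow> finite_rank (\<lambda>z \<zeta>. (1 - bil z \<zeta>) * K z \<zeta>)"
proof -
  assume K: "finite_rank K"
  have "finite_rank (\<lambda>z \<zeta>. K z \<zeta> - (\<Sum>k\<in>UNIV. z $ k * \<zeta> $ k * K z \<zeta>))"
    by (intro finite_rank_diff K finite_rank_sum finite_rank_mult) auto
  thus ?thesis by (simp add: bil_def sum_distrib_right left_diff_distrib)
qed

lemma pd_kernel_sum:
  assumes a: "\<And>i. i \<in> I \<Longrightarrow> holo_on (a i) (ball 0 1)" and b: "\<And>i. i \<in> I \<Longrightarrow> holo_on (b i) (ball 0 1)"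
    and K: "\<And>z \<zeta>. norm z < 1 \<Longrightarrow> norm \<zeta> < 1 \<Longrightarrow> K z \<zeta> = (\<Sum>i\<in>I. a i z * b i \<zeta>)"
    and z: "norm z < 1" and \<zeta>: "norm \<zeta> < 1"
  shows "pd k (K z) \<zeta> = (\<Sum>i\<in>I. a i z * pd k (b i) \<zeta>)"
    and "pd k (\<lambda>w. K w \<zeta>) z = (\<Sum>i\<in>I. pd k (a i) z * b i \<zeta>)"
proof -
  have "pd k (K z) \<zeta> = pd k (\<lambda>\<zeta>. \<Sum>i\<in>I. a i z * b i \<zeta>) \<zeta>"
    by (rule pd_cong_open[of "ball 0 1"]) (use z \<zeta> K in auto)
  also have "\<dots> = (\<Sum>i\<in>I. pd k (\<lambda>\<zeta>. a i z * b i \<zeta>) \<zeta>)"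
    by (rule pd_sum[where U = "ball 0 1"]) (use b \<zeta> in \<open>auto intro: holo_on_cmult\<close>)
  also have "\<dots> = (\<Sum>i\<in>I. a i z * pd k (b i) \<zeta>)"
    by (intro sum.cong refl pd_cmult[where U = "ball 0 1"]) (use b \<zeta> in auto)
  finally show "pd k (K z) \<zeta> = \<dots>" .
  have "pd k (\<lambda>w. K w \<zeta>) z = pd k (\<lambda>w. \<Sum>i\<in>I. b i \<zeta> * a i w) z"
    by (rule pd_cong_open[of "ball 0 1"]) (use z \<zeta> K in \<open>auto simp: mult.commute\<close>)
  also have "\<dots> = (\<Sum>i\<in>I. pd k (\<lambda>w. b i \<zeta> * a i w) z)"
    by (rule pd_sum[where U = "ball 0 1"]) (use a z in \<open>auto intro: holo_on_cmult\<close>)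
  also have "\<dots> = (\<Sum>i\<in>I. b i \<zeta> * pd k (a i) z)"
    by (intro sum.cong refl pd_cmult[where U = "ball 0 1"]) (use a z in auto)
  finally show "pd k (\<lambda>w. K w \<zeta>) z = (\<Sum>i\<in>I. pd k (a i) z * b i \<zeta>)" by (simp add: mult.commute)
qed

lemma finite_rank_pd:
  assumes K: "finite_rank K"
  shows "finite_rank (\<lambda>z \<zeta>. pd k (K z) \<zeta>)" and "finite_rank (\<lambda>z \<zeta>. pd k (\<lambda>w. K w \<zeta>) z)"
proof -
  from K obtain n a b where ab: "\<And>i::nat. i < n \<Longrightarrow> holo_on (a i) (ball 0 1)" "\<And>i. i < n \<Longrightarrow> holo_on (b i) (ball 0 1)"
    "\<And>z \<zeta>. norm z < 1 \<Longrightarrow> norm \<zeta> < 1 \<Longrightarrow> K z \<zeta> = (\<Sum>i<n. a i z * b i \<zeta>)" by (rule finite_rankE) blast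
  show "finite_rank (\<lambda>z \<zeta>. pd k (K z) \<zeta>)"
    by (rule finite_rank_sumI[of "{..<n}" a "\<lambda>i. pd k (b i)"]) (auto intro!: ab holo_on_pd pd_kernel_sum)
  show "finite_rank (\<lambda>z \<zeta>. pd k (\<lambda>w. K w \<zeta>) z)"
    by (rule finite_rank_sumI[of "{..<n}" "\<lambda>i. pd k (a i)" b]) (auto intro!: ab holo_on_pd pd_kernel_sum)
qed

lemma finite_rank_Eu:
  assumes K: "finite_rank K"
  shows "finite_rank (\<lambda>z \<zeta>. Eu (K z) \<zeta>)" and "finite_rank (\<lambda>z \<zeta>. Eu (\<lambda>w. K w \<zeta>) z)"
proof -
  have "finite_rank (\<lambda>z \<zeta>. \<Sum>k\<in>UNIV. 1 * \<zeta> $ k * pd k (K z) \<zeta>)"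
    by (intro finite_rank_sum finite_rank_mult finite_rank_pd K) auto
  thus "finite_rank (\<lambda>z \<zeta>. Eu (K z) \<zeta>)" by (simp add: Eu_def)
  have "finite_rank (\<lambda>z \<zeta>. \<Sum>k\<in>UNIV. z $ k * 1 * pd k (\<lambda>w. K w \<zeta>) z)"
    by (intro finite_rank_sum finite_rank_mult finite_rank_pd K) auto
  thus "finite_rank (\<lambda>z \<zeta>. Eu (\<lambda>w. K w \<zeta>) z)" by (simp add: Eu_def)
qed

lemma finite_rank_raise:
  assumes K: "finite_rank K"
  shows "finite_rank (\<lambda>z \<zeta>. raise m (K z) \<zeta>)" and "finite_rank (\<lambda>z \<zeta>. raise m (\<lambda>w. K w \<zeta>) z)"
  unfolding raise_def by (intro finite_rank_add finite_rank_cmult finite_rank_Eu K)+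

lemma finite_rank_holo:
  assumes K: "finite_rank K"
  shows "norm z < 1 \<Longrightarrow> holo_on (K z) (ball 0 1)" and "norm \<zeta> < 1 \<Longrightarrow> holo_on (\<lambda>w. K w \<zeta>) (ball 0 1)"
proof -
  from K obtain n a b where ab: "\<And>i::nat. i < n \<Longrightarrow> holo_on (a i) (ball 0 1)" "\<And>i. i < n \<Longrightarrow> holo_on (b i) (ball 0 1)"
    "\<And>z \<zeta>. norm z < 1 \<Longrightarrow> norm \<zeta> < 1 \<Longrightarrow> K z \<zeta> = (\<Sum>i<n. a i z * b i \<zeta>)" by (rule finite_rankE) blast
  show "holo_on (K z) (ball 0 1)" if "norm z < 1"
  proof (rule holo_on_cong)
    show "holo_on (\<lambda>\<zeta>. \<Sum>i<n. a i z * b i \<zeta>) (ball 0 1)" by (intro holo_on_sum holo_on_cmult ab) auto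
  qed (use that ab(3) in auto)
  show "holo_on (\<lambda>w. K w \<zeta>) (ball 0 1)" if "norm \<zeta> < 1"
  proof (rule holo_on_cong)
    show "holo_on (\<lambda>z. \<Sum>i<n. a i z * b i \<zeta>) (ball 0 1)" by (intro holo_on_sum holo_on_mult holo_on_const ab) auto
  qed (use that ab(3) in auto)
qed

lemma finite_rank_line:
  assumes K: "finite_rank K" and D: "\<And>s. s \<in> D \<Longrightarrow> norm (z + s *s u) < 1" "\<And>s. s \<in> D \<Longrightarrow> norm (w + s *s v) < 1"
  shows "(\<lambda>s. K (z + s *s u) (w + s *s v)) holomorphic_on D"
proof -
  from K obtain n a b where ab: "\<And>i::nat. i < n \<Longrightarrow> holo_on (a i) (ball 0 1)" "\<And>i. i < n \<Longrightarrow> holo_on (b i) (ball 0 1)"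
    "\<And>z \<zeta>. norm z < 1 \<Longrightarrow> norm \<zeta> < 1 \<Longrightarrow> K z \<zeta> = (\<Sum>i<n. a i z * b i \<zeta>)" by (rule finite_rankE) blast
  have h: "(\<lambda>s. f (z + s *s u)) holomorphic_on D" if "holo_on f (ball 0 1)" "\<And>s. s \<in> D \<Longrightarrow> norm (z + s *s u) < 1" for f and z u :: "complex^'a"
    unfolding holomorphic_on_def field_differentiable_def
    by (intro ballI exI) (rule has_field_derivative_at_within[OF holo_on_line[OF that(1)]], use that(2) in simp)
  have "(\<lambda>s. \<Sum>i<n. a i (z + s *s u) * b i (w + s *s v)) holomorphic_on D"
    by (intro holomorphic_intros h ab D) auto
  thus ?thesis by (rule holomorphic_transform) (use D ab(3) in auto)
qed

text \<open>A single complex parameter suffices: the pair (z + s u, cv z + s cv u) has the form (w,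
  cv w) for real s and equals the given pair at s = \<i>. The admissible s form an open convex set
  containing \<i> and -\<i>, hence also 0 and a real interval around it.\<close>

lemma polarization:
  assumes K: "finite_rank K" and 0: "\<And>z. norm z < 1 \<Longrightarrow> K z (cv z) = 0"
    and Z: "norm Z < 1" and \<zeta>: "norm \<zeta> < 1"
  shows "K Z \<zeta> = 0"
proof -
  define z where "z = (1/2) *s (Z + cv \<zeta>)"
  define u where "u = (1/(2 * \<i>)) *s (Z - cv \<zeta>)"
  have zu: "z + \<i> *s u = Z" "z + (-\<i>) *s u = cv \<zeta>"
    unfolding z_def u_def by (simp_all add: vec_eq_iff field_simps)
  define D where "D = {s. norm (z + s *s u) < 1 \<and> norm (z + cnj s *s u) < 1}"
  define \<phi> where "\<phi> = (\<lambda>s. K (z + s *s u) (cv z + s *s cv u))"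
  have cvl: "cv (z + s *s u) = cv z + cnj s *s cv u" for s by (simp add: cv_add cv_smult)
  have ncv: "norm (cv z + s *s cv u) = norm (z + cnj s *s u)" for s
    using norm_cv[of "z + cnj s *s u"] unfolding cvl by simp
  have hol: "\<phi> holomorphic_on D" unfolding \<phi>_def
    by (rule finite_rank_line[OF K]) (auto simp: D_def ncv)
  have cvx: "convex {s. norm (z + s *s u) < 1}"
  proof -
    have e: "z + ((1 - t) *\<^sub>R s + t *\<^sub>R s') *s u = (1 - t) *\<^sub>R (z + s *s u) + t *\<^sub>R (z + s' *s u)" for t :: real and s s'
      unfolding vec_eq_iff vector_add_component vector_smult_component vector_scaleR_component
      unfolding scaleR_conv_of_real by (simp add: algebra_simps)
    show ?thesis unfolding convex_alt
    proof (intro ballI allI impI)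
      fix x y :: complex and t :: real
      assume "x \<in> {s. norm (z + s *s u) < 1}" "y \<in> {s. norm (z + s *s u) < 1}" "0 \<le> t \<and> t \<le> 1"
      hence "(1 - t) *\<^sub>R (z + x *s u) + t *\<^sub>R (z + y *s u) \<in> ball 0 1"
        by (intro convexD_alt) auto
      thus "(1 - t) *\<^sub>R x + t *\<^sub>R y \<in> {s. norm (z + s *s u) < 1}"
        unfolding mem_Collect_eq e by simp
    qed
  qed
  have "D = {s. norm (z + s *s u) < 1} \<inter> cnj -` {s. norm (z + s *s u) < 1}" unfolding D_def by auto
  moreover have "convex (cnj -` {s. norm (z + s *s u) < 1})"
    by (rule convex_linear_vimage[OF bounded_linear.linear[OF bounded_linear_cnj] cvx])
  ultimately have "convex D" using convex_Int[OF cvx] by simp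
  hence con: "connected D" by (rule convex_connected)
  have op: "open D" unfolding D_def
    by (intro open_Collect_conj open_Collect_less continuous_intros)
  have iD: "\<i> \<in> D" "-\<i> \<in> D" using zu Z \<zeta> by (auto simp: D_def)
  hence 0: "0 \<in> D" using convexD_alt[OF \<open>convex D\<close> iD, of "1/2"] by simp
  have lp: "0 islimpt (D \<inter> \<real>)"
  proof -
    obtain e where e: "e > 0" "ball 0 e \<subseteq> D" using op 0 open_contains_ball by blast
    show ?thesis unfolding islimpt_approachable
    proof (intro allI impI)
      fix d :: real assume "d > 0"
      thus "\<exists>x'\<in>D \<inter> \<real>. x' \<noteq> 0 \<and> dist x' 0 < d"
        using e by (intro bexI[of _ "of_real (min d e / 2)"]) auto
    qed
  qed
  have "\<phi> \<i> = 0"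
  proof (rule analytic_continuation[OF hol op con _ 0 lp _ iD(1)])
    fix s assume s: "s \<in> D \<inter> \<real>"
    hence "cnj s = s" by (auto elim: Reals_cases)
    hence "\<phi> s = K (z + s *s u) (cv (z + s *s u))" unfolding \<phi>_def cvl by simp
    thus "\<phi> s = 0" using assms(2)[of "z + s *s u"] s by (simp add: D_def)
  qed auto
  moreover have "cv z + \<i> *s cv u = \<zeta>"
    using cvl[of "-\<i>"] unfolding zu by simp
  ultimately show ?thesis unfolding \<phi>_def zu by simp
qed

section \<open>Wirtinger derivatives of the restriction to the diagonal\<close>

lemma diag_has_derivative:
  assumes K: "finite_rank K" and z: "norm z < 1"
  shows "((\<lambda>z. K z (cv z)) has_derivative (\<lambda>v. (\<Sum>k\<in>UNIV. v $ k * pd k (\<lambda>w. K w (cv z)) z) +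
     (\<Sum>k\<in>UNIV. cnj (v $ k) * pd k (K z) (cv z)))) (at z)"
proof -
  from K obtain n a b where ab: "\<And>i::nat. i < n \<Longrightarrow> holo_on (a i) (ball 0 1)" "\<And>i. i < n \<Longrightarrow> holo_on (b i) (ball 0 1)"
    "\<And>z \<zeta>. norm z < 1 \<Longrightarrow> norm \<zeta> < 1 \<Longrightarrow> K z \<zeta> = (\<Sum>i<n. a i z * b i \<zeta>)" by (rule finite_rankE) blast
  have "((\<lambda>z. \<Sum>i<n. a i z * b i (cv z)) has_derivative (\<lambda>v. \<Sum>i<n. a i z * (\<Sum>k\<in>UNIV. cnj (v $ k) * pd k (b i) (cv z)) +
     (\<Sum>k\<in>UNIV. v $ k * pd k (a i) z) * b i (cv z))) (at z)"
    by (intro has_derivative_sum has_derivative_mult holo_on_has_derivative[where U = "ball 0 1"] cv_has_derivative[where U = "ball 0 1"])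
       (use ab z in auto)
  moreover have "(\<Sum>i<n. a i z * (\<Sum>k\<in>UNIV. cnj (v $ k) * pd k (b i) (cv z)) + (\<Sum>k\<in>UNIV. v $ k * pd k (a i) z) * b i (cv z)) =
    (\<Sum>k\<in>UNIV. v $ k * pd k (\<lambda>w. K w (cv z)) z) + (\<Sum>k\<in>UNIV. cnj (v $ k) * pd k (K z) (cv z))" for v
  proof -
    have "(\<Sum>k\<in>UNIV. v $ k * pd k (\<lambda>w. K w (cv z)) z) = (\<Sum>k\<in>UNIV. \<Sum>i<n. v $ k * pd k (a i) z * b i (cv z))"
      using pd_kernel_sum(2)[of "{..<n}" a b K z "cv z"] ab z by (simp add: sum_distrib_left mult.assoc)
    also have "\<dots> = (\<Sum>i<n. (\<Sum>k\<in>UNIV. v $ k * pd k (a i) z) * b i (cv z))"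
      unfolding sum_distrib_right by (rule sum.swap)
    finally have 1: "(\<Sum>k\<in>UNIV. v $ k * pd k (\<lambda>w. K w (cv z)) z) = \<dots>" .
    have "(\<Sum>k\<in>UNIV. cnj (v $ k) * pd k (K z) (cv z)) = (\<Sum>k\<in>UNIV. \<Sum>i<n. a i z * (cnj (v $ k) * pd k (b i) (cv z)))"
      using pd_kernel_sum(1)[of "{..<n}" a b K z "cv z"] ab z by (simp add: sum_distrib_left mult_ac)
    also have "\<dots> = (\<Sum>i<n. a i z * (\<Sum>k\<in>UNIV. cnj (v $ k) * pd k (b i) (cv z)))"
      unfolding sum_distrib_left by (rule sum.swap)
    finally show ?thesis unfolding 1 by (simp add: sum.distrib)
  qed
  ultimately have "((\<lambda>z. \<Sum>i<n. a i z * b i (cv z)) has_derivative (\<lambda>v. (\<Sum>k\<in>UNIV. v $ k * pd k (\<lambda>w. K w (cv z)) z) +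
     (\<Sum>k\<in>UNIV. cnj (v $ k) * pd k (K z) (cv z)))) (at z)" by simp
  thus ?thesis by (rule has_derivative_cong_open[of "ball 0 1", rotated 3]) (use z ab(3) in auto)
qed

lemma frechet_diag:
  assumes K: "finite_rank K" and z: "norm z < 1" and u: "\<And>z. norm z < 1 \<Longrightarrow> u z = K z (cv z)"
  shows "(u has_derivative (\<lambda>v. (\<Sum>k\<in>UNIV. v $ k * pd k (\<lambda>w. K w (cv z)) z) +
     (\<Sum>k\<in>UNIV. cnj (v $ k) * pd k (K z) (cv z)))) (at z)"
    and "frechet_derivative u (at z) v = (\<Sum>k\<in>UNIV. v $ k * pd k (\<lambda>w. K w (cv z)) z) +
     (\<Sum>k\<in>UNIV. cnj (v $ k) * pd k (K z) (cv z))"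
proof -
  show d: "(u has_derivative (\<lambda>v. (\<Sum>k\<in>UNIV. v $ k * pd k (\<lambda>w. K w (cv z)) z) +
     (\<Sum>k\<in>UNIV. cnj (v $ k) * pd k (K z) (cv z)))) (at z)"
    by (rule has_derivative_cong_open[OF _ _ _ diag_has_derivative[OF K z], of "ball 0 1"]) (use z u in auto)
  show "frechet_derivative u (at z) v = (\<Sum>k\<in>UNIV. v $ k * pd k (\<lambda>w. K w (cv z)) z) +
     (\<Sum>k\<in>UNIV. cnj (v $ k) * pd k (K z) (cv z))"
    unfolding frechet_derivative_at[OF d, symmetric] ..
qed

lemma axis_sums:
  fixes d :: "'n::finite \<Rightarrow> complex"
  shows "(\<Sum>k\<in>UNIV. axis j c $ k * d k) = c * d j" "(\<Sum>k\<in>UNIV. cnj (axis j c $ k) * d k) = cnj c * d j"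
proof -
  have "(\<Sum>k\<in>UNIV. axis j c $ k * d k) = (\<Sum>k\<in>UNIV. if k = j then c * d k else 0)"
    by (intro sum.cong) (auto simp: axis_def)
  thus "(\<Sum>k\<in>UNIV. axis j c $ k * d k) = c * d j" by simp
  have "(\<Sum>k\<in>UNIV. cnj (axis j c $ k) * d k) = (\<Sum>k\<in>UNIV. if k = j then cnj c * d k else 0)"
    by (intro sum.cong) (auto simp: axis_def)
  thus "(\<Sum>k\<in>UNIV. cnj (axis j c $ k) * d k) = cnj c * d j" by simp
qed

lemma dz_diag:
  assumes K: "finite_rank K" and z: "norm z < 1" and u: "\<And>z. norm z < 1 \<Longrightarrow> u z = K z (cv z)"
  shows "dz j u z = pd j (\<lambda>w. K w (cv z)) z" and "dzbar j u z = pd j (K z) (cv z)"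
proof -
  have fd: "frechet_derivative u (at z) v = (\<Sum>k\<in>UNIV. v $ k * pd k (\<lambda>w. K w (cv z)) z) +
     (\<Sum>k\<in>UNIV. cnj (v $ k) * pd k (K z) (cv z))" for v by (rule frechet_diag(2)[OF K z u])
  show "dz j u z = pd j (\<lambda>w. K w (cv z)) z" and "dzbar j u z = pd j (K z) (cv z)"
    unfolding dz_def dzbar_def fd axis_sums by (simp_all add: algebra_simps)
qed

definition Lop :: "nat \<Rightarrow> (complex^'n \<Rightarrow> complex^'n \<Rightarrow> complex) \<Rightarrow> complex^'n \<Rightarrow> complex^'n \<Rightarrow> complex" where
  "Lop m K z \<zeta> = (\<Sum>k\<in>UNIV. pd k (\<lambda>w. pd k (K w) \<zeta>) z) - raise m (\<lambda>w. raise m (K w) \<zeta>) z"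

lemma finite_rank_Lop: "finite_rank K \<Longrightarrow> finite_rank (Lop m K)"
  unfolding Lop_def by (intro finite_rank_diff finite_rank_sum finite_rank_pd finite_rank_raise) auto

lemma inv_laplacian_diag:
  assumes K: "finite_rank K" and z: "norm z < 1" and u: "\<And>z. norm z < 1 \<Longrightarrow> u z = K z (cv z)"
  shows "dz j (dzbar k u) z = pd j (\<lambda>w. pd k (K w) (cv z)) z"
    and "inv_laplacian u z = (1 - bil z (cv z)) * Lop 0 K z (cv z)"
proof -
  show m: "dz j (dzbar k u) z = pd j (\<lambda>w. pd k (K w) (cv z)) z" for j k
    by (rule dz_diag(1)[OF finite_rank_pd(1)[OF K] z]) (rule dz_diag(2)[OF K _ u])
  have "Ebarop u z = Eu (K z) (cv z)" if "norm z < 1" for z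
    unfolding Ebarop_def Eu_def using dz_diag(2)[OF K that u] by simp
  hence "Eop (Ebarop u) z = Eu (\<lambda>w. Eu (K w) (cv z)) z"
    unfolding Eop_def using dz_diag(1)[OF finite_rank_Eu(1)[OF K] z] by (simp add: Eu_def[of "\<lambda>w. Eu (K w) (cv z)"])
  thus "inv_laplacian u z = (1 - bil z (cv z)) * Lop 0 K z (cv z)"
    unfolding inv_laplacian_def Lop_def m bil_cv by (simp add: raise_def)
qed

text \<open>Each directional derivative of the diagonal restriction of a finite rank kernel is again
  such a restriction, of the kernel \<open>D K v\<close>, so the first order argument can be
  repeated.\<close>

lemma C2_on_diag:
  fixes u :: "complex^'n \<Rightarrow> complex"
  assumes K: "finite_rank K" and u: "\<And>z. norm z < 1 \<Longrightarrow> u z = K z (cv z)"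
  shows "C2_on (ball 0 1) u"
proof -
  have diff: "\<psi> differentiable_on (ball 0 1)" if "finite_rank L" "\<And>z. norm z < 1 \<Longrightarrow> \<psi> z = L z (cv z)" for \<psi> and L :: "complex^'n \<Rightarrow> complex^'n \<Rightarrow> complex"
    unfolding differentiable_on_def
  proof
    fix z :: "complex^'n" assume "z \<in> ball 0 1"
    thus "\<psi> differentiable (at z within ball 0 1)"
      using frechet_diag(1)[OF that(1) _ that(2), of z]
      by (auto intro: differentiableI has_derivative_at_withinI)
  qed
  define D where "D = (\<lambda>L v (z::complex^'n) \<zeta>. (\<Sum>k\<in>UNIV. v $ k * pd k (\<lambda>w. L w \<zeta>) z) + (\<Sum>k\<in>UNIV. cnj (v $ k) * pd k (L z) \<zeta>) :: complex)"
  have D: "finite_rank (D L v)" if "finite_rank L" for L v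
    unfolding D_def by (intro finite_rank_add finite_rank_sum finite_rank_cmult finite_rank_pd that) auto
  have fD: "frechet_derivative \<psi> (at z) v = D L v z (cv z)"
    if "finite_rank L" "\<And>z. norm z < 1 \<Longrightarrow> \<psi> z = L z (cv z)" "norm z < 1" for \<psi> L v z
    unfolding D_def by (rule frechet_diag(2)[OF that(1,3,2)])
  have 1: "frechet_derivative u (at z) v = D K v z (cv z)" if "norm z < 1" for z v by (rule fD[OF K u that])
  have 2: "frechet_derivative (\<lambda>y. frechet_derivative u (at y) v) (at z) w = D (D K v) w z (cv z)" if "norm z < 1" for z v w
    by (rule fD[OF D[OF K] 1 that])
  show ?thesis unfolding C2_on_def
    by (intro conjI allI diff[OF K u] diff[OF D[OF K] 1] differentiable_imp_continuous_on diff[OF D[OF D[OF K]] 2])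
qed

section \<open>The operator on kernels\<close>

lemma one_minus_bil_nonzero: "norm z < 1 \<Longrightarrow> norm \<zeta> < 1 \<Longrightarrow> 1 - bil z \<zeta> \<noteq> 0"
  by (rule one_minus_bil_nz[of z 1]) auto

lemma bil_mult_pd:
  fixes h :: "complex^'n \<Rightarrow> complex"
  assumes h: "holo_on h (ball 0 1)" and z: "norm z < 1"
  shows "pd k (\<lambda>w. (1 - bil w \<zeta>) * h w) z = (1 - bil z \<zeta>) * pd k h z - \<zeta> $ k * h z"
proof -
  have b: "holo_on (\<lambda>w. 1 - bil \<zeta> w) (ball 0 1)" by (intro holo_on_diff holo_on_const holo_on_bil)
  have pb: "pd k (\<lambda>w. 1 - bil \<zeta> w) z = - \<zeta> $ k" by (subst pd_diff[where U = UNIV]) (auto intro: holo_on_bil)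
  have "pd k (\<lambda>w. (1 - bil \<zeta> w) * h w) z = (1 - bil \<zeta> z) * pd k h z + - \<zeta> $ k * h z"
    unfolding pb[symmetric] by (rule pd_mult[OF b h]) (use z in simp)
  thus ?thesis by (simp add: bil_commute)
qed

lemma bil_mult_raise:
  fixes h :: "complex^'n \<Rightarrow> complex"
  assumes h: "holo_on h (ball 0 1)" and z: "norm z < 1"
  shows "raise m (\<lambda>w. (1 - bil w \<zeta>) * h w) z = (1 - bil z \<zeta>) * raise m h z - bil z \<zeta> * h z"
proof -
  have "Eu (\<lambda>w. (1 - bil w \<zeta>) * h w) z = (\<Sum>k\<in>UNIV. (1 - bil z \<zeta>) * (z $ k * pd k h z) - z $ k * \<zeta> $ k * h z)"
    unfolding Eu_def bil_mult_pd[OF h z] by (simp add: algebra_simps)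
  also have "\<dots> = (1 - bil z \<zeta>) * Eu h z - bil z \<zeta> * h z"
    by (simp add: sum_subtractf sum_distrib_left sum_distrib_right Eu_def bil_def[of z \<zeta>])
  finally show ?thesis by (simp add: raise_def algebra_simps)
qed

lemma raise_cong: "(\<And>w. norm w < 1 \<Longrightarrow> f w = g w) \<Longrightarrow> norm z < 1 \<Longrightarrow> raise m f z = raise m g z"
  unfolding raise_def Eu_def using pd_cong_open[of "ball 0 1" z f g] by simp

lemma Lop_cong:
  assumes "\<And>z \<zeta>. norm z < 1 \<Longrightarrow> norm \<zeta> < 1 \<Longrightarrow> K z \<zeta> = K' z \<zeta>" "norm z < 1" "norm \<zeta> < 1"
  shows "Lop m K z \<zeta> = Lop m K' z \<zeta>"
proof -
  have 1: "pd k (K w) \<zeta> = pd k (K' w) \<zeta>" if "norm w < 1" for k w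
    by (rule pd_cong_open[of "ball 0 1"]) (use assms that in auto)
  have 2: "pd k (\<lambda>w. pd k (K w) \<zeta>) z = pd k (\<lambda>w. pd k (K' w) \<zeta>) z" for k
    by (rule pd_cong_open[of "ball 0 1"]) (use assms 1 in auto)
  have 3: "raise m (K w) \<zeta> = raise m (K' w) \<zeta>" if "norm w < 1" for w
    by (rule raise_cong) (use assms that in auto)
  show ?thesis unfolding Lop_def 2 using raise_cong[OF 3 assms(2)] by simp
qed

lemma Lop_sum:
  assumes a: "\<And>i. i \<in> I \<Longrightarrow> holo_on (a i) (ball 0 1)" and b: "\<And>i. i \<in> I \<Longrightarrow> holo_on (b i) (ball 0 1)"
    and K: "\<And>z \<zeta>. norm z < 1 \<Longrightarrow> norm \<zeta> < 1 \<Longrightarrow> K z \<zeta> = (\<Sum>i\<in>I. a i z * b i \<zeta>)"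
    and z: "norm z < 1" and \<zeta>: "norm \<zeta> < 1"
  shows "Lop m K z \<zeta> = (\<Sum>i\<in>I. \<Sum>k\<in>UNIV. pd k (a i) z * pd k (b i) \<zeta>) - (\<Sum>i\<in>I. raise m (a i) z * raise m (b i) \<zeta>)"
proof -
  have hp: "holo_on (pd k (b i)) (ball 0 1)" if "i \<in> I" for k i by (rule holo_on_pd[OF b[OF that]]) simp
  have hr: "holo_on (raise m (b i)) (ball 0 1)" if "i \<in> I" for i by (rule holo_on_raise[OF b[OF that]]) simp
  have 1: "pd k (\<lambda>w. pd k (K w) \<zeta>) z = (\<Sum>i\<in>I. pd k (a i) z * pd k (b i) \<zeta>)" for k
    by (rule pd_kernel_sum(2)[of I a "\<lambda>i. pd k (b i)" "\<lambda>z \<zeta>. pd k (K z) \<zeta>", OF a hp _ z \<zeta>])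
       (auto intro: pd_kernel_sum(1)[OF a b K])
  have r: "raise m (K w) \<zeta> = (\<Sum>i\<in>I. a i w * raise m (b i) \<zeta>)" if "norm w < 1" "norm \<zeta> < 1" for w \<zeta>
  proof -
    have pk: "pd k (K w) \<zeta> = (\<Sum>i\<in>I. a i w * pd k (b i) \<zeta>)" for k
      by (rule pd_kernel_sum(1)[OF a b K that])
    have "Eu (K w) \<zeta> = (\<Sum>i\<in>I. a i w * Eu (b i) \<zeta>)"
      unfolding Eu_def pk sum_distrib_left by (subst sum.swap) (simp add: mult_ac)
    thus ?thesis unfolding raise_def K[OF that] by (simp add: sum_distrib_left distrib_left sum.distrib mult_ac)
  qed
  have "raise m (\<lambda>w. raise m (K w) \<zeta>) z = (\<Sum>i\<in>I. raise m (a i) z * raise m (b i) \<zeta>)"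
  proof -
    have "Eu (\<lambda>w. raise m (K w) \<zeta>) z = (\<Sum>k\<in>UNIV. z $ k * (\<Sum>i\<in>I. pd k (a i) z * raise m (b i) \<zeta>))"
      unfolding Eu_def
      by (intro sum.cong refl arg_cong2[where f = "(*)"] pd_kernel_sum(2)[of I a "\<lambda>i. raise m (b i)" "\<lambda>z \<zeta>. raise m (K z) \<zeta>", OF a _ _ z \<zeta>])
         (use a hr r in \<open>auto\<close>)
    also have "\<dots> = (\<Sum>i\<in>I. Eu (a i) z * raise m (b i) \<zeta>)"
      unfolding Eu_def sum_distrib_left sum_distrib_right by (subst sum.swap) (simp add: mult_ac)
    finally have "raise m (\<lambda>w. raise m (K w) \<zeta>) z = (\<Sum>i\<in>I. of_nat m * (a i z * raise m (b i) \<zeta>) + Eu (a i) z * raise m (b i) \<zeta>)"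
      unfolding raise_def[of m "\<lambda>w. raise m (K w) \<zeta>"] r[OF z \<zeta>] by (simp only: sum_distrib_left sum.distrib)
    also have "\<dots> = (\<Sum>i\<in>I. raise m (a i) z * raise m (b i) \<zeta>)"
      by (intro sum.cong refl) (simp add: raise_def[of m "a _"] algebra_simps)
    finally show ?thesis .
  qed
  moreover have "(\<Sum>k\<in>UNIV. \<Sum>i\<in>I. pd k (a i) z * pd k (b i) \<zeta>) = (\<Sum>i\<in>I. \<Sum>k\<in>UNIV. pd k (a i) z * pd k (b i) \<zeta>)"
    by (rule sum.swap)
  ultimately show ?thesis unfolding Lop_def 1 by simp
qed

text \<open>With x = \<open>bil z \<zeta>\<close>, the operator m + E passes through 1 - x as (1 -
  x) (m + 1 + E) - 1, in either variable. The first order remainders of (m + E) (m + E') cancel the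
  terms E and E' in the remainder -E - E' - N of the Laplacian and leave the scalar 2 m + 1 -
  N.\<close>

lemma Lop_bil_mult:
  fixes K :: "complex^'n \<Rightarrow> complex^'n \<Rightarrow> complex"
  assumes K: "finite_rank K" and z: "norm z < 1" and \<zeta>: "norm \<zeta> < 1"
  shows "Lop m (\<lambda>z \<zeta>. (1 - bil z \<zeta>) * K z \<zeta>) z \<zeta> =
    (1 - bil z \<zeta>) * Lop (Suc m) K z \<zeta> + (2 * of_nat m + 1 - of_nat CARD('n)) * K z \<zeta>"
proof -
  define x where "x = bil z \<zeta>"
  define k where "k = (\<lambda>w. K w \<zeta>)"
  define R where "R = (\<lambda>w. raise m (K w) \<zeta>)"
  define D where "D = (\<lambda>j w. pd j (K w) \<zeta>)"
  have hk: "holo_on k (ball 0 1)" unfolding k_def by (rule finite_rank_holo(2)[OF K \<zeta>])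
  have hR: "holo_on R (ball 0 1)" unfolding R_def by (rule finite_rank_holo(2)[OF finite_rank_raise(1)[OF K] \<zeta>])
  have hD: "holo_on (D j) (ball 0 1)" for j unfolding D_def by (rule finite_rank_holo(2)[OF finite_rank_pd(1)[OF K] \<zeta>])
  have op: "open (ball 0 1 :: (complex^'n) set)" by simp
  have bilk: "holo_on (\<lambda>w. (1 - bil w \<zeta>) * h w) (ball 0 1)" if "holo_on h (ball 0 1)" for h
    using holo_on_mult[OF holo_on_diff[OF holo_on_const holo_on_bil] that, of 1 \<zeta>] by (simp add: bil_commute)
  have 1: "pd j (\<lambda>w. pd j ((\<lambda>\<zeta>. (1 - bil w \<zeta>) * K w \<zeta>)) \<zeta>) z =
      (1 - x) * pd j (D j) z - \<zeta> $ j * D j z - (k z + z $ j * pd j k z)" for j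
  proof -
    have e: "pd j (\<lambda>\<zeta>. (1 - bil w \<zeta>) * K w \<zeta>) \<zeta> = (1 - bil w \<zeta>) * D j w - w $ j * k w" if "norm w < 1" for w
      using bil_mult_pd[OF finite_rank_holo(1)[OF K that] \<zeta>, of j w] by (simp add: D_def k_def bil_commute)
    have "pd j (\<lambda>w. pd j ((\<lambda>\<zeta>. (1 - bil w \<zeta>) * K w \<zeta>)) \<zeta>) z = pd j (\<lambda>w. (1 - bil w \<zeta>) * D j w - w $ j * k w) z"
      by (rule pd_cong_open[OF op]) (use z e in auto)
    also have "\<dots> = pd j (\<lambda>w. (1 - bil w \<zeta>) * D j w) z - pd j (\<lambda>w. w $ j * k w) z"
      by (rule pd_diff[where U = "ball 0 1"]) (use z in \<open>auto intro!: bilk hD holo_on_mult hk\<close>)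
    also have "pd j (\<lambda>w. (1 - bil w \<zeta>) * D j w) z = (1 - x) * pd j (D j) z - \<zeta> $ j * D j z"
      unfolding x_def by (rule bil_mult_pd[OF hD z])
    also have "pd j (\<lambda>w. w $ j * k w) z = k z + z $ j * pd j k z"
      using pd_mult[of "\<lambda>w. w $ j" "ball 0 1" k z j] hk z by simp
    finally show ?thesis .
  qed
  have S1: "(\<Sum>j\<in>UNIV. pd j (\<lambda>w. pd j ((\<lambda>\<zeta>. (1 - bil w \<zeta>) * K w \<zeta>)) \<zeta>) z) =
     (1 - x) * (\<Sum>j\<in>UNIV. pd j (D j) z) - Eu (K z) \<zeta> - (of_nat CARD('n) * k z + Eu k z)"
    unfolding 1 by (simp add: sum_subtractf sum.distrib sum_distrib_left Eu_def D_def)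
  have e: "raise m (\<lambda>\<zeta>. (1 - bil w \<zeta>) * K w \<zeta>) \<zeta> = (1 - bil w \<zeta>) * (R w + k w) - k w" if "norm w < 1" for w
    using bil_mult_raise[OF finite_rank_holo(1)[OF K that] \<zeta>, of m w]
    by (simp add: R_def k_def bil_commute algebra_simps)
  have rdiff: "raise m (\<lambda>w. p w - q w) z = raise m p z - raise m q z" if "holo_on p (ball 0 1)" "holo_on q (ball 0 1)" for p q
    using that z by (simp add: raise_def Eu_def pd_diff[where U = "ball 0 1"] sum_subtractf algebra_simps)
  have radd: "raise m (\<lambda>w. p w + q w) z = raise m p z + raise m q z" if "holo_on p (ball 0 1)" "holo_on q (ball 0 1)" for p q
    using that z by (simp add: raise_def Eu_add[where U = "ball 0 1"] algebra_simps)
  have S2: "raise m (\<lambda>w. raise m (\<lambda>\<zeta>. (1 - bil w \<zeta>) * K w \<zeta>) \<zeta>) z =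
     (1 - x) * (raise m R z + raise m k z) - x * (R z + k z) - raise m k z"
  proof -
    have "raise m (\<lambda>w. raise m (\<lambda>\<zeta>. (1 - bil w \<zeta>) * K w \<zeta>) \<zeta>) z = raise m (\<lambda>w. (1 - bil w \<zeta>) * (R w + k w) - k w) z"
      by (rule raise_cong[OF e z])
    also have "\<dots> = raise m (\<lambda>w. (1 - bil w \<zeta>) * (R w + k w)) z - raise m k z"
      by (intro rdiff bilk holo_on_add hR hk)
    also have "raise m (\<lambda>w. (1 - bil w \<zeta>) * (R w + k w)) z = (1 - x) * raise m (\<lambda>w. R w + k w) z - x * (R z + k z)"
      unfolding x_def by (rule bil_mult_raise[OF holo_on_add[OF hR hk] z])
    finally show ?thesis unfolding radd[OF hR hk] by simp
  qed
  have S3: "raise (Suc m) (\<lambda>w. raise (Suc m) (K w) \<zeta>) z = raise m R z + R z + raise m k z + k z"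
  proof -
    have "raise (Suc m) (\<lambda>w. raise (Suc m) (K w) \<zeta>) z = raise (Suc m) (\<lambda>w. R w + k w) z"
      by (rule raise_cong[OF _ z]) (simp add: raise_def R_def k_def algebra_simps)
    also have "\<dots> = raise m (\<lambda>w. R w + k w) z + (R z + k z)" by (simp add: raise_def algebra_simps)
    finally show ?thesis unfolding radd[OF hR hk] by simp
  qed
  have r: "R z = of_nat m * k z + Eu (K z) \<zeta>" "raise m k z = of_nat m * k z + Eu k z"
    by (simp_all add: R_def raise_def k_def)
  show ?thesis unfolding Lop_def S1 S2 S3 r x_def[symmetric] by (simp add: D_def k_def algebra_simps)
qed

section \<open>Vanishing of tame kernels\<close>

lemma evcomb_kernel_holo:
  assumes L: "evcomb (ball 0 1) L" and K: "finite_rank K"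
  shows "holo_on (\<lambda>z. L (K z)) (ball 0 1)" and "holo_on (\<lambda>\<zeta>. L (\<lambda>z. K z \<zeta>)) (ball 0 1)"
proof -
  obtain T \<gamma> where T: "finite T" "T \<subseteq> ball 0 1" "\<And>f. L f = (\<Sum>x\<in>T. \<gamma> x * f x)" using L unfolding evcomb_def by blast
  have n: "norm x < 1" if "x \<in> T" for x using T(2) that by auto
  show "holo_on (\<lambda>z. L (K z)) (ball 0 1)" "holo_on (\<lambda>\<zeta>. L (\<lambda>z. K z \<zeta>)) (ball 0 1)" unfolding T(3)
    by (intro holo_on_sum holo_on_cmult finite_rank_holo[OF K] n; assumption)+
qed

lemma tame_cong:
  fixes f g :: "complex^'n \<Rightarrow> complex"
  assumes f: "tame f" and e: "\<And>z. norm z < 1 \<Longrightarrow> f z = g z"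
  shows "tame g"
  unfolding tame_def
proof (intro allI impI)
  fix \<epsilon> :: real assume "\<epsilon> > 0"
  then obtain s0 where s0: "s0 > 0" "\<forall>s z. 0 < s \<and> s < s0 \<and> norm z \<le> 1 - s \<longrightarrow> norm (f z) * sqrt s \<le> \<epsilon>"
    using f unfolding tame_def by blast
  show "\<exists>s0>0. \<forall>s z. 0 < s \<and> s < s0 \<and> norm z \<le> 1 - s \<longrightarrow> norm (g z) * sqrt s \<le> \<epsilon>"
  proof (intro exI[of _ s0] conjI allI impI s0(1))
    fix s and z :: "complex^'n" assume sz: "0 < s \<and> s < s0 \<and> norm z \<le> 1 - s"
    hence "f z = g z" by (intro e) linarith
    thus "norm (g z) * sqrt s \<le> \<epsilon>" using s0(2) sz by metis
  qed
qed

lemma one_minus_bil_lower: "norm z < 1 \<Longrightarrow> 1 - norm \<zeta> \<le> norm (1 - bil z \<zeta>)"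
proof -
  assume z: "norm z < 1"
  have "norm (1::complex) - norm (bil z \<zeta>) \<le> norm (1 - bil z \<zeta>)" by (rule norm_triangle_ineq2)
  moreover have "norm z * norm \<zeta> \<le> 1 * norm \<zeta>" using z by (intro mult_right_mono) auto
  ultimately show ?thesis using norm_bil_le[of z \<zeta>] by simp
qed

text \<open>An arbitrary representation of K comes with no growth bound on its factors. The A_i from
  \<open>rank_reduce\<close> are combinations of functions K(., y), hence holomorphic and tame,
  since for fixed \<zeta> the factor (1 - x)^(-m) is bounded; the dual functionals express the B_i
  through K and make them holomorphic. Then \<open>tame_rel_vanish\<close> applies.\<close>

lemma kernel_vanish:
  fixes F K :: "complex^'n \<Rightarrow> complex^'n \<Rightarrow> complex"
  assumes F: "\<And>\<zeta>. norm \<zeta> < 1 \<Longrightarrow> tame (\<lambda>z. F z \<zeta>)" and K: "finite_rank K" and m: "m \<ge> 1"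
    and FK: "\<And>z \<zeta>. norm z < 1 \<Longrightarrow> norm \<zeta> < 1 \<Longrightarrow> F z \<zeta> = (1 - bil z \<zeta>) ^ m * K z \<zeta>"
    and L: "\<And>z \<zeta>. norm z < 1 \<Longrightarrow> norm \<zeta> < 1 \<Longrightarrow> Lop m K z \<zeta> = 0"
    and z: "norm z < 1" and \<zeta>: "norm \<zeta> < 1"
  shows "K z \<zeta> = 0"
proof -
  from K obtain n0 a0 b0 where ab: "\<And>i::nat. i < n0 \<Longrightarrow> holo_on (a0 i) (ball 0 1)" "\<And>i. i < n0 \<Longrightarrow> holo_on (b0 i) (ball 0 1)"
    "\<And>z \<zeta>. norm z < 1 \<Longrightarrow> norm \<zeta> < 1 \<Longrightarrow> K z \<zeta> = (\<Sum>i<n0. a0 i z * b0 i \<zeta>)" by (rule finite_rankE) blast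
  have "\<exists>(n::nat) A B La Ld. (\<forall>x\<in>ball 0 1. \<forall>y\<in>ball 0 1. K x y = (\<Sum>i<n. A i x * B i y)) \<and>
     (\<forall>i<n. evcomb (ball 0 1) (La i) \<and> A i = (\<lambda>x. La i (K x))) \<and>
     (\<forall>i<n. evcomb (ball 0 1) (Ld i) \<and> (\<forall>i'<n. Ld i (A i') = (if i' = i then 1 else 0)))"
    by (rule rank_reduce[of "{..<n0}" _ _ _ a0 b0]) (use ab(3) in auto)
  then obtain n :: nat and A B La Ld where
    rep0: "\<forall>x\<in>ball 0 1. \<forall>y\<in>ball 0 1. K x y = (\<Sum>i<n. A i x * B i y)" and
    La0: "\<forall>i<n. evcomb (ball 0 1) (La i) \<and> A i = (\<lambda>x. La i (K x))" and
    Ld0: "\<forall>i<n. evcomb (ball 0 1) (Ld i) \<and> (\<forall>i'<n. Ld i (A i') = (if i' = i then 1 else 0))" by blast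
  have rep: "K z \<zeta> = (\<Sum>i<n. A i z * B i \<zeta>)" if "norm z < 1" "norm \<zeta> < 1" for z \<zeta> using rep0 that by simp
  have La: "evcomb (ball 0 1) (La i)" "A i = (\<lambda>x. La i (K x))" if "i < n" for i using La0 that by blast+
  have Ld: "evcomb (ball 0 1) (Ld i)" "Ld i (A i') = (if i' = i then 1 else 0)" if "i < n" "i' < n" for i i' using Ld0 that by blast+
  have hA: "holo_on (A i) (ball 0 1)" if "i < n" for i
    unfolding La(2)[OF that] by (rule evcomb_kernel_holo(1)[OF La(1)[OF that] K])
  have hB: "holo_on (B i) (ball 0 1)" if i: "i < n" for i
  proof (rule holo_on_cong)
    show "holo_on (\<lambda>\<zeta>. Ld i (\<lambda>z. K z \<zeta>)) (ball 0 1)" by (rule evcomb_kernel_holo(2)[OF Ld(1)[OF i i] K])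
    fix w :: "complex^'n" assume w: "w \<in> ball 0 1"
    have "Ld i (\<lambda>z. K z w) = Ld i (\<lambda>z. \<Sum>i'<n. A i' z * B i' w)"
      by (rule evcomb_cong[OF Ld(1)[OF i i]], rule rep) (use w in simp_all)
    also have "\<dots> = (\<Sum>i'<n. Ld i (A i') * B i' w)" by (rule evcomb_sum[OF Ld(1)[OF i i]])
    also have "\<dots> = (\<Sum>i'<n. if i' = i then B i' w else 0)" by (intro sum.cong refl) (simp add: Ld(2)[OF i])
    also have "\<dots> = B i w" using i by simp
    finally show "Ld i (\<lambda>z. K z w) = B i w" .
  qed simp
  have tK: "tame (\<lambda>z. K z \<zeta>)" if \<zeta>: "norm \<zeta> < 1" for \<zeta>
  proof (rule tame_cong)
    show "tame (\<lambda>z. inverse (1 - bil z \<zeta>) ^ m * F z \<zeta>)"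
    proof (rule tame_mult_bdd[OF F[OF \<zeta>]])
      fix z :: "complex^'n" assume z: "norm z < 1"
      show "norm (inverse (1 - bil z \<zeta>) ^ m) \<le> inverse (1 - norm \<zeta>) ^ m" unfolding norm_power norm_inverse
        using \<zeta> one_minus_bil_lower[OF z, of \<zeta>] by (intro power_mono le_imp_inverse_le) auto
    qed
    fix z :: "complex^'n" assume z: "norm z < 1"
    show "inverse (1 - bil z \<zeta>) ^ m * F z \<zeta> = K z \<zeta>"
      unfolding FK[OF z \<zeta>] using one_minus_bil_nonzero[OF z \<zeta>] by (simp add: power_mult_distrib[symmetric] mult.assoc[symmetric])
  qed
  have tA: "tame (A i)" if i: "i < n" for i
  proof -
    obtain T \<gamma> where T: "T \<subseteq> ball 0 1" "\<And>f. La i f = (\<Sum>x\<in>T. \<gamma> x * f x)" using La(1)[OF i] unfolding evcomb_def by blast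
    have "tame (\<lambda>z. \<Sum>y\<in>T. \<gamma> y * K z y)"
    proof (rule tame_sum)
      fix y assume "y \<in> T"
      hence "norm y < 1" using T(1) by auto
      thus "tame (\<lambda>z. \<gamma> y * K z y)" by (intro tame_mult_bdd[OF tK, where C = "norm (\<gamma> y)"]) auto
    qed
    thus ?thesis unfolding La(2)[OF i] T(2) .
  qed
  have "rel m m {..<n} A B 1 1"
    unfolding rel_def
  proof (intro ballI)
    fix z \<zeta> :: "complex^'n" assume "z \<in> ball 0 1" "\<zeta> \<in> ball 0 1"
    hence z\<zeta>: "norm z < 1" "norm \<zeta> < 1" by auto
    have "Lop m K z \<zeta> = (\<Sum>i<n. \<Sum>k\<in>UNIV. pd k (A i) z * pd k (B i) \<zeta>) - (\<Sum>i<n. raise m (A i) z * raise m (B i) \<zeta>)"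
      by (rule Lop_sum[OF _ _ _ z\<zeta>]) (use hA hB rep in auto)
    thus "(\<Sum>i<n. \<Sum>k\<in>UNIV. pd k (A i) z * pd k (B i) \<zeta>) =
      (\<Sum>i<n. (of_nat m * A i z + Eu (A i) z) * (of_nat m * B i \<zeta> + Eu (B i) \<zeta>))"
      unfolding L[OF z\<zeta>] raise_def by simp
  qed
  note R = this
  have "B i \<zeta> = 0" if "i < n" for i
    by (rule tame_rel_vanish[OF hA hB R m tA _ _ that \<zeta>, where Ld = Ld]) (use Ld in auto)
  thus ?thesis unfolding rep[OF z \<zeta>] by simp
qed

text \<open>The reduction is applied to the kernel of z-derivatives, indexed by pairs (l, z),
  because a relation of order zero involves the first factors only through their derivatives, and
  \<open>tame_rel_const\<close> needs functionals dual to these.\<close>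

lemma kernel_mixed_zero:
  fixes F :: "complex^'n \<Rightarrow> complex^'n \<Rightarrow> complex"
  assumes tF: "\<And>\<zeta>. norm \<zeta> < 1 \<Longrightarrow> tame (\<lambda>z. F z \<zeta>)" and F: "finite_rank F"
    and L: "\<And>z \<zeta>. norm z < 1 \<Longrightarrow> norm \<zeta> < 1 \<Longrightarrow> Lop 0 F z \<zeta> = 0"
    and z: "norm z < 1" and \<zeta>: "norm \<zeta> < 1"
  shows "pd j (\<lambda>w. pd k (F w) \<zeta>) z = 0"
proof -
  from F obtain n0 a0 b0 where ab: "\<And>i::nat. i < n0 \<Longrightarrow> holo_on (a0 i) (ball 0 1)" "\<And>i. i < n0 \<Longrightarrow> holo_on (b0 i) (ball 0 1)"
    "\<And>z \<zeta>. norm z < 1 \<Longrightarrow> norm \<zeta> < 1 \<Longrightarrow> F z \<zeta> = (\<Sum>i<n0. a0 i z * b0 i \<zeta>)" by (rule finite_rankE) blast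
  have op: "open (ball 0 1 :: (complex^'n) set)" by simp
  define S where "S = (UNIV :: 'n set) \<times> (ball 0 1 :: (complex^'n) set)"
  define K where "K = (\<lambda>x \<zeta>. pd (fst x) (\<lambda>w. F w \<zeta>) (snd x))"
  have K: "K x \<zeta> = (\<Sum>i<n0. pd (fst x) (a0 i) (snd x) * b0 i \<zeta>)" if "norm (snd x) < 1" "norm \<zeta> < 1" for x \<zeta>
    unfolding K_def by (rule pd_kernel_sum(2)[OF _ _ _ that]) (use ab in auto)
  have "\<exists>(n::nat) A B La Ld. (\<forall>x\<in>S. \<forall>y\<in>ball 0 1. K x y = (\<Sum>i<n. A i x * B i y)) \<and>
     (\<forall>i<n. evcomb (ball 0 1) (La i) \<and> A i = (\<lambda>x. La i (K x))) \<and>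
     (\<forall>i<n. evcomb S (Ld i) \<and> (\<forall>i'<n. Ld i (A i') = (if i' = i then 1 else 0)))"
    by (rule rank_reduce[of "{..<n0}" _ _ _ "\<lambda>i x. pd (fst x) (a0 i) (snd x)" b0]) (use K in \<open>auto simp: S_def\<close>)
  then obtain n :: nat and A B La Ld where
    rep0: "\<forall>x\<in>S. \<forall>y\<in>ball 0 1. K x y = (\<Sum>i<n. A i x * B i y)" and
    La0: "\<forall>i<n. evcomb (ball 0 1) (La i) \<and> A i = (\<lambda>x. La i (K x))" and
    Ld0: "\<forall>i<n. evcomb S (Ld i) \<and> (\<forall>i'<n. Ld i (A i') = (if i' = i then 1 else 0))" by blast
  have rep: "K (l, z) \<zeta> = (\<Sum>i<n. A i (l, z) * B i \<zeta>)" if "norm z < 1" "norm \<zeta> < 1" for l z \<zeta> using rep0 that by (simp add: S_def)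
  have La: "evcomb (ball 0 1) (La i)" "A i = (\<lambda>x. La i (K x))" if "i < n" for i using La0 that by blast+
  have Ld: "evcomb S (Ld i)" "Ld i (A i') = (if i' = i then 1 else 0)" if "i < n" "i' < n" for i i' using Ld0 that by blast+
  \<comment> \<open>Primitives of the reduced coefficients: \<open>La i\<close> acts in \<zeta> and
    commutes with \<open>pd l\<close>, so \<open>pd l (f i)\<close> is A_i(l, .). As combinations of
    functions F(., y) they inherit the growth of F.\<close>
  define f where "f = (\<lambda>i z. La i (F z))"
  have hf: "holo_on (f i) (ball 0 1)" if "i < n" for i
    unfolding f_def by (rule evcomb_kernel_holo(1)[OF La(1)[OF that] F])
  have tf: "tame (f i)" if i: "i < n" for i
  proof -
    obtain T \<gamma> where T: "T \<subseteq> ball 0 1" "\<And>f. La i f = (\<Sum>x\<in>T. \<gamma> x * f x)" using La(1)[OF i] unfolding evcomb_def by blast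
    have "tame (\<lambda>z. \<Sum>y\<in>T. \<gamma> y * F z y)"
    proof (rule tame_sum)
      fix y assume "y \<in> T"
      hence "norm y < 1" using T(1) by auto
      thus "tame (\<lambda>z. \<gamma> y * F z y)" by (intro tame_mult_bdd[OF tF, where C = "norm (\<gamma> y)"]) auto
    qed
    thus ?thesis unfolding f_def T(2) .
  qed
  have pf: "pd l (f i) z = A i (l, z)" if i: "i < n" and z: "norm z < 1" for i l z
  proof -
    obtain T \<gamma> where T: "T \<subseteq> ball 0 1" "\<And>f. La i f = (\<Sum>x\<in>T. \<gamma> x * f x)" using La(1)[OF i] unfolding evcomb_def by blast
    have n: "norm y < 1" if "y \<in> T" for y using T(1) that by auto
    have "pd l (f i) z = pd l (\<lambda>z. \<Sum>y\<in>T. \<gamma> y * F z y) z" unfolding f_def T(2) ..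
    also have "\<dots> = (\<Sum>y\<in>T. pd l (\<lambda>z. \<gamma> y * F z y) z)"
      by (rule pd_sum[where U = "ball 0 1"]) (use z in \<open>auto intro!: holo_on_cmult finite_rank_holo[OF F] n\<close>)
    also have "\<dots> = (\<Sum>y\<in>T. \<gamma> y * pd l (\<lambda>z. F z y) z)"
      by (intro sum.cong refl pd_cmult[where U = "ball 0 1"]) (use z in \<open>auto intro!: finite_rank_holo[OF F] n\<close>)
    finally show ?thesis unfolding La(2)[OF i] T(2) K_def by simp
  qed
  have hB: "holo_on (B i) (ball 0 1)" if i: "i < n" for i
  proof (rule holo_on_cong[OF op])
    obtain T \<gamma> where T: "T \<subseteq> S" "\<And>f. Ld i f = (\<Sum>x\<in>T. \<gamma> x * f x)" using Ld(1)[OF i i] unfolding evcomb_def by blast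
    have n: "norm (snd x) < 1" if "x \<in> T" for x using T(1) that by (auto simp: S_def)
    have hK: "holo_on (K x) (ball 0 1)" if "x \<in> T" for x
      unfolding K_def using finite_rank_holo(1)[OF finite_rank_pd(2)[OF F] n[OF that]] .
    show "holo_on (\<lambda>\<zeta>. Ld i (\<lambda>x. K x \<zeta>)) (ball 0 1)" unfolding T(2) by (intro holo_on_sum holo_on_cmult hK)
    fix w :: "complex^'n" assume w: "w \<in> ball 0 1"
    have "Ld i (\<lambda>x. K x w) = Ld i (\<lambda>x. \<Sum>i'<n. A i' x * B i' w)"
      by (rule evcomb_cong[OF Ld(1)[OF i i]]) (use w rep0 in blast)
    also have "\<dots> = (\<Sum>i'<n. Ld i (A i') * B i' w)" by (rule evcomb_sum[OF Ld(1)[OF i i]])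
    also have "\<dots> = (\<Sum>i'<n. if i' = i then B i' w else 0)" by (intro sum.cong refl) (simp add: Ld(2)[OF i])
    also have "\<dots> = B i w" using i by simp
    finally show "Ld i (\<lambda>x. K x w) = B i w" .
  qed
  have pK: "pd k (\<lambda>\<zeta>. K (l, z) \<zeta>) \<zeta> = (\<Sum>i<n. A i (l, z) * pd k (B i) \<zeta>)" if "norm z < 1" "norm \<zeta> < 1" for k l z \<zeta>
  proof -
    have "pd k (\<lambda>\<zeta>. K (l, z) \<zeta>) \<zeta> = pd k (\<lambda>\<zeta>. \<Sum>i<n. A i (l, z) * B i \<zeta>) \<zeta>"
      by (rule pd_cong_open[OF op]) (use that rep in auto)
    also have "\<dots> = (\<Sum>i<n. pd k (\<lambda>\<zeta>. A i (l, z) * B i \<zeta>) \<zeta>)"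
      by (rule pd_sum[where U = "ball 0 1"]) (use hB that in \<open>auto intro: holo_on_cmult\<close>)
    also have "\<dots> = (\<Sum>i<n. A i (l, z) * pd k (B i) \<zeta>)"
      by (intro sum.cong refl pd_cmult[where U = "ball 0 1"]) (use hB that in auto)
    finally show ?thesis .
  qed
  have mix: "pd l (\<lambda>w. pd k (F w) \<zeta>) z = (\<Sum>i<n. A i (l, z) * pd k (B i) \<zeta>)" if z: "norm z < 1" and \<zeta>: "norm \<zeta> < 1" for k l z \<zeta>
  proof -
    have hb: "holo_on (pd k (b0 i)) (ball 0 1)" if "i < n0" for i by (rule holo_on_pd[OF ab(2)[OF that] op])
    have ha: "holo_on (pd l (a0 i)) (ball 0 1)" if "i < n0" for i by (rule holo_on_pd[OF ab(1)[OF that] op])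
    have "pd l (\<lambda>w. pd k (F w) \<zeta>) z = (\<Sum>i<n0. pd l (a0 i) z * pd k (b0 i) \<zeta>)"
      by (rule pd_kernel_sum(2)[where a = a0 and b = "\<lambda>i. pd k (b0 i)" and K = "\<lambda>w \<zeta>. pd k (F w) \<zeta>", OF _ _ _ z \<zeta>])
         (use ab hb in \<open>auto intro!: pd_kernel_sum(1)\<close>)
    also have "\<dots> = pd k (K (l, z)) \<zeta>"
      using pd_kernel_sum(1)[of "{..<n0}" "\<lambda>i. pd l (a0 i)" b0 "\<lambda>z. K (l, z)" z \<zeta> k] ab ha K z \<zeta> by simp
    also have "\<dots> = (\<Sum>i<n. A i (l, z) * pd k (B i) \<zeta>)" by (rule pK[OF z \<zeta>])
    finally show ?thesis .
  qed
  have "rel 0 0 {..<n} f B 1 1"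
    unfolding rel_def
  proof (intro ballI)
    fix z \<zeta> :: "complex^'n" assume "z \<in> ball 0 1" "\<zeta> \<in> ball 0 1"
    hence z\<zeta>: "norm z < 1" "norm \<zeta> < 1" by auto
    have "(\<Sum>i<n. \<Sum>k\<in>UNIV. pd k (f i) z * pd k (B i) \<zeta>) = (\<Sum>k\<in>UNIV. \<Sum>i<n. A i (k, z) * pd k (B i) \<zeta>)"
      by (subst sum.swap) (simp add: pf z\<zeta>)
    also have "\<dots> = (\<Sum>k\<in>UNIV. pd k (\<lambda>w. pd k (F w) \<zeta>) z)" by (simp add: mix z\<zeta>)
    also have "\<dots> = Eu (\<lambda>w. Eu (F w) \<zeta>) z" using L[OF z\<zeta>] by (simp add: Lop_def raise_def)
    also have "\<dots> = (\<Sum>l\<in>UNIV. z $ l * (\<Sum>k\<in>UNIV. \<zeta> $ k * pd l (\<lambda>w. pd k (F w) \<zeta>) z))"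
      unfolding Eu_def
    proof (intro sum.cong refl arg_cong2[where f = "(*)"])
      fix l
      have h: "holo_on (\<lambda>w. pd k (F w) \<zeta>) (ball 0 1)" for k by (rule finite_rank_holo(2)[OF finite_rank_pd(1)[OF F] z\<zeta>(2)])
      have "pd l (\<lambda>w. \<Sum>k\<in>UNIV. \<zeta> $ k * pd k (F w) \<zeta>) z = (\<Sum>k\<in>UNIV. pd l (\<lambda>w. \<zeta> $ k * pd k (F w) \<zeta>) z)"
        by (rule pd_sum[where U = "ball 0 1"]) (use z\<zeta> h in \<open>auto intro: holo_on_cmult\<close>)
      also have "\<dots> = (\<Sum>k\<in>UNIV. \<zeta> $ k * pd l (\<lambda>w. pd k (F w) \<zeta>) z)"
        by (intro sum.cong refl pd_cmult[where U = "ball 0 1"]) (use z\<zeta> h in auto)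
      finally show "pd l (\<lambda>w. \<Sum>k\<in>UNIV. \<zeta> $ k * pd k (F w) \<zeta>) z = \<dots>" .
    qed
    also have "\<dots> = (\<Sum>l\<in>UNIV. \<Sum>k\<in>UNIV. \<Sum>i<n. z $ l * A i (l, z) * (\<zeta> $ k * pd k (B i) \<zeta>))"
      unfolding mix[OF z\<zeta>] by (simp add: sum_distrib_left mult_ac)
    also have "\<dots> = (\<Sum>i<n. \<Sum>l\<in>UNIV. \<Sum>k\<in>UNIV. z $ l * A i (l, z) * (\<zeta> $ k * pd k (B i) \<zeta>))"
      by (subst sum.swap[of _ "{..<n}"]) (subst sum.swap[of _ "{..<n}" UNIV], rule refl)
    also have "\<dots> = (\<Sum>i<n. Eu (f i) z * Eu (B i) \<zeta>)"
      unfolding Eu_def by (intro sum.cong refl) (simp add: pf z\<zeta> sum_product)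
    finally show "(\<Sum>i<n. \<Sum>k\<in>UNIV. pd k (f i) z * pd k (B i) \<zeta>) =
      (\<Sum>i<n. (of_nat 0 * f i z + Eu (f i) z) * (of_nat 0 * B i \<zeta> + Eu (B i) \<zeta>))" by simp
  qed
  moreover have "Ld i (\<lambda>x. pd (fst x) (f i') (snd x)) = (if i' = i then 1 else 0)" if "i < n" "i' < n" for i i'
  proof -
    have "Ld i (\<lambda>x. pd (fst x) (f i') (snd x)) = Ld i (A i')"
      by (rule evcomb_cong[OF Ld(1)[OF that]]) (use pf that in \<open>auto simp: S_def\<close>)
    thus ?thesis using Ld(2)[OF that] by simp
  qed
  \<comment> \<open>E B_i = 0 forces B_i to be constant, by \<open>raise_ray\<close> with j = 0, so
    every mixed derivative of F vanishes.\<close>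
  ultimately have E0: "Eu (B i) w = 0" if "i < n" "norm w < 1" for i w
    by (intro tame_rel_const[where f = f and Ld = Ld, OF hf hB _ tf _ _ that]) (use Ld in \<open>auto simp: S_def\<close>)
  have "pd k (B i) \<zeta> = 0" if "i < n" for i
  proof -
    have r0: "raise 0 (B i) w = 0" if "w \<in> ball 0 1" for w
      using E0[OF \<open>i < n\<close>, of w] that by (simp add: raise_def)
    have c: "B i w = B i 0" if "w \<in> ball 0 1" for w
    proof -
      have "B i w = 0 ^ 0 * B i 0" by (rule raise_ray[OF hB[OF \<open>i < n\<close>] that r0])
      thus ?thesis by (simp only: power_0 mult_1)
    qed
    have "pd k (B i) \<zeta> = pd k (\<lambda>w. B i 0) \<zeta>" by (rule pd_cong_open[OF op _ c]) (use \<zeta> in simp_all)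
    thus ?thesis by simp
  qed
  thus ?thesis unfolding mix[OF z \<zeta>] by simp
qed

section \<open>Divisibility by all powers\<close>

text \<open>Only the first variable is ever differentiated, so the coefficients in \<tau> may be
  arbitrary functions; t ranges over a domain that shrinks in the induction.\<close>

definition separable :: "complex set \<Rightarrow> (complex \<Rightarrow> complex \<Rightarrow> complex) \<Rightarrow> bool" where
  "separable D K \<longleftrightarrow> (\<exists>(n::nat) a b. (\<forall>i<n. a i holomorphic_on D) \<and>
     (\<forall>t\<in>D. \<forall>\<tau>\<in>ball 0 1. K t \<tau> = (\<Sum>i<n. a i t * b i \<tau>)))"

lemma separableE:
  assumes "separable D K"
  obtains n :: nat and a b where "\<And>i. i < n \<Longrightarrow> a i holomorphic_on D"
    "\<And>t \<tau>. t \<in> D \<Longrightarrow> norm \<tau> < 1 \<Longrightarrow> K t \<tau> = (\<Sum>i<n. a i t * b i \<tau>)"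
proof -
  obtain n :: nat and a b where *: "\<forall>i<n. a i holomorphic_on D"
    "\<forall>t\<in>D. \<forall>\<tau>\<in>ball 0 1. K t \<tau> = (\<Sum>i<n. a i t * b i \<tau>)"
    using assms unfolding separable_def by blast
  show thesis by (rule that[of n a b]) (use * in auto)
qed

lemma separable_sumI:
  assumes "finite I" "\<And>i. i \<in> I \<Longrightarrow> a i holomorphic_on D"
    "\<And>t \<tau>. t \<in> D \<Longrightarrow> norm \<tau> < 1 \<Longrightarrow> K t \<tau> = (\<Sum>i\<in>I. a i t * b i \<tau>)"
  shows "separable D K"
proof -
  obtain h where h: "bij_betw h {..<card I} I" using ex_bij_betw_nat_finite[OF assms(1)] by (auto simp: atLeast0LessThan)
  have m: "h i \<in> I" if "i < card I" for i using h that by (auto simp: bij_betw_def)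
  have "K t \<tau> = (\<Sum>i<card I. a (h i) t * b (h i) \<tau>)" if "t \<in> D" "norm \<tau> < 1" for t \<tau>
    unfolding assms(3)[OF that] using sum.reindex_bij_betw[OF h, of "\<lambda>i. a i t * b i \<tau>"] by simp
  thus ?thesis unfolding separable_def
    by (intro exI[of _ "card I"] exI[of _ "\<lambda>i. a (h i)"] exI[of _ "\<lambda>i. b (h i)"]) (auto intro: assms m)
qed

lemma separable_cong:
  assumes K: "separable D K" and e: "\<And>t \<tau>. t \<in> D \<Longrightarrow> norm \<tau> < 1 \<Longrightarrow> K t \<tau> = L t \<tau>"
  shows "separable D L"
proof -
  from K obtain n a b where ab: "\<And>i::nat. i < n \<Longrightarrow> a i holomorphic_on D"
    "\<And>t \<tau>. t \<in> D \<Longrightarrow> norm \<tau> < 1 \<Longrightarrow> K t \<tau> = (\<Sum>i<n. a i t * b i \<tau>)" by (rule separableE) blast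
  show ?thesis by (rule separable_sumI[of "{..<n}" a _ _ b]) (simp_all add: ab e[symmetric])
qed

lemma one_minus_mult_nonzero: "norm t < 1 \<Longrightarrow> norm \<tau> < 1 \<Longrightarrow> 1 - t * \<tau> \<noteq> (0::complex)"
proof
  assume "norm t < 1" "norm \<tau> < 1" "1 - t * \<tau> = 0"
  hence "norm (t * \<tau>) = 1" by simp
  moreover have "norm (t * \<tau>) \<le> 1 * norm \<tau>" unfolding norm_mult using \<open>norm t < 1\<close> by (intro mult_right_mono) auto
  ultimately show False using \<open>norm \<tau> < 1\<close> by simp
qed

text \<open>The pole at 1 / \<tau> belongs to one fraction only. Clearing denominators gives a
  polynomial identity on D, hence everywhere, and at t = 1 / \<tau> it says that the product over S
  vanishes there, which is excluded.\<close>

lemma simple_fractions_independent: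
  fixes S :: "complex set"
  assumes D: "open D" "D \<noteq> {}" "D \<subseteq> ball 0 1" and S: "finite S" "S \<subseteq> ball 0 1"
    and \<tau>: "norm \<tau> < 1" "\<tau> \<noteq> 0" "\<tau> \<notin> S"
    and e: "\<And>t. t \<in> D \<Longrightarrow> inverse (1 - t * \<tau>) = (\<Sum>\<sigma>\<in>S. c \<sigma> * inverse (1 - t * \<sigma>))"
  shows False
proof -
  define P where "P = (\<lambda>S t. \<Prod>\<sigma>\<in>S. 1 - t * \<sigma> :: complex)"
  define Q where "Q = (\<lambda>t. P S t - (1 - t * \<tau>) * (\<Sum>\<sigma>\<in>S. c \<sigma> * P (S - {\<sigma>}) t))"
  have "Q t = 0" if t: "t \<in> D" for t
  proof -
    have t1: "norm t < 1" using t D(3) by auto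
    have "P S t * inverse (1 - t * \<sigma>) = P (S - {\<sigma>}) t" if "\<sigma> \<in> S" for \<sigma>
    proof -
      have "1 - t * \<sigma> \<noteq> 0" using one_minus_mult_nonzero[OF t1, of \<sigma>] S(2) that by auto
      thus ?thesis unfolding P_def prod.remove[OF S(1) that] by simp
    qed
    hence "P S t * inverse (1 - t * \<tau>) = (\<Sum>\<sigma>\<in>S. c \<sigma> * P (S - {\<sigma>}) t)"
      unfolding e[OF t] sum_distrib_left by (intro sum.cong refl) (simp add: mult.left_commute)
    hence "Q t = P S t - (1 - t * \<tau>) * (P S t * inverse (1 - t * \<tau>))" unfolding Q_def by simp
    thus ?thesis using one_minus_mult_nonzero[OF t1 \<tau>(1)] by simp
  qed
  moreover have "Q holomorphic_on UNIV" unfolding Q_def P_def by (intro holomorphic_intros)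
  ultimately have "Q (inverse \<tau>) = 0"
    using analytic_continuation_open[of D UNIV Q "\<lambda>_. 0" "inverse \<tau>"] D by auto
  hence "P S (inverse \<tau>) = 0" unfolding Q_def using \<tau>(2) by simp
  then obtain \<sigma> where "\<sigma> \<in> S" "1 - inverse \<tau> * \<sigma> = 0" unfolding P_def using S(1) by auto
  thus False using \<tau>(2,3) by (simp add: field_simps)
qed

text \<open>In the reduced form every coefficient A_i is a combination of fractions 1 / (1 - t
  \<sigma>) with \<sigma> in a finite set S. If T were infinite, the fraction of some further \<tau>
  in T would be a combination of these.\<close>

lemma finite_simple_fractions:
  fixes a :: "nat \<Rightarrow> complex \<Rightarrow> complex"
  assumes D: "open D" "D \<noteq> {}" "D \<subseteq> ball 0 1" and T: "T \<subseteq> ball 0 1" "\<And>\<tau>. \<tau> \<in> T \<Longrightarrow> \<kappa> \<tau> \<noteq> 0"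
    and e: "\<And>t \<tau>. t \<in> D \<Longrightarrow> \<tau> \<in> T \<Longrightarrow> \<kappa> \<tau> * inverse (1 - t * \<tau>) = (\<Sum>i<n0. a i t * b i \<tau>)"
  shows "finite T"
proof (rule ccontr)
  assume inf: "infinite T"
  define K where "K = (\<lambda>t \<tau>. inverse (1 - t * \<tau>) :: complex)"
  have K: "K t \<tau> = (\<Sum>i<n0. a i t * (b i \<tau> / \<kappa> \<tau>))" if "t \<in> D" "\<tau> \<in> T" for t \<tau>
  proof -
    have "K t \<tau> = (\<Sum>i<n0. a i t * b i \<tau>) / \<kappa> \<tau>" unfolding e[OF that, symmetric] K_def using T(2)[OF that(2)] by simp
    thus ?thesis by (simp add: sum_divide_distrib)
  qed
  have "\<exists>(n::nat) A B La Ld. (\<forall>x\<in>D. \<forall>y\<in>T. K x y = (\<Sum>i<n. A i x * B i y)) \<and>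
     (\<forall>i<n. evcomb T (La i) \<and> A i = (\<lambda>x. La i (K x))) \<and>
     (\<forall>i<n. evcomb D (Ld i) \<and> (\<forall>i'<n. Ld i (A i') = (if i' = i then 1 else 0)))"
    by (rule rank_reduce[of "{..<n0}" _ _ _ a "\<lambda>i \<tau>. b i \<tau> / \<kappa> \<tau>"]) (use K in auto)
  then obtain n :: nat and A B La where rep: "\<forall>x\<in>D. \<forall>y\<in>T. K x y = (\<Sum>i<n. A i x * B i y)" and
    La: "\<forall>i<n. evcomb T (La i) \<and> A i = (\<lambda>x. La i (K x))" by blast
  have "\<forall>i\<in>{..<n}. \<exists>p. finite (fst p) \<and> fst p \<subseteq> T \<and> (\<forall>f. La i f = (\<Sum>x\<in>fst p. snd p x * f x))"
  proof
    fix i assume "i \<in> {..<n}"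
    hence "evcomb T (La i)" using La by simp
    then obtain U \<gamma> where "finite U" "U \<subseteq> T" "\<forall>f. La i f = (\<Sum>x\<in>U. \<gamma> x * f x)" unfolding evcomb_def by blast
    thus "\<exists>p. finite (fst p) \<and> fst p \<subseteq> T \<and> (\<forall>f. La i f = (\<Sum>x\<in>fst p. snd p x * f x))"
      by (intro exI[of _ "(U, \<gamma>)"]) simp
  qed
  from bchoice[OF this] obtain p where p: "\<forall>i\<in>{..<n}. finite (fst (p i)) \<and> fst (p i) \<subseteq> T \<and> (\<forall>f. La i f = (\<Sum>x\<in>fst (p i). snd (p i) x * f x))" by (rule exE)
  define S where "S = (\<Union>i<n. fst (p i))"
  have S: "finite S" "S \<subseteq> T" using p by (auto simp: S_def)
  \<comment> \<open>The value 0 is excluded because its fraction is constant and has no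
    pole.\<close>
  have "infinite (T - (S \<union> {0}))" using inf S(1) by (intro Diff_infinite_finite) auto
  hence "T - (S \<union> {0}) \<noteq> {}" by (rule infinite_imp_nonempty)
  then obtain \<tau> where \<tau>: "\<tau> \<in> T" "\<tau> \<notin> S" "\<tau> \<noteq> 0" by blast
  define c where "c = (\<lambda>\<sigma>. \<Sum>i<n. if \<sigma> \<in> fst (p i) then B i \<tau> * snd (p i) \<sigma> else 0)"
  have "inverse (1 - t * \<tau>) = (\<Sum>\<sigma>\<in>S. c \<sigma> * inverse (1 - t * \<sigma>))" if t: "t \<in> D" for t
  proof -
    have "inverse (1 - t * \<tau>) = (\<Sum>i<n. A i t * B i \<tau>)" using rep t \<tau>(1) by (simp add: K_def)
    also have "\<dots> = (\<Sum>i<n. \<Sum>\<sigma>\<in>S. (if \<sigma> \<in> fst (p i) then B i \<tau> * snd (p i) \<sigma> else 0) * inverse (1 - t * \<sigma>))"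
    proof (intro sum.cong refl)
      fix i assume i: "i \<in> {..<n}"
      have "A i t * B i \<tau> = (\<Sum>\<sigma>\<in>fst (p i). (if \<sigma> \<in> fst (p i) then B i \<tau> * snd (p i) \<sigma> else 0) * inverse (1 - t * \<sigma>))"
        using La i p by (simp add: K_def sum_distrib_left sum_distrib_right mult_ac)
      also have "\<dots> = (\<Sum>\<sigma>\<in>S. (if \<sigma> \<in> fst (p i) then B i \<tau> * snd (p i) \<sigma> else 0) * inverse (1 - t * \<sigma>))"
        by (rule sum.mono_neutral_left) (use S(1) i in \<open>auto simp: S_def\<close>)
      finally show "A i t * B i \<tau> = \<dots>" .
    qed
    also have "\<dots> = (\<Sum>\<sigma>\<in>S. c \<sigma> * inverse (1 - t * \<sigma>))"
      unfolding c_def sum_distrib_right by (rule sum.swap)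
    finally show ?thesis .
  qed
  moreover have "S \<subseteq> ball 0 1" "norm \<tau> < 1" using S(2) T(1) \<tau>(1) by auto
  ultimately show False using simple_fractions_independent[OF D S(1) _ _ \<tau>(3,2)] by blast
qed

text \<open>G is (1 - t \<tau>)^(m+1) times a separable sum. The product rule loses one power, and
  the factors t and \<tau> that it produces are distributed to the two sides.\<close>

lemma separable_deriv:
  assumes D: "open D" "D \<subseteq> ball 0 1" and G: "\<And>\<tau>. norm \<tau> < 1 \<Longrightarrow> (\<lambda>t. G t \<tau>) holomorphic_on D"
    and sep: "separable D (\<lambda>t \<tau>. G t \<tau> * inverse (1 - t * \<tau>) ^ Suc m)"
  shows "separable D (\<lambda>t \<tau>. deriv (\<lambda>t. G t \<tau>) t * inverse (1 - t * \<tau>) ^ m)"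
proof -
  from sep obtain n a b where ab: "\<And>i::nat. i < n \<Longrightarrow> a i holomorphic_on D"
    "\<And>t \<tau>. t \<in> D \<Longrightarrow> norm \<tau> < 1 \<Longrightarrow> G t \<tau> * inverse (1 - t * \<tau>) ^ Suc m = (\<Sum>i<n. a i t * b i \<tau>)" by (rule separableE) blast
  let ?a = "case_sum (\<lambda>i. deriv (a i)) (\<lambda>i t. - (t * deriv (a i) t) - of_nat (Suc m) * a i t)"
  let ?b = "case_sum b (\<lambda>i \<tau>. \<tau> * b i \<tau>)"
  have ha: "?a i holomorphic_on D" if "i \<in> {..<n} <+> {..<n}" for i
    using that D(1) ab(1) by (auto intro!: holomorphic_intros)
  show ?thesis
  proof (rule separable_sumI[of "{..<n} <+> {..<n}" ?a _ _ ?b, OF _ ha])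
    fix t \<tau> :: complex assume t: "t \<in> D" and \<tau>: "norm \<tau> < 1"
    have nz: "1 - t * \<tau> \<noteq> 0" if "t \<in> D" for t using one_minus_mult_nonzero[OF _ \<tau>] D(2) that by auto
    have e: "(1 - t * \<tau>) ^ Suc m * (\<Sum>i<n. a i t * b i \<tau>) = G t \<tau>" if "t \<in> D" for t
      unfolding ab(2)[OF that \<tau>, symmetric] using nz[OF that]
      by (simp add: power_inverse del: power_Suc)
    have da: "(a i has_field_derivative deriv (a i) t) (at t)" if "i < n" for i
      by (rule holomorphic_derivI[OF ab(1)[OF that] D(1) t])
    have "((\<lambda>t. (1 - t * \<tau>) ^ Suc m * (\<Sum>i<n. a i t * b i \<tau>)) has_field_derivative
       ((1 - t * \<tau>) ^ Suc m * (\<Sum>i<n. deriv (a i) t * b i \<tau>) + of_nat (Suc m) * ((1 - t * \<tau>) ^ m * - \<tau>) * (\<Sum>i<n. a i t * b i \<tau>))) (at t)"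
      by (rule derivative_eq_intros refl da | simp)+
    hence "((\<lambda>t. G t \<tau>) has_field_derivative
       ((1 - t * \<tau>) ^ Suc m * (\<Sum>i<n. deriv (a i) t * b i \<tau>) + of_nat (Suc m) * ((1 - t * \<tau>) ^ m * - \<tau>) * (\<Sum>i<n. a i t * b i \<tau>))) (at t)"
      by (rule has_field_derivative_transform_within_open[OF _ D(1) t e])
    hence "deriv (\<lambda>t. G t \<tau>) t = (1 - t * \<tau>) ^ m * ((1 - t * \<tau>) * (\<Sum>i<n. deriv (a i) t * b i \<tau>) - of_nat (Suc m) * \<tau> * (\<Sum>i<n. a i t * b i \<tau>))"
      by (subst DERIV_imp_deriv) (auto simp: algebra_simps)
    hence "deriv (\<lambda>t. G t \<tau>) t * inverse (1 - t * \<tau>) ^ m = (1 - t * \<tau>) * (\<Sum>i<n. deriv (a i) t * b i \<tau>) - of_nat (Suc m) * \<tau> * (\<Sum>i<n. a i t * b i \<tau>)"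
      using nz[OF t] by (simp add: power_inverse)
    also have "\<dots> = (\<Sum>i<n. deriv (a i) t * b i \<tau>) + (\<Sum>i<n. (- (t * deriv (a i) t) - of_nat (Suc m) * a i t) * (\<tau> * b i \<tau>))"
      unfolding left_diff_distrib sum_subtractf sum_distrib_left
      by (simp add: sum_negf sum_distrib_left mult_ac)
    also have "\<dots> = (\<Sum>i\<in>{..<n} <+> {..<n}. ?a i t * ?b i \<tau>)" by (simp add: sum.Plus comp_def)
    finally show "deriv (\<lambda>t. G t \<tau>) t * inverse (1 - t * \<tau>) ^ m = \<dots>" .
  qed auto
qed

text \<open>Induction on the number of terms: dividing by the last coefficient and differentiating in the
  first variable removes one term and preserves the divisibility by every power of \<open>1 - t\<tau>\<close>.\<close>
lemma separable_all_powers: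
  fixes h :: "nat \<Rightarrow> complex \<Rightarrow> complex"
  assumes "open D" "connected D" "D \<noteq> {}" "D \<subseteq> ball 0 1" "\<And>i. i < s \<Longrightarrow> h i holomorphic_on D"
    "\<And>m. separable D (\<lambda>t \<tau>. (\<Sum>i<s. h i t * g i \<tau>) * inverse (1 - t * \<tau>) ^ m)"
  shows "finite {\<tau>. norm \<tau> < 1 \<and> (\<exists>t\<in>D. (\<Sum>i<s. h i t * g i \<tau>) \<noteq> 0)}"
  using assms
proof (induction s arbitrary: h D)
  case 0
  thus ?case by simp
next
  case (Suc s)
  define H where "H = (\<lambda>t \<tau>. \<Sum>i<Suc s. h i t * g i \<tau>)"
  have hH: "(\<lambda>t. H t \<tau>) holomorphic_on D" for \<tau> unfolding H_def by (intro holomorphic_intros Suc.prems) auto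
  show ?case
  proof (cases "\<forall>t\<in>D. h s t = 0")
    case True
    have "finite {\<tau>. norm \<tau> < 1 \<and> (\<exists>t\<in>D. (\<Sum>i<s. h i t * g i \<tau>) \<noteq> 0)}"
    proof (rule Suc.IH[OF Suc.prems(1-4)])
      show "separable D (\<lambda>t \<tau>. (\<Sum>i<s. h i t * g i \<tau>) * inverse (1 - t * \<tau>) ^ m)" for m
        by (rule separable_cong[OF Suc.prems(6)[of m]]) (use True in simp)
    qed (use Suc.prems(5) in simp)
    moreover have "{\<tau>. norm \<tau> < 1 \<and> (\<exists>t\<in>D. (\<Sum>i<Suc s. h i t * g i \<tau>) \<noteq> 0)} = {\<tau>. norm \<tau> < 1 \<and> (\<exists>t\<in>D. (\<Sum>i<s. h i t * g i \<tau>) \<noteq> 0)}"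
      using True by auto
    ultimately show ?thesis by simp
  next
    case False
    then obtain t0 where t0: "t0 \<in> D" "h s t0 \<noteq> 0" by blast
    have "continuous_on D (h s)" using Suc.prems(5)[of s] holomorphic_on_imp_continuous_on by simp
    hence "open (D \<inter> h s -` (- {0}))" using Suc.prems(1) by (intro continuous_open_preimage) auto
    then obtain e where e: "e > 0" "ball t0 e \<subseteq> D \<inter> h s -` (- {0})" using t0 open_contains_ball by blast
    \<comment> \<open>A disc without zeros of the last coefficient, so that dividing by it preserves
      separability.\<close>
    define D' where "D' = ball t0 e"
    have D': "open D'" "connected D'" "D' \<noteq> {}" "D' \<subseteq> ball 0 1" "D' \<subseteq> D" using e Suc.prems(4) by (auto simp: D'_def)
    have nz: "h s t \<noteq> 0" if "t \<in> D'" for t using e(2) that by (auto simp: D'_def)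
    have hh: "h i holomorphic_on D'" if "i < Suc s" for i using Suc.prems(5)[OF that] D'(5) by (rule holomorphic_on_subset)
    define q where "q = (\<lambda>i t. h i t / h s t)"
    have hq: "q i holomorphic_on D'" if "i < s" for i unfolding q_def
      by (intro holomorphic_intros hh nz) (use that in auto)
    define G where "G = (\<lambda>t \<tau>. (\<Sum>i<s. q i t * g i \<tau>) + g s \<tau>)"
    have GH: "H t \<tau> = h s t * G t \<tau>" if "t \<in> D'" for t \<tau>
      unfolding H_def G_def q_def using nz[OF that] by (simp add: distrib_left sum_distrib_left)
    have hG: "(\<lambda>t. G t \<tau>) holomorphic_on D'" for \<tau> unfolding G_def by (intro holomorphic_intros hq) auto
    have dG: "deriv (\<lambda>t. G t \<tau>) t = (\<Sum>i<s. deriv (q i) t * g i \<tau>)" if "t \<in> D'" for t \<tau>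
    proof (rule DERIV_imp_deriv)
      have "(q i has_field_derivative deriv (q i) t) (at t)" if "i < s" for i
        by (rule holomorphic_derivI[OF hq[OF that] D'(1) \<open>t \<in> D'\<close>])
      thus "((\<lambda>t. G t \<tau>) has_field_derivative (\<Sum>i<s. deriv (q i) t * g i \<tau>)) (at t)"
        unfolding G_def by (auto intro!: derivative_eq_intros)
    qed
    have aD: "x holomorphic_on D'" if "x holomorphic_on D" for x using that D'(5) by (rule holomorphic_on_subset)
    have sG: "separable D' (\<lambda>t \<tau>. G t \<tau> * inverse (1 - t * \<tau>) ^ m)" for m
    proof -
      have "separable D (\<lambda>t \<tau>. H t \<tau> * inverse (1 - t * \<tau>) ^ m)"
        using Suc.prems(6)[of m] unfolding H_def .
      from this obtain n a b where ab: "\<And>i::nat. i < n \<Longrightarrow> a i holomorphic_on D"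
        "\<And>t \<tau>. t \<in> D \<Longrightarrow> norm \<tau> < 1 \<Longrightarrow> H t \<tau> * inverse (1 - t * \<tau>) ^ m = (\<Sum>i<n. a i t * b i \<tau>)" by (rule separableE) blast
      show ?thesis
      proof (rule separable_sumI[of "{..<n}" "\<lambda>i t. a i t / h s t" _ _ b])
        fix t \<tau> :: complex assume t: "t \<in> D'" and \<tau>: "norm \<tau> < 1"
        have "G t \<tau> * inverse (1 - t * \<tau>) ^ m = H t \<tau> * inverse (1 - t * \<tau>) ^ m / h s t"
          unfolding GH[OF t] using nz[OF t] by simp
        also have "\<dots> = (\<Sum>i<n. a i t * b i \<tau>) / h s t" using ab(2)[of t \<tau>] t \<tau> D'(5) by auto
        finally show "G t \<tau> * inverse (1 - t * \<tau>) ^ m = (\<Sum>i<n. a i t / h s t * b i \<tau>)" by (simp add: sum_divide_distrib)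
      next
        show "(\<lambda>t. a i t / h s t) holomorphic_on D'" if "i \<in> {..<n}" for i
          by (intro holomorphic_intros hh nz aD ab(1)) (use that in auto)
      qed simp
    qed
    \<comment> \<open>Since the g_i are arbitrary functions, finitely many exceptional \<tau> cannot
      be excluded: a function supported on such a set is divisible by every power. Outside
      \<open>Z1\<close> the quotient G does not depend on t.\<close>
    define Z1 where "Z1 = {\<tau>. norm \<tau> < 1 \<and> (\<exists>t\<in>D'. (\<Sum>i<s. deriv (q i) t * g i \<tau>) \<noteq> 0)}"
    have Z1: "finite Z1" unfolding Z1_def
    proof (rule Suc.IH[OF D'(1-4)])
      show "deriv (q i) holomorphic_on D'" if "i < s" for i by (intro holomorphic_deriv hq D'(1) that)
      show "separable D' (\<lambda>t \<tau>. (\<Sum>i<s. deriv (q i) t * g i \<tau>) * inverse (1 - t * \<tau>) ^ m)" for m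
        by (rule separable_cong[OF separable_deriv[OF D'(1,4) hG sG[of "Suc m"]]]) (simp add: dG)
    qed
    have const: "G t \<tau> = G t0 \<tau>" if "norm \<tau> < 1" "\<tau> \<notin> Z1" "t \<in> D'" for t \<tau>
    proof -
      have "((\<lambda>t. G t \<tau>) has_field_derivative 0) (at x within D')" if x: "x \<in> D'" for x
      proof -
        have "deriv (\<lambda>t. G t \<tau>) x = 0" unfolding dG[OF x] using \<open>\<tau> \<notin> Z1\<close> \<open>norm \<tau> < 1\<close> x by (auto simp: Z1_def)
        thus ?thesis using holomorphic_derivI[OF hG D'(1) x, of \<tau>] by (metis has_field_derivative_at_within)
      qed
      then obtain c where "\<And>x. x \<in> D' \<Longrightarrow> G x \<tau> = c"
        using has_field_derivative_zero_constant[of D' "\<lambda>t. G t \<tau>"] by (auto simp: D'_def)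
      thus ?thesis using that(3) e(1) by (simp add: D'_def)
    qed
    \<comment> \<open>Outside \<open>Z1\<close>, G is a function of \<tau> alone; as its quotient by
      1 - t \<tau> is separable, \<open>finite_simple_fractions\<close> bounds its support.\<close>
    define Z2 where "Z2 = {\<tau>. norm \<tau> < 1 \<and> \<tau> \<notin> Z1 \<and> G t0 \<tau> \<noteq> 0}"
    have Z2: "finite Z2"
    proof -
      from sG[of 1] obtain n a b where ab: "\<And>i::nat. i < n \<Longrightarrow> a i holomorphic_on D'"
        "\<And>t \<tau>. t \<in> D' \<Longrightarrow> norm \<tau> < 1 \<Longrightarrow> G t \<tau> * inverse (1 - t * \<tau>) ^ 1 = (\<Sum>i<n. a i t * b i \<tau>)" by (rule separableE) blast
      show ?thesis
      proof (rule finite_simple_fractions[OF D'(1,3,4), of Z2 "G t0"])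
        fix t \<tau> :: complex assume "t \<in> D'" "\<tau> \<in> Z2"
        thus "G t0 \<tau> * inverse (1 - t * \<tau>) = (\<Sum>i<n. a i t * b i \<tau>)"
          using ab(2)[of t \<tau>] const[of \<tau> t] by (simp add: Z2_def)
      qed (auto simp: Z2_def)
    qed
    have "H t \<tau> = 0" if \<tau>: "norm \<tau> < 1" "\<tau> \<notin> Z1" "\<tau> \<notin> Z2" and t: "t \<in> D" for t \<tau>
    proof -
      have "H x \<tau> = 0" if "x \<in> D'" for x
        unfolding GH[OF that] using const[OF \<tau>(1,2) that] \<tau> by (simp add: Z2_def)
      thus ?thesis
        using analytic_continuation_open[of D' D "\<lambda>t. H t \<tau>" "\<lambda>_. 0" t] D' Suc.prems(1,2) hH t by auto
    qed
    hence "{\<tau>. norm \<tau> < 1 \<and> (\<exists>t\<in>D. H t \<tau> \<noteq> 0)} \<subseteq> Z1 \<union> Z2" by blast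
    hence "finite {\<tau>. norm \<tau> < 1 \<and> (\<exists>t\<in>D. H t \<tau> \<noteq> 0)}" using Z1 Z2 by (meson finite_Un finite_subset)
    thus ?thesis unfolding H_def .
  qed
qed

text \<open>On the complex line through z, spanned by a unit vector v, \<open>bil\<close> becomes t
  \<tau> and the one variable statement applies. Its finite exceptional set is harmless because F is
  holomorphic in the second variable as well.\<close>

lemma finite_rank_all_powers:
  fixes F :: "complex^'n \<Rightarrow> complex^'n \<Rightarrow> complex"
  assumes F: "finite_rank F" and K: "\<And>m. finite_rank (K m)"
    and FK: "\<And>m z \<zeta>. norm z < 1 \<Longrightarrow> norm \<zeta> < 1 \<Longrightarrow> F z \<zeta> = (1 - bil z \<zeta>) ^ m * K m z \<zeta>"
    and z: "norm z < 1"
  shows "F z (cv z) = 0"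
proof -
  \<comment> \<open>For z = 0 any unit vector will do.\<close>
  define v where "v = (if z = 0 then axis undefined 1 else inverse (of_real (norm z)) *s z)"
  define r where "r = complex_of_real (norm z)"
  have v: "norm v = 1" by (simp add: v_def norm_smult_vec norm_inverse)
  have rv: "r *s v = z" by (simp add: r_def v_def vec_eq_iff)
  have n: "norm (t *s v) < 1" "norm (t *s cv v) < 1" if "norm t < 1" for t using v that by (simp_all add: norm_smult_vec)
  have b: "bil (t *s v) (\<tau> *s cv v) = t * \<tau>" for t \<tau>
    using v by (simp add: bil_smult_left bil_smult_right bil_cv)
  have hol: "(\<lambda>t. f (t *s w)) holomorphic_on ball 0 1" if "holo_on f (ball 0 1)" "norm w = 1" for f and w :: "complex^'n"
    unfolding holomorphic_on_def field_differentiable_def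
  proof (intro ballI exI)
    fix t :: complex assume "t \<in> ball 0 1"
    hence "0 + t *s w \<in> ball 0 1" using that(2) by (simp add: norm_smult_vec)
    from holo_on_line[OF that(1) this]
    show "((\<lambda>t. f (t *s w)) has_field_derivative (\<Sum>k\<in>UNIV. w $ k * pd k f (0 + t *s w))) (at t within ball 0 1)"
      unfolding add_0 by (rule has_field_derivative_at_within)
  qed
  from F obtain s a c where ac: "\<And>i::nat. i < s \<Longrightarrow> holo_on (a i) (ball 0 1)" "\<And>i. i < s \<Longrightarrow> holo_on (c i) (ball 0 1)"
    "\<And>z \<zeta>. norm z < 1 \<Longrightarrow> norm \<zeta> < 1 \<Longrightarrow> F z \<zeta> = (\<Sum>i<s. a i z * c i \<zeta>)" by (rule finite_rankE) blast
  define H where "H = (\<lambda>t \<tau>. \<Sum>i<s. a i (t *s v) * c i (\<tau> *s cv v))"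
  have HF: "H t \<tau> = F (t *s v) (\<tau> *s cv v)" if "norm t < 1" "norm \<tau> < 1" for t \<tau>
    unfolding H_def using ac(3)[of "t *s v" "\<tau> *s cv v"] n that by simp
  define Z where "Z = {\<tau>. norm \<tau> < 1 \<and> (\<exists>t\<in>ball 0 1. H t \<tau> \<noteq> 0)}"
  have Z: "finite Z" unfolding Z_def H_def
  proof (rule separable_all_powers[where h = "\<lambda>i t. a i (t *s v)" and g = "\<lambda>i \<tau>. c i (\<tau> *s cv v)"])
    show "(\<lambda>t. a i (t *s v)) holomorphic_on ball 0 1" if "i < s" for i by (rule hol[OF ac(1)[OF that] v])
    fix m
    from K[of m] obtain p d e where de: "\<And>i::nat. i < p \<Longrightarrow> holo_on (d i) (ball 0 1)" "\<And>i. i < p \<Longrightarrow> holo_on (e i) (ball 0 1)"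
      "\<And>z \<zeta>. norm z < 1 \<Longrightarrow> norm \<zeta> < 1 \<Longrightarrow> K m z \<zeta> = (\<Sum>i<p. d i z * e i \<zeta>)" by (rule finite_rankE) blast
    have "separable (ball 0 1) (\<lambda>t \<tau>. H t \<tau> * inverse (1 - t * \<tau>) ^ m)"
    proof (rule separable_sumI[of "{..<p}" "\<lambda>i t. d i (t *s v)" _ _ "\<lambda>i \<tau>. e i (\<tau> *s cv v)"])
      fix t \<tau> :: complex assume "t \<in> ball 0 1" and \<tau>: "norm \<tau> < 1"
      hence t: "norm t < 1" by simp
      have "H t \<tau> = (1 - t * \<tau>) ^ m * (\<Sum>i<p. d i (t *s v) * e i (\<tau> *s cv v))"
        unfolding HF[OF t \<tau>] FK[OF n(1)[OF t] n(2)[OF \<tau>], of m] b de(3)[OF n(1)[OF t] n(2)[OF \<tau>]] ..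
      thus "H t \<tau> * inverse (1 - t * \<tau>) ^ m = (\<Sum>i<p. d i (t *s v) * e i (\<tau> *s cv v))"
        using one_minus_mult_nonzero[OF t \<tau>] by (simp add: power_inverse)
    qed (auto intro!: hol de v)
    thus "separable (ball 0 1) (\<lambda>t \<tau>. (\<Sum>i<s. a i (t *s v) * c i (\<tau> *s cv v)) * inverse (1 - t * \<tau>) ^ m)"
      unfolding H_def .
  qed auto
  have r: "norm r < 1" using z by (simp add: r_def)
  have op: "open (ball 0 1 - Z)" using Z by (intro open_Diff finite_imp_closed) auto
  have ne: "ball (0::complex) 1 - Z \<noteq> {}"
  proof
    assume "ball (0::complex) 1 - Z = {}"
    hence "ball (0::complex) 1 \<subseteq> Z" by (simp only: Diff_eq_empty_iff)
    hence "finite (ball (0::complex) 1)" by (rule finite_subset[OF _ Z])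
    thus False using uncountable_ball[of 1 "0::complex"] by (simp add: countable_finite)
  qed
  have hH: "H r holomorphic_on ball 0 1" unfolding H_def by (intro holomorphic_intros hol ac) (use v in auto)
  have H0: "H r \<tau> = 0" if "\<tau> \<in> ball 0 1 - Z" for \<tau> using that r by (auto simp: Z_def)
  have "H r r = 0"
    using analytic_continuation_open[OF op open_ball ne connected_ball Diff_subset hH holomorphic_on_const H0, of r] r by simp
  moreover have "r *s cv v = cv z" unfolding rv[symmetric] cv_smult by (simp add: r_def)
  ultimately show ?thesis using HF[OF r r] by (simp only: rv)
qed

section \<open>Eigenfunctions\<close>

text \<open>The eigenvalue equation is passed from \<open>K\<close> to \<open>K / (1 - \<langle>z, \<zeta>\<rangle>)\<close>: the operator changes
  from \<open>Lop m\<close> to \<open>Lop (m + 1)\<close> and the eigenvalue by \<open>N - 2m - 1\<close>.\<close>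
lemma eigen_chain:
  fixes F :: "complex^'n \<Rightarrow> complex^'n \<Rightarrow> complex"
  assumes F: "finite_rank F"
    and eig: "\<And>z \<zeta>. norm z < 1 \<Longrightarrow> norm \<zeta> < 1 \<Longrightarrow> (1 - bil z \<zeta>) * Lop 0 F z \<zeta> = c * F z \<zeta>"
  defines "\<mu> \<equiv> \<lambda>m::nat. c + of_nat m * (of_nat CARD('n) - of_nat m)"
  assumes nz: "\<And>m'. m' < m \<Longrightarrow> \<mu> m' \<noteq> 0"
  shows "\<exists>K. finite_rank K \<and> (\<forall>z \<zeta>. norm z < 1 \<and> norm \<zeta> < 1 \<longrightarrow> F z \<zeta> = (1 - bil z \<zeta>) ^ m * K z \<zeta> \<and>
    (1 - bil z \<zeta>) * Lop m K z \<zeta> = \<mu> m * K z \<zeta>)"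
  using nz
proof (induction m)
  case 0
  thus ?case using F eig by (intro exI[of _ F]) (simp add: \<mu>_def)
next
  case (Suc m)
  then obtain K where K: "finite_rank K"
    "\<forall>z \<zeta>. norm z < 1 \<and> norm \<zeta> < 1 \<longrightarrow> F z \<zeta> = (1 - bil z \<zeta>) ^ m * K z \<zeta> \<and> (1 - bil z \<zeta>) * Lop m K z \<zeta> = \<mu> m * K z \<zeta>"
    by (metis less_Suc_eq)
  have \<mu>m: "\<mu> m \<noteq> 0" using Suc.prems by simp
  define K' where "K' = (\<lambda>z \<zeta>. inverse (\<mu> m) * Lop m K z \<zeta>)"
  have fK': "finite_rank K'" unfolding K'_def by (intro finite_rank_cmult finite_rank_Lop K(1))
  have KK': "K z \<zeta> = (1 - bil z \<zeta>) * K' z \<zeta>" if "norm z < 1" "norm \<zeta> < 1" for z \<zeta>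
  proof -
    have "\<mu> m * K z \<zeta> = (1 - bil z \<zeta>) * Lop m K z \<zeta>" using K(2) that by metis
    thus ?thesis using \<mu>m by (simp add: K'_def field_simps)
  qed
  show ?case
  proof (intro exI[of _ K'] conjI allI impI fK')
    fix z \<zeta> :: "complex^'n" assume z\<zeta>: "norm z < 1 \<and> norm \<zeta> < 1"
    hence z: "norm z < 1" and \<zeta>: "norm \<zeta> < 1" by auto
    show "F z \<zeta> = (1 - bil z \<zeta>) ^ Suc m * K' z \<zeta>" using K(2) z\<zeta> KK'[OF z \<zeta>] by simp
    have "\<mu> m * K' z \<zeta> = Lop m K z \<zeta>" using \<mu>m by (simp add: K'_def)
    also have "\<dots> = Lop m (\<lambda>z \<zeta>. (1 - bil z \<zeta>) * K' z \<zeta>) z \<zeta>" by (rule Lop_cong[OF KK' z \<zeta>])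
    also have "\<dots> = (1 - bil z \<zeta>) * Lop (Suc m) K' z \<zeta> + (2 * of_nat m + 1 - of_nat CARD('n)) * K' z \<zeta>"
      by (rule Lop_bil_mult[OF fK' z \<zeta>])
    finally show "(1 - bil z \<zeta>) * Lop (Suc m) K' z \<zeta> = \<mu> (Suc m) * K' z \<zeta>"
      by (simp add: \<mu>_def algebra_simps)
  qed
qed

lemma eigen_kernel_zero:
  fixes F :: "complex^'n \<Rightarrow> complex^'n \<Rightarrow> complex"
  assumes F: "finite_rank F" and tF: "\<And>\<zeta>. norm \<zeta> < 1 \<Longrightarrow> tame (\<lambda>z. F z \<zeta>)"
    and eig: "\<And>z \<zeta>. norm z < 1 \<Longrightarrow> norm \<zeta> < 1 \<Longrightarrow> (1 - bil z \<zeta>) * Lop 0 F z \<zeta> = c * F z \<zeta>"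
    and c: "c \<noteq> 0" and z: "norm z < 1"
  shows "F z (cv z) = 0"
proof -
  \<comment> \<open>The solution of \<mu>(m + 1) = \<mu>(m) + N - 2 m - 1 with \<mu>(0) = c.\<close>
  define \<mu> where "\<mu> = (\<lambda>m::nat. c + of_nat m * (of_nat CARD('n) - of_nat m))"
  have chain: "\<exists>K. finite_rank K \<and> (\<forall>z \<zeta>. norm z < 1 \<and> norm \<zeta> < 1 \<longrightarrow> F z \<zeta> = (1 - bil z \<zeta>) ^ m * K z \<zeta> \<and>
    (1 - bil z \<zeta>) * Lop m K z \<zeta> = \<mu> m * K z \<zeta>)" if "\<And>m'. m' < m \<Longrightarrow> \<mu> m' \<noteq> 0" for m
    using eigen_chain[OF F eig, of m] that unfolding \<mu>_def by blast
  show ?thesis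
  proof (cases "\<exists>m. \<mu> m = 0")
    case True
    \<comment> \<open>The least zero, so that all earlier eigenvalues are nonzero and the chain
      reaches it; it is positive because \<mu>(0) = c.\<close>
    define m where "m = (LEAST m. \<mu> m = 0)"
    have m: "\<mu> m = 0" unfolding m_def using True by (rule LeastI_ex)
    have "\<mu> m' \<noteq> 0" if "m' < m" for m' using not_less_Least that unfolding m_def by blast
    then obtain K where K: "finite_rank K" "\<forall>z \<zeta>. norm z < 1 \<and> norm \<zeta> < 1 \<longrightarrow> F z \<zeta> = (1 - bil z \<zeta>) ^ m * K z \<zeta> \<and>
      (1 - bil z \<zeta>) * Lop m K z \<zeta> = \<mu> m * K z \<zeta>" using chain by blast
    have m1: "m \<ge> 1" using m c by (cases m) (auto simp: \<mu>_def)
    have FK: "F z \<zeta> = (1 - bil z \<zeta>) ^ m * K z \<zeta>" if "norm z < 1" "norm \<zeta> < 1" for z \<zeta> using K(2) that by blast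
    have L: "Lop m K z \<zeta> = 0" if "norm z < 1" "norm \<zeta> < 1" for z \<zeta>
    proof -
      have "(1 - bil z \<zeta>) * Lop m K z \<zeta> = \<mu> m * K z \<zeta>" using K(2) that by blast
      thus ?thesis using one_minus_bil_nonzero[OF that] m by simp
    qed
    have z': "norm (cv z) < 1" using z by simp
    have "K z (cv z) = 0" by (rule kernel_vanish[OF tF K(1) m1 FK L z z'])
    thus ?thesis using FK[OF z z'] by simp
  next
    case False
    hence "\<forall>m. \<exists>K. finite_rank K \<and> (\<forall>z \<zeta>. norm z < 1 \<and> norm \<zeta> < 1 \<longrightarrow> F z \<zeta> = (1 - bil z \<zeta>) ^ m * K z \<zeta> \<and>
      (1 - bil z \<zeta>) * Lop m K z \<zeta> = \<mu> m * K z \<zeta>)" using chain by blast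
    from choice[OF this] obtain K where "\<forall>m. finite_rank (K m) \<and> (\<forall>z \<zeta>. norm z < 1 \<and> norm \<zeta> < 1 \<longrightarrow> F z \<zeta> = (1 - bil z \<zeta>) ^ m * K m z \<zeta> \<and>
      (1 - bil z \<zeta>) * Lop m (K m) z \<zeta> = \<mu> m * K m z \<zeta>)" by (rule exE)
    thus ?thesis by (intro finite_rank_all_powers[OF F _ _ z, of K]) blast+
  qed
qed

theorem theorem3p6:
  fixes f g :: "nat \<Rightarrow> complex ^ 'n \<Rightarrow> complex" and s :: nat
    and u :: "complex ^ 'n \<Rightarrow> complex"
  assumes "\<And>j. j \<in> {1..s} \<Longrightarrow> holo_on (f j) unit_ball"
    and "\<And>j. j \<in> {1..s} \<Longrightarrow> holo_on (g j) unit_ball"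
    and "\<And>j. j \<in> {1..s} \<Longrightarrow> f j \<in> bergman (2 * CARD('n) + 2)"
    and "u = (\<lambda>z. \<Sum>j=1..s. f j z * cnj (g j z))"
    and "inv_lap_eigenfunction u"
  shows "pluriharmonic_on unit_ball u"
proof -
  define F where "F = (\<lambda>z \<zeta>. \<Sum>j=1..s. f j z * cnj (g j (cv \<zeta>)))"
  have F: "finite_rank F"
  proof (rule finite_rank_sumI[of "{1..s}" f "\<lambda>j \<zeta>. cnj (g j (cv \<zeta>))"])
    show "holo_on (\<lambda>\<zeta>. cnj (g j (cv \<zeta>))) (ball 0 1)" if "j \<in> {1..s}" for j
      by (rule holo_on_conj[OF assms(2)[OF that, unfolded unit_ball_def]]) simp
  qed (use assms(1) in \<open>auto simp: F_def unit_ball_def\<close>)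
  have tF: "tame (\<lambda>z. F z \<zeta>)" for \<zeta>
  proof -
    have "tame (\<lambda>z. \<Sum>j=1..s. cnj (g j (cv \<zeta>)) * f j z)"
      by (intro tame_sum tame_mult_bdd[OF bergman_tame[OF assms(3)], where g = "\<lambda>z. cnj (g _ (cv \<zeta>))"]) (assumption, rule order_refl)
    thus ?thesis by (simp add: F_def mult.commute)
  qed
  have uF: "u z = F z (cv z)" for z by (simp add: assms(4) F_def)
  from assms(5) obtain c where "\<forall>z\<in>ball 0 1. inv_laplacian u z = c * u z"
    unfolding inv_lap_eigenfunction_def unit_ball_def by blast
  hence c: "inv_laplacian u z = c * u z" if "norm z < 1" for z using that by simp
  have eig: "(1 - bil z \<zeta>) * Lop 0 F z \<zeta> = c * F z \<zeta>" if z: "norm z < 1" and \<zeta>: "norm \<zeta> < 1" for z \<zeta>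
  proof -
    have "finite_rank (\<lambda>z \<zeta>. (1 - bil z \<zeta>) * Lop 0 F z \<zeta> - c * F z \<zeta>)"
      by (intro finite_rank_diff finite_rank_bil_mult finite_rank_Lop finite_rank_cmult F)
    moreover have "(1 - bil z (cv z)) * Lop 0 F z (cv z) - c * F z (cv z) = 0" if "norm z < 1" for z
      using inv_laplacian_diag(2)[OF F that uF] c[OF that] uF[of z] by simp
    ultimately have "(1 - bil z \<zeta>) * Lop 0 F z \<zeta> - c * F z \<zeta> = 0" by (rule polarization[OF _ _ z \<zeta>])
    thus ?thesis by simp
  qed
  have mix: "pd j (\<lambda>w. pd k (F w) \<zeta>) z = 0" if z: "norm z < 1" and \<zeta>: "norm \<zeta> < 1" for j k z \<zeta>
  proof (cases "c = 0")
    case True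
    have "Lop 0 F z \<zeta> = 0" if "norm z < 1" "norm \<zeta> < 1" for z \<zeta>
      using eig[OF that] one_minus_bil_nonzero[OF that] True by simp
    thus ?thesis by (rule kernel_mixed_zero[OF tF F _ z \<zeta>])
  next
    case False
    \<comment> \<open>For c nonzero even F itself vanishes, so u is identically zero.\<close>
    have F0: "F z \<zeta> = 0" if "norm z < 1" "norm \<zeta> < 1" for z \<zeta>
      by (rule polarization[OF F eigen_kernel_zero[OF F tF eig False] that])
    have "pd k (F w) \<zeta> = 0" if "norm w < 1" for w
      using pd_cong_open[of "ball 0 1" \<zeta> "F w" "\<lambda>_. 0" k] F0[OF that] \<zeta> by simp
    thus ?thesis using pd_cong_open[of "ball 0 1" z "\<lambda>w. pd k (F w) \<zeta>" "\<lambda>_. 0" j] z by simp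
  qed
  show ?thesis unfolding pluriharmonic_on_def unit_ball_def
    using C2_on_diag[OF F uF] inv_laplacian_diag(1)[OF F _ uF] mix by simp
qed

end
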